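(* Let $r\ge 2$. The graded commutative algebra $(H^*(\mathcal{A}),\cdot)$ and the Harrison cohomology class $[\mu_3]$ are complete invariants of the DGCA homotopy class of an $(r-1)$-connected Poincaré DGCA $\mathcal{A}^*$ of degree $n$ with $n\le 4r-1$ admitting a Hodge homotopy. That is, if $\mathcal{A}^*$ and $\mathcal{A}'^*$ are two $(r-1)$-connected Poincaré DGCAs of degree $n\le 4r-1$ over $\mathbb{K}$ admitting Hodge homotopies, with associated classes $[\mu_3]\in \mathrm{HHarr}^{3,-1}(H^*(\mathcal{A}),H^*(\mathcal{A}))$ and $[\mu_3']\in\mathrm{HHarr}^{3,-1}(H^*(\mathcal{A}'),H^*(\mathcal{A}'))$, then $\mathcal{A}^*$ and $\mathcal{A}'^*$ are in the same homotopy class if and only if there exists an isomorphism of graded commutative algebras $\phi:(H^*(\mathcal{A}),\cdot)\to(H^*(\mathcal{A}'),\cdot)$ mapping $[\mu_3]$ to $[\mu_3']$ under the induced isomorphism of Harrison cohomologies. In particular, $\mathcal{A}^*$ is formal if and only if $[\mu_3]=0$.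
   Context: $\mathbb{K}$ is a field of characteristic zero. A DGCA is a unital differential graded commutative algebra with differential $d$ of degree $+1$. A Poincaré DGCA of degree $n$ is a DGCA $(\mathcal{A}^*=\bigoplus_{k=0}^n\mathcal{A}^k,d)$ with finite-dimensional cohomology $H^*(\mathcal{A})$ and a linear functional (fundamental class) $\int: H^n(\mathcal{A})\to\mathbb{K}$ such that the pairing on $H^*(\mathcal{A})$ given on homogeneous elements by $\langle a,b\rangle=\int a\cdot b$ if $\deg a+\deg b=n$ and $0$ otherwise is non-degenerate. It induces a pairing on $\mathcal{A}^*$: $\langle\alpha,\beta\rangle=\int[\alpha\cdot\beta]$ if $\deg\alpha+\deg\beta=n$, and $0$ otherwise. A Hodge homotopy is a linear operator $d^-:\mathcal{A}^*\to\mathcal{A}^{*-1}$ with $d^-d^-=0$, $d^-dd^-=d^-$, $dd^-d=d$, $\langle \mathrm{Im}(d^-),\mathrm{Im}(d^-)\rangle=0$ and $\langle\mathrm{Im}(\pi_{\mathcal{H}}),\mathrm{Im}(d^-)\rangle=0$, where $\pi_{\mathcal{H}}:=\mathrm{id}_{\mathcal{A}^*}-(dd^-+d^-d)$ (a projection). The harmonic subspace is $\mathcal{H}^*:=\mathrm{Im}(\pi_{\mathcal{H}})$; it consists of closed elements and $\mathcal{H}^*\to H^*(\mathcal{A})$, $\alpha\mapsto[\alpha]$, is an isomorphism, with inverse denoted $\iota:H^*(\mathcal{A})\to\mathcal{H}^*\subseteq\mathcal{A}^*$. $\mathcal{A}^*$ is $(r-1)$-connected ($r\ge2$) if $H^0(\mathcal{A})=\mathbb{K}$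 and $H^k(\mathcal{A})=0$ for $1\le k\le r-1$. Two DGCAs are in the same homotopy class if they are connected by a zig-zag of quasi-isomorphisms of DGCAs; $\mathcal{A}^*$ is formal if it is in the same homotopy class as $(H^*(\mathcal{A}),0)$. Harrison cohomology: for a graded commutative algebra $B$, $\mathrm{CHoch}^{p,q}(B,B)$ is the space of linear maps $f:B^{\otimes p}\to B$ of degree $q$, with differential $\mathrm{CHoch}^{p,q}\to\mathrm{CHoch}^{p+1,q}$ $$(d_{\mathrm{Hoch}}f)(a_1,\dots,a_{p+1})=(-1)^{q\deg a_1}a_1f(a_2,\dots,a_{p+1})+\sum_{i=1}^p(-1)^if(a_1,\dots,a_ia_{i+1},\dots,a_{p+1})+(-1)^{p+1}f(a_1,\dots,a_p)a_{p+1}.$$ $\mathrm{CHarr}^{p,q}(B,B)$ is the subcomplex of cochains vanishing on signed shuffles (for $0<i<p$, the sum over $(i,p-i)$-shuffles of $f$ applied to the shuffled arguments, with sign the product of the sign of the permutation and the Koszul sign, is zero); $d_{\mathrm{Harr}}$ is the restricted differential and $\mathrm{HHarr}^{p,q}(B,B)$ its cohomology. The class $[\mu_3]$: choosing a Hodge homotopy $d^-$ on $\mathcal{A}^*$, put $$\mu_3(a,b,c)=\big[\pi_{\mathcal{H}}\big(d^-(\iota(a)\cdot\iota(b))\cdot\iota(c)-(-1)^{\deg a}\iota(a)\cdot d^-(\iota(b)\cdot\iota(c))\big)\big].$$ This is the ternary operation of the minimal unital $C_\infty$-structure on $H^*(\mathcal{A})$ (with binary operation the cohomology product) obtained by homotopy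 transfer; it is a Harrison cocycle of bidegree $(3,-1)$ whose class $[\mu_3]\in\mathrm{HHarr}^{3,-1}(H^*(\mathcal{A}),H^*(\mathcal{A}))$ does not depend on the choice of Hodge homotopy. *)

theory Defs
  imports
    "HOL-Algebra.QuotRing"
    "HOL-Combinatorics.Permutations"
    "Jordan_Normal_Form.Missing_VectorSpace"
begin

section \<open>Graded commutative algebras and DGCAs\<close>

definition field_of_char_zero :: "('k, 'm) ring_scheme \<Rightarrow> bool" where
  "field_of_char_zero K \<longleftrightarrow> field K \<and> (\<forall>m::nat. 0 < m \<longrightarrow> [m] \<cdot>\<^bsub>K\<^esub> \<one>\<^bsub>K\<^esub> \<noteq> \<zero>\<^bsub>K\<^esub>)"

text \<open>The integer \<open>(-1)\<^sup>k\<close>; it acts on algebra elements through \<^const>\<open>add_pow\<close>.\<close>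

definition neg1_pow :: "int \<Rightarrow> int" where
  "neg1_pow k = (if even k then 1 else - 1)"

text \<open>The carrier is the whole algebra, \<open>gr B k\<close> its homogeneous part of degree \<open>k\<close>. Degrees
  are integers; a nonnegatively graded algebra has \<open>gr B k = {0}\<close> for \<open>k < 0\<close>.\<close>

record ('k, 'a) graded_module = "('k, 'a) module" +
  gr :: "int \<Rightarrow> 'a set"

definition decomposes :: "('k, 'a, 'm) graded_module_scheme \<Rightarrow> 'a \<Rightarrow> (int \<Rightarrow> 'a) \<Rightarrow> bool" where
  "decomposes B x c \<longleftrightarrow> (\<forall>k. c k \<in> gr B k) \<and> finite {k. c k \<noteq> \<zero>\<^bsub>B\<^esub>} \<and>
     x = (\<Oplus>\<^bsub>B\<^esub>k\<in>{k. c k \<noteq> \<zero>\<^bsub>B\<^esub>}. c k)"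

definition component :: "('k, 'a, 'm) graded_module_scheme \<Rightarrow> int \<Rightarrow> 'a \<Rightarrow> 'a" where
  "component B k x = (THE c. decomposes B x c) k"

text \<open>The linear map given by \<open>x \<mapsto> (-1)\<^bsup>q deg x\<^esup> x\<close> on homogeneous \<open>x\<close>.\<close>

definition sign_twist :: "('k, 'a, 'm) graded_module_scheme \<Rightarrow> int \<Rightarrow> 'a \<Rightarrow> 'a" where
  "sign_twist B q x =
     (\<Oplus>\<^bsub>B\<^esub>k\<in>{k. component B k x \<noteq> \<zero>\<^bsub>B\<^esub>}. [neg1_pow (q * k)] \<cdot>\<^bsub>B\<^esub> component B k x)"

locale graded_comm_algebra = vectorspace K B + B?: ring B
  for K :: "('k, 'l) ring_scheme" and B :: "('k, 'a, 'm) graded_module_scheme" +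
  assumes smult_mult_left:
      "\<lbrakk>c \<in> carrier K; x \<in> carrier B; y \<in> carrier B\<rbrakk> \<Longrightarrow>
        (c \<odot>\<^bsub>B\<^esub> x) \<otimes>\<^bsub>B\<^esub> y = c \<odot>\<^bsub>B\<^esub> (x \<otimes>\<^bsub>B\<^esub> y)"
    and smult_mult_right:
      "\<lbrakk>c \<in> carrier K; x \<in> carrier B; y \<in> carrier B\<rbrakk> \<Longrightarrow>
        x \<otimes>\<^bsub>B\<^esub> (c \<odot>\<^bsub>B\<^esub> y) = c \<odot>\<^bsub>B\<^esub> (x \<otimes>\<^bsub>B\<^esub> y)"
    and gr_subspace: "subspace K (gr B k) B"
    and gr_direct_sum: "x \<in> carrier B \<Longrightarrow> \<exists>!c. decomposes B x c"
    and one_gr: "\<one>\<^bsub>B\<^esub> \<in> gr B 0"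
    and mult_gr: "\<lbrakk>x \<in> gr B k; y \<in> gr B l\<rbrakk> \<Longrightarrow> x \<otimes>\<^bsub>B\<^esub> y \<in> gr B (k + l)"
    and graded_comm:
      "\<lbrakk>x \<in> gr B k; y \<in> gr B l\<rbrakk> \<Longrightarrow> x \<otimes>\<^bsub>B\<^esub> y = [neg1_pow (k * l)] \<cdot>\<^bsub>B\<^esub> (y \<otimes>\<^bsub>B\<^esub> x)"

record ('k, 'a) dgca = "('k, 'a) graded_module" +
  diff :: "'a \<Rightarrow> 'a"

locale dgca = graded_comm_algebra K A
  for K :: "('k, 'l) ring_scheme" and A :: "('k, 'a) dgca" +
  assumes diff_linear: "diff A \<in> module_hom K A A"
    and diff_degree: "x \<in> gr A k \<Longrightarrow> diff A x \<in> gr A (k + 1)"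
    and diff_diff: "x \<in> carrier A \<Longrightarrow> diff A (diff A x) = \<zero>\<^bsub>A\<^esub>"
    and leibniz:
      "\<lbrakk>x \<in> gr A k; y \<in> carrier A\<rbrakk> \<Longrightarrow>
        diff A (x \<otimes>\<^bsub>A\<^esub> y) = diff A x \<otimes>\<^bsub>A\<^esub> y \<oplus>\<^bsub>A\<^esub> [neg1_pow k] \<cdot>\<^bsub>A\<^esub> (x \<otimes>\<^bsub>A\<^esub> diff A y)"

definition graded_algebra_hom :: "('k, 'l) ring_scheme \<Rightarrow> ('k, 'a, 'm) graded_module_scheme \<Rightarrow>
    ('k, 'b, 'n) graded_module_scheme \<Rightarrow> ('a \<Rightarrow> 'b) set" where
  "graded_algebra_hom K B C =
     {f \<in> ring_hom B C \<inter> module_hom K B C. \<forall>k. f ` gr B k \<subseteq> gr C k}"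

definition graded_algebra_iso :: "('k, 'l) ring_scheme \<Rightarrow> ('k, 'a, 'm) graded_module_scheme \<Rightarrow>
    ('k, 'b, 'n) graded_module_scheme \<Rightarrow> ('a \<Rightarrow> 'b) set" where
  "graded_algebra_iso K B C =
     {f \<in> graded_algebra_hom K B C. bij_betw f (carrier B) (carrier C)}"

definition dgca_hom :: "('k, 'l) ring_scheme \<Rightarrow> ('k, 'a) dgca \<Rightarrow> ('k, 'b) dgca \<Rightarrow> ('a \<Rightarrow> 'b) set" where
  "dgca_hom K A B =
     {f \<in> graded_algebra_hom K A B. \<forall>x\<in>carrier A. f (diff A x) = diff B (f x)}"


section \<open>Cohomology\<close>

definition quotient_module :: "('k, 'a, 'm) module_scheme \<Rightarrow> 'a set \<Rightarrow> ('k, 'a set) module" where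
  "quotient_module M N =
     \<lparr>carrier = carrier (M Quot N), mult = mult (M Quot N), one = one (M Quot N),
      zero = zero (M Quot N), add = add (M Quot N),
      smult = (\<lambda>c X. \<Union>x\<in>X. N +>\<^bsub>M\<^esub> (c \<odot>\<^bsub>M\<^esub> x))\<rparr>"

definition cocycles :: "('k, 'a) dgca \<Rightarrow> 'a set" where
  "cocycles A = a_kernel A A (diff A)"

definition coboundaries :: "('k, 'a) dgca \<Rightarrow> 'a set" where
  "coboundaries A = diff A ` carrier A"

definition coh_class :: "('k, 'a) dgca \<Rightarrow> 'a \<Rightarrow> 'a set" where
  "coh_class A x = coboundaries A +>\<^bsub>A\<^esub> x"

text \<open>The DGCA \<open>(H(A), 0)\<close>; its elements are cosets of the coboundaries in the cocycles.\<close>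

definition cohomology :: "('k, 'a) dgca \<Rightarrow> ('k, 'a set) dgca" where
  "cohomology A = (let H = quotient_module (A\<lparr>carrier := cocycles A\<rparr>) (coboundaries A) in
     \<lparr>carrier = carrier H, mult = mult H, one = one H, zero = zero H, add = add H, smult = smult H,
      gr = (\<lambda>k. coh_class A ` (cocycles A \<inter> gr A k)), diff = (\<lambda>_. zero H)\<rparr>)"

definition cohomology_map :: "('k, 'b) dgca \<Rightarrow> ('a \<Rightarrow> 'b) \<Rightarrow> 'a set \<Rightarrow> 'b set" where
  "cohomology_map B f X = (\<Union>x\<in>X. coh_class B (f x))"


section \<open>Homotopy classes and formality\<close>

definition quasi_iso :: "('k, 'l) ring_scheme \<Rightarrow> ('k, 'a) dgca \<Rightarrow> ('k, 'b) dgca \<Rightarrow> ('a \<Rightarrow> 'b) \<Rightarrow> bool"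
  where
  "quasi_iso K A B f \<longleftrightarrow> dgca K A \<and> dgca K B \<and> f \<in> dgca_hom K A B \<and>
     bij_betw (cohomology_map B f) (carrier (cohomology A)) (carrier (cohomology B))"

definition has_quasi_iso :: "('k, 'l) ring_scheme \<Rightarrow> ('k, 'a) dgca \<Rightarrow> ('k, 'b) dgca \<Rightarrow> bool" where
  "has_quasi_iso K A B \<longleftrightarrow> (\<exists>f. quasi_iso K A B f)"

text \<open>HOL cannot quantify over the types carrying the intermediate DGCAs of a zig-zag. Here they
  live in one type that is large enough to contain copies of both end points and of every algebra
  with countably many generators over either of them. The additional summand \<open>'u\<close> is arbitrary:
  a statement proved for all \<open>'u\<close> covers zig-zags through DGCAs of any size.\<close>

type_synonym ('a, 'b, 'u) zigzag_space = "(nat \<Rightarrow> 'a + 'b) + 'u"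

definition same_homotopy_class ::
    "'u itself \<Rightarrow> ('k, 'l) ring_scheme \<Rightarrow> ('k, 'a) dgca \<Rightarrow> ('k, 'b) dgca \<Rightarrow> bool" where
  "same_homotopy_class U K A B \<longleftrightarrow>
     (\<exists>C D :: ('k, ('a, 'b, 'u) zigzag_space) dgca.
        (has_quasi_iso K A C \<or> has_quasi_iso K C A) \<and>
        equivclp (has_quasi_iso K) C D \<and>
        (has_quasi_iso K D B \<or> has_quasi_iso K B D))"

definition formal :: "'u itself \<Rightarrow> ('k, 'l) ring_scheme \<Rightarrow> ('k, 'a) dgca \<Rightarrow> bool" where
  "formal U K A \<longleftrightarrow> same_homotopy_class U K A (cohomology A)"


section \<open>Connectedness, Poincare duality and Hodge homotopies\<close>

text \<open>\<open>H\<^sup>0(A) = \<bbbK>\<close> says that the unit map \<open>\<bbbK> \<rightarrow> H\<^sup>0(A)\<close> is bijective.\<close>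

definition cohomologically_connected :: "('k, 'l) ring_scheme \<Rightarrow> ('k, 'a) dgca \<Rightarrow> nat \<Rightarrow> bool" where
  "cohomologically_connected K A m \<longleftrightarrow>
     bij_betw (\<lambda>c. c \<odot>\<^bsub>cohomology A\<^esub> \<one>\<^bsub>cohomology A\<^esub>) (carrier K) (gr (cohomology A) 0) \<and>
     (\<forall>k. 1 \<le> k \<and> k \<le> int m \<longrightarrow> gr (cohomology A) k = {\<zero>\<^bsub>cohomology A\<^esub>})"

text \<open>The functional \<open>\<integral>\<close> is only given in degree \<open>n\<close>. Precomposing it with the projection
  to degree \<open>n\<close> gives the bilinear pairing with value \<open>\<integral>ab\<close> on homogeneous elements of
  complementary degrees and \<open>0\<close> on all other homogeneous ones.\<close>

definition cohomology_pairing ::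
    "('k, 'a) dgca \<Rightarrow> nat \<Rightarrow> ('a set \<Rightarrow> 'k) \<Rightarrow> 'a set \<Rightarrow> 'a set \<Rightarrow> 'k" where
  "cohomology_pairing A n fund a b =
     fund (component (cohomology A) (int n) (a \<otimes>\<^bsub>cohomology A\<^esub> b))"

definition cochain_pairing :: "('k, 'a) dgca \<Rightarrow> nat \<Rightarrow> ('a set \<Rightarrow> 'k) \<Rightarrow> 'a \<Rightarrow> 'a \<Rightarrow> 'k" where
  "cochain_pairing A n fund x y = fund (coh_class A (component A (int n) (x \<otimes>\<^bsub>A\<^esub> y)))"

locale poincare_dgca = dgca K A
  for K :: "('k, 'l) ring_scheme" and A :: "('k, 'a) dgca" and n :: nat and fund :: "'a set \<Rightarrow> 'k" +
  assumes gr_bounded: "k < 0 \<or> int n < k \<Longrightarrow> gr A k = {\<zero>\<^bsub>A\<^esub>}"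
    and cohomology_fin_dim: "vectorspace.fin_dim K (cohomology A)"
    and fund_closed: "a \<in> gr (cohomology A) (int n) \<Longrightarrow> fund a \<in> carrier K"
    and fund_add:
      "\<lbrakk>a \<in> gr (cohomology A) (int n); b \<in> gr (cohomology A) (int n)\<rbrakk> \<Longrightarrow>
        fund (a \<oplus>\<^bsub>cohomology A\<^esub> b) = fund a \<oplus>\<^bsub>K\<^esub> fund b"
    and fund_smult:
      "\<lbrakk>c \<in> carrier K; a \<in> gr (cohomology A) (int n)\<rbrakk> \<Longrightarrow>
        fund (c \<odot>\<^bsub>cohomology A\<^esub> a) = c \<otimes>\<^bsub>K\<^esub> fund a"
    and pairing_nondegenerate_left:
      "\<lbrakk>a \<in> carrier (cohomology A);
        \<forall>b\<in>carrier (cohomology A). cohomology_pairing A n fund a b = \<zero>\<^bsub>K\<^esub>\<rbrakk> \<Longrightarrow>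
        a = \<zero>\<^bsub>cohomology A\<^esub>"
    and pairing_nondegenerate_right:
      "\<lbrakk>b \<in> carrier (cohomology A);
        \<forall>a\<in>carrier (cohomology A). cohomology_pairing A n fund a b = \<zero>\<^bsub>K\<^esub>\<rbrakk> \<Longrightarrow>
        b = \<zero>\<^bsub>cohomology A\<^esub>"

definition harmonic_proj :: "('k, 'a) dgca \<Rightarrow> ('a \<Rightarrow> 'a) \<Rightarrow> 'a \<Rightarrow> 'a" where
  "harmonic_proj A h x = x \<ominus>\<^bsub>A\<^esub> (diff A (h x) \<oplus>\<^bsub>A\<^esub> h (diff A x))"

definition harmonic :: "('k, 'a) dgca \<Rightarrow> ('a \<Rightarrow> 'a) \<Rightarrow> 'a set" where
  "harmonic A h = harmonic_proj A h ` carrier A"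

locale hodge_homotopy = poincare_dgca K A n fund
  for K :: "('k, 'l) ring_scheme" and A :: "('k, 'a) dgca" and n :: nat and fund :: "'a set \<Rightarrow> 'k" +
  fixes h :: "'a \<Rightarrow> 'a"
  assumes h_linear: "h \<in> module_hom K A A"
    and h_degree: "x \<in> gr A k \<Longrightarrow> h x \<in> gr A (k - 1)"
    and h_h: "x \<in> carrier A \<Longrightarrow> h (h x) = \<zero>\<^bsub>A\<^esub>"
    and h_diff_h: "x \<in> carrier A \<Longrightarrow> h (diff A (h x)) = h x"
    and diff_h_diff: "x \<in> carrier A \<Longrightarrow> diff A (h (diff A x)) = diff A x"
    and h_isotropic:
      "\<lbrakk>x \<in> h ` carrier A; y \<in> h ` carrier A\<rbrakk> \<Longrightarrow> cochain_pairing A n fund x y = \<zero>\<^bsub>K\<^esub>"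
    and harmonic_orthogonal:
      "\<lbrakk>x \<in> harmonic A h; y \<in> h ` carrier A\<rbrakk> \<Longrightarrow> cochain_pairing A n fund x y = \<zero>\<^bsub>K\<^esub>"

text \<open>The inverse \<open>\<iota>\<close> of the isomorphism from the harmonic subspace to cohomology.\<close>

definition harmonic_rep :: "('k, 'a) dgca \<Rightarrow> ('a \<Rightarrow> 'a) \<Rightarrow> 'a set \<Rightarrow> 'a" where
  "harmonic_rep A h = the_inv_into (harmonic A h) (coh_class A)"


section \<open>Harrison cohomology\<close>

definition tuples :: "('k, 'a, 'm) graded_module_scheme \<Rightarrow> nat \<Rightarrow> 'a list set" where
  "tuples B p = {as. length as = p \<and> set as \<subseteq> carrier B}"

definition multilinear :: "('k, 'l) ring_scheme \<Rightarrow> ('k, 'a, 'm) graded_module_scheme \<Rightarrow> nat \<Rightarrow>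
    ('a list \<Rightarrow> 'a) \<Rightarrow> bool" where
  "multilinear K B p f \<longleftrightarrow>
     (\<forall>as\<in>tuples B p. \<forall>i<p. \<forall>x\<in>carrier B. \<forall>y\<in>carrier B. \<forall>c\<in>carrier K.
        f (as[i := x \<oplus>\<^bsub>B\<^esub> y]) = f (as[i := x]) \<oplus>\<^bsub>B\<^esub> f (as[i := y]) \<and>
        f (as[i := c \<odot>\<^bsub>B\<^esub> x]) = c \<odot>\<^bsub>B\<^esub> f (as[i := x]))"

text \<open>Linear maps \<open>B\<^bsup>\<otimes>p\<^esup> \<rightarrow> B\<close> are represented by multilinear functions on \<open>p\<close>-tuples, extended
  by \<^const>\<open>undefined\<close> outside \<open>tuples B p\<close> so that equal cochains are equal functions.\<close>

definition hoch_cochains :: "('k, 'l) ring_scheme \<Rightarrow> ('k, 'a, 'm) graded_module_scheme \<Rightarrow> nat \<Rightarrow>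
    int \<Rightarrow> ('a list \<Rightarrow> 'a) set" where
  "hoch_cochains K B p q =
     {f \<in> tuples B p \<rightarrow>\<^sub>E carrier B. multilinear K B p f \<and>
        (\<forall>as ks. length as = p \<and> list_all2 (\<lambda>a k. a \<in> gr B k) as ks \<longrightarrow>
           f as \<in> gr B (sum_list ks + q))}"

definition hoch_diff :: "('k, 'a, 'm) graded_module_scheme \<Rightarrow> nat \<Rightarrow> int \<Rightarrow> ('a list \<Rightarrow> 'a) \<Rightarrow>
    'a list \<Rightarrow> 'a" where
  "hoch_diff B p q f = (\<lambda>as\<in>tuples B (Suc p).
     sign_twist B q (hd as) \<otimes>\<^bsub>B\<^esub> f (tl as)
     \<oplus>\<^bsub>B\<^esub> (\<Oplus>\<^bsub>B\<^esub>i\<in>{1..p}. [neg1_pow (int i)] \<cdot>\<^bsub>B\<^esub>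
            f (take (i - 1) as @ [as ! (i - 1) \<otimes>\<^bsub>B\<^esub> as ! i] @ drop (i + 1) as))
     \<oplus>\<^bsub>B\<^esub> [neg1_pow (int p + 1)] \<cdot>\<^bsub>B\<^esub> (f (butlast as) \<otimes>\<^bsub>B\<^esub> last as))"

text \<open>An \<open>(i, p - i)\<close>-shuffle \<open>\<sigma>\<close> moves the entry at position \<open>j\<close> to position \<open>\<sigma> j\<close>, so the
  shuffled tuple has the entry number \<open>\<sigma>\<^sup>-\<^sup>1 m\<close> at position \<open>m\<close>.\<close>

definition shuffle_perms :: "nat \<Rightarrow> nat \<Rightarrow> (nat \<Rightarrow> nat) set" where
  "shuffle_perms i p =
     {\<sigma>. \<sigma> permutes {..<p} \<and> strict_mono_on {..<i} \<sigma> \<and> strict_mono_on {i..<p} \<sigma>}"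

definition koszul_sign :: "(nat \<Rightarrow> nat) \<Rightarrow> int list \<Rightarrow> int" where
  "koszul_sign \<sigma> ks =
     (\<Prod>(j, l)\<in>{(j, l). j < l \<and> l < length ks \<and> \<sigma> l < \<sigma> j}. neg1_pow (ks ! j * ks ! l))"

definition harr_cochains :: "('k, 'l) ring_scheme \<Rightarrow> ('k, 'a, 'm) graded_module_scheme \<Rightarrow> nat \<Rightarrow>
    int \<Rightarrow> ('a list \<Rightarrow> 'a) set" where
  "harr_cochains K B p q =
     {f \<in> hoch_cochains K B p q.
        \<forall>i as ks. 0 < i \<and> i < p \<and> length as = p \<and> list_all2 (\<lambda>a k. a \<in> gr B k) as ks \<longrightarrow>
          (\<Oplus>\<^bsub>B\<^esub>\<sigma>\<in>shuffle_perms i p.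
             [(sign \<sigma> * koszul_sign \<sigma> ks)] \<cdot>\<^bsub>B\<^esub> f (permute_list (inv_into UNIV \<sigma>) as)) = \<zero>\<^bsub>B\<^esub>}"

text \<open>Only the vector space structure is meaningful; the ring multiplication and unit that the
  record type carries along are dummies.\<close>

definition harr_module :: "('k, 'l) ring_scheme \<Rightarrow> ('k, 'a, 'm) graded_module_scheme \<Rightarrow> nat \<Rightarrow>
    int \<Rightarrow> ('k, 'a list \<Rightarrow> 'a) module" where
  "harr_module K B p q =
     \<lparr>carrier = harr_cochains K B p q,
      mult = (\<lambda>f g. \<lambda>as\<in>tuples B p. \<zero>\<^bsub>B\<^esub>),
      one = (\<lambda>as\<in>tuples B p. \<zero>\<^bsub>B\<^esub>),
      zero = (\<lambda>as\<in>tuples B p. \<zero>\<^bsub>B\<^esub>),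
      add = (\<lambda>f g. \<lambda>as\<in>tuples B p. f as \<oplus>\<^bsub>B\<^esub> g as),
      smult = (\<lambda>c f. \<lambda>as\<in>tuples B p. c \<odot>\<^bsub>B\<^esub> f as)\<rparr>"

definition harr_cocycles :: "('k, 'l) ring_scheme \<Rightarrow> ('k, 'a, 'm) graded_module_scheme \<Rightarrow> nat \<Rightarrow>
    int \<Rightarrow> ('a list \<Rightarrow> 'a) set" where
  "harr_cocycles K B p q =
     a_kernel (harr_module K B p q) (harr_module K B (Suc p) q) (hoch_diff B p q)"

definition harr_coboundaries :: "('k, 'l) ring_scheme \<Rightarrow> ('k, 'a, 'm) graded_module_scheme \<Rightarrow> nat \<Rightarrow>
    int \<Rightarrow> ('a list \<Rightarrow> 'a) set" where
  "harr_coboundaries K B p q =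
     (if p = 0 then {\<zero>\<^bsub>harr_module K B p q\<^esub>}
      else hoch_diff B (p - 1) q ` harr_cochains K B (p - 1) q)"

definition harr_cohomology :: "('k, 'l) ring_scheme \<Rightarrow> ('k, 'a, 'm) graded_module_scheme \<Rightarrow> nat \<Rightarrow>
    int \<Rightarrow> ('k, ('a list \<Rightarrow> 'a) set) module" where
  "harr_cohomology K B p q =
     quotient_module ((harr_module K B p q)\<lparr>carrier := harr_cocycles K B p q\<rparr>)
       (harr_coboundaries K B p q)"

definition harr_class :: "('k, 'l) ring_scheme \<Rightarrow> ('k, 'a, 'm) graded_module_scheme \<Rightarrow> nat \<Rightarrow>
    int \<Rightarrow> ('a list \<Rightarrow> 'a) \<Rightarrow> ('a list \<Rightarrow> 'a) set" where
  "harr_class K B p q f = harr_coboundaries K B p q +>\<^bsub>harr_module K B p q\<^esub> f"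

text \<open>An isomorphism \<open>\<phi> : B \<rightarrow> C\<close> acts on cochains by \<open>f \<mapsto> \<phi> \<circ> f \<circ> (\<phi>\<^sup>-\<^sup>1)\<^bsup>\<otimes>p\<^esup>\<close>.\<close>

definition harr_transport :: "('k, 'a, 'm) graded_module_scheme \<Rightarrow> ('k, 'b, 'n) graded_module_scheme \<Rightarrow>
    nat \<Rightarrow> ('a \<Rightarrow> 'b) \<Rightarrow> ('a list \<Rightarrow> 'a) \<Rightarrow> 'b list \<Rightarrow> 'b" where
  "harr_transport B C p \<phi> f =
     (\<lambda>bs\<in>tuples C p. \<phi> (f (map (the_inv_into (carrier B) \<phi>) bs)))"

definition harr_cohomology_map :: "('k, 'l) ring_scheme \<Rightarrow> ('k, 'a, 'm) graded_module_scheme \<Rightarrow>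
    ('k, 'b, 'n) graded_module_scheme \<Rightarrow> nat \<Rightarrow> int \<Rightarrow> ('a \<Rightarrow> 'b) \<Rightarrow>
    ('a list \<Rightarrow> 'a) set \<Rightarrow> ('b list \<Rightarrow> 'b) set" where
  "harr_cohomology_map K B C p q \<phi> X =
     (\<Union>f\<in>X. harr_class K C p q (harr_transport B C p \<phi> f))"


section \<open>The class of the ternary operation\<close>

definition mu3 :: "('k, 'a) dgca \<Rightarrow> ('a \<Rightarrow> 'a) \<Rightarrow> 'a set \<Rightarrow> 'a set \<Rightarrow> 'a set \<Rightarrow> 'a set" where
  "mu3 A h a b c =
     (let \<iota> = harmonic_rep A h in
      coh_class A (harmonic_proj A h
        (h (\<iota> a \<otimes>\<^bsub>A\<^esub> \<iota> b) \<otimes>\<^bsub>A\<^esub> \<iota> c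
         \<ominus>\<^bsub>A\<^esub> \<iota> (sign_twist (cohomology A) 1 a) \<otimes>\<^bsub>A\<^esub> h (\<iota> b \<otimes>\<^bsub>A\<^esub> \<iota> c))))"

definition mu3_class :: "('k, 'l) ring_scheme \<Rightarrow> ('k, 'a) dgca \<Rightarrow> ('a \<Rightarrow> 'a) \<Rightarrow>
    ('a set list \<Rightarrow> 'a set) set" where
  "mu3_class K A h = harr_class K (cohomology A) 3 (- 1)
     (\<lambda>as\<in>tuples (cohomology A) 3. mu3 A h (as ! 0) (as ! 1) (as ! 2))"

end

theory Submission
  imports Defs
begin

text \<open>A linear section \<open>s\<close> of the cocycles over cohomology together with a homotopy \<open>\<eta>\<close> from \<open>s a \<cdot> s b\<close>
  to \<open>s (a \<cdot> b)\<close> determines the ternary operation as the class of a Massey-type cocycle. Such data can be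
  pushed forward along quasi-isomorphisms and, after a gauge change, lifted along them; two choices on
  the same algebra change the operation by a Harrison coboundary. This makes the class invariant.

  Conversely, let \<open>T\<close> be an isomorphism of cohomology rings matching the two classes. The common model
  is the homotopy pullback of the harmonic projections of the two algebras, made of triples \<open>(x, y, z)\<close>
  with \<open>z\<close> harmonic and \<open>dz = \<pi>' y - T \<pi> x\<close>. The projections are multiplicative only up to the homotopy
  \<open>\<kappa>\<close>, which is used to twist the product. On a subalgebra \<open>S\<close> that is harmonic in low degrees, connectedness, duality
  and \<open>n \<le> 4r - 1\<close> leave a single obstruction to associativity, for three factors of degree \<open>r\<close>
  with \<open>n = 4r - 1\<close>. It is the difference of the two ternary operations, and a Harrison cochain bounding
  this difference corrects it. Formality is the case of the cohomology algebra with zero homotopy.\<close>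

text \<open>Where \<open>4r - 1\<close> comes from: classes of positive degree have degree at least
  \<open>r\<close>, so the ternary operation takes them to degree at least \<open>3r - 1\<close>.
  Duality leaves no harmonic elements strictly between degrees \<open>n - r\<close> and
  \<open>n\<close>, and in degree \<open>n\<close> the orthogonality conditions on a Hodge homotopy
  make the operation vanish. What survives is degree \<open>n - r\<close>, reached only by three
  factors of degree \<open>r\<close> with \<open>n = 4r - 1\<close>. The obstacle to the converse is
  strictness. A map that respects products up to homotopy is not a morphism of DGCAs, so an exactly
  associative and graded commutative product has to be found. It exists because the correction terms
  are harmonic, occur in a short list of degrees, and products of two elements in those degrees have
  no harmonic part; hence corrections of corrections never arise. The obstacle to invariance is that
  intermediate algebras of a zig-zag carry neither a pairing nor a Hodge homotopy. This is why the
  operation is characterized by data that make sense on every DGCA.\<close>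

section \<open>Abelian groups and graded algebras\<close>

text \<open>Rewriting with these rules moves all negative terms of an equation to the other side, so that
  associativity and commutativity decide the remaining equation between positive sums.\<close>

lemma (in abelian_group) diff_simps:
  assumes "a \<in> carrier G" "b \<in> carrier G" "c \<in> carrier G"
  shows "(a \<ominus> b) \<oplus> c = (a \<oplus> c) \<ominus> b" "a \<oplus> (b \<ominus> c) = (a \<oplus> b) \<ominus> c"
    "(a \<ominus> b) \<ominus> c = a \<ominus> (b \<oplus> c)" "a \<ominus> (b \<ominus> c) = (a \<oplus> c) \<ominus> b"
    "(a \<ominus> b = c) = (a = c \<oplus> b)" "(a = b \<ominus> c) = (a \<oplus> c = b)"
proof -
  have nc: "\<ominus> a \<in> carrier G" "\<ominus> b \<in> carrier G" "\<ominus> c \<in> carrier G" using assms by auto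
  show "(a \<ominus> b) \<oplus> c = (a \<oplus> c) \<ominus> b" "a \<oplus> (b \<ominus> c) = (a \<oplus> b) \<ominus> c"
    "(a \<ominus> b) \<ominus> c = a \<ominus> (b \<oplus> c)" "a \<ominus> (b \<ominus> c) = (a \<oplus> c) \<ominus> b"
    using assms nc by (auto simp: a_minus_def minus_add a_ac)
  show "(a \<ominus> b = c) = (a = c \<oplus> b)"
    using assms nc by (metis a_minus_def add.inv_solve_right')
  show "(a = b \<ominus> c) = (a \<oplus> c = b)"
    using assms nc by (metis a_minus_def add.inv_solve_right)
qed

lemma (in abelian_group) diff_simps2:
  assumes "a \<in> carrier G" "b \<in> carrier G"
  shows "\<ominus> (a \<ominus> b) = b \<ominus> a" "(\<ominus> a) \<oplus> b = b \<ominus> a" "a \<oplus> (\<ominus> b) = a \<ominus> b"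
    "a \<ominus> (\<ominus> b) = a \<oplus> b" "(\<ominus> a) \<ominus> b = \<ominus> (a \<oplus> b)" "(\<ominus> a = b) = (a \<oplus> b = \<zero>)" "(a = \<ominus> b) = (a \<oplus> b = \<zero>)"
proof -
  show "\<ominus> (a \<ominus> b) = b \<ominus> a" "(\<ominus> a) \<oplus> b = b \<ominus> a" "a \<oplus> (\<ominus> b) = a \<ominus> b"
    "a \<ominus> (\<ominus> b) = a \<oplus> b" "(\<ominus> a) \<ominus> b = \<ominus> (a \<oplus> b)"
    using assms by (auto simp: a_minus_def minus_add a_ac)
  show "(\<ominus> a = b) = (a \<oplus> b = \<zero>)"
    using assms by (metis minus_equality minus_minus r_neg a_comm)
  show "(a = \<ominus> b) = (a \<oplus> b = \<zero>)"
    using assms by (metis minus_equality minus_minus r_neg a_comm)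
qed

lemma (in abelian_group) add_neg1_pow:
  "x \<in> carrier G \<Longrightarrow> [neg1_pow k] \<cdot> x = (if even k then x else \<ominus> x)"
  using add.int_pow_neg[of x 1] by (auto simp: neg1_pow_def)

lemma (in abelian_group) finsum_support:
  assumes "finite S" "{k. f k \<noteq> \<zero>} \<subseteq> S" "\<And>k. f k \<in> carrier G"
  shows "(\<Oplus>k\<in>{k. f k \<noteq> \<zero>}. f k) = (\<Oplus>k\<in>S. f k)"
  by (rule add.finprod_mono_neutral_cong_left) (use assms in auto)

section \<open>Additive maps, and gradings given by projections\<close>

lemma additive_zero:
  assumes "abelian_group G" "abelian_group H" "\<And>x. x \<in> carrier G \<Longrightarrow> F x \<in> carrier H"
    "\<And>x y. x \<in> carrier G \<Longrightarrow> y \<in> carrier G \<Longrightarrow> F (x \<oplus>\<^bsub>G\<^esub> y) = F x \<oplus>\<^bsub>H\<^esub> F y"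
  shows "F \<zero>\<^bsub>G\<^esub> = \<zero>\<^bsub>H\<^esub>"
proof -
  interpret G: abelian_group G by fact
  interpret H: abelian_group H by fact
  have "F \<zero>\<^bsub>G\<^esub> \<oplus>\<^bsub>H\<^esub> F \<zero>\<^bsub>G\<^esub> = F \<zero>\<^bsub>G\<^esub>" using assms(4)[of "\<zero>\<^bsub>G\<^esub>" "\<zero>\<^bsub>G\<^esub>"] by simp
  then show ?thesis using assms(3)[of "\<zero>\<^bsub>G\<^esub>"] by (simp add: H.add.l_cancel_one)
qed

lemma additive_minus:
  assumes "abelian_group G" "abelian_group H" "\<And>x. x \<in> carrier G \<Longrightarrow> F x \<in> carrier H"
    "\<And>x y. x \<in> carrier G \<Longrightarrow> y \<in> carrier G \<Longrightarrow> F (x \<oplus>\<^bsub>G\<^esub> y) = F x \<oplus>\<^bsub>H\<^esub> F y"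
    and x: "x \<in> carrier G"
  shows "F (\<ominus>\<^bsub>G\<^esub> x) = \<ominus>\<^bsub>H\<^esub> F x"
proof -
  interpret G: abelian_group G by fact
  interpret H: abelian_group H by fact
  have "F (\<ominus>\<^bsub>G\<^esub> x) \<oplus>\<^bsub>H\<^esub> F x = \<zero>\<^bsub>H\<^esub>"
    using assms(4)[of "\<ominus>\<^bsub>G\<^esub> x" x] x additive_zero[of G H F] assms(1-4) by (simp add: G.l_neg)
  then show ?thesis using assms(3) x by (metis G.a_inv_closed H.minus_equality)
qed

lemma additive_finsum:
  assumes "abelian_group G" "abelian_group H" "\<And>x. x \<in> carrier G \<Longrightarrow> F x \<in> carrier H"
    "\<And>x y. x \<in> carrier G \<Longrightarrow> y \<in> carrier G \<Longrightarrow> F (x \<oplus>\<^bsub>G\<^esub> y) = F x \<oplus>\<^bsub>H\<^esub> F y"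
    and "finite S" "\<And>k. k \<in> S \<Longrightarrow> f k \<in> carrier G"
  shows "F (\<Oplus>\<^bsub>G\<^esub> k\<in>S. f k) = (\<Oplus>\<^bsub>H\<^esub> k\<in>S. F (f k))"
proof -
  interpret G: abelian_group G by fact
  interpret H: abelian_group H by fact
  show ?thesis using assms(5,6)
  proof (induction S rule: finite_induct)
    case empty
    then show ?case using additive_zero[of G H F] assms(1-4) by simp
  next
    case (insert k S)
    then have f: "f \<in> S \<rightarrow> carrier G" "f k \<in> carrier G" "(\<lambda>k. F (f k)) \<in> S \<rightarrow> carrier H"
        "F (f k) \<in> carrier H"
      using assms(3) by auto
    then show ?case using insert assms(4) by simp
  qed
qed

text \<open>Applying the projections to a finite sum of homogeneous elements recovers the summands,
  which gives uniqueness. Existence follows since \<open>x\<close> and the sum of its projections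
  have the same projections, and these separate elements. Gradings on cohomology and on the algebra
  of triples are verified in this way, before \<open>component\<close> is known to behave
  there.\<close>

lemma unique_decompositionI:
  fixes B :: "('k, 'a, 'm) graded_module_scheme"
  assumes "abelian_group B"
    and sub: "\<And>k x. x \<in> gr B k \<Longrightarrow> x \<in> carrier B"
    and P: "\<And>k x. x \<in> carrier B \<Longrightarrow> P k x \<in> gr B k"
    and add: "\<And>k x y. x \<in> carrier B \<Longrightarrow> y \<in> carrier B \<Longrightarrow> P k (x \<oplus>\<^bsub>B\<^esub> y) = P k x \<oplus>\<^bsub>B\<^esub> P k y"
    and idem: "\<And>k x. x \<in> gr B k \<Longrightarrow> P k x = x"
    and orth: "\<And>k l x. x \<in> gr B l \<Longrightarrow> l \<noteq> k \<Longrightarrow> P k x = \<zero>\<^bsub>B\<^esub>"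
    and fin: "\<And>x. x \<in> carrier B \<Longrightarrow> finite {k. P k x \<noteq> \<zero>\<^bsub>B\<^esub>}"
    and sep: "\<And>x. x \<in> carrier B \<Longrightarrow> (\<And>k. P k x = \<zero>\<^bsub>B\<^esub>) \<Longrightarrow> x = \<zero>\<^bsub>B\<^esub>"
    and x: "x \<in> carrier B"
  shows "decomposes B x (\<lambda>k. P k x)" "\<exists>!c. decomposes B x c"
proof -
  interpret B: abelian_group B by fact
  have Pc: "P k x \<in> carrier B" if "x \<in> carrier B" for k x using P sub that by blast
  have Psum: "P j (\<Oplus>\<^bsub>B\<^esub> k\<in>S. c k) = (if j \<in> S then c j else \<zero>\<^bsub>B\<^esub>)"
    if "finite S" "\<And>k. c k \<in> gr B k" for j S c
  proof -
    have "P j (\<Oplus>\<^bsub>B\<^esub> k\<in>S. c k) = (\<Oplus>\<^bsub>B\<^esub> k\<in>S. P j (c k))"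
      by (rule additive_finsum) (use that sub Pc add assms(1) in auto)
    also have "\<dots> = (\<Oplus>\<^bsub>B\<^esub> k\<in>S. if j = k then c k else \<zero>\<^bsub>B\<^esub>)"
    proof (rule B.finsum_cong'[OF refl])
      show "(\<lambda>k. if j = k then c k else \<zero>\<^bsub>B\<^esub>) \<in> S \<rightarrow> carrier B"
        using sub[OF that(2)] by auto
      show "P j (c k) = (if j = k then c k else \<zero>\<^bsub>B\<^esub>)" for k
        using idem[OF that(2)[of j]] orth[OF that(2)[of k]] by metis
    qed
    also have "\<dots> = (if j \<in> S then c j else \<zero>\<^bsub>B\<^esub>)"
    proof (cases "j \<in> S")
      case True
      then show ?thesis using B.add.finprod_singleton[of j S c] that(1) sub[OF that(2)] by auto
    next
      case False
      then have "(\<Oplus>\<^bsub>B\<^esub> k\<in>S. if j = k then c k else \<zero>\<^bsub>B\<^esub>) = (\<Oplus>\<^bsub>B\<^esub> k\<in>S. \<zero>\<^bsub>B\<^esub>)"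
        by (intro B.finsum_cong') auto
      then show ?thesis using False by simp
    qed
    finally show ?thesis .
  qed
  let ?S = "{k. P k x \<noteq> \<zero>\<^bsub>B\<^esub>}"
  let ?y = "\<Oplus>\<^bsub>B\<^esub> k\<in>?S. P k x"
  have y: "?y \<in> carrier B" using Pc x by (auto intro!: B.finsum_closed)
  have "P j (x \<ominus>\<^bsub>B\<^esub> ?y) = \<zero>\<^bsub>B\<^esub>" for j
  proof -
    have "P j (x \<ominus>\<^bsub>B\<^esub> ?y) = P j x \<ominus>\<^bsub>B\<^esub> P j ?y"
      using add[of x "\<ominus>\<^bsub>B\<^esub> ?y" j] x y additive_minus[of B B "P j" ?y] Pc assms(1) add
      by (simp add: a_minus_def)
    also have "P j ?y = P j x" using Psum[of ?S "\<lambda>k. P k x" j] fin x P by auto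
    finally show ?thesis using Pc x by (simp add: B.r_neg a_minus_def)
  qed
  then have "x \<ominus>\<^bsub>B\<^esub> ?y = \<zero>\<^bsub>B\<^esub>" using sep x y by blast
  then have "x = ?y" using x y by (simp add: B.diff_simps)
  then show dec: "decomposes B x (\<lambda>k. P k x)" using P fin x by (simp add: decomposes_def)
  have "c = (\<lambda>k. P k x)" if c: "decomposes B x c" for c
  proof
    fix j
    have "P j (\<Oplus>\<^bsub>B\<^esub> k\<in>{k. c k \<noteq> \<zero>\<^bsub>B\<^esub>}. c k) = c j"
      using Psum[of "{k. c k \<noteq> \<zero>\<^bsub>B\<^esub>}" c j] c by (auto simp: decomposes_def)
    then show "c j = P j x" using c by (auto simp: decomposes_def)
  qed
  then show "\<exists>!c. decomposes B x c" using dec by blast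
qed

section \<open>Homogeneous components and the sign twist\<close>

context graded_comm_algebra
begin

lemma gr_submodule: "submodule K (gr B k) B"
  using gr_subspace by (simp add: subspace_def)

lemma gr_closed: "x \<in> gr B k \<Longrightarrow> x \<in> carrier B"
  using submodule.subset[OF gr_submodule] by auto

lemma gr_add: "x \<in> gr B k \<Longrightarrow> y \<in> gr B k \<Longrightarrow> x \<oplus>\<^bsub>B\<^esub> y \<in> gr B k"
  using submodule.m_closed[OF gr_submodule] by auto

lemma gr_smult: "c \<in> carrier K \<Longrightarrow> x \<in> gr B k \<Longrightarrow> c \<odot>\<^bsub>B\<^esub> x \<in> gr B k"
  using submodule.smult_closed[OF gr_submodule] by auto

lemma gr_zero: "\<zero>\<^bsub>B\<^esub> \<in> gr B k"
  using submodule.zero_closed[OF gr_submodule] by auto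

lemma smult_minus_one: "x \<in> carrier B \<Longrightarrow> (\<ominus>\<^bsub>K\<^esub> \<one>\<^bsub>K\<^esub>) \<odot>\<^bsub>B\<^esub> x = \<ominus>\<^bsub>B\<^esub> x"
  using smult_l_minus[of "\<one>\<^bsub>K\<^esub>" x] by simp

lemma gr_minus: "x \<in> gr B k \<Longrightarrow> \<ominus>\<^bsub>B\<^esub> x \<in> gr B k"
  using gr_smult[of "\<ominus>\<^bsub>K\<^esub> \<one>\<^bsub>K\<^esub>" x k] smult_minus_one gr_closed by simp

lemma gr_diff: "x \<in> gr B k \<Longrightarrow> y \<in> gr B k \<Longrightarrow> x \<ominus>\<^bsub>B\<^esub> y \<in> gr B k"
  by (simp add: a_minus_def gr_add gr_minus)

lemma gr_sign: "x \<in> gr B k \<Longrightarrow> [neg1_pow q] \<cdot>\<^bsub>B\<^esub> x \<in> gr B k"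
  using M.add_neg1_pow[OF gr_closed] gr_minus by simp

lemma decomposes_component: "x \<in> carrier B \<Longrightarrow> decomposes B x (\<lambda>k. component B k x)"
  unfolding component_def using theI'[OF gr_direct_sum[of x]] by simp

lemma component_eq: "x \<in> carrier B \<Longrightarrow> decomposes B x c \<Longrightarrow> component B k x = c k"
  using gr_direct_sum[of x] decomposes_component[of x] by metis

lemma component_gr [simp]: "x \<in> carrier B \<Longrightarrow> component B k x \<in> gr B k"
  using decomposes_component by (auto simp: decomposes_def)

lemma component_closed [simp]: "x \<in> carrier B \<Longrightarrow> component B k x \<in> carrier B"
  using component_gr gr_closed by blast

lemma finite_components: "x \<in> carrier B \<Longrightarrow> finite {k. component B k x \<noteq> \<zero>\<^bsub>B\<^esub>}"
  using decomposes_component by (auto simp: decomposes_def)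

lemma sum_components:
  assumes "x \<in> carrier B" "finite S" "{k. component B k x \<noteq> \<zero>\<^bsub>B\<^esub>} \<subseteq> S"
  shows "(\<Oplus>\<^bsub>B\<^esub> k\<in>S. component B k x) = x"
  using decomposes_component[OF assms(1)] M.finsum_support[of S "\<lambda>k. component B k x"] assms
  by (simp add: decomposes_def)

lemma component_eqI:
  assumes "finite S" "\<And>k. k \<in> S \<Longrightarrow> c k \<in> gr B k" "x = (\<Oplus>\<^bsub>B\<^esub> k\<in>S. c k)"
  shows "component B k x = (if k \<in> S then c k else \<zero>\<^bsub>B\<^esub>)"
proof -
  let ?c = "\<lambda>k. if k \<in> S then c k else \<zero>\<^bsub>B\<^esub>"
  have g: "?c k \<in> gr B k" for k using assms gr_zero by auto
  have "x = (\<Oplus>\<^bsub>B\<^esub> k\<in>S. ?c k)"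
    unfolding assms(3) by (rule M.finsum_cong'[OF refl]) (use g gr_closed in \<open>blast, auto\<close>)
  moreover have "(\<Oplus>\<^bsub>B\<^esub> k\<in>{k. ?c k \<noteq> \<zero>\<^bsub>B\<^esub>}. ?c k) = (\<Oplus>\<^bsub>B\<^esub> k\<in>S. ?c k)"
    by (rule M.finsum_support) (use assms gr_closed g in auto)
  moreover have "finite {k. ?c k \<noteq> \<zero>\<^bsub>B\<^esub>}" by (rule finite_subset[OF _ assms(1)]) auto
  ultimately have "decomposes B x ?c" using g by (simp add: decomposes_def)
  moreover have "x \<in> carrier B"
    unfolding assms(3) by (rule M.finsum_closed) (use gr_closed[OF assms(2)] in auto)
  ultimately show ?thesis using component_eq by blast
qed

lemma component_homogeneous: "x \<in> gr B l \<Longrightarrow> component B k x = (if k = l then x else \<zero>\<^bsub>B\<^esub>)"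
  using component_eqI[of "{l}" "\<lambda>_. x" x k] gr_closed by auto

lemma component_add:
  assumes "x \<in> carrier B" "y \<in> carrier B"
  shows "component B k (x \<oplus>\<^bsub>B\<^esub> y) = component B k x \<oplus>\<^bsub>B\<^esub> component B k y"
proof -
  let ?S = "insert k ({k. component B k x \<noteq> \<zero>\<^bsub>B\<^esub>} \<union> {k. component B k y \<noteq> \<zero>\<^bsub>B\<^esub>})"
  have fin: "finite ?S" using finite_components assms by auto
  have "x \<oplus>\<^bsub>B\<^esub> y = (\<Oplus>\<^bsub>B\<^esub> k\<in>?S. component B k x) \<oplus>\<^bsub>B\<^esub> (\<Oplus>\<^bsub>B\<^esub> k\<in>?S. component B k y)"
    by (subst sum_components[OF assms(1) fin] sum_components[OF assms(2) fin], blast)+ simp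
  also have "\<dots> = (\<Oplus>\<^bsub>B\<^esub> k\<in>?S. component B k x \<oplus>\<^bsub>B\<^esub> component B k y)"
    using assms by (intro M.finsum_addf[symmetric]) auto
  finally show ?thesis
    using component_eqI[of ?S "\<lambda>k. component B k x \<oplus>\<^bsub>B\<^esub> component B k y" "x \<oplus>\<^bsub>B\<^esub> y" k] fin assms gr_add
    by auto
qed

lemma component_smult:
  assumes "c \<in> carrier K" "x \<in> carrier B"
  shows "component B k (c \<odot>\<^bsub>B\<^esub> x) = c \<odot>\<^bsub>B\<^esub> component B k x"
proof -
  let ?S = "insert k {k. component B k x \<noteq> \<zero>\<^bsub>B\<^esub>}"
  have fin: "finite ?S" using finite_components assms by auto
  have "c \<odot>\<^bsub>B\<^esub> x = c \<odot>\<^bsub>B\<^esub> (\<Oplus>\<^bsub>B\<^esub> k\<in>?S. component B k x)"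
    by (subst sum_components[OF assms(2) fin]) auto
  also have "\<dots> = (\<Oplus>\<^bsub>B\<^esub> k\<in>?S. c \<odot>\<^bsub>B\<^esub> component B k x)"
    using assms fin smult_r_distr M.abelian_group_axioms
    by (intro additive_finsum[of B B "\<lambda>x. c \<odot>\<^bsub>B\<^esub> x"]) auto
  finally show ?thesis
    using component_eqI[of ?S "\<lambda>k. c \<odot>\<^bsub>B\<^esub> component B k x" "c \<odot>\<^bsub>B\<^esub> x" k] fin assms gr_smult
    by auto
qed

lemma component_minus: "x \<in> carrier B \<Longrightarrow> component B k (\<ominus>\<^bsub>B\<^esub> x) = \<ominus>\<^bsub>B\<^esub> component B k x"
  using component_smult[of "\<ominus>\<^bsub>K\<^esub> \<one>\<^bsub>K\<^esub>" x k] by (simp add: smult_minus_one)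

lemma component_diff:
  "x \<in> carrier B \<Longrightarrow> y \<in> carrier B \<Longrightarrow> component B k (x \<ominus>\<^bsub>B\<^esub> y) = component B k x \<ominus>\<^bsub>B\<^esub> component B k y"
  by (simp add: a_minus_def component_add component_minus)

lemma component_zero [simp]: "component B k \<zero>\<^bsub>B\<^esub> = \<zero>\<^bsub>B\<^esub>"
  using component_homogeneous[OF gr_zero[of k], of k] by simp

lemma component_eq_zeroI: "x \<in> carrier B \<Longrightarrow> (\<And>k. component B k x = \<zero>\<^bsub>B\<^esub>) \<Longrightarrow> x = \<zero>\<^bsub>B\<^esub>"
  using sum_components[of x "{}"] by simp

lemma components_eqI:
  assumes "x \<in> carrier B" "y \<in> carrier B" "\<And>k. component B k x = component B k y"
  shows "x = y"
proof -
  have "x \<ominus>\<^bsub>B\<^esub> y = \<zero>\<^bsub>B\<^esub>"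
    by (rule component_eq_zeroI) (use assms in \<open>auto simp: component_diff M.diff_simps\<close>)
  then show ?thesis using assms by (simp add: M.diff_simps)
qed

lemma gr_iff_components:
  assumes x: "x \<in> carrier B"
  shows "x \<in> gr B l \<longleftrightarrow> (\<forall>k. k \<noteq> l \<longrightarrow> component B k x = \<zero>\<^bsub>B\<^esub>)"
proof
  assume "\<forall>k. k \<noteq> l \<longrightarrow> component B k x = \<zero>\<^bsub>B\<^esub>"
  then have "component B k x = component B k (component B l x)" for k
    unfolding component_homogeneous[OF component_gr[OF x], of k l] by auto
  then have "x = component B l x"
    using components_eqI[OF x component_closed[OF x]] by blast
  then show "x \<in> gr B l" using component_gr[OF x, of l] by simp
qed (simp add: component_homogeneous)

lemma homogeneous_induct [consumes 1, case_names homogeneous add]: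
  assumes "x \<in> carrier B" and hom: "\<And>k y. y \<in> gr B k \<Longrightarrow> P y"
    and add: "\<And>x y. x \<in> carrier B \<Longrightarrow> y \<in> carrier B \<Longrightarrow> P x \<Longrightarrow> P y \<Longrightarrow> P (x \<oplus>\<^bsub>B\<^esub> y)"
  shows "P x"
proof -
  have "P (\<Oplus>\<^bsub>B\<^esub> k\<in>S. component B k x)" if "finite S" for S
    using that
  proof (induction S rule: finite_induct)
    case empty
    then show ?case using hom[OF gr_zero] by simp
  next
    case (insert k S)
    then show ?case using assms(1) hom[OF component_gr] by (auto intro!: add M.finsum_closed)
  qed
  from this[OF finite_components[OF assms(1)]] show ?thesis
    using sum_components[OF assms(1) finite_components[OF assms(1)] order_refl] by simp
qed

text \<open>Enlarging the index set beyond the support allows the twists of two elements and of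
  their sum to be written over one common set.\<close>

lemma sign_twist_eq_sum:
  assumes "x \<in> carrier B" "finite S" "{k. component B k x \<noteq> \<zero>\<^bsub>B\<^esub>} \<subseteq> S"
  shows "sign_twist B q x = (\<Oplus>\<^bsub>B\<^esub> k\<in>S. [neg1_pow (q * k)] \<cdot>\<^bsub>B\<^esub> component B k x)"
proof -
  have "{k. component B k x \<noteq> \<zero>\<^bsub>B\<^esub>} = {k. [neg1_pow (q * k)] \<cdot>\<^bsub>B\<^esub> component B k x \<noteq> \<zero>\<^bsub>B\<^esub>}"
    using assms by (auto simp: M.add_neg1_pow M.diff_simps)
  then show ?thesis unfolding sign_twist_def
    using M.finsum_support[of S "\<lambda>k. [neg1_pow (q * k)] \<cdot>\<^bsub>B\<^esub> component B k x"] assms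
    by auto
qed

lemma sign_twist_closed [simp]: "x \<in> carrier B \<Longrightarrow> sign_twist B q x \<in> carrier B"
  unfolding sign_twist_def by (auto intro!: M.finsum_closed)

lemma sign_twist_add:
  assumes "x \<in> carrier B" "y \<in> carrier B"
  shows "sign_twist B q (x \<oplus>\<^bsub>B\<^esub> y) = sign_twist B q x \<oplus>\<^bsub>B\<^esub> sign_twist B q y"
proof -
  let ?S = "{k. component B k x \<noteq> \<zero>\<^bsub>B\<^esub>} \<union> {k. component B k y \<noteq> \<zero>\<^bsub>B\<^esub>}"
  have fin: "finite ?S" using finite_components assms by auto
  have sub: "{k. component B k (x \<oplus>\<^bsub>B\<^esub> y) \<noteq> \<zero>\<^bsub>B\<^esub>} \<subseteq> ?S" using assms by (auto simp: component_add)
  have "sign_twist B q (x \<oplus>\<^bsub>B\<^esub> y) =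
    (\<Oplus>\<^bsub>B\<^esub> k\<in>?S. [neg1_pow (q * k)] \<cdot>\<^bsub>B\<^esub> component B k x \<oplus>\<^bsub>B\<^esub> [neg1_pow (q * k)] \<cdot>\<^bsub>B\<^esub> component B k y)"
    unfolding sign_twist_eq_sum[OF M.a_closed[OF assms] fin sub]
    by (rule M.finsum_cong'[OF refl])
      (use assms in \<open>auto simp: component_add M.add_neg1_pow M.minus_add\<close>)
  also have "\<dots> = (\<Oplus>\<^bsub>B\<^esub> k\<in>?S. [neg1_pow (q * k)] \<cdot>\<^bsub>B\<^esub> component B k x) \<oplus>\<^bsub>B\<^esub>
      (\<Oplus>\<^bsub>B\<^esub> k\<in>?S. [neg1_pow (q * k)] \<cdot>\<^bsub>B\<^esub> component B k y)"
    by (rule M.finsum_addf) (use assms in auto)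
  also have "\<dots> = sign_twist B q x \<oplus>\<^bsub>B\<^esub> sign_twist B q y"
    using sign_twist_eq_sum[OF assms(1) fin] sign_twist_eq_sum[OF assms(2) fin] by auto
  finally show ?thesis .
qed

lemma sign_twist_homogeneous: "x \<in> gr B k \<Longrightarrow> sign_twist B q x = [neg1_pow (q * k)] \<cdot>\<^bsub>B\<^esub> x"
  by (subst sign_twist_eq_sum[of x "{k}" q]) (auto simp: component_homogeneous gr_closed M.add_neg1_pow)

lemma sign_twist_smult:
  assumes c: "c \<in> carrier K" and x: "x \<in> carrier B"
  shows "sign_twist B q (c \<odot>\<^bsub>B\<^esub> x) = c \<odot>\<^bsub>B\<^esub> sign_twist B q x"
  using x
proof (induction rule: homogeneous_induct)
  case (homogeneous k y)
  then show ?case using c gr_closed[of y k] smult_r_minus[of c y]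
    by (simp add: sign_twist_homogeneous[of _ k] gr_smult M.add_neg1_pow)
next
  case (add x y)
  then show ?case using c by (simp add: sign_twist_add smult_r_distr)
qed

lemma sign_twist_one: "sign_twist B q \<one>\<^bsub>B\<^esub> = \<one>\<^bsub>B\<^esub>"
  using sign_twist_homogeneous[OF one_gr] M.add_neg1_pow[of "\<one>\<^bsub>B\<^esub>" 0] by simp

end

lemma module_hom_facts:
  assumes "module K M" "module K N" "f \<in> module_hom K M N"
  shows "\<And>x. x \<in> carrier M \<Longrightarrow> f x \<in> carrier N"
    "\<And>x y. x \<in> carrier M \<Longrightarrow> y \<in> carrier M \<Longrightarrow> f (x \<oplus>\<^bsub>M\<^esub> y) = f x \<oplus>\<^bsub>N\<^esub> f y"
    "\<And>c x. c \<in> carrier K \<Longrightarrow> x \<in> carrier M \<Longrightarrow> f (c \<odot>\<^bsub>M\<^esub> x) = c \<odot>\<^bsub>N\<^esub> f x"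
    "f \<zero>\<^bsub>M\<^esub> = \<zero>\<^bsub>N\<^esub>" "\<And>x. x \<in> carrier M \<Longrightarrow> f (\<ominus>\<^bsub>M\<^esub> x) = \<ominus>\<^bsub>N\<^esub> f x"
    "\<And>x y. x \<in> carrier M \<Longrightarrow> y \<in> carrier M \<Longrightarrow> f (x \<ominus>\<^bsub>M\<^esub> y) = f x \<ominus>\<^bsub>N\<^esub> f y"
proof -
  interpret M: module K M by fact
  interpret N: module K N by fact
  show c: "\<And>x. x \<in> carrier M \<Longrightarrow> f x \<in> carrier N"
    and a: "\<And>x y. x \<in> carrier M \<Longrightarrow> y \<in> carrier M \<Longrightarrow> f (x \<oplus>\<^bsub>M\<^esub> y) = f x \<oplus>\<^bsub>N\<^esub> f y"
    and "\<And>c x. c \<in> carrier K \<Longrightarrow> x \<in> carrier M \<Longrightarrow> f (c \<odot>\<^bsub>M\<^esub> x) = c \<odot>\<^bsub>N\<^esub> f x"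
    using assms(3) by (auto simp: module_hom_def)
  have g: "abelian_group M" "abelian_group N" by unfold_locales
  show "f \<zero>\<^bsub>M\<^esub> = \<zero>\<^bsub>N\<^esub>" by (rule additive_zero[OF g]) (use c a in auto)
  show m: "f (\<ominus>\<^bsub>M\<^esub> x) = \<ominus>\<^bsub>N\<^esub> f x" if "x \<in> carrier M" for x
    by (rule additive_minus[OF g]) (use c a that in auto)
  show "f (x \<ominus>\<^bsub>M\<^esub> y) = f x \<ominus>\<^bsub>N\<^esub> f y" if "x \<in> carrier M" "y \<in> carrier M" for x y
    using a[of x "\<ominus>\<^bsub>M\<^esub> y"] m[of y] that by (simp add: a_minus_def)
qed

section \<open>Cohomology of a DGCA\<close>

context dgca
begin

lemma is_module: "module K A" ..

lemmas d_hom = module_hom_facts[OF is_module is_module diff_linear]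
lemmas d_closed [simp] = d_hom(1)
lemmas d_add = d_hom(2)
lemmas d_smult = d_hom(3)
lemmas d_zero [simp] = d_hom(4)
lemmas d_minus = d_hom(5)
lemmas d_diff = d_hom(6)

lemma component_d: "x \<in> carrier A \<Longrightarrow> component A k (diff A x) = diff A (component A (k - 1) x)"
proof (induction rule: homogeneous_induct)
  case (homogeneous l y)
  have "component A k (diff A y) = (if k = l + 1 then diff A y else \<zero>\<^bsub>A\<^esub>)"
    by (rule component_homogeneous) (use homogeneous diff_degree in auto)
  moreover have "component A (k - 1) y = (if k - 1 = l then y else \<zero>\<^bsub>A\<^esub>)"
    by (rule component_homogeneous) (use homogeneous in auto)
  ultimately show ?case by auto
next
  case (add x y)
  then show ?case by (simp add: component_add d_add)
qed

text \<open>The sign depends on the degree of the first factor; for an inhomogeneous factor it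
  becomes the linear map \<open>sign_twist\<close>. Both sides are additive in \<open>x\<close>, so
  homogeneous \<open>x\<close> suffice.\<close>

lemma leibniz_general:
  assumes "x \<in> carrier A" "y \<in> carrier A"
  shows "diff A (x \<otimes>\<^bsub>A\<^esub> y) = diff A x \<otimes>\<^bsub>A\<^esub> y \<oplus>\<^bsub>A\<^esub> sign_twist A 1 x \<otimes>\<^bsub>A\<^esub> diff A y"
  using assms(1)
proof (induction rule: homogeneous_induct)
  case (homogeneous k x)
  then have "x \<in> carrier A" by (rule gr_closed)
  then show ?case using homogeneous assms(2)
    by (simp add: leibniz[of _ k] sign_twist_homogeneous[of _ k] M.add_neg1_pow B.l_minus)
next
  case (add u v)
  then show ?case using assms(2)
    by (simp add: B.l_distr d_add sign_twist_add M.a_ac)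
qed

lemma sign_twist_involution: "x \<in> carrier A \<Longrightarrow> sign_twist A 1 (sign_twist A 1 x) = x"
proof (induction rule: homogeneous_induct)
  case (homogeneous k x)
  then show ?case using gr_closed[of x k]
    by (simp add: sign_twist_homogeneous[of _ k] M.add_neg1_pow gr_minus)
next
  case (add u v)
  then show ?case by (simp add: sign_twist_add)
qed

lemma d_sign_twist: "x \<in> carrier A \<Longrightarrow> diff A (sign_twist A 1 x) = \<ominus>\<^bsub>A\<^esub> sign_twist A 1 (diff A x)"
proof (induction rule: homogeneous_induct)
  case (homogeneous k x)
  then show ?case using gr_closed[of x k] diff_degree[of x k]
    by (simp add: sign_twist_homogeneous[of _ k] sign_twist_homogeneous[of _ "k + 1"]
      M.add_neg1_pow d_minus)
next
  case (add u v)
  then show ?case by (simp add: sign_twist_add d_add M.minus_add)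
qed

lemma d_one: "diff A \<one>\<^bsub>A\<^esub> = \<zero>\<^bsub>A\<^esub>"
proof -
  have "diff A (\<one>\<^bsub>A\<^esub> \<otimes>\<^bsub>A\<^esub> \<one>\<^bsub>A\<^esub>) = diff A \<one>\<^bsub>A\<^esub> \<oplus>\<^bsub>A\<^esub> diff A \<one>\<^bsub>A\<^esub>"
    using leibniz[OF one_gr, of "\<one>\<^bsub>A\<^esub>"] M.add_neg1_pow[of "diff A \<one>\<^bsub>A\<^esub>" 0] by simp
  then show ?thesis by (simp add: M.add.l_cancel_one)
qed

lemma cocycles_iff: "x \<in> cocycles A \<longleftrightarrow> x \<in> carrier A \<and> diff A x = \<zero>\<^bsub>A\<^esub>"
  by (auto simp: cocycles_def a_kernel_def')

lemma coboundaries_iff: "x \<in> coboundaries A \<longleftrightarrow> (\<exists>y\<in>carrier A. x = diff A y)"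
  by (auto simp: coboundaries_def)

lemma cocycle_closed: "x \<in> cocycles A \<Longrightarrow> x \<in> carrier A"
  by (simp add: cocycles_iff)

lemma coboundaries_cocycles: "x \<in> coboundaries A \<Longrightarrow> x \<in> cocycles A"
  by (auto simp: coboundaries_iff cocycles_iff diff_diff)

lemma coboundary_closed: "x \<in> coboundaries A \<Longrightarrow> x \<in> carrier A"
  using coboundaries_cocycles cocycle_closed by blast

lemma coboundary_d: "x \<in> carrier A \<Longrightarrow> diff A x \<in> coboundaries A"
  by (auto simp: coboundaries_iff)

lemma coboundary_zero: "\<zero>\<^bsub>A\<^esub> \<in> coboundaries A"
  using coboundary_d[of "\<zero>\<^bsub>A\<^esub>"] by simp

lemma coboundary_add: "x \<in> coboundaries A \<Longrightarrow> y \<in> coboundaries A \<Longrightarrow> x \<oplus>\<^bsub>A\<^esub> y \<in> coboundaries A"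
  unfolding coboundaries_iff by (metis M.a_closed d_add)

lemma coboundary_smult: "c \<in> carrier K \<Longrightarrow> x \<in> coboundaries A \<Longrightarrow> c \<odot>\<^bsub>A\<^esub> x \<in> coboundaries A"
  unfolding coboundaries_iff by (metis smult_closed d_smult)

lemma coboundary_minus: "x \<in> coboundaries A \<Longrightarrow> \<ominus>\<^bsub>A\<^esub> x \<in> coboundaries A"
  unfolding coboundaries_iff by (metis M.a_inv_closed d_minus)

lemma coboundary_diff: "x \<in> coboundaries A \<Longrightarrow> y \<in> coboundaries A \<Longrightarrow> x \<ominus>\<^bsub>A\<^esub> y \<in> coboundaries A"
  by (simp add: a_minus_def coboundary_add coboundary_minus)

lemma coboundary_finsum:
  "finite S \<Longrightarrow> (\<And>k. k \<in> S \<Longrightarrow> f k \<in> coboundaries A) \<Longrightarrow> (\<Oplus>\<^bsub>A\<^esub> k\<in>S. f k) \<in> coboundaries A"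
proof (induction S rule: finite_induct)
  case empty
  then show ?case using coboundary_zero by simp
next
  case (insert k S)
  then have "f \<in> S \<rightarrow> carrier A" "f k \<in> carrier A" using coboundary_closed by auto
  then show ?case using insert coboundary_add by simp
qed

lemma cocycle_add: "x \<in> cocycles A \<Longrightarrow> y \<in> cocycles A \<Longrightarrow> x \<oplus>\<^bsub>A\<^esub> y \<in> cocycles A"
  by (simp add: cocycles_iff d_add)

lemma cocycle_minus: "x \<in> cocycles A \<Longrightarrow> \<ominus>\<^bsub>A\<^esub> x \<in> cocycles A"
  by (simp add: cocycles_iff d_minus)

lemma cocycle_diff: "x \<in> cocycles A \<Longrightarrow> y \<in> cocycles A \<Longrightarrow> x \<ominus>\<^bsub>A\<^esub> y \<in> cocycles A"
  by (simp add: cocycles_iff d_diff M.diff_simps)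

lemma cocycle_smult: "c \<in> carrier K \<Longrightarrow> x \<in> cocycles A \<Longrightarrow> c \<odot>\<^bsub>A\<^esub> x \<in> cocycles A"
  by (simp add: cocycles_iff d_smult)

lemma cocycle_zero: "\<zero>\<^bsub>A\<^esub> \<in> cocycles A"
  by (simp add: cocycles_iff)

lemma cocycle_one: "\<one>\<^bsub>A\<^esub> \<in> cocycles A"
  by (simp add: cocycles_iff d_one)

lemma cocycle_mult: "x \<in> cocycles A \<Longrightarrow> y \<in> cocycles A \<Longrightarrow> x \<otimes>\<^bsub>A\<^esub> y \<in> cocycles A"
  by (simp add: cocycles_iff leibniz_general)

lemma coboundary_mult_right: "x \<in> coboundaries A \<Longrightarrow> y \<in> cocycles A \<Longrightarrow> x \<otimes>\<^bsub>A\<^esub> y \<in> coboundaries A"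
proof -
  assume "x \<in> coboundaries A" and y: "y \<in> cocycles A"
  then obtain w where w: "w \<in> carrier A" "x = diff A w" by (auto simp: coboundaries_iff)
  then have "x \<otimes>\<^bsub>A\<^esub> y = diff A (w \<otimes>\<^bsub>A\<^esub> y)" using y by (simp add: leibniz_general cocycles_iff)
  then show ?thesis using w y coboundary_d by (simp add: cocycles_iff)
qed

lemma coboundary_mult_left: "x \<in> cocycles A \<Longrightarrow> y \<in> coboundaries A \<Longrightarrow> x \<otimes>\<^bsub>A\<^esub> y \<in> coboundaries A"
proof -
  assume x: "x \<in> cocycles A" and "y \<in> coboundaries A"
  then obtain w where w: "w \<in> carrier A" "y = diff A w" by (auto simp: coboundaries_iff)
  have z: "sign_twist A 1 \<zero>\<^bsub>A\<^esub> = \<zero>\<^bsub>A\<^esub>"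
    using sign_twist_homogeneous[OF gr_zero[of 0]] M.add_neg1_pow[of "\<zero>\<^bsub>A\<^esub>"] by simp
  \<comment> \<open>The twist applied to \<open>x\<close> cancels the one produced by the Leibniz
    rule, since twisting is an involution; the other Leibniz term vanishes because \<open>x\<close>,
    and with it its twist, is closed.\<close>
  have "x \<otimes>\<^bsub>A\<^esub> y = diff A (sign_twist A 1 x \<otimes>\<^bsub>A\<^esub> w)"
    using x w z by (simp add: leibniz_general cocycles_iff sign_twist_involution d_sign_twist)
  then show ?thesis using w x coboundary_d by (simp add: cocycles_iff)
qed

lemma component_cocycle: "x \<in> cocycles A \<Longrightarrow> component A k x \<in> cocycles A"
  using component_d[of x "k + 1"] by (simp add: cocycles_iff)

lemma component_coboundary: "x \<in> coboundaries A \<Longrightarrow> component A k x \<in> coboundaries A"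
  unfolding coboundaries_iff by (metis component_d component_closed)

text \<open>Only the component of a primitive in degree \<open>k - 1\<close> contributes to the
  differential in degree \<open>k\<close>.\<close>

lemma homogeneous_coboundary:
  assumes "x \<in> coboundaries A" "x \<in> gr A k"
  obtains y where "y \<in> gr A (k - 1)" "x = diff A y"
proof -
  obtain w where w: "w \<in> carrier A" "x = diff A w" using assms by (auto simp: coboundaries_iff)
  then have "x = diff A (component A (k - 1) w)"
    using component_d[of w k] component_homogeneous[OF assms(2), of k] by simp
  then show ?thesis using that component_gr w by blast
qed

lemma coh_class_eq_set: "coh_class A x = {b \<oplus>\<^bsub>A\<^esub> x | b. b \<in> coboundaries A}"
  by (auto simp: coh_class_def a_r_coset_def')

lemma coh_class_eq_iff:
  assumes "x \<in> carrier A" "y \<in> carrier A"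
  shows "coh_class A x = coh_class A y \<longleftrightarrow> x \<ominus>\<^bsub>A\<^esub> y \<in> coboundaries A"
proof
  assume "coh_class A x = coh_class A y"
  moreover have "x \<in> coh_class A x"
    using coboundary_zero assms by (force simp: coh_class_eq_set)
  ultimately obtain b where b: "b \<in> coboundaries A" "x = b \<oplus>\<^bsub>A\<^esub> y" by (auto simp: coh_class_eq_set)
  then have "x \<ominus>\<^bsub>A\<^esub> y = b" using assms coboundary_closed by (simp add: M.diff_simps M.a_ac)
  then show "x \<ominus>\<^bsub>A\<^esub> y \<in> coboundaries A" using b by simp
next
  assume b: "x \<ominus>\<^bsub>A\<^esub> y \<in> coboundaries A"
  have *: "coh_class A x \<subseteq> coh_class A y" if "x \<ominus>\<^bsub>A\<^esub> y \<in> coboundaries A" "x \<in> carrier A" "y \<in> carrier A" for x y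
  proof
    fix u assume "u \<in> coh_class A x"
    then obtain c where c: "c \<in> coboundaries A" "u = c \<oplus>\<^bsub>A\<^esub> x" by (auto simp: coh_class_eq_set)
    then have "u = (c \<oplus>\<^bsub>A\<^esub> (x \<ominus>\<^bsub>A\<^esub> y)) \<oplus>\<^bsub>A\<^esub> y" using that coboundary_closed
      by (simp add: M.diff_simps M.a_ac)
    then show "u \<in> coh_class A y" using coboundary_add[OF c(1) that(1)] by (auto simp: coh_class_eq_set)
  qed
  have "y \<ominus>\<^bsub>A\<^esub> x = \<ominus>\<^bsub>A\<^esub> (x \<ominus>\<^bsub>A\<^esub> y)" using assms by (simp add: M.diff_simps2)
  then have "y \<ominus>\<^bsub>A\<^esub> x \<in> coboundaries A" using b coboundary_minus by simp
  then show "coh_class A x = coh_class A y" using *[of x y] *[of y x] b assms by blast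
qed

lemma coh_class_self: "x \<in> carrier A \<Longrightarrow> x \<in> coh_class A x"
  using coboundary_zero by (force simp: coh_class_eq_set)

lemma mem_coh_class:
  assumes "x \<in> carrier A" "u \<in> coh_class A x"
  shows "u \<in> carrier A \<and> coh_class A u = coh_class A x"
proof -
  obtain b where b: "b \<in> coboundaries A" "u = b \<oplus>\<^bsub>A\<^esub> x" using assms by (auto simp: coh_class_eq_set)
  then have "u \<ominus>\<^bsub>A\<^esub> x = b" using assms coboundary_closed by (simp add: M.diff_simps M.a_ac)
  then show ?thesis using b assms coboundary_closed by (simp add: coh_class_eq_iff)
qed

lemma mem_coh_class_cocycle: "x \<in> cocycles A \<Longrightarrow> u \<in> coh_class A x \<Longrightarrow> u \<in> cocycles A"
  using coboundaries_cocycles cocycle_add by (auto simp: coh_class_eq_set)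

lemma coh_carrier: "carrier (cohomology A) = coh_class A ` cocycles A"
  by (auto simp: cohomology_def Let_def quotient_module_def FactRing_def A_RCOSETS_def'
     coh_class_def a_r_coset_def')

lemma coh_gr: "gr (cohomology A) k = coh_class A ` (cocycles A \<inter> gr A k)"
  by (simp add: cohomology_def Let_def)

lemma coh_zero_eq: "\<zero>\<^bsub>cohomology A\<^esub> = coboundaries A"
  by (simp add: cohomology_def Let_def quotient_module_def FactRing_def)

lemma coh_class_zero: "coh_class A \<zero>\<^bsub>A\<^esub> = \<zero>\<^bsub>cohomology A\<^esub>"
  using coboundary_closed by (force simp: coh_zero_eq coh_class_eq_set)

lemma coh_class_eq_zero_iff:
  "x \<in> carrier A \<Longrightarrow> coh_class A x = \<zero>\<^bsub>cohomology A\<^esub> \<longleftrightarrow> x \<in> coboundaries A"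
  using coh_class_eq_iff[of x "\<zero>\<^bsub>A\<^esub>"] by (simp add: coh_class_zero a_minus_def)

lemma coh_one: "\<one>\<^bsub>cohomology A\<^esub> = coh_class A \<one>\<^bsub>A\<^esub>"
  by (simp add: cohomology_def Let_def quotient_module_def FactRing_def coh_class_def a_r_coset_def')

lemma coh_diff: "diff (cohomology A) X = \<zero>\<^bsub>cohomology A\<^esub>"
  by (simp add: cohomology_def Let_def)

lemma coh_add:
  assumes "x \<in> cocycles A" "y \<in> cocycles A"
  shows "coh_class A x \<oplus>\<^bsub>cohomology A\<^esub> coh_class A y = coh_class A (x \<oplus>\<^bsub>A\<^esub> y)"
proof -
  have "coh_class A x \<oplus>\<^bsub>cohomology A\<^esub> coh_class A y =
     {u \<oplus>\<^bsub>A\<^esub> v | u v. u \<in> coh_class A x \<and> v \<in> coh_class A y}"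
    by (auto simp: cohomology_def Let_def quotient_module_def FactRing_def set_add_def')
  also have "\<dots> = coh_class A (x \<oplus>\<^bsub>A\<^esub> y)"
  proof (intro equalityI subsetI)
    fix w assume "w \<in> {u \<oplus>\<^bsub>A\<^esub> v | u v. u \<in> coh_class A x \<and> v \<in> coh_class A y}"
    then obtain b c where *: "w = (b \<oplus>\<^bsub>A\<^esub> x) \<oplus>\<^bsub>A\<^esub> (c \<oplus>\<^bsub>A\<^esub> y)" "b \<in> coboundaries A" "c \<in> coboundaries A"
      by (auto simp: coh_class_eq_set)
    then have "w = (b \<oplus>\<^bsub>A\<^esub> c) \<oplus>\<^bsub>A\<^esub> (x \<oplus>\<^bsub>A\<^esub> y)" using assms coboundary_closed cocycle_closed
      by (simp add: M.a_ac)
    then show "w \<in> coh_class A (x \<oplus>\<^bsub>A\<^esub> y)" using * coboundary_add by (auto simp: coh_class_eq_set)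
  next
    fix w assume "w \<in> coh_class A (x \<oplus>\<^bsub>A\<^esub> y)"
    then obtain b where "w = b \<oplus>\<^bsub>A\<^esub> (x \<oplus>\<^bsub>A\<^esub> y)" "b \<in> coboundaries A" by (auto simp: coh_class_eq_set)
    then have "w = (b \<oplus>\<^bsub>A\<^esub> x) \<oplus>\<^bsub>A\<^esub> y" "b \<oplus>\<^bsub>A\<^esub> x \<in> coh_class A x"
      using assms coboundary_closed cocycle_closed by (auto simp: coh_class_eq_set M.a_ac)
    then show "w \<in> {u \<oplus>\<^bsub>A\<^esub> v | u v. u \<in> coh_class A x \<and> v \<in> coh_class A y}"
      using coh_class_self assms cocycle_closed by blast
  qed
  finally show ?thesis .
qed

lemma coh_mult:
  assumes "x \<in> cocycles A" "y \<in> cocycles A"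
  shows "coh_class A x \<otimes>\<^bsub>cohomology A\<^esub> coh_class A y = coh_class A (x \<otimes>\<^bsub>A\<^esub> y)"
proof -
  have "coh_class A x \<otimes>\<^bsub>cohomology A\<^esub> coh_class A y =
     (\<Union>u\<in>coh_class A x. \<Union>v\<in>coh_class A y. coh_class A (u \<otimes>\<^bsub>A\<^esub> v))"
    by (auto simp: cohomology_def Let_def quotient_module_def FactRing_def rcoset_mult_def
      coh_class_def a_r_coset_def')
  also have "\<dots> = coh_class A (x \<otimes>\<^bsub>A\<^esub> y)"
  proof -
    have "coh_class A (u \<otimes>\<^bsub>A\<^esub> v) = coh_class A (x \<otimes>\<^bsub>A\<^esub> y)"
      if uv: "u \<in> coh_class A x" "v \<in> coh_class A y" for u v
    proof -
      have c: "u \<in> cocycles A" "v \<in> cocycles A" "x \<in> carrier A" "y \<in> carrier A"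
          "u \<in> carrier A" "v \<in> carrier A"
        using uv assms mem_coh_class_cocycle cocycle_closed by blast+
      have e: "u \<ominus>\<^bsub>A\<^esub> x \<in> coboundaries A" "v \<ominus>\<^bsub>A\<^esub> y \<in> coboundaries A"
        using uv c coh_class_eq_iff mem_coh_class by blast+
      \<comment> \<open>The difference of the products splits into two terms, each the product of an
        exact and a closed factor.\<close>
      have "u \<otimes>\<^bsub>A\<^esub> v \<ominus>\<^bsub>A\<^esub> x \<otimes>\<^bsub>A\<^esub> y = (u \<ominus>\<^bsub>A\<^esub> x) \<otimes>\<^bsub>A\<^esub> v \<oplus>\<^bsub>A\<^esub> x \<otimes>\<^bsub>A\<^esub> (v \<ominus>\<^bsub>A\<^esub> y)"
        using c by (simp add: a_minus_def B.l_distr B.r_distr B.l_minus B.r_minus M.a_ac M.r_neg2 M.r_neg1)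
      then have "u \<otimes>\<^bsub>A\<^esub> v \<ominus>\<^bsub>A\<^esub> x \<otimes>\<^bsub>A\<^esub> y \<in> coboundaries A"
        using coboundary_add[OF coboundary_mult_right[OF e(1) c(2)] coboundary_mult_left[OF assms(1) e(2)]] by simp
      then show ?thesis using c by (simp add: coh_class_eq_iff)
    qed
    then show ?thesis using coh_class_self assms cocycle_closed by blast
  qed
  finally show ?thesis .
qed

lemma coh_smult:
  assumes "c \<in> carrier K" "x \<in> cocycles A"
  shows "c \<odot>\<^bsub>cohomology A\<^esub> coh_class A x = coh_class A (c \<odot>\<^bsub>A\<^esub> x)"
proof -
  have "c \<odot>\<^bsub>cohomology A\<^esub> coh_class A x = (\<Union>u\<in>coh_class A x. coh_class A (c \<odot>\<^bsub>A\<^esub> u))"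
    by (auto simp: cohomology_def Let_def quotient_module_def coh_class_def a_r_coset_def')
  also have "\<dots> = coh_class A (c \<odot>\<^bsub>A\<^esub> x)"
  proof -
    have "coh_class A (c \<odot>\<^bsub>A\<^esub> u) = coh_class A (c \<odot>\<^bsub>A\<^esub> x)" if u: "u \<in> coh_class A x" for u
    proof -
      have cc: "x \<in> carrier A" "u \<in> carrier A" "u \<ominus>\<^bsub>A\<^esub> x \<in> coboundaries A"
        using u assms cocycle_closed coh_class_eq_iff mem_coh_class by blast+
      have "c \<odot>\<^bsub>A\<^esub> u \<ominus>\<^bsub>A\<^esub> c \<odot>\<^bsub>A\<^esub> x = c \<odot>\<^bsub>A\<^esub> (u \<ominus>\<^bsub>A\<^esub> x)" using cc assms
        by (simp add: a_minus_def smult_r_distr smult_r_minus)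
      then show ?thesis using cc assms coboundary_smult by (simp add: coh_class_eq_iff)
    qed
    then show ?thesis using coh_class_self assms cocycle_closed by blast
  qed
  finally show ?thesis .
qed

lemma coh_cases [consumes 1]:
  assumes "X \<in> carrier (cohomology A)"
  obtains x where "x \<in> cocycles A" "X = coh_class A x"
  using assms by (auto simp: coh_carrier)

lemma coh_class_closed [simp]: "x \<in> cocycles A \<Longrightarrow> coh_class A x \<in> carrier (cohomology A)"
  by (simp add: coh_carrier)

text \<open>The map that will turn out to be \<open>component\<close> on cohomology. The chosen
  representative does not matter, because components of coboundaries are coboundaries.\<close>

definition coh_component :: "int \<Rightarrow> 'a set \<Rightarrow> 'a set" where
  "coh_component k X = coh_class A (component A k (SOME x. x \<in> cocycles A \<and> coh_class A x = X))"

lemma coh_component_class: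
  assumes "x \<in> cocycles A"
  shows "coh_component k (coh_class A x) = coh_class A (component A k x)"
proof -
  let ?y = "SOME y. y \<in> cocycles A \<and> coh_class A y = coh_class A x"
  have y: "?y \<in> cocycles A \<and> coh_class A ?y = coh_class A x" by (rule someI[of _ x]) (use assms in auto)
  then have "?y \<ominus>\<^bsub>A\<^esub> x \<in> coboundaries A" using assms cocycle_closed coh_class_eq_iff by blast
  then have "component A k (?y \<ominus>\<^bsub>A\<^esub> x) \<in> coboundaries A" by (rule component_coboundary)
  then show ?thesis unfolding coh_component_def
    using y assms cocycle_closed by (subst coh_class_eq_iff) (auto simp: component_diff)
qed

lemma coh_abelian_group: "abelian_group (cohomology A)"
proof (rule abelian_groupI)
  fix X Y Z assume "X \<in> carrier (cohomology A)" "Y \<in> carrier (cohomology A)" "Z \<in> carrier (cohomology A)"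
  then obtain x y z where xyz: "x \<in> cocycles A" "X = coh_class A x" "y \<in> cocycles A" "Y = coh_class A y"
     "z \<in> cocycles A" "Z = coh_class A z" by (elim coh_cases) blast
  then show "(X \<oplus>\<^bsub>cohomology A\<^esub> Y) \<oplus>\<^bsub>cohomology A\<^esub> Z = X \<oplus>\<^bsub>cohomology A\<^esub> (Y \<oplus>\<^bsub>cohomology A\<^esub> Z)"
    by (simp add: coh_add cocycle_add M.a_assoc cocycle_closed)
next
  fix X Y assume "X \<in> carrier (cohomology A)" "Y \<in> carrier (cohomology A)"
  then obtain x y where xy: "x \<in> cocycles A" "X = coh_class A x" "y \<in> cocycles A" "Y = coh_class A y"
    by (elim coh_cases) blast
  then show "X \<oplus>\<^bsub>cohomology A\<^esub> Y \<in> carrier (cohomology A)"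
    "X \<oplus>\<^bsub>cohomology A\<^esub> Y = Y \<oplus>\<^bsub>cohomology A\<^esub> X"
    by (simp_all add: coh_add cocycle_add M.a_comm cocycle_closed)
next
  fix X assume "X \<in> carrier (cohomology A)"
  then obtain x where x: "x \<in> cocycles A" "X = coh_class A x" by (rule coh_cases)
  then show "\<zero>\<^bsub>cohomology A\<^esub> \<oplus>\<^bsub>cohomology A\<^esub> X = X"
    by (simp add: coh_class_zero[symmetric] coh_add cocycle_zero cocycle_closed)
  show "\<exists>Y\<in>carrier (cohomology A). Y \<oplus>\<^bsub>cohomology A\<^esub> X = \<zero>\<^bsub>cohomology A\<^esub>"
    using x cocycle_minus[OF x(1)]
    by (intro bexI[of _ "coh_class A (\<ominus>\<^bsub>A\<^esub> x)"])
      (simp_all add: coh_class_zero[symmetric] coh_add M.l_neg cocycle_closed)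
qed (simp add: coh_class_zero[symmetric] cocycle_zero)

lemma coh_submodule:
  assumes m: "module K (cohomology A)"
  shows "submodule K (gr (cohomology A) k) (cohomology A)"
proof -
  have "coh_class A x \<in> gr (cohomology A) k" if "x \<in> cocycles A" "x \<in> gr A k" for x
    using that by (auto simp: coh_gr)
  then show ?thesis
    unfolding submodule_def using m
    by (auto simp: coh_gr coh_add coh_smult cocycle_add cocycle_smult gr_add gr_smult
       coh_class_zero[symmetric] cocycle_zero gr_zero intro!: imageI)
qed

lemma coh_module: "module K (cohomology A)"
proof (rule moduleI)
  show "cring K" ..
  show "abelian_group (cohomology A)" by (rule coh_abelian_group)
  fix a b X Y assume ab: "a \<in> carrier K" "b \<in> carrier K"
    and "X \<in> carrier (cohomology A)" "Y \<in> carrier (cohomology A)"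
  then obtain x y where xy: "x \<in> cocycles A" "X = coh_class A x" "y \<in> cocycles A" "Y = coh_class A y"
    by (elim coh_cases) blast
  show "(a \<oplus>\<^bsub>K\<^esub> b) \<odot>\<^bsub>cohomology A\<^esub> X = a \<odot>\<^bsub>cohomology A\<^esub> X \<oplus>\<^bsub>cohomology A\<^esub> b \<odot>\<^bsub>cohomology A\<^esub> X"
    "a \<odot>\<^bsub>cohomology A\<^esub> (X \<oplus>\<^bsub>cohomology A\<^esub> Y) = a \<odot>\<^bsub>cohomology A\<^esub> X \<oplus>\<^bsub>cohomology A\<^esub> a \<odot>\<^bsub>cohomology A\<^esub> Y"
    "(a \<otimes>\<^bsub>K\<^esub> b) \<odot>\<^bsub>cohomology A\<^esub> X = a \<odot>\<^bsub>cohomology A\<^esub> (b \<odot>\<^bsub>cohomology A\<^esub> X)"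
    "a \<odot>\<^bsub>cohomology A\<^esub> X \<in> carrier (cohomology A)"
    using ab xy by (simp_all add: coh_smult coh_add cocycle_smult cocycle_add cocycle_closed
      smult_l_distr smult_r_distr smult_assoc1)
next
  fix X assume "X \<in> carrier (cohomology A)"
  then obtain x where x: "x \<in> cocycles A" "X = coh_class A x" by (rule coh_cases)
  then show "\<one>\<^bsub>K\<^esub> \<odot>\<^bsub>cohomology A\<^esub> X = X" by (simp add: coh_smult cocycle_closed)
qed

lemma coh_ring: "ring (cohomology A)"
proof (rule ringI)
  show "abelian_group (cohomology A)" by (rule coh_abelian_group)
  show "monoid (cohomology A)"
  proof (rule monoidI)
    fix X Y Z assume "X \<in> carrier (cohomology A)" "Y \<in> carrier (cohomology A)" "Z \<in> carrier (cohomology A)"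
    then obtain x y z where xyz: "x \<in> cocycles A" "X = coh_class A x" "y \<in> cocycles A" "Y = coh_class A y"
       "z \<in> cocycles A" "Z = coh_class A z" by (elim coh_cases) blast
    then show "(X \<otimes>\<^bsub>cohomology A\<^esub> Y) \<otimes>\<^bsub>cohomology A\<^esub> Z = X \<otimes>\<^bsub>cohomology A\<^esub> (Y \<otimes>\<^bsub>cohomology A\<^esub> Z)"
      by (simp add: coh_mult cocycle_mult B.m_assoc cocycle_closed)
  next
    fix X Y assume "X \<in> carrier (cohomology A)" "Y \<in> carrier (cohomology A)"
    then obtain x y where "x \<in> cocycles A" "X = coh_class A x" "y \<in> cocycles A" "Y = coh_class A y"
      by (elim coh_cases) blast
    then show "X \<otimes>\<^bsub>cohomology A\<^esub> Y \<in> carrier (cohomology A)" by (simp add: coh_mult cocycle_mult)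
  next
    fix X assume "X \<in> carrier (cohomology A)"
    then obtain x where x: "x \<in> cocycles A" "X = coh_class A x" by (rule coh_cases)
    then show "\<one>\<^bsub>cohomology A\<^esub> \<otimes>\<^bsub>cohomology A\<^esub> X = X" "X \<otimes>\<^bsub>cohomology A\<^esub> \<one>\<^bsub>cohomology A\<^esub> = X"
      by (simp_all add: coh_one coh_mult cocycle_one cocycle_closed)
  qed (simp add: coh_one cocycle_one)
next
  fix X Y Z assume "X \<in> carrier (cohomology A)" "Y \<in> carrier (cohomology A)" "Z \<in> carrier (cohomology A)"
  then obtain x y z where xyz: "x \<in> cocycles A" "X = coh_class A x" "y \<in> cocycles A" "Y = coh_class A y"
     "z \<in> cocycles A" "Z = coh_class A z" by (elim coh_cases) blast
  then show "(X \<oplus>\<^bsub>cohomology A\<^esub> Y) \<otimes>\<^bsub>cohomology A\<^esub> Z =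
      X \<otimes>\<^bsub>cohomology A\<^esub> Z \<oplus>\<^bsub>cohomology A\<^esub> Y \<otimes>\<^bsub>cohomology A\<^esub> Z"
    "Z \<otimes>\<^bsub>cohomology A\<^esub> (X \<oplus>\<^bsub>cohomology A\<^esub> Y) =
      Z \<otimes>\<^bsub>cohomology A\<^esub> X \<oplus>\<^bsub>cohomology A\<^esub> Z \<otimes>\<^bsub>cohomology A\<^esub> Y"
    by (simp_all add: coh_mult coh_add cocycle_mult cocycle_add B.l_distr B.r_distr cocycle_closed)
qed

lemma coh_minus:
  assumes "x \<in> cocycles A" shows "\<ominus>\<^bsub>cohomology A\<^esub> coh_class A x = coh_class A (\<ominus>\<^bsub>A\<^esub> x)"
proof -
  interpret H: ring "cohomology A" by (rule coh_ring)
  have "coh_class A (\<ominus>\<^bsub>A\<^esub> x) \<oplus>\<^bsub>cohomology A\<^esub> coh_class A x = \<zero>\<^bsub>cohomology A\<^esub>"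
    using assms cocycle_minus by (simp add: coh_add M.l_neg cocycle_closed coh_class_zero)
  then show ?thesis using assms cocycle_minus by (simp add: H.minus_equality)
qed

lemma coh_component_decomposes:
  assumes "X \<in> carrier (cohomology A)"
  shows "decomposes (cohomology A) X (\<lambda>k. coh_component k X)"
    "\<exists>!c. decomposes (cohomology A) X c"
proof -
  have *: "abelian_group (cohomology A)"
    "\<And>k x. x \<in> gr (cohomology A) k \<Longrightarrow> x \<in> carrier (cohomology A)"
    "\<And>k x. x \<in> carrier (cohomology A) \<Longrightarrow> coh_component k x \<in> gr (cohomology A) k"
    "\<And>k x y. x \<in> carrier (cohomology A) \<Longrightarrow> y \<in> carrier (cohomology A) \<Longrightarrow>
      coh_component k (x \<oplus>\<^bsub>cohomology A\<^esub> y) = coh_component k x \<oplus>\<^bsub>cohomology A\<^esub> coh_component k y"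
    "\<And>k x. x \<in> gr (cohomology A) k \<Longrightarrow> coh_component k x = x"
    "\<And>k l x. x \<in> gr (cohomology A) l \<Longrightarrow> l \<noteq> k \<Longrightarrow> coh_component k x = \<zero>\<^bsub>cohomology A\<^esub>"
    "\<And>x. x \<in> carrier (cohomology A) \<Longrightarrow> finite {k. coh_component k x \<noteq> \<zero>\<^bsub>cohomology A\<^esub>}"
    "\<And>x. x \<in> carrier (cohomology A) \<Longrightarrow> (\<And>k. coh_component k x = \<zero>\<^bsub>cohomology A\<^esub>) \<Longrightarrow> x = \<zero>\<^bsub>cohomology A\<^esub>"
  proof -
    show "abelian_group (cohomology A)" by (rule coh_abelian_group)
    show "\<And>k x. x \<in> gr (cohomology A) k \<Longrightarrow> x \<in> carrier (cohomology A)" by (auto simp: coh_gr)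
    show "coh_component k x \<in> gr (cohomology A) k" if "x \<in> carrier (cohomology A)" for k x
      using that by (elim coh_cases)
        (auto simp: coh_component_class coh_gr cocycle_closed component_cocycle intro!: imageI)
    show "coh_component k (x \<oplus>\<^bsub>cohomology A\<^esub> y) = coh_component k x \<oplus>\<^bsub>cohomology A\<^esub> coh_component k y"
      if "x \<in> carrier (cohomology A)" "y \<in> carrier (cohomology A)" for k x y
      using that by (elim coh_cases)
        (simp add: coh_component_class coh_add component_cocycle cocycle_add component_add cocycle_closed)
    show "coh_component k x = x" if "x \<in> gr (cohomology A) k" for k x
      using that by (auto simp: coh_component_class coh_gr component_homogeneous)
    show "coh_component k x = \<zero>\<^bsub>cohomology A\<^esub>" if "x \<in> gr (cohomology A) l" "l \<noteq> k" for k l x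
      using that by (auto simp: coh_component_class coh_gr component_homogeneous coh_class_zero)
    show "finite {k. coh_component k x \<noteq> \<zero>\<^bsub>cohomology A\<^esub>}" if "x \<in> carrier (cohomology A)" for x
    proof -
      obtain y where y: "y \<in> cocycles A" "x = coh_class A y" using \<open>x \<in> _\<close> by (rule coh_cases)
      have "{k. coh_component k x \<noteq> \<zero>\<^bsub>cohomology A\<^esub>} \<subseteq> {k. component A k y \<noteq> \<zero>\<^bsub>A\<^esub>}"
        using y by (auto simp: coh_component_class coh_class_zero)
      then show ?thesis using finite_components y cocycle_closed finite_subset by blast
    qed
    show "x = \<zero>\<^bsub>cohomology A\<^esub>" if "x \<in> carrier (cohomology A)" "\<And>k. coh_component k x = \<zero>\<^bsub>cohomology A\<^esub>" for x
    proof -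
      obtain y where y: "y \<in> cocycles A" "x = coh_class A y" using \<open>x \<in> _\<close> by (rule coh_cases)
      have "component A k y \<in> coboundaries A" for k
        using that(2)[of k] y by (simp add: coh_component_class coh_class_eq_zero_iff cocycle_closed)
      then have "(\<Oplus>\<^bsub>A\<^esub> k\<in>{k. component A k y \<noteq> \<zero>\<^bsub>A\<^esub>}. component A k y) \<in> coboundaries A"
        using finite_components y cocycle_closed by (intro coboundary_finsum) auto
      then have "y \<in> coboundaries A"
        using sum_components[OF cocycle_closed[OF y(1)] finite_components[OF cocycle_closed[OF y(1)]] order_refl] by simp
      then show ?thesis using y by (simp add: coh_class_eq_zero_iff cocycle_closed)
    qed
  qed
  show "decomposes (cohomology A) X (\<lambda>k. coh_component k X)"
    by (rule unique_decompositionI(1)[where P = coh_component]; (fact assms | fact *))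
  show "\<exists>!c. decomposes (cohomology A) X c"
    by (rule unique_decompositionI(2)[where P = coh_component]; (fact assms | fact *))
qed

lemma dgca_cohomology: "dgca K (cohomology A)"
proof -
  interpret H: ring "cohomology A" by (rule coh_ring)
  interpret HM: module K "cohomology A" by (rule coh_module)
  interpret HV: vectorspace K "cohomology A" ..
  show ?thesis
  proof (intro dgca.intro graded_comm_algebra.intro dgca_axioms.intro
      graded_comm_algebra_axioms.intro, goal_cases)
    case 1
    then show ?case by (rule HV.vectorspace_axioms)
  next
    case 2
    then show ?case by (rule coh_ring)
  next
    case (3 c X Y)
    then show ?case by (elim coh_cases)
      (simp add: coh_smult coh_mult cocycle_mult cocycle_smult smult_mult_left cocycle_closed)
  next
    case (4 c X Y)
    then show ?case by (elim coh_cases)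
      (simp add: coh_smult coh_mult cocycle_mult cocycle_smult smult_mult_right cocycle_closed)
  next
    case (5 k)
    then show ?case unfolding subspace_def using coh_submodule[OF coh_module] HV.vectorspace_axioms by blast
  next
    case (6 X)
    then show ?case by (rule coh_component_decomposes)
  next
    case 7
    then show ?case by (auto simp: coh_one coh_gr cocycle_one one_gr)
  next
    case (8 X k Y l)
    then show ?case by (auto simp: coh_gr coh_mult cocycle_mult mult_gr intro!: imageI)
  next
    case (9 X k Y l)
    then obtain x y where xy: "x \<in> cocycles A" "x \<in> gr A k" "X = coh_class A x"
      "y \<in> cocycles A" "y \<in> gr A l" "Y = coh_class A y" by (auto simp: coh_gr)
    then have "x \<otimes>\<^bsub>A\<^esub> y = [neg1_pow (k * l)] \<cdot>\<^bsub>A\<^esub> (y \<otimes>\<^bsub>A\<^esub> x)" by (intro graded_comm)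
    then show ?case using xy
      by (auto simp: coh_mult cocycle_mult cocycle_closed H.add_neg1_pow M.add_neg1_pow coh_minus)
  next
    case 10
    then show ?case by (auto simp: module_hom_def coh_diff)
  next
    case (11 X k)
    then show ?case by (auto simp: coh_diff coh_gr coh_class_zero[symmetric] cocycle_zero gr_zero)
  next
    case (12 X)
    then show ?case by (simp add: coh_diff)
  next
    case (13 X k Y)
    then have "X \<in> carrier (cohomology A)" by (auto simp: coh_gr)
    then show ?case using 13 H.add_neg1_pow by (simp add: coh_diff)
  qed
qed

lemma component_cohomology:
  assumes "x \<in> cocycles A"
  shows "component (cohomology A) k (coh_class A x) = coh_class A (component A k x)"
proof -
  interpret H: dgca K "cohomology A" by (rule dgca_cohomology)
  show ?thesis using H.component_eq[OF _ coh_component_decomposes(1)] assms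
    by (simp add: coh_component_class)
qed

lemma sign_twist_cohomology:
  assumes "x \<in> cocycles A" "x \<in> gr A k"
  shows "sign_twist (cohomology A) q (coh_class A x) = coh_class A (sign_twist A q x)"
proof -
  interpret H: dgca K "cohomology A" by (rule dgca_cohomology)
  have "coh_class A x \<in> gr (cohomology A) k" using assms by (auto simp: coh_gr)
  then show ?thesis using assms
    by (simp add: H.sign_twist_homogeneous[of _ k] sign_twist_homogeneous[of _ k] M.add_neg1_pow
       H.M.add_neg1_pow coh_minus cocycle_closed)
qed

end

section \<open>Homomorphisms and quasi-isomorphisms\<close>

lemma dgca_homD:
  assumes "dgca K A" "dgca K B" "f \<in> dgca_hom K A B"
  shows "f \<in> module_hom K A B"
    "\<And>x. x \<in> carrier A \<Longrightarrow> f x \<in> carrier B"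
    "\<And>x y. x \<in> carrier A \<Longrightarrow> y \<in> carrier A \<Longrightarrow> f (x \<oplus>\<^bsub>A\<^esub> y) = f x \<oplus>\<^bsub>B\<^esub> f y"
    "\<And>x y. x \<in> carrier A \<Longrightarrow> y \<in> carrier A \<Longrightarrow> f (x \<otimes>\<^bsub>A\<^esub> y) = f x \<otimes>\<^bsub>B\<^esub> f y"
    "\<And>c x. c \<in> carrier K \<Longrightarrow> x \<in> carrier A \<Longrightarrow> f (c \<odot>\<^bsub>A\<^esub> x) = c \<odot>\<^bsub>B\<^esub> f x"
    "\<And>x. x \<in> carrier A \<Longrightarrow> f (diff A x) = diff B (f x)"
    "\<And>x. x \<in> carrier A \<Longrightarrow> f (\<ominus>\<^bsub>A\<^esub> x) = \<ominus>\<^bsub>B\<^esub> f x"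
    "\<And>x y. x \<in> carrier A \<Longrightarrow> y \<in> carrier A \<Longrightarrow> f (x \<ominus>\<^bsub>A\<^esub> y) = f x \<ominus>\<^bsub>B\<^esub> f y"
    "f \<zero>\<^bsub>A\<^esub> = \<zero>\<^bsub>B\<^esub>" "f \<one>\<^bsub>A\<^esub> = \<one>\<^bsub>B\<^esub>"
    "\<And>x k. x \<in> gr A k \<Longrightarrow> f x \<in> gr B k"
    "\<And>x. x \<in> cocycles A \<Longrightarrow> f x \<in> cocycles B"
    "\<And>x. x \<in> coboundaries A \<Longrightarrow> f x \<in> coboundaries B"
proof -
  interpret A: dgca K A by fact
  interpret B: dgca K B by fact
  show m: "f \<in> module_hom K A B" and "f \<one>\<^bsub>A\<^esub> = \<one>\<^bsub>B\<^esub>"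
    "\<And>x y. x \<in> carrier A \<Longrightarrow> y \<in> carrier A \<Longrightarrow> f (x \<otimes>\<^bsub>A\<^esub> y) = f x \<otimes>\<^bsub>B\<^esub> f y"
    using assms(3) by (auto simp: dgca_hom_def graded_algebra_hom_def ring_hom_def)
  show "\<And>x k. x \<in> gr A k \<Longrightarrow> f x \<in> gr B k"
    using assms(3) by (force simp: dgca_hom_def graded_algebra_hom_def)
  note m = module_hom_facts[OF A.is_module B.is_module m]
  show "\<And>x y. x \<in> carrier A \<Longrightarrow> y \<in> carrier A \<Longrightarrow> f (x \<oplus>\<^bsub>A\<^esub> y) = f x \<oplus>\<^bsub>B\<^esub> f y"
    "\<And>c x. c \<in> carrier K \<Longrightarrow> x \<in> carrier A \<Longrightarrow> f (c \<odot>\<^bsub>A\<^esub> x) = c \<odot>\<^bsub>B\<^esub> f x"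
    "\<And>x. x \<in> carrier A \<Longrightarrow> f (\<ominus>\<^bsub>A\<^esub> x) = \<ominus>\<^bsub>B\<^esub> f x"
    "\<And>x y. x \<in> carrier A \<Longrightarrow> y \<in> carrier A \<Longrightarrow> f (x \<ominus>\<^bsub>A\<^esub> y) = f x \<ominus>\<^bsub>B\<^esub> f y"
    "f \<zero>\<^bsub>A\<^esub> = \<zero>\<^bsub>B\<^esub>" by (fact m)+
  show c: "\<And>x. x \<in> carrier A \<Longrightarrow> f x \<in> carrier B" by (fact m)
  show d: "\<And>x. x \<in> carrier A \<Longrightarrow> f (diff A x) = diff B (f x)"
    using assms(3) by (auto simp: dgca_hom_def)
  show "f x \<in> cocycles B" if "x \<in> cocycles A" for x
    using that c d[of x] m(4) by (simp add: A.cocycles_iff B.cocycles_iff)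
  show "f x \<in> coboundaries B" if "x \<in> coboundaries A" for x
    using that c d by (auto simp: A.coboundaries_iff intro!: B.coboundary_d)
qed

lemma cohomology_map_class:
  assumes "dgca K A" "dgca K B" "f \<in> dgca_hom K A B" "x \<in> cocycles A"
  shows "cohomology_map B f (coh_class A x) = coh_class B (f x)"
proof -
  interpret A: dgca K A by fact
  interpret B: dgca K B by fact
  note f = dgca_homD[OF assms(1-3)]
  have "coh_class B (f u) = coh_class B (f x)" if "u \<in> coh_class A x" for u
  proof -
    have c: "u \<in> carrier A" "x \<in> carrier A" "u \<ominus>\<^bsub>A\<^esub> x \<in> coboundaries A"
      using that assms(4) A.cocycle_closed A.coh_class_eq_iff A.mem_coh_class by blast+
    have "f u \<ominus>\<^bsub>B\<^esub> f x \<in> coboundaries B" using f(13)[OF c(3)] f(8)[OF c(1,2)] by simp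
    then show ?thesis using f(2) c B.coh_class_eq_iff by simp
  qed
  then show ?thesis unfolding cohomology_map_def
    using A.coh_class_self[OF A.cocycle_closed[OF assms(4)]] by blast
qed

text \<open>Removes the quotient sets: the first clause is surjectivity on cohomology and the second
  injectivity, both in terms of representatives. All liftings along quasi-isomorphisms start from
  this form.\<close>

lemma quasi_iso_iff:
  assumes "dgca K A" "dgca K B" "f \<in> dgca_hom K A B"
  shows "quasi_iso K A B f \<longleftrightarrow>
    (\<forall>y\<in>cocycles B. \<exists>x\<in>cocycles A. y \<ominus>\<^bsub>B\<^esub> f x \<in> coboundaries B) \<and>
    (\<forall>x\<in>cocycles A. f x \<in> coboundaries B \<longrightarrow> x \<in> coboundaries A)"
proof -
  interpret A: dgca K A by fact
  interpret B: dgca K B by fact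
  note f = dgca_homD[OF assms]
  have inj: "inj_on (cohomology_map B f) (carrier (cohomology A)) \<longleftrightarrow>
     (\<forall>x\<in>cocycles A. f x \<in> coboundaries B \<longrightarrow> x \<in> coboundaries A)"
  proof
    assume i: "inj_on (cohomology_map B f) (carrier (cohomology A))"
    show "\<forall>x\<in>cocycles A. f x \<in> coboundaries B \<longrightarrow> x \<in> coboundaries A"
    proof (intro ballI impI)
      fix x assume x: "x \<in> cocycles A" "f x \<in> coboundaries B"
      then have "cohomology_map B f (coh_class A x) = cohomology_map B f (coh_class A \<zero>\<^bsub>A\<^esub>)"
        using f B.coh_class_eq_zero_iff A.cocycle_zero A.cocycle_closed
        by (simp add: cohomology_map_class[OF assms] B.coh_class_zero)
      then have "coh_class A x = coh_class A \<zero>\<^bsub>A\<^esub>"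
        using i x A.cocycle_zero by (auto dest: inj_onD)
      then show "x \<in> coboundaries A" using x A.cocycle_closed A.coh_class_eq_zero_iff A.coh_class_zero by simp
    qed
  next
    assume i: "\<forall>x\<in>cocycles A. f x \<in> coboundaries B \<longrightarrow> x \<in> coboundaries A"
    show "inj_on (cohomology_map B f) (carrier (cohomology A))"
    proof (rule inj_onI)
      fix X Y assume XY: "X \<in> carrier (cohomology A)" "Y \<in> carrier (cohomology A)"
        and eq: "cohomology_map B f X = cohomology_map B f Y"
      then obtain x y where xy: "x \<in> cocycles A" "X = coh_class A x" "y \<in> cocycles A" "Y = coh_class A y"
        by (elim A.coh_cases) blast
      then have "f (x \<ominus>\<^bsub>A\<^esub> y) \<in> coboundaries B"
        using eq f A.cocycle_closed by (simp add: cohomology_map_class[OF assms] B.coh_class_eq_iff)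
      then have "x \<ominus>\<^bsub>A\<^esub> y \<in> coboundaries A" using i xy A.cocycle_diff by blast
      then show "X = Y" using xy A.coh_class_eq_iff A.cocycle_closed by simp
    qed
  qed
  have surj: "cohomology_map B f ` carrier (cohomology A) = carrier (cohomology B) \<longleftrightarrow>
    (\<forall>y\<in>cocycles B. \<exists>x\<in>cocycles A. y \<ominus>\<^bsub>B\<^esub> f x \<in> coboundaries B)"
  proof -
    have 1: "cohomology_map B f ` carrier (cohomology A) = (\<lambda>x. coh_class B (f x)) ` cocycles A"
      using cohomology_map_class[OF assms] by (auto simp: A.coh_carrier image_image)
    have 2: "(coh_class B y \<in> (\<lambda>x. coh_class B (f x)) ` cocycles A) \<longleftrightarrow>
        (\<exists>x\<in>cocycles A. y \<ominus>\<^bsub>B\<^esub> f x \<in> coboundaries B)" if "y \<in> cocycles B" for y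
      using that f(12) B.coh_class_eq_iff[of y] B.cocycle_closed by (simp add: image_iff)
    have "(\<lambda>x. coh_class B (f x)) ` cocycles A \<subseteq> carrier (cohomology B)" using f(12) by auto
    then have "(\<lambda>x. coh_class B (f x)) ` cocycles A = carrier (cohomology B) \<longleftrightarrow>
      (\<forall>y\<in>cocycles B. coh_class B y \<in> (\<lambda>x. coh_class B (f x)) ` cocycles A)"
      by (auto simp: B.coh_carrier)
    then show ?thesis using 1 2 by simp
  qed
  show ?thesis unfolding quasi_iso_def bij_betw_def inj surj using assms by blast
qed

section \<open>Harrison cochains of low order\<close>

text \<open>The shift \<open>j\<close> covers degree-preserving maps, the homotopy of degree
  \<open>-1\<close>, and multiplication by a homogeneous element.\<close>

lemma component_graded_hom:
  assumes "graded_comm_algebra K B" "graded_comm_algebra K C"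
    and f: "\<And>x. x \<in> carrier B \<Longrightarrow> f x \<in> carrier C"
      "\<And>x y. x \<in> carrier B \<Longrightarrow> y \<in> carrier B \<Longrightarrow> f (x \<oplus>\<^bsub>B\<^esub> y) = f x \<oplus>\<^bsub>C\<^esub> f y"
      "\<And>k x. x \<in> gr B k \<Longrightarrow> f x \<in> gr C (k + j)"
    and x: "x \<in> carrier B"
  shows "component C (k + j) (f x) = f (component B k x)"
proof -
  interpret B: graded_comm_algebra K B by fact
  interpret C: graded_comm_algebra K C by fact
  have f0: "f \<zero>\<^bsub>B\<^esub> = \<zero>\<^bsub>C\<^esub>"
    by (rule additive_zero) (use f in \<open>auto intro: B.M.abelian_group_axioms C.M.abelian_group_axioms\<close>)
  show ?thesis using x
  proof (induction rule: B.homogeneous_induct)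
    case (homogeneous l y)
    have "component C (k + j) (f y) = (if k + j = l + j then f y else \<zero>\<^bsub>C\<^esub>)"
      by (rule C.component_homogeneous) (use homogeneous f in auto)
    then show ?case using B.component_homogeneous[OF homogeneous, of k] f0 by auto
  next
    case (add x y)
    then show ?case using f by (simp add: B.component_add C.component_add)
  qed
qed

lemma sign_twist_graded_hom:
  assumes "graded_comm_algebra K B" "graded_comm_algebra K C"
    and f: "\<And>x. x \<in> carrier B \<Longrightarrow> f x \<in> carrier C"
      "\<And>x y. x \<in> carrier B \<Longrightarrow> y \<in> carrier B \<Longrightarrow> f (x \<oplus>\<^bsub>B\<^esub> y) = f x \<oplus>\<^bsub>C\<^esub> f y"
      "\<And>k x. x \<in> gr B k \<Longrightarrow> f x \<in> gr C k"
    and x: "x \<in> carrier B"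
  shows "sign_twist C q (f x) = f (sign_twist B q x)"
proof -
  interpret B: graded_comm_algebra K B by fact
  interpret C: graded_comm_algebra K C by fact
  have fm: "f (\<ominus>\<^bsub>B\<^esub> x) = \<ominus>\<^bsub>C\<^esub> f x" if "x \<in> carrier B" for x
    by (rule additive_minus)
      (use f that in \<open>auto intro: B.M.abelian_group_axioms C.M.abelian_group_axioms\<close>)
  show ?thesis using x
  proof (induction rule: B.homogeneous_induct)
    case (homogeneous l y)
    then show ?case using f fm B.gr_closed[of y l] C.gr_closed[of "f y" l]
      by (simp add: B.sign_twist_homogeneous[of _ l] C.sign_twist_homogeneous[of _ l]
        B.M.add_neg1_pow C.M.add_neg1_pow)
  next
    case (add x y)
    then show ?case using f by (simp add: B.sign_twist_add C.sign_twist_add)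
  qed
qed

lemma graded_algebra_isoD:
  assumes "graded_comm_algebra K B" "graded_comm_algebra K C" "\<phi> \<in> graded_algebra_iso K B C"
  shows "\<And>x. x \<in> carrier B \<Longrightarrow> \<phi> x \<in> carrier C"
    "\<And>x y. x \<in> carrier B \<Longrightarrow> y \<in> carrier B \<Longrightarrow> \<phi> (x \<oplus>\<^bsub>B\<^esub> y) = \<phi> x \<oplus>\<^bsub>C\<^esub> \<phi> y"
    "\<And>x y. x \<in> carrier B \<Longrightarrow> y \<in> carrier B \<Longrightarrow> \<phi> (x \<otimes>\<^bsub>B\<^esub> y) = \<phi> x \<otimes>\<^bsub>C\<^esub> \<phi> y"
    "\<And>c x. c \<in> carrier K \<Longrightarrow> x \<in> carrier B \<Longrightarrow> \<phi> (c \<odot>\<^bsub>B\<^esub> x) = c \<odot>\<^bsub>C\<^esub> \<phi> x"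
    "\<And>x. x \<in> carrier B \<Longrightarrow> \<phi> (\<ominus>\<^bsub>B\<^esub> x) = \<ominus>\<^bsub>C\<^esub> \<phi> x"
    "\<And>x y. x \<in> carrier B \<Longrightarrow> y \<in> carrier B \<Longrightarrow> \<phi> (x \<ominus>\<^bsub>B\<^esub> y) = \<phi> x \<ominus>\<^bsub>C\<^esub> \<phi> y"
    "\<phi> \<zero>\<^bsub>B\<^esub> = \<zero>\<^bsub>C\<^esub>" "\<phi> \<one>\<^bsub>B\<^esub> = \<one>\<^bsub>C\<^esub>"
    "\<And>x k. x \<in> gr B k \<Longrightarrow> \<phi> x \<in> gr C k"
    "\<phi> \<in> module_hom K B C" "bij_betw \<phi> (carrier B) (carrier C)"
proof -
  interpret B: graded_comm_algebra K B by fact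
  interpret C: graded_comm_algebra K C by fact
  show m: "\<phi> \<in> module_hom K B C" and "\<phi> \<one>\<^bsub>B\<^esub> = \<one>\<^bsub>C\<^esub>" "bij_betw \<phi> (carrier B) (carrier C)"
    "\<And>x y. x \<in> carrier B \<Longrightarrow> y \<in> carrier B \<Longrightarrow> \<phi> (x \<otimes>\<^bsub>B\<^esub> y) = \<phi> x \<otimes>\<^bsub>C\<^esub> \<phi> y"
    using assms(3) by (auto simp: graded_algebra_iso_def graded_algebra_hom_def ring_hom_def)
  show "\<And>x k. x \<in> gr B k \<Longrightarrow> \<phi> x \<in> gr C k"
    using assms(3) by (force simp: graded_algebra_iso_def graded_algebra_hom_def)
  have "module K B" "module K C" by unfold_locales
  note m = module_hom_facts[OF this m]
  show "\<And>x. x \<in> carrier B \<Longrightarrow> \<phi> x \<in> carrier C"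
    "\<And>x y. x \<in> carrier B \<Longrightarrow> y \<in> carrier B \<Longrightarrow> \<phi> (x \<oplus>\<^bsub>B\<^esub> y) = \<phi> x \<oplus>\<^bsub>C\<^esub> \<phi> y"
    "\<And>c x. c \<in> carrier K \<Longrightarrow> x \<in> carrier B \<Longrightarrow> \<phi> (c \<odot>\<^bsub>B\<^esub> x) = c \<odot>\<^bsub>C\<^esub> \<phi> x"
    "\<And>x. x \<in> carrier B \<Longrightarrow> \<phi> (\<ominus>\<^bsub>B\<^esub> x) = \<ominus>\<^bsub>C\<^esub> \<phi> x"
    "\<And>x y. x \<in> carrier B \<Longrightarrow> y \<in> carrier B \<Longrightarrow> \<phi> (x \<ominus>\<^bsub>B\<^esub> y) = \<phi> x \<ominus>\<^bsub>C\<^esub> \<phi> y"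
    "\<phi> \<zero>\<^bsub>B\<^esub> = \<zero>\<^bsub>C\<^esub>" by (fact m)+
qed

text \<open>Only the grading needs an argument: if \<open>y\<close> has degree \<open>k\<close>, the
  components of its preimage in other degrees are sent to zero by the injective map
  \<open>\<phi>\<close>.\<close>

lemma graded_algebra_iso_inverse:
  assumes "graded_comm_algebra K B" "graded_comm_algebra K C" "\<phi> \<in> graded_algebra_iso K B C"
  shows "the_inv_into (carrier B) \<phi> \<in> graded_algebra_iso K C B"
proof -
  interpret B: graded_comm_algebra K B by fact
  interpret C: graded_comm_algebra K C by fact
  note p = graded_algebra_isoD[OF assms]
  let ?g = "the_inv_into (carrier B) \<phi>"
  have bij: "inj_on \<phi> (carrier B)" "\<phi> ` carrier B = carrier C" using p(11) by (auto simp: bij_betw_def)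
  have g: "?g y \<in> carrier B" "\<phi> (?g y) = y" if "y \<in> carrier C" for y
    using that bij by (auto intro: the_inv_into_into f_the_inv_into_f)
  have gf: "?g (\<phi> x) = x" if "x \<in> carrier B" for x using bij that the_inv_into_f_f by metis
  have eqI: "?g y = x" if "x \<in> carrier B" "\<phi> x = y" for x y using gf that by blast
  have gr: "?g y \<in> gr B k" if y: "y \<in> gr C k" for y k
  proof -
    have yc: "y \<in> carrier C" using y C.gr_closed by simp
    have "component B l (?g y) = \<zero>\<^bsub>B\<^esub>" if "l \<noteq> k" for l
    proof -
      have "\<phi> (component B l (?g y)) = component C l y"
        using component_graded_hom[OF assms(1,2), of \<phi> 0 "?g y" l] p(1,2,9) g[OF yc] by simp
      also have "\<dots> = \<phi> \<zero>\<^bsub>B\<^esub>" using C.component_homogeneous[OF y] that p(7) by simp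
      finally show ?thesis using bij(1) g[OF yc] by (auto dest: inj_onD)
    qed
    then show ?thesis using B.gr_iff_components g[OF yc] by blast
  qed
  have "?g \<in> ring_hom C B"
    by (rule ring_hom_memI) (use g p in \<open>auto intro!: eqI\<close>)
  moreover have "?g \<in> module_hom K C B"
    unfolding module_hom_def using g p by (auto intro!: eqI)
  moreover have "bij_betw ?g (carrier C) (carrier B)"
    using bij_betw_the_inv_into p(11) by blast
  ultimately show ?thesis using gr by (auto simp: graded_algebra_iso_def graded_algebra_hom_def)
qed

section \<open>Harrison cochains of arity two and three in curried form\<close>

definition cochain2 :: "('k, 'a, 'm) graded_module_scheme \<Rightarrow> ('a \<Rightarrow> 'a \<Rightarrow> 'a) \<Rightarrow> 'a list \<Rightarrow> 'a" where
  "cochain2 B \<beta> = (\<lambda>as\<in>tuples B 2. \<beta> (as ! 0) (as ! 1))"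

definition closed3 :: "('k, 'a, 'm) graded_module_scheme \<Rightarrow> ('a \<Rightarrow> 'a \<Rightarrow> 'a \<Rightarrow> 'a) \<Rightarrow> bool" where
  "closed3 B f \<longleftrightarrow> (\<forall>x\<in>carrier B. \<forall>y\<in>carrier B. \<forall>z\<in>carrier B. f x y z \<in> carrier B)"

lemma closed3D: "closed3 B f \<Longrightarrow> x \<in> carrier B \<Longrightarrow> y \<in> carrier B \<Longrightarrow> z \<in> carrier B \<Longrightarrow> f x y z \<in> carrier B"
  by (simp add: closed3_def)

definition cochain3 :: "('k, 'a, 'm) graded_module_scheme \<Rightarrow> ('a \<Rightarrow> 'a \<Rightarrow> 'a \<Rightarrow> 'a) \<Rightarrow> 'a list \<Rightarrow> 'a" where
  "cochain3 B f = (\<lambda>as\<in>tuples B 3. f (as ! 0) (as ! 1) (as ! 2))"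

text \<open>Harrison cochains of bidegree \<open>(2, -1)\<close> as functions of two arguments. For
  two arguments the shuffle condition is graded symmetry.\<close>

definition harrison2 :: "('k, 'l) ring_scheme \<Rightarrow> ('k, 'a, 'm) graded_module_scheme \<Rightarrow> ('a \<Rightarrow> 'a \<Rightarrow> 'a) \<Rightarrow> bool"
  where
  "harrison2 K B \<beta> \<longleftrightarrow>
    (\<forall>x\<in>carrier B. \<forall>y\<in>carrier B. \<beta> x y \<in> carrier B) \<and>
    (\<forall>x\<in>carrier B. \<forall>x'\<in>carrier B. \<forall>y\<in>carrier B.
       \<beta> (x \<oplus>\<^bsub>B\<^esub> x') y = \<beta> x y \<oplus>\<^bsub>B\<^esub> \<beta> x' y \<and> \<beta> y (x \<oplus>\<^bsub>B\<^esub> x') = \<beta> y x \<oplus>\<^bsub>B\<^esub> \<beta> y x') \<and>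
    (\<forall>c\<in>carrier K. \<forall>x\<in>carrier B. \<forall>y\<in>carrier B.
       \<beta> (c \<odot>\<^bsub>B\<^esub> x) y = c \<odot>\<^bsub>B\<^esub> \<beta> x y \<and> \<beta> x (c \<odot>\<^bsub>B\<^esub> y) = c \<odot>\<^bsub>B\<^esub> \<beta> x y) \<and>
    (\<forall>k l. \<forall>x\<in>gr B k. \<forall>y\<in>gr B l. \<beta> x y \<in> gr B (k + l - 1) \<and> \<beta> x y = [neg1_pow (k * l)] \<cdot>\<^bsub>B\<^esub> \<beta> y x)"

text \<open>The Hochschild differential for \<open>p = 2\<close> and \<open>q = -1\<close>; twisting
  with parameter \<open>1\<close> gives the same signs as with \<open>-1\<close>.\<close>

definition harrison_diff2 :: "('k, 'a, 'm) graded_module_scheme \<Rightarrow> ('a \<Rightarrow> 'a \<Rightarrow> 'a) \<Rightarrow> 'a \<Rightarrow> 'a \<Rightarrow> 'a \<Rightarrow> 'a"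
  where
  "harrison_diff2 B \<beta> a b c =
     ((sign_twist B 1 a \<otimes>\<^bsub>B\<^esub> \<beta> b c \<ominus>\<^bsub>B\<^esub> \<beta> (a \<otimes>\<^bsub>B\<^esub> b) c) \<oplus>\<^bsub>B\<^esub> \<beta> a (b \<otimes>\<^bsub>B\<^esub> c)) \<ominus>\<^bsub>B\<^esub> \<beta> a b \<otimes>\<^bsub>B\<^esub> c"

lemma harrison2D:
  assumes "harrison2 K B \<beta>"
  shows "\<And>x y. x \<in> carrier B \<Longrightarrow> y \<in> carrier B \<Longrightarrow> \<beta> x y \<in> carrier B"
    "\<And>x x' y. x \<in> carrier B \<Longrightarrow> x' \<in> carrier B \<Longrightarrow> y \<in> carrier B \<Longrightarrow> \<beta> (x \<oplus>\<^bsub>B\<^esub> x') y = \<beta> x y \<oplus>\<^bsub>B\<^esub> \<beta> x' y"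
    "\<And>x x' y. x \<in> carrier B \<Longrightarrow> x' \<in> carrier B \<Longrightarrow> y \<in> carrier B \<Longrightarrow> \<beta> y (x \<oplus>\<^bsub>B\<^esub> x') = \<beta> y x \<oplus>\<^bsub>B\<^esub> \<beta> y x'"
    "\<And>c x y. c \<in> carrier K \<Longrightarrow> x \<in> carrier B \<Longrightarrow> y \<in> carrier B \<Longrightarrow> \<beta> (c \<odot>\<^bsub>B\<^esub> x) y = c \<odot>\<^bsub>B\<^esub> \<beta> x y"
    "\<And>c x y. c \<in> carrier K \<Longrightarrow> x \<in> carrier B \<Longrightarrow> y \<in> carrier B \<Longrightarrow> \<beta> x (c \<odot>\<^bsub>B\<^esub> y) = c \<odot>\<^bsub>B\<^esub> \<beta> x y"
    "\<And>x y k l. x \<in> gr B k \<Longrightarrow> y \<in> gr B l \<Longrightarrow> \<beta> x y \<in> gr B (k + l - 1)"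
    "\<And>x y k l. x \<in> gr B k \<Longrightarrow> y \<in> gr B l \<Longrightarrow> \<beta> x y = [neg1_pow (k * l)] \<cdot>\<^bsub>B\<^esub> \<beta> y x"
  using assms unfolding harrison2_def by blast+

lemma tuples2_iff: "as \<in> tuples B 2 \<longleftrightarrow> (\<exists>x\<in>carrier B. \<exists>y\<in>carrier B. as = [x, y])"
  by (auto simp: tuples_def numeral_2_eq_2 length_Suc_conv)

lemma tuples3_iff: "as \<in> tuples B 3 \<longleftrightarrow> (\<exists>x\<in>carrier B. \<exists>y\<in>carrier B. \<exists>z\<in>carrier B. as = [x, y, z])"
  by (auto simp: tuples_def numeral_3_eq_3 length_Suc_conv)

lemma cochain3_eq_iff:
  "cochain3 B f = cochain3 B g \<longleftrightarrow> (\<forall>x\<in>carrier B. \<forall>y\<in>carrier B. \<forall>z\<in>carrier B. f x y z = g x y z)"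
proof
  assume e: "cochain3 B f = cochain3 B g"
  show "\<forall>x\<in>carrier B. \<forall>y\<in>carrier B. \<forall>z\<in>carrier B. f x y z = g x y z"
  proof (intro ballI)
    fix x y z assume "x \<in> carrier B" "y \<in> carrier B" "z \<in> carrier B"
    then show "f x y z = g x y z" using fun_cong[OF e, of "[x, y, z]"] tuples3_iff[of "[x, y, z]" B]
      by (simp add: cochain3_def)
  qed
next
  assume "\<forall>x\<in>carrier B. \<forall>y\<in>carrier B. \<forall>z\<in>carrier B. f x y z = g x y z"
  then show "cochain3 B f = cochain3 B g"
    by (auto simp: cochain3_def tuples3_iff fun_eq_iff restrict_def)
qed

lemma list_all2_pair:
  assumes "length as = 2" "list_all2 P as ks"
  shows "\<exists>x y k l. as = [x, y] \<and> ks = [k, l] \<and> P x k \<and> P y l"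
proof -
  obtain x y where as: "as = [x, y]" using assms(1) by (auto simp: numeral_2_eq_2 length_Suc_conv)
  then show ?thesis using assms(2) by (auto simp: list_all2_Cons1)
qed

lemma shuffle_perms_1_2: "shuffle_perms (Suc 0) 2 = {id, transpose 0 (Suc 0)}"
proof -
  have "{..<2} = {0, 1::nat}" by auto
  moreover have "strict_mono_on {..<Suc 0} \<sigma>" "strict_mono_on {Suc 0..<2} \<sigma>" for \<sigma> :: "nat \<Rightarrow> nat"
    by (auto simp: strict_mono_on_def)
  ultimately show ?thesis
    unfolding shuffle_perms_def by (auto simp: permutes_doubleton_iff)
qed

lemma koszul_sign_id: "koszul_sign id ks = 1"
  unfolding koszul_sign_def by (rule prod.neutral) auto

lemma koszul_sign_transpose: "koszul_sign (transpose 0 (Suc 0)) [k, l] = neg1_pow (k * l)"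
proof -
  have "{(j, m). j < m \<and> m < length [k, l] \<and> transpose 0 (Suc 0) m < transpose 0 (Suc 0) j} = {(0, 1)}"
    by (auto simp: transpose_def less_Suc_eq split: if_splits)
  then show ?thesis unfolding koszul_sign_def by simp
qed

context graded_comm_algebra
begin

text \<open>The only admissible splitting of two arguments is one and one, and its shuffles are the
  identity and the transposition. The shuffle sum is therefore \<open>f [x, y]\<close> minus
  \<open>f [y, x]\<close> with its Koszul sign.\<close>

lemma harrison_cochains_iff:
  "f \<in> harr_cochains K B 2 (-1) \<longleftrightarrow> (\<exists>\<beta>. harrison2 K B \<beta> \<and> f = cochain2 B \<beta>)"
proof -
  have shuffle: "(\<Oplus>\<^bsub>B\<^esub> \<sigma>\<in>shuffle_perms i 2. [(sign \<sigma> * koszul_sign \<sigma> [k, l])] \<cdot>\<^bsub>B\<^esub>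
         f (permute_list (inv_into UNIV \<sigma>) [x, y])) = f [x, y] \<ominus>\<^bsub>B\<^esub> [neg1_pow (k * l)] \<cdot>\<^bsub>B\<^esub> f [y, x]"
    if "f [x, y] \<in> carrier B" "f [y, x] \<in> carrier B" "0 < i" "i < 2" for i k l x y f
  proof -
    have i: "i = Suc 0" using that by auto
    have p: "permute_list (inv_into UNIV id) [x, y] = [x, y]"
      "permute_list (inv_into UNIV (transpose 0 (Suc 0))) [x, y] = [y, x]"
      by (simp_all add: permute_list_def numeral_2_eq_2)
    have n: "[(sign (transpose 0 (Suc 0)) * koszul_sign (transpose 0 (Suc 0)) [k, l])] \<cdot>\<^bsub>B\<^esub> u =
       \<ominus>\<^bsub>B\<^esub> ([neg1_pow (k * l)] \<cdot>\<^bsub>B\<^esub> u)" if "u \<in> carrier B" for u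
      unfolding koszul_sign_transpose using that M.add.int_pow_neg[of u 1]
      by (auto simp: sign_swap_id neg1_pow_def)
    have ne: "id \<noteq> transpose 0 (Suc 0)" by (metis id_apply transpose_apply_first Zero_not_Suc)
    have c: "[neg1_pow (k * l)] \<cdot>\<^bsub>B\<^esub> f [y, x] \<in> carrier B" using that(2) by (simp add: M.add_neg1_pow)
    let ?g = "\<lambda>\<sigma>. [(sign \<sigma> * koszul_sign \<sigma> [k, l])] \<cdot>\<^bsub>B\<^esub> f (permute_list (inv_into UNIV \<sigma>) [x, y])"
    have g: "?g id = f [x, y]" "?g (transpose 0 (Suc 0)) = \<ominus>\<^bsub>B\<^esub> ([neg1_pow (k * l)] \<cdot>\<^bsub>B\<^esub> f [y, x])"
      unfolding p n[OF that(2)] using that by (simp_all add: koszul_sign_id)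
    have "(\<Oplus>\<^bsub>B\<^esub> \<sigma>\<in>{id, transpose 0 (Suc 0)}. ?g \<sigma>) = ?g id \<oplus>\<^bsub>B\<^esub> (\<Oplus>\<^bsub>B\<^esub> \<sigma>\<in>{transpose 0 (Suc 0)}. ?g \<sigma>)"
      by (rule M.finsum_insert) (use ne that c g in auto)
    also have "(\<Oplus>\<^bsub>B\<^esub> \<sigma>\<in>{transpose 0 (Suc 0)}. ?g \<sigma>) = ?g (transpose 0 (Suc 0)) \<oplus>\<^bsub>B\<^esub> (\<Oplus>\<^bsub>B\<^esub> \<sigma>\<in>{}. ?g \<sigma>)"
      by (rule M.finsum_insert) (use c g in auto)
    finally have "(\<Oplus>\<^bsub>B\<^esub> \<sigma>\<in>{id, transpose 0 (Suc 0)}. ?g \<sigma>) =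
        f [x, y] \<ominus>\<^bsub>B\<^esub> [neg1_pow (k * l)] \<cdot>\<^bsub>B\<^esub> f [y, x]"
      using c by (simp only: g a_minus_def M.finsum_empty M.r_zero M.a_inv_closed)
    then show ?thesis by (simp only: i shuffle_perms_1_2)
  qed
  show ?thesis
  proof
    assume f: "f \<in> harr_cochains K B 2 (-1)"
    let ?\<beta> = "\<lambda>x y. f [x, y]"
    have h: "f \<in> hoch_cochains K B 2 (-1)" using f by (simp add: harr_cochains_def)
    have cl: "f [x, y] \<in> carrier B" if "x \<in> carrier B" "y \<in> carrier B" for x y
      using h that tuples2_iff[of "[x, y]" B] by (auto simp: hoch_cochains_def)
    have m: "multilinear K B 2 f" using h by (simp add: hoch_cochains_def)
    have m1: "f [x \<oplus>\<^bsub>B\<^esub> x', y] = f [x, y] \<oplus>\<^bsub>B\<^esub> f [x', y] \<and> f [c \<odot>\<^bsub>B\<^esub> x, y] = c \<odot>\<^bsub>B\<^esub> f [x, y]"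
      if "x \<in> carrier B" "x' \<in> carrier B" "y \<in> carrier B" "c \<in> carrier K" for x x' y c
      using m[unfolded multilinear_def, rule_format, of "[x, y]" 0 x x' c] that
         tuples2_iff[of "[x, y]" B] by simp
    have m2: "f [y, x \<oplus>\<^bsub>B\<^esub> x'] = f [y, x] \<oplus>\<^bsub>B\<^esub> f [y, x'] \<and> f [y, c \<odot>\<^bsub>B\<^esub> x] = c \<odot>\<^bsub>B\<^esub> f [y, x]"
      if "x \<in> carrier B" "x' \<in> carrier B" "y \<in> carrier B" "c \<in> carrier K" for x x' y c
      using m[unfolded multilinear_def, rule_format, of "[y, x]" 1 x x' c] that
         tuples2_iff[of "[y, x]" B] by simp
    have dg: "f [x, y] \<in> gr B (k + l - 1)" if "x \<in> gr B k" "y \<in> gr B l" for x y k l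
    proof -
      have "f [x, y] \<in> gr B (sum_list [k, l] + -1)"
        using h[unfolded hoch_cochains_def] that by (auto dest!: spec[of _ "[x, y]"] dest: spec[of _ "[k, l]"])
      then show ?thesis by (simp add: algebra_simps)
    qed
    have sy: "f [x, y] = [neg1_pow (k * l)] \<cdot>\<^bsub>B\<^esub> f [y, x]" if "x \<in> gr B k" "y \<in> gr B l" for x y k l
    proof -
      have cc: "f [x, y] \<in> carrier B" "f [y, x] \<in> carrier B" using that cl gr_closed by auto
      have "(\<Oplus>\<^bsub>B\<^esub> \<sigma>\<in>shuffle_perms 1 2. [(sign \<sigma> * koszul_sign \<sigma> [k, l])] \<cdot>\<^bsub>B\<^esub>
         f (permute_list (inv_into UNIV \<sigma>) [x, y])) = \<zero>\<^bsub>B\<^esub>"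
        using f[unfolded harr_cochains_def, simplified, THEN conjunct2, rule_format, of 1 "[x, y]" "[k, l]"] that
        by simp
      then have "f [x, y] \<ominus>\<^bsub>B\<^esub> [neg1_pow (k * l)] \<cdot>\<^bsub>B\<^esub> f [y, x] = \<zero>\<^bsub>B\<^esub>"
        using shuffle[OF cc, of 1 k l] by simp
      then show ?thesis using cc by (auto simp: M.diff_simps M.add_neg1_pow)
    qed
    note m1_add = m1[OF _ _ _ R.one_closed, THEN conjunct1]
      and m2_add = m2[OF _ _ _ R.one_closed, THEN conjunct1]
    have sm: "f [c \<odot>\<^bsub>B\<^esub> x, y] = c \<odot>\<^bsub>B\<^esub> f [x, y]" "f [x, c \<odot>\<^bsub>B\<^esub> y] = c \<odot>\<^bsub>B\<^esub> f [x, y]"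
      if "x \<in> carrier B" "y \<in> carrier B" "c \<in> carrier K" for x y c
      using m1[of x x y c] m2[of y y x c] that by auto
    have "harrison2 K B ?\<beta>" unfolding harrison2_def
      by (intro conjI ballI allI; (rule dg sy; assumption)?) (simp_all add: cl sm m1_add m2_add)
    moreover have "f = cochain2 B ?\<beta>"
    proof
      fix as
      have "f \<in> extensional (tuples B 2)" using h by (auto simp: hoch_cochains_def PiE_def)
      then show "f as = cochain2 B ?\<beta> as"
        by (auto simp: cochain2_def tuples2_iff extensional_def restrict_def)
    qed
    ultimately show "\<exists>\<beta>. harrison2 K B \<beta> \<and> f = cochain2 B \<beta>" by blast
  next
    assume "\<exists>\<beta>. harrison2 K B \<beta> \<and> f = cochain2 B \<beta>"
    then obtain \<beta> where b: "harrison2 K B \<beta>" and f: "f = cochain2 B \<beta>" by blast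
    note h = harrison2D[OF b]
    have ev: "f [x, y] = \<beta> x y" if "x \<in> carrier B" "y \<in> carrier B" for x y
      using that tuples2_iff[of "[x, y]" B] by (simp add: f cochain2_def)
    have "f \<in> tuples B 2 \<rightarrow>\<^sub>E carrier B"
      using h(1) by (auto simp: f cochain2_def tuples2_iff)
    moreover have "multilinear K B 2 f"
      unfolding multilinear_def
    proof (intro ballI allI impI)
      fix as i x y c
      assume "as \<in> tuples B 2" and i: "i < (2::nat)" and c: "x \<in> carrier B" "y \<in> carrier B" "c \<in> carrier K"
      then obtain u v where as: "as = [u, v]" "u \<in> carrier B" "v \<in> carrier B" by (auto simp: tuples2_iff)
      have "i = 0 \<or> i = 1" using i by auto
      then show "f (as[i := x \<oplus>\<^bsub>B\<^esub> y]) = f (as[i := x]) \<oplus>\<^bsub>B\<^esub> f (as[i := y]) \<and>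
         f (as[i := c \<odot>\<^bsub>B\<^esub> x]) = c \<odot>\<^bsub>B\<^esub> f (as[i := x])"
        using as c h(1-5) by (auto simp: ev)
    qed
    moreover have "f as \<in> gr B (sum_list ks + -1)"
      if L: "length as = 2" "list_all2 (\<lambda>a k. a \<in> gr B k) as ks" for as ks
    proof -
      obtain x y k l where "as = [x, y]" "ks = [k, l]" "x \<in> gr B k" "y \<in> gr B l"
        using list_all2_pair[OF L] by blast
      then show ?thesis using h(6)[of x k y l] ev[of x y] gr_closed by (auto simp: algebra_simps)
    qed
    moreover have "(\<Oplus>\<^bsub>B\<^esub> \<sigma>\<in>shuffle_perms i 2. [(sign \<sigma> * koszul_sign \<sigma> ks)] \<cdot>\<^bsub>B\<^esub>
         f (permute_list (inv_into UNIV \<sigma>) as)) = \<zero>\<^bsub>B\<^esub>"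
      if I: "0 < i" "i < 2" and L: "length as = 2" "list_all2 (\<lambda>a k. a \<in> gr B k) as ks" for i as ks
    proof -
      obtain x y k l where *: "as = [x, y]" "ks = [k, l]" "x \<in> gr B k" "y \<in> gr B l"
        using list_all2_pair[OF L] by blast
      then have c: "f [x, y] \<in> carrier B" "f [y, x] \<in> carrier B"
          "f [x, y] = [neg1_pow (k * l)] \<cdot>\<^bsub>B\<^esub> f [y, x]"
        using h(1)[of x y] h(1)[of y x] h(7)[OF *(3,4)] gr_closed ev by simp_all
      show ?thesis unfolding *(1,2) shuffle[OF c(1,2) I]
        using c by (simp add: M.diff_simps M.add_neg1_pow del: c(3))
    qed
    ultimately show "f \<in> harr_cochains K B 2 (-1)"
      unfolding harr_cochains_def hoch_cochains_def by blast
  qed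
qed

lemma hoch_diff_cochain2:
  assumes "harrison2 K B \<beta>"
  shows "hoch_diff B 2 (-1) (cochain2 B \<beta>) = cochain3 B (harrison_diff2 B \<beta>)"
proof
  fix as
  note h = harrison2D[OF assms]
  have ev: "cochain2 B \<beta> [x, y] = \<beta> x y" if "x \<in> carrier B" "y \<in> carrier B" for x y
    using that tuples2_iff[of "[x, y]" B] by (simp add: cochain2_def)
  have s: "Suc 2 = 3" by simp
  have tw: "sign_twist B (-1) a = sign_twist B 1 a" for a
    by (simp add: sign_twist_def neg1_pow_def)
  show "hoch_diff B 2 (-1) (cochain2 B \<beta>) as = cochain3 B (harrison_diff2 B \<beta>) as"
  proof (cases "as \<in> tuples B 3")
    case False
    then show ?thesis by (simp add: hoch_diff_def cochain3_def)
  next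
    case True
    then obtain a b c where abc: "as = [a, b, c]" "a \<in> carrier B" "b \<in> carrier B" "c \<in> carrier B"
      by (auto simp: tuples3_iff)
    have cl: "\<beta> (a \<otimes>\<^bsub>B\<^esub> b) c \<in> carrier B" "\<beta> a (b \<otimes>\<^bsub>B\<^esub> c) \<in> carrier B" "\<beta> a b \<in> carrier B" "\<beta> b c \<in> carrier B"
      using abc h(1) by auto
    have n: "neg1_pow 2 = 1" "neg1_pow 1 = -1" "neg1_pow 3 = -1" by (simp_all add: neg1_pow_def)
    have mm: "[(-1::int)] \<cdot>\<^bsub>B\<^esub> u = \<ominus>\<^bsub>B\<^esub> u" "[(1::int)] \<cdot>\<^bsub>B\<^esub> u = u" if "u \<in> carrier B" for u
      using M.add.int_pow_neg[of u 1] that by auto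
    let ?g = "\<lambda>i. [neg1_pow (int i)] \<cdot>\<^bsub>B\<^esub>
        cochain2 B \<beta> (take (i - 1) as @ [as ! (i - 1) \<otimes>\<^bsub>B\<^esub> as ! i] @ drop (i + 1) as)"
    have g: "?g 1 = \<ominus>\<^bsub>B\<^esub> \<beta> (a \<otimes>\<^bsub>B\<^esub> b) c" "?g 2 = \<beta> a (b \<otimes>\<^bsub>B\<^esub> c)"
      using abc cl by (simp_all add: ev n mm numeral_2_eq_2)
    have "(\<Oplus>\<^bsub>B\<^esub> i\<in>{1, 2}. ?g i) = ?g 1 \<oplus>\<^bsub>B\<^esub> (\<Oplus>\<^bsub>B\<^esub> i\<in>{2}. ?g i)"
      by (rule M.finsum_insert) (use g cl in auto)
    also have "(\<Oplus>\<^bsub>B\<^esub> i\<in>{2}. ?g i) = ?g 2 \<oplus>\<^bsub>B\<^esub> (\<Oplus>\<^bsub>B\<^esub> i\<in>{}. ?g i)"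
      by (rule M.finsum_insert) (use g cl in auto)
    finally have sum: "(\<Oplus>\<^bsub>B\<^esub> i\<in>{1, 2}. ?g i) = \<ominus>\<^bsub>B\<^esub> \<beta> (a \<otimes>\<^bsub>B\<^esub> b) c \<oplus>\<^bsub>B\<^esub> \<beta> a (b \<otimes>\<^bsub>B\<^esub> c)"
      unfolding g using cl by simp
    have i: "{1..2} = {1, 2::nat}" by auto
    show ?thesis
      unfolding hoch_diff_def s restrict_apply'[OF True] i sum cochain3_def
      using abc cl by (simp add: harrison_diff2_def a_minus_def M.a_ac tw ev n mm)
  qed
qed

lemma harr_coboundaries3:
  "harr_coboundaries K B 3 (-1) = {cochain3 B (harrison_diff2 B \<beta>) | \<beta>. harrison2 K B \<beta>}"
  using hoch_diff_cochain2 harrison_cochains_iff by (force simp: harr_coboundaries_def image_iff)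

lemma harrison2_zero: "harrison2 K B (\<lambda>_ _. \<zero>\<^bsub>B\<^esub>)"
  by (auto simp: harrison2_def gr_zero M.add_neg1_pow)

lemma harrison2_add:
  assumes "harrison2 K B \<beta>" "harrison2 K B \<gamma>"
  shows "harrison2 K B (\<lambda>x y. \<beta> x y \<oplus>\<^bsub>B\<^esub> \<gamma> x y)"
proof -
  note b = harrison2D[OF assms(1)] and c = harrison2D[OF assms(2)]
  have s: "\<beta> x y \<oplus>\<^bsub>B\<^esub> \<gamma> x y = [neg1_pow (k * l)] \<cdot>\<^bsub>B\<^esub> (\<beta> y x \<oplus>\<^bsub>B\<^esub> \<gamma> y x)" if "x \<in> gr B k" "y \<in> gr B l" for x y k l
    using b(7)[OF that] c(7)[OF that] b(1)[of y x] c(1)[of y x] gr_closed that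
    by (simp add: M.add_neg1_pow M.minus_add)
  have g: "\<beta> x y \<oplus>\<^bsub>B\<^esub> \<gamma> x y \<in> gr B (k + l - 1)" if "x \<in> gr B k" "y \<in> gr B l" for x y k l
    using b(6)[OF that] c(6)[OF that] by (rule gr_add)
  show ?thesis unfolding harrison2_def
    by (intro conjI ballI allI; (rule s g; assumption)?)
      (simp_all add: b(1-5) c(1-5) M.a_ac smult_r_distr)
qed

lemma harrison2_minus:
  assumes "harrison2 K B \<beta>"
  shows "harrison2 K B (\<lambda>x y. \<ominus>\<^bsub>B\<^esub> \<beta> x y)"
proof -
  note b = harrison2D[OF assms(1)]
  have s: "\<ominus>\<^bsub>B\<^esub> \<beta> x y = [neg1_pow (k * l)] \<cdot>\<^bsub>B\<^esub> (\<ominus>\<^bsub>B\<^esub> \<beta> y x)" if "x \<in> gr B k" "y \<in> gr B l" for x y k l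
    using b(7)[OF that] b(1)[of y x] gr_closed that by (simp add: M.add_neg1_pow)
  have g: "\<ominus>\<^bsub>B\<^esub> \<beta> x y \<in> gr B (k + l - 1)" if "x \<in> gr B k" "y \<in> gr B l" for x y k l
    using b(6)[OF that] by (rule gr_minus)
  show ?thesis unfolding harrison2_def
    by (intro conjI ballI allI; (rule s g; assumption)?)
      (simp_all add: b(1-5) M.minus_add smult_r_minus)
qed

lemma harrison_diff2_closed:
  assumes "harrison2 K B \<beta>" "a \<in> carrier B" "b \<in> carrier B" "c \<in> carrier B"
  shows "harrison_diff2 B \<beta> a b c \<in> carrier B"
  using assms harrison2D(1)[OF assms(1)] by (simp add: harrison_diff2_def)

lemma harrison_diff2_add:
  assumes "harrison2 K B \<beta>" "harrison2 K B \<gamma>" "a \<in> carrier B" "b \<in> carrier B" "c \<in> carrier B"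
  shows "harrison_diff2 B (\<lambda>x y. \<beta> x y \<oplus>\<^bsub>B\<^esub> \<gamma> x y) a b c =
    harrison_diff2 B \<beta> a b c \<oplus>\<^bsub>B\<^esub> harrison_diff2 B \<gamma> a b c"
  using assms harrison2D(1)[OF assms(1)] harrison2D(1)[OF assms(2)]
  by (simp add: harrison_diff2_def B.l_distr B.r_distr M.diff_simps M.a_ac)

lemma harrison_diff2_minus:
  assumes "harrison2 K B \<beta>" "a \<in> carrier B" "b \<in> carrier B" "c \<in> carrier B"
  shows "harrison_diff2 B (\<lambda>x y. \<ominus>\<^bsub>B\<^esub> \<beta> x y) a b c = \<ominus>\<^bsub>B\<^esub> harrison_diff2 B \<beta> a b c"
  using assms harrison2D(1)[OF assms(1)]
  by (simp add: harrison_diff2_def B.l_minus B.r_minus M.diff_simps M.diff_simps2 M.a_ac)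

lemma harr_class_set:
  assumes "closed3 B F"
  shows "harr_class K B 3 (-1) (cochain3 B F) =
    {cochain3 B (\<lambda>a b c. harrison_diff2 B \<beta> a b c \<oplus>\<^bsub>B\<^esub> F a b c) | \<beta>. harrison2 K B \<beta>}"
proof -
  have "(\<lambda>as\<in>tuples B 3. cochain3 B (harrison_diff2 B \<beta>) as \<oplus>\<^bsub>B\<^esub> cochain3 B F as) =
      cochain3 B (\<lambda>a b c. harrison_diff2 B \<beta> a b c \<oplus>\<^bsub>B\<^esub> F a b c)" for \<beta>
    by (auto simp: cochain3_def restrict_def)
  then show ?thesis
    by (auto simp: harr_class_def a_r_coset_def' harr_coboundaries3 harr_module_def)
qed

text \<open>Classes are cosets, so equality puts one representative into the coset of the other.
  Conversely a cochain \<open>\<beta>\<close> gives one inclusion and its negative the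
  other.\<close>

lemma harr_class_eq_iff:
  assumes F: "closed3 B F"
    and G: "closed3 B G"
  shows "harr_class K B 3 (-1) (cochain3 B F) = harr_class K B 3 (-1) (cochain3 B G) \<longleftrightarrow>
    (\<exists>\<beta>. harrison2 K B \<beta> \<and> (\<forall>a\<in>carrier B. \<forall>b\<in>carrier B. \<forall>c\<in>carrier B.
      F a b c = harrison_diff2 B \<beta> a b c \<oplus>\<^bsub>B\<^esub> G a b c))"
proof
  assume e: "harr_class K B 3 (-1) (cochain3 B F) = harr_class K B 3 (-1) (cochain3 B G)"
  have "cochain3 B F \<in> harr_class K B 3 (-1) (cochain3 B F)"
  proof -
    have "cochain3 B F = cochain3 B (\<lambda>a b c. harrison_diff2 B (\<lambda>_ _. \<zero>\<^bsub>B\<^esub>) a b c \<oplus>\<^bsub>B\<^esub> F a b c)"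
      using closed3D[OF F] by (auto simp: cochain3_eq_iff harrison_diff2_def M.diff_simps a_minus_def)
    then show ?thesis unfolding harr_class_set[OF F] using harrison2_zero by blast
  qed
  then have "cochain3 B F \<in> harr_class K B 3 (-1) (cochain3 B G)" using e by simp
  then show "\<exists>\<beta>. harrison2 K B \<beta> \<and> (\<forall>a\<in>carrier B. \<forall>b\<in>carrier B. \<forall>c\<in>carrier B.
      F a b c = harrison_diff2 B \<beta> a b c \<oplus>\<^bsub>B\<^esub> G a b c)"
    unfolding harr_class_set[OF G] by (auto simp: cochain3_eq_iff)
next
  have sub: "harr_class K B 3 (-1) (cochain3 B F) \<subseteq> harr_class K B 3 (-1) (cochain3 B G)"
    if F: "closed3 B F"
    and G: "closed3 B G"
    and b: "harrison2 K B \<beta>"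
    and e: "\<forall>a\<in>carrier B. \<forall>b\<in>carrier B. \<forall>c\<in>carrier B. F a b c = harrison_diff2 B \<beta> a b c \<oplus>\<^bsub>B\<^esub> G a b c"
    for F G \<beta>
  proof
    fix f assume "f \<in> harr_class K B 3 (-1) (cochain3 B F)"
    then obtain \<gamma> where g: "harrison2 K B \<gamma>" "f = cochain3 B (\<lambda>a b c. harrison_diff2 B \<gamma> a b c \<oplus>\<^bsub>B\<^esub> F a b c)"
      unfolding harr_class_set[OF F] by blast
    have "f = cochain3 B (\<lambda>a b c. harrison_diff2 B (\<lambda>x y. \<gamma> x y \<oplus>\<^bsub>B\<^esub> \<beta> x y) a b c \<oplus>\<^bsub>B\<^esub> G a b c)"
      unfolding g(2) cochain3_eq_iff using e closed3D[OF G] g b harrison_diff2_closed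
      by (auto simp: harrison_diff2_add M.a_assoc)
    then show "f \<in> harr_class K B 3 (-1) (cochain3 B G)"
      unfolding harr_class_set[OF G] using harrison2_add[OF g(1) b] by blast
  qed
  assume "\<exists>\<beta>. harrison2 K B \<beta> \<and> (\<forall>a\<in>carrier B. \<forall>b\<in>carrier B. \<forall>c\<in>carrier B.
      F a b c = harrison_diff2 B \<beta> a b c \<oplus>\<^bsub>B\<^esub> G a b c)"
  then obtain \<beta> where b: "harrison2 K B \<beta>"
    and e: "\<forall>a\<in>carrier B. \<forall>b\<in>carrier B. \<forall>c\<in>carrier B. F a b c = harrison_diff2 B \<beta> a b c \<oplus>\<^bsub>B\<^esub> G a b c" by blast
  have "\<forall>a\<in>carrier B. \<forall>b\<in>carrier B. \<forall>c\<in>carrier B.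
     G a b c = harrison_diff2 B (\<lambda>x y. \<ominus>\<^bsub>B\<^esub> \<beta> x y) a b c \<oplus>\<^bsub>B\<^esub> F a b c"
    using e b closed3D[OF G] harrison_diff2_closed[OF b]
    by (simp add: harrison_diff2_minus M.diff_simps M.diff_simps2 M.a_ac M.r_neg1 M.r_neg2)
  then show "harr_class K B 3 (-1) (cochain3 B F) = harr_class K B 3 (-1) (cochain3 B G)"
    using sub[OF F G b e] sub[OF G F harrison2_minus[OF b]] by blast
qed

text \<open>The zero of the quotient is the set of coboundaries, which is the class of the zero
  cochain. In this form vanishing can be transported along isomorphisms.\<close>

lemma harr_class_eq_zero_iff:
  assumes F: "closed3 B F"
  shows "harr_class K B 3 (-1) (cochain3 B F) = \<zero>\<^bsub>harr_cohomology K B 3 (-1)\<^esub> \<longleftrightarrow>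
    harr_class K B 3 (-1) (cochain3 B F) = harr_class K B 3 (-1) (cochain3 B (\<lambda>_ _ _. \<zero>\<^bsub>B\<^esub>))"
proof -
  have "harr_class K B 3 (-1) (cochain3 B (\<lambda>_ _ _. \<zero>\<^bsub>B\<^esub>)) = harr_coboundaries K B 3 (-1)"
  proof -
    have "cochain3 B (\<lambda>a b c. harrison_diff2 B \<beta> a b c \<oplus>\<^bsub>B\<^esub> \<zero>\<^bsub>B\<^esub>) = cochain3 B (harrison_diff2 B \<beta>)"
      if "harrison2 K B \<beta>" for \<beta>
      unfolding cochain3_eq_iff using harrison_diff2_closed[OF that] by simp
    then have "{cochain3 B (\<lambda>a b c. harrison_diff2 B \<beta> a b c \<oplus>\<^bsub>B\<^esub> \<zero>\<^bsub>B\<^esub>) |\<beta>. harrison2 K B \<beta>} =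
        {cochain3 B (harrison_diff2 B \<beta>) |\<beta>. harrison2 K B \<beta>}"
      by (intro Collect_cong ex_cong1) auto
    moreover have "closed3 B (\<lambda>_ _ _. \<zero>\<^bsub>B\<^esub>)" by (simp add: closed3_def)
    ultimately show ?thesis
      unfolding harr_coboundaries3 by (simp only: harr_class_set)
  qed
  then show ?thesis by (simp add: harr_cohomology_def quotient_module_def FactRing_def)
qed

end

section \<open>Transport of Harrison classes along isomorphisms\<close>

lemma harrison2_transport:
  assumes "graded_comm_algebra K B" "graded_comm_algebra K C" "\<phi> \<in> graded_algebra_iso K B C"
    and \<beta>: "harrison2 K B \<beta>"
  defines "\<psi> \<equiv> the_inv_into (carrier B) \<phi>"
  shows "harrison2 K C (\<lambda>x y. \<phi> (\<beta> (\<psi> x) (\<psi> y)))"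
    "\<And>a b c. a \<in> carrier C \<Longrightarrow> b \<in> carrier C \<Longrightarrow> c \<in> carrier C \<Longrightarrow>
      harrison_diff2 C (\<lambda>x y. \<phi> (\<beta> (\<psi> x) (\<psi> y))) a b c = \<phi> (harrison_diff2 B \<beta> (\<psi> a) (\<psi> b) (\<psi> c))"
proof -
  interpret B: graded_comm_algebra K B by fact
  interpret C: graded_comm_algebra K C by fact
  note p = graded_algebra_isoD[OF assms(1-3)]
  note q = graded_algebra_isoD[OF assms(2,1) graded_algebra_iso_inverse[OF assms(1-3)], folded \<psi>_def]
  note h = harrison2D[OF \<beta>]
  have pq: "\<phi> (\<psi> x) = x" if "x \<in> carrier C" for x
    using p(11) that unfolding \<psi>_def by (auto simp: bij_betw_def f_the_inv_into_f)
  have s: "\<phi> (\<beta> (\<psi> x) (\<psi> y)) = [neg1_pow (k * l)] \<cdot>\<^bsub>C\<^esub> \<phi> (\<beta> (\<psi> y) (\<psi> x))"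
    if "x \<in> gr C k" "y \<in> gr C l" for x y k l
    using h(7)[OF q(9)[OF that(1)] q(9)[OF that(2)]] h(1)[of "\<psi> y" "\<psi> x"] C.gr_closed[OF that(1)]
      C.gr_closed[OF that(2)] p(1,5) q(1) by (simp add: B.M.add_neg1_pow C.M.add_neg1_pow)
  show "harrison2 K C (\<lambda>x y. \<phi> (\<beta> (\<psi> x) (\<psi> y)))"
    unfolding harrison2_def
    by (intro conjI ballI allI; (rule s; assumption)?)
      (simp_all add: C.gr_closed p(1-6,9) q(1-6,9) h(1-6))
  fix a b c assume abc: "a \<in> carrier C" "b \<in> carrier C" "c \<in> carrier C"
  have tw: "\<psi> (sign_twist C 1 a) = sign_twist B 1 (\<psi> a)"
    using sign_twist_graded_hom[OF assms(2,1) q(1,2,9) abc(1)] by simp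
  have "\<phi> (harrison_diff2 B \<beta> (\<psi> a) (\<psi> b) (\<psi> c)) = ((\<phi> (\<psi> (sign_twist C 1 a)) \<otimes>\<^bsub>C\<^esub> \<phi> (\<beta> (\<psi> b) (\<psi> c)) \<ominus>\<^bsub>C\<^esub>
     \<phi> (\<beta> (\<psi> a \<otimes>\<^bsub>B\<^esub> \<psi> b) (\<psi> c))) \<oplus>\<^bsub>C\<^esub> \<phi> (\<beta> (\<psi> a) (\<psi> b \<otimes>\<^bsub>B\<^esub> \<psi> c))) \<ominus>\<^bsub>C\<^esub> \<phi> (\<beta> (\<psi> a) (\<psi> b)) \<otimes>\<^bsub>C\<^esub> \<phi> (\<psi> c)"
    unfolding harrison_diff2_def tw using abc p(1-6) q(1) h(1) by simp
  then show "harrison_diff2 C (\<lambda>x y. \<phi> (\<beta> (\<psi> x) (\<psi> y))) a b c = \<phi> (harrison_diff2 B \<beta> (\<psi> a) (\<psi> b) (\<psi> c))"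
    unfolding harrison_diff2_def using abc q(3) pq by simp
qed

text \<open>\<open>harr_cohomology_map\<close> is a union over representatives. Since transport
  commutes with the differential, all representatives give the same class, and there is at least
  one; so the union is that class.\<close>

lemma harr_cohomology_map_class:
  assumes "graded_comm_algebra K B" "graded_comm_algebra K C" "\<phi> \<in> graded_algebra_iso K B C"
    and F: "closed3 B F"
  defines "\<psi> \<equiv> the_inv_into (carrier B) \<phi>"
  shows "harr_cohomology_map K B C 3 (-1) \<phi> (harr_class K B 3 (-1) (cochain3 B F)) =
    harr_class K C 3 (-1) (cochain3 C (\<lambda>x y z. \<phi> (F (\<psi> x) (\<psi> y) (\<psi> z))))"
proof -
  interpret B: graded_comm_algebra K B by fact
  interpret C: graded_comm_algebra K C by fact
  note p = graded_algebra_isoD[OF assms(1-3)]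
  note q = graded_algebra_isoD[OF assms(2,1) graded_algebra_iso_inverse[OF assms(1-3)], folded \<psi>_def]
  have F': "closed3 C (\<lambda>x y z. \<phi> (F (\<psi> x) (\<psi> y) (\<psi> z)))"
    using p(1) q(1) closed3D[OF F] by (simp add: closed3_def)
  have tr: "harr_transport B C 3 \<phi> (cochain3 B G) = cochain3 C (\<lambda>x y z. \<phi> (G (\<psi> x) (\<psi> y) (\<psi> z)))" for G
    unfolding harr_transport_def cochain3_def
  proof (rule restrict_ext)
    fix bs assume "bs \<in> tuples C 3"
    then obtain x y z where "bs = [x, y, z]" "x \<in> carrier C" "y \<in> carrier C" "z \<in> carrier C"
      by (auto simp: tuples3_iff)
    then show "\<phi> ((\<lambda>as\<in>tuples B 3. G (as ! 0) (as ! 1) (as ! 2)) (map (the_inv_into (carrier B) \<phi>) bs)) =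
      \<phi> (G (\<psi> (bs ! 0)) (\<psi> (bs ! 1)) (\<psi> (bs ! 2)))"
      using tuples3_iff[of "[\<psi> x, \<psi> y, \<psi> z]" B] q(1) by (simp add: \<psi>_def)
  qed
  have eq: "harr_class K C 3 (-1) (harr_transport B C 3 \<phi> f) =
     harr_class K C 3 (-1) (cochain3 C (\<lambda>x y z. \<phi> (F (\<psi> x) (\<psi> y) (\<psi> z))))"
    if f_in: "f \<in> harr_class K B 3 (-1) (cochain3 B F)" for f
  proof -
    obtain \<beta> where \<beta>: "harrison2 K B \<beta>"
      and f: "f = cochain3 B (\<lambda>a b c. harrison_diff2 B \<beta> a b c \<oplus>\<^bsub>B\<^esub> F a b c)"
      using f_in unfolding B.harr_class_set[OF F] by blast
    note t = harrison2_transport[OF assms(1-3) \<beta>, folded \<psi>_def]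
    have cl: "closed3 C (\<lambda>x y z. \<phi> (harrison_diff2 B \<beta> (\<psi> x) (\<psi> y) (\<psi> z) \<oplus>\<^bsub>B\<^esub> F (\<psi> x) (\<psi> y) (\<psi> z)))"
      using p(1) q(1) closed3D[OF F] B.harrison_diff2_closed[OF \<beta>] by (simp add: closed3_def)
    have "harrison2 K C (\<lambda>x y. \<phi> (\<beta> (\<psi> x) (\<psi> y))) \<and> (\<forall>a\<in>carrier C. \<forall>b\<in>carrier C. \<forall>c\<in>carrier C.
      \<phi> (harrison_diff2 B \<beta> (\<psi> a) (\<psi> b) (\<psi> c) \<oplus>\<^bsub>B\<^esub> F (\<psi> a) (\<psi> b) (\<psi> c)) =
      harrison_diff2 C (\<lambda>x y. \<phi> (\<beta> (\<psi> x) (\<psi> y))) a b c \<oplus>\<^bsub>C\<^esub> \<phi> (F (\<psi> a) (\<psi> b) (\<psi> c)))"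
      using t p(2) q(1) closed3D[OF F] B.harrison_diff2_closed[OF \<beta>] by simp
    then show ?thesis unfolding f tr C.harr_class_eq_iff[OF cl F'] by blast
  qed
  have ne: "harr_class K B 3 (-1) (cochain3 B F) \<noteq> {}"
    unfolding B.harr_class_set[OF F] using B.harrison2_zero by blast
  show ?thesis unfolding harr_cohomology_map_def using eq ne by auto
qed

section \<open>Hodge homotopies\<close>

context graded_comm_algebra
begin

lemma component_mult_left:
  assumes "a \<in> gr B l" "b \<in> carrier B"
  shows "component B (k + l) (a \<otimes>\<^bsub>B\<^esub> b) = a \<otimes>\<^bsub>B\<^esub> component B k b"
proof (rule component_graded_hom[where B = B and K = K])
  show "graded_comm_algebra K B" by (rule graded_comm_algebra_axioms)
  show "\<And>k x. x \<in> gr B k \<Longrightarrow> a \<otimes>\<^bsub>B\<^esub> x \<in> gr B (k + l)"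
    using mult_gr[OF assms(1)] by (metis add.commute)
qed (use assms gr_closed in \<open>auto simp: B.r_distr intro: graded_comm_algebra_axioms\<close>)

lemma mult_commute_cases:
  assumes "x \<in> gr B k" "y \<in> gr B l"
  shows "x \<otimes>\<^bsub>B\<^esub> y = (if even (k * l) then y \<otimes>\<^bsub>B\<^esub> x else \<ominus>\<^bsub>B\<^esub> (y \<otimes>\<^bsub>B\<^esub> x))"
  using graded_comm[OF assms] gr_closed assms by (simp add: M.add_neg1_pow)

lemma add_sub_cancel: "x \<in> carrier B \<Longrightarrow> y \<in> carrier B \<Longrightarrow> y \<oplus>\<^bsub>B\<^esub> (x \<ominus>\<^bsub>B\<^esub> y) = x"
  by (simp add: a_minus_def M.a_ac M.r_neg M.r_neg1 M.r_neg2)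

lemma sub_self: "x \<in> carrier B \<Longrightarrow> x \<ominus>\<^bsub>B\<^esub> x = \<zero>\<^bsub>B\<^esub>"
  by (simp add: a_minus_def M.r_neg)

end

section \<open>The harmonic projection\<close>

context hodge_homotopy
begin

abbreviation \<pi> :: "'a \<Rightarrow> 'a" where "\<pi> \<equiv> harmonic_proj A h"

lemmas h_hom = module_hom_facts[OF is_module is_module h_linear]
lemmas h_closed [simp] = h_hom(1)
lemmas h_add = h_hom(2)
lemmas h_smult = h_hom(3)
lemmas h_zero [simp] = h_hom(4)
lemmas h_minus = h_hom(5)
lemmas h_sub = h_hom(6)

lemma pi_closed [simp]: "x \<in> carrier A \<Longrightarrow> \<pi> x \<in> carrier A"
  by (simp add: harmonic_proj_def)

lemma pi_add: "x \<in> carrier A \<Longrightarrow> y \<in> carrier A \<Longrightarrow> \<pi> (x \<oplus>\<^bsub>A\<^esub> y) = \<pi> x \<oplus>\<^bsub>A\<^esub> \<pi> y"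
  by (simp add: harmonic_proj_def h_add d_add M.diff_simps M.a_ac)

lemma pi_smult: "c \<in> carrier K \<Longrightarrow> x \<in> carrier A \<Longrightarrow> \<pi> (c \<odot>\<^bsub>A\<^esub> x) = c \<odot>\<^bsub>A\<^esub> \<pi> x"
  by (simp add: harmonic_proj_def h_smult d_smult a_minus_def smult_r_distr smult_r_minus)

lemma pi_linear: "\<pi> \<in> module_hom K A A"
  using pi_add pi_smult by (simp add: module_hom_def)

lemmas pi_hom = module_hom_facts[OF is_module is_module pi_linear]
lemmas pi_zero [simp] = pi_hom(4)
lemmas pi_minus = pi_hom(5)
lemmas pi_sub = pi_hom(6)

lemma pi_gr: "x \<in> gr A k \<Longrightarrow> \<pi> x \<in> gr A k"
  using diff_degree[OF h_degree, of x k] h_degree[OF diff_degree, of x k]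
  by (simp add: harmonic_proj_def gr_diff gr_add)

text \<open>The Hodge decomposition: a harmonic part, an exact part, and a part in the image of
  \<open>h\<close>.\<close>

lemma pi_decomp: "x \<in> carrier A \<Longrightarrow> x = \<pi> x \<oplus>\<^bsub>A\<^esub> (diff A (h x) \<oplus>\<^bsub>A\<^esub> h (diff A x))"
  by (simp add: harmonic_proj_def M.diff_simps M.a_ac)

lemma pi_d: "x \<in> carrier A \<Longrightarrow> \<pi> (diff A x) = \<zero>\<^bsub>A\<^esub>"
  by (simp add: harmonic_proj_def diff_h_diff diff_diff sub_self)

lemma d_pi: "x \<in> carrier A \<Longrightarrow> diff A (\<pi> x) = \<zero>\<^bsub>A\<^esub>"
  by (simp add: harmonic_proj_def d_diff d_add diff_h_diff diff_diff sub_self)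

lemma h_pi: "x \<in> carrier A \<Longrightarrow> h (\<pi> x) = \<zero>\<^bsub>A\<^esub>"
  by (simp add: harmonic_proj_def h_sub h_add h_diff_h h_h sub_self)

lemma pi_h: "x \<in> carrier A \<Longrightarrow> \<pi> (h x) = \<zero>\<^bsub>A\<^esub>"
  by (simp add: harmonic_proj_def h_diff_h h_h sub_self)

lemma pi_eq: "x \<in> carrier A \<Longrightarrow> diff A x = \<zero>\<^bsub>A\<^esub> \<Longrightarrow> h x = \<zero>\<^bsub>A\<^esub> \<Longrightarrow> \<pi> x = x"
  by (simp add: harmonic_proj_def a_minus_def)

lemma pi_idem [simp]: "x \<in> carrier A \<Longrightarrow> \<pi> (\<pi> x) = \<pi> x"
  by (rule pi_eq) (simp_all add: d_pi h_pi)

lemma harmonic_iff: "x \<in> harmonic A h \<longleftrightarrow> x \<in> carrier A \<and> \<pi> x = x"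
  by (auto simp: harmonic_def image_iff intro!: bexI[of _ x])

lemma harmonicD: "x \<in> harmonic A h \<Longrightarrow> x \<in> carrier A \<and> diff A x = \<zero>\<^bsub>A\<^esub> \<and> h x = \<zero>\<^bsub>A\<^esub> \<and> \<pi> x = x"
  by (metis harmonic_iff d_pi h_pi)

lemma pi_harmonic: "x \<in> carrier A \<Longrightarrow> \<pi> x \<in> harmonic A h"
  by (simp add: harmonic_iff)

lemma harmonic_cocycle: "x \<in> harmonic A h \<Longrightarrow> x \<in> cocycles A"
  by (simp add: cocycles_iff harmonicD)

lemma pi_cocycle: "x \<in> carrier A \<Longrightarrow> \<pi> x \<in> cocycles A"
  by (simp add: cocycles_iff d_pi)

lemma cocycle_pi: "x \<in> cocycles A \<Longrightarrow> x = \<pi> x \<oplus>\<^bsub>A\<^esub> diff A (h x)"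
  using pi_decomp[of x] by (simp add: cocycles_iff)

lemma cocycle_sub_pi: "x \<in> cocycles A \<Longrightarrow> x \<ominus>\<^bsub>A\<^esub> \<pi> x \<in> coboundaries A"
proof -
  assume x: "x \<in> cocycles A"
  then have "x \<in> carrier A" by (rule cocycle_closed)
  moreover have "x \<ominus>\<^bsub>A\<^esub> \<pi> x = diff A (h x)" using cocycle_pi[OF x] \<open>x \<in> carrier A\<close> by (simp add: M.diff_simps M.a_ac)
  ultimately show ?thesis by (simp add: coboundary_d)
qed

lemma coh_class_pi: "x \<in> cocycles A \<Longrightarrow> coh_class A (\<pi> x) = coh_class A x"
  using cocycle_sub_pi[of x] coh_class_eq_iff[of x "\<pi> x"] cocycle_closed by auto

lemma pi_coboundary: "x \<in> coboundaries A \<Longrightarrow> \<pi> x = \<zero>\<^bsub>A\<^esub>"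
  by (auto simp: coboundaries_iff pi_d)

lemma coboundary_iff_pi: "x \<in> cocycles A \<Longrightarrow> x \<in> coboundaries A \<longleftrightarrow> \<pi> x = \<zero>\<^bsub>A\<^esub>"
  using pi_coboundary cocycle_sub_pi[of x] cocycle_closed[of x] by (auto simp: a_minus_def)

lemma pi_eq_iff: "x \<in> cocycles A \<Longrightarrow> y \<in> cocycles A \<Longrightarrow> coh_class A x = coh_class A y \<longleftrightarrow> \<pi> x = \<pi> y"
  using coboundary_iff_pi[OF cocycle_diff, of x y] cocycle_closed[of x] cocycle_closed[of y]
  by (simp add: coh_class_eq_iff pi_sub M.diff_simps)

lemma harmonic_rep_class: "x \<in> cocycles A \<Longrightarrow> harmonic_rep A h (coh_class A x) = \<pi> x"
proof -
  assume x: "x \<in> cocycles A"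
  have "inj_on (coh_class A) (harmonic A h)"
    by (rule inj_onI) (metis pi_eq_iff harmonicD harmonic_cocycle)
  then have "the_inv_into (harmonic A h) (coh_class A) (coh_class A (\<pi> x)) = \<pi> x"
    by (rule the_inv_into_f_f) (use x cocycle_closed pi_harmonic in auto)
  then show ?thesis using x by (simp add: harmonic_rep_def coh_class_pi)
qed

lemma harmonic_rep_props:
  assumes "a \<in> carrier (cohomology A)"
  shows "harmonic_rep A h a \<in> harmonic A h" "coh_class A (harmonic_rep A h a) = a"
proof -
  obtain x where "x \<in> cocycles A" "a = coh_class A x" using assms by (rule coh_cases)
  then show "harmonic_rep A h a \<in> harmonic A h" "coh_class A (harmonic_rep A h a) = a"
    by (simp_all add: harmonic_rep_class pi_harmonic cocycle_closed coh_class_pi)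
qed

text \<open>The harmonic part of a product of cocycles depends only on their classes, and a cocycle
  differs from its projection by a coboundary.\<close>

lemma pi_mult_left:
  assumes "x \<in> cocycles A" "y \<in> cocycles A"
  shows "\<pi> (\<pi> x \<otimes>\<^bsub>A\<^esub> y) = \<pi> (x \<otimes>\<^bsub>A\<^esub> y)"
proof -
  have c: "x \<in> carrier A" "y \<in> carrier A" using assms cocycle_closed by auto
  have "x \<otimes>\<^bsub>A\<^esub> y = \<pi> x \<otimes>\<^bsub>A\<^esub> y \<oplus>\<^bsub>A\<^esub> (x \<ominus>\<^bsub>A\<^esub> \<pi> x) \<otimes>\<^bsub>A\<^esub> y"
    using c by (simp add: B.l_distr[symmetric] add_sub_cancel)
  then show ?thesis
    using c pi_coboundary[OF coboundary_mult_right[OF cocycle_sub_pi[OF assms(1)] assms(2)]]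
    by (simp add: pi_add)
qed

lemma pi_mult_right:
  assumes "x \<in> cocycles A" "y \<in> cocycles A"
  shows "\<pi> (x \<otimes>\<^bsub>A\<^esub> \<pi> y) = \<pi> (x \<otimes>\<^bsub>A\<^esub> y)"
proof -
  have c: "x \<in> carrier A" "y \<in> carrier A" using assms cocycle_closed by auto
  have "x \<otimes>\<^bsub>A\<^esub> y = x \<otimes>\<^bsub>A\<^esub> \<pi> y \<oplus>\<^bsub>A\<^esub> x \<otimes>\<^bsub>A\<^esub> (y \<ominus>\<^bsub>A\<^esub> \<pi> y)"
    using c by (simp add: B.r_distr[symmetric] add_sub_cancel)
  then show ?thesis
    using c pi_coboundary[OF coboundary_mult_left[OF assms(1) cocycle_sub_pi[OF assms(2)]]]
    by (simp add: pi_add)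
qed

lemma component_pi: "x \<in> carrier A \<Longrightarrow> component A k (\<pi> x) = \<pi> (component A k x)"
  using component_graded_hom[of K A A \<pi> 0 x k] pi_gr pi_add graded_comm_algebra_axioms by simp

lemma component_h: "x \<in> carrier A \<Longrightarrow> component A (k - 1) (h x) = h (component A k x)"
  using component_graded_hom[of K A A h "-1" x k] h_degree h_add graded_comm_algebra_axioms by simp

text \<open>The value lies in degree \<open>-1\<close>, where a Poincare DGCA is zero.\<close>

lemma h_one: "h \<one>\<^bsub>A\<^esub> = \<zero>\<^bsub>A\<^esub>"
  using h_degree[OF one_gr] gr_bounded[of "-1"] by auto

lemma pi_one: "\<pi> \<one>\<^bsub>A\<^esub> = \<one>\<^bsub>A\<^esub>"
  by (rule pi_eq) (simp_all add: h_one d_one)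

lemma fund_zero: "fund \<zero>\<^bsub>cohomology A\<^esub> = \<zero>\<^bsub>K\<^esub>"
proof -
  interpret H: dgca K "cohomology A" by (rule dgca_cohomology)
  have "fund (\<zero>\<^bsub>K\<^esub> \<odot>\<^bsub>cohomology A\<^esub> \<zero>\<^bsub>cohomology A\<^esub>) = \<zero>\<^bsub>K\<^esub> \<otimes>\<^bsub>K\<^esub> fund \<zero>\<^bsub>cohomology A\<^esub>"
    using H.gr_zero by (intro fund_smult) auto
  then show ?thesis using fund_closed[OF H.gr_zero] by simp
qed

lemma top_cocycle: "x \<in> gr A (int n) \<Longrightarrow> x \<in> cocycles A"
  using diff_degree[of x "int n"] gr_bounded[of "int n + 1"] gr_closed[of x "int n"]
  by (auto simp: cocycles_iff)

lemma cochain_pairing_top: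
  "x \<in> carrier A \<Longrightarrow> y \<in> carrier A \<Longrightarrow> x \<otimes>\<^bsub>A\<^esub> y \<in> gr A (int n) \<Longrightarrow>
    cochain_pairing A n fund x y = fund (coh_class A (x \<otimes>\<^bsub>A\<^esub> y))"
  by (simp add: cochain_pairing_def component_homogeneous)

text \<open>The contraction of the tensor square, \<open>h\<close> tensor identity plus
  \<open>\<pi>\<close> tensor \<open>h\<close>, followed by the product and \<open>\<pi>\<close>;
  the twist is the Koszul sign for moving \<open>h\<close> past the first factor. Up to sign
  conventions this is the binary component of the homotopy transfer morphism from \<open>A\<close>
  to its harmonic subspace.\<close>

definition \<kappa> :: "'a \<Rightarrow> 'a \<Rightarrow> 'a" where
  "\<kappa> x y = \<pi> (h x \<otimes>\<^bsub>A\<^esub> y) \<oplus>\<^bsub>A\<^esub> \<pi> (sign_twist A 1 (\<pi> x) \<otimes>\<^bsub>A\<^esub> h y)"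

lemma kappa_closed [simp]: "x \<in> carrier A \<Longrightarrow> y \<in> carrier A \<Longrightarrow> \<kappa> x y \<in> carrier A"
  by (simp add: \<kappa>_def)

lemma kappa_add_left:
  "x \<in> carrier A \<Longrightarrow> x' \<in> carrier A \<Longrightarrow> y \<in> carrier A \<Longrightarrow> \<kappa> (x \<oplus>\<^bsub>A\<^esub> x') y = \<kappa> x y \<oplus>\<^bsub>A\<^esub> \<kappa> x' y"
  by (simp add: \<kappa>_def h_add pi_add sign_twist_add B.l_distr M.a_ac)

lemma kappa_add_right:
  "x \<in> carrier A \<Longrightarrow> y \<in> carrier A \<Longrightarrow> y' \<in> carrier A \<Longrightarrow> \<kappa> x (y \<oplus>\<^bsub>A\<^esub> y') = \<kappa> x y \<oplus>\<^bsub>A\<^esub> \<kappa> x y'"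
  by (simp add: \<kappa>_def h_add pi_add B.r_distr M.a_ac)

lemma kappa_smult_left:
  "c \<in> carrier K \<Longrightarrow> x \<in> carrier A \<Longrightarrow> y \<in> carrier A \<Longrightarrow> \<kappa> (c \<odot>\<^bsub>A\<^esub> x) y = c \<odot>\<^bsub>A\<^esub> \<kappa> x y"
  by (simp add: \<kappa>_def h_smult pi_smult sign_twist_smult smult_mult_left smult_r_distr)

lemma kappa_smult_right:
  "c \<in> carrier K \<Longrightarrow> x \<in> carrier A \<Longrightarrow> y \<in> carrier A \<Longrightarrow> \<kappa> x (c \<odot>\<^bsub>A\<^esub> y) = c \<odot>\<^bsub>A\<^esub> \<kappa> x y"
  by (simp add: \<kappa>_def h_smult pi_smult smult_mult_right smult_r_distr)

lemma kappa_zero_left [simp]: "y \<in> carrier A \<Longrightarrow> \<kappa> \<zero>\<^bsub>A\<^esub> y = \<zero>\<^bsub>A\<^esub>"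
  using kappa_smult_left[of "\<zero>\<^bsub>K\<^esub>" "\<zero>\<^bsub>A\<^esub>" y] by simp

lemma kappa_zero_right [simp]: "x \<in> carrier A \<Longrightarrow> \<kappa> x \<zero>\<^bsub>A\<^esub> = \<zero>\<^bsub>A\<^esub>"
  using kappa_smult_right[of "\<zero>\<^bsub>K\<^esub>" x "\<zero>\<^bsub>A\<^esub>"] by simp

lemma kappa_one_left: "y \<in> carrier A \<Longrightarrow> \<kappa> \<one>\<^bsub>A\<^esub> y = \<zero>\<^bsub>A\<^esub>"
  by (simp add: \<kappa>_def h_one pi_one sign_twist_one pi_h)

lemma kappa_one_right: "x \<in> carrier A \<Longrightarrow> \<kappa> x \<one>\<^bsub>A\<^esub> = \<zero>\<^bsub>A\<^esub>"
  by (simp add: \<kappa>_def h_one pi_h)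

lemma kappa_gr: "x \<in> gr A k \<Longrightarrow> y \<in> gr A l \<Longrightarrow> \<kappa> x y \<in> gr A (k + l - 1)"
proof -
  assume x: "x \<in> gr A k" and y: "y \<in> gr A l"
  have "h x \<otimes>\<^bsub>A\<^esub> y \<in> gr A (k - 1 + l)" using x y by (intro mult_gr h_degree)
  moreover have "sign_twist A 1 (\<pi> x) \<otimes>\<^bsub>A\<^esub> h y \<in> gr A (k + (l - 1))"
    using x y by (simp add: sign_twist_homogeneous[OF pi_gr[OF x]] gr_sign pi_gr mult_gr h_degree)
  ultimately show ?thesis unfolding \<kappa>_def by (intro gr_add pi_gr) (simp_all add: algebra_simps)
qed

lemma kappa_harmonic: "x \<in> carrier A \<Longrightarrow> y \<in> carrier A \<Longrightarrow> \<pi> (\<kappa> x y) = \<kappa> x y"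
  by (simp add: \<kappa>_def pi_add)

lemma kappa_homogeneous:
  assumes "x \<in> gr A k" "y \<in> carrier A"
  shows "\<kappa> x y = \<pi> (h x \<otimes>\<^bsub>A\<^esub> y) \<oplus>\<^bsub>A\<^esub> [neg1_pow k] \<cdot>\<^bsub>A\<^esub> \<pi> (\<pi> x \<otimes>\<^bsub>A\<^esub> h y)"
  using assms gr_closed[OF assms(1)] pi_gr[OF assms(1)]
  by (simp add: \<kappa>_def sign_twist_homogeneous[of _ k] M.add_neg1_pow B.l_minus pi_minus)

text \<open>\<open>\<kappa>\<close> is a homotopy between the two products on \<open>A\<close> with values in the harmonic subspace.\<close>

lemma pi_mult_homotopy:
  assumes x: "x \<in> gr A k" and y: "y \<in> carrier A"
  shows "\<pi> (x \<otimes>\<^bsub>A\<^esub> y) = \<pi> (\<pi> x \<otimes>\<^bsub>A\<^esub> \<pi> y) \<oplus>\<^bsub>A\<^esub> (\<kappa> (diff A x) y \<oplus>\<^bsub>A\<^esub> [neg1_pow k] \<cdot>\<^bsub>A\<^esub> \<kappa> x (diff A y))"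
proof -
  have xc: "x \<in> carrier A" using x by (rule gr_closed)
  have hx: "h x \<in> gr A (k - 1)" and px: "\<pi> x \<in> gr A k" and dx: "diff A x \<in> gr A (k + 1)"
    using x by (auto intro: h_degree pi_gr diff_degree)
  have k1: "\<kappa> (diff A x) y = \<pi> (h (diff A x) \<otimes>\<^bsub>A\<^esub> y)"
    using kappa_homogeneous[OF dx y] xc y by (simp add: pi_d M.add_neg1_pow)
  have k2: "\<kappa> x (diff A y) = \<pi> (h x \<otimes>\<^bsub>A\<^esub> diff A y) \<oplus>\<^bsub>A\<^esub> [neg1_pow k] \<cdot>\<^bsub>A\<^esub> \<pi> (\<pi> x \<otimes>\<^bsub>A\<^esub> h (diff A y))"
    using kappa_homogeneous[OF x, of "diff A y"] y by simp
  \<comment> \<open>Exact elements have no harmonic part, so inside \<open>\<pi>\<close> a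
    differential may be moved from one factor to the other.\<close>
  have e1: "\<pi> (diff A (h x) \<otimes>\<^bsub>A\<^esub> y) = [neg1_pow k] \<cdot>\<^bsub>A\<^esub> \<pi> (h x \<otimes>\<^bsub>A\<^esub> diff A y)"
  proof -
    have "\<zero>\<^bsub>A\<^esub> = \<pi> (diff A (h x \<otimes>\<^bsub>A\<^esub> y))" using xc y by (simp add: pi_d)
    also have "\<dots> = \<pi> (diff A (h x) \<otimes>\<^bsub>A\<^esub> y) \<oplus>\<^bsub>A\<^esub> [neg1_pow (k - 1)] \<cdot>\<^bsub>A\<^esub> \<pi> (h x \<otimes>\<^bsub>A\<^esub> diff A y)"
      using leibniz[OF hx y] xc y by (simp add: M.add_neg1_pow pi_add pi_minus)
    finally have "\<zero>\<^bsub>A\<^esub> = \<pi> (diff A (h x) \<otimes>\<^bsub>A\<^esub> y) \<oplus>\<^bsub>A\<^esub> [neg1_pow (k - 1)] \<cdot>\<^bsub>A\<^esub> \<pi> (h x \<otimes>\<^bsub>A\<^esub> diff A y)" .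
    then show ?thesis using xc y by (auto simp: M.add_neg1_pow M.diff_simps M.diff_simps2)
  qed
  have e2: "\<pi> (\<pi> x \<otimes>\<^bsub>A\<^esub> diff A (h y)) = \<zero>\<^bsub>A\<^esub>"
  proof -
    have "\<zero>\<^bsub>A\<^esub> = \<pi> (diff A (\<pi> x \<otimes>\<^bsub>A\<^esub> h y))" using xc y by (simp add: pi_d)
    also have "\<dots> = [neg1_pow k] \<cdot>\<^bsub>A\<^esub> \<pi> (\<pi> x \<otimes>\<^bsub>A\<^esub> diff A (h y))"
      using leibniz[OF px, of "h y"] xc y by (simp add: M.add_neg1_pow pi_add pi_minus d_pi)
    finally show ?thesis using xc y by (auto simp: M.add_neg1_pow M.diff_simps M.diff_simps2 split: if_splits)
  qed
  have "\<pi> (x \<otimes>\<^bsub>A\<^esub> y) = \<pi> ((\<pi> x \<oplus>\<^bsub>A\<^esub> (diff A (h x) \<oplus>\<^bsub>A\<^esub> h (diff A x))) \<otimes>\<^bsub>A\<^esub> y)"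
    using pi_decomp[OF xc] by simp
  also have "\<dots> = \<pi> (\<pi> x \<otimes>\<^bsub>A\<^esub> y) \<oplus>\<^bsub>A\<^esub> (\<pi> (diff A (h x) \<otimes>\<^bsub>A\<^esub> y) \<oplus>\<^bsub>A\<^esub> \<pi> (h (diff A x) \<otimes>\<^bsub>A\<^esub> y))"
    using xc y by (simp add: B.l_distr pi_add)
  also have "\<pi> (\<pi> x \<otimes>\<^bsub>A\<^esub> y) = \<pi> (\<pi> x \<otimes>\<^bsub>A\<^esub> (\<pi> y \<oplus>\<^bsub>A\<^esub> (diff A (h y) \<oplus>\<^bsub>A\<^esub> h (diff A y))))"
    using pi_decomp[OF y] by simp
  also have "\<dots> = \<pi> (\<pi> x \<otimes>\<^bsub>A\<^esub> \<pi> y) \<oplus>\<^bsub>A\<^esub> \<pi> (\<pi> x \<otimes>\<^bsub>A\<^esub> h (diff A y))"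
    using xc y by (simp add: B.r_distr pi_add e2)
  finally show ?thesis using xc y unfolding e1 k1 k2
    by (simp add: M.add_neg1_pow M.minus_add M.a_ac)
qed

end

section \<open>Vanishing results from connectedness and duality\<close>

locale connected_hodge = hodge_homotopy K A n fund h
  for K :: "('k, 'l) ring_scheme" and A :: "('k, 'a) dgca" (structure) and n :: nat and fund :: "'a set \<Rightarrow> 'k"
    and h :: "'a \<Rightarrow> 'a" +
  fixes r :: nat
  assumes r_ge_2: "2 \<le> r" and n_le: "n \<le> 4 * r - 1"
    and connected: "cohomologically_connected K A (r - 1)"
begin

lemma coh_gr_0:
  assumes "a \<in> gr (cohomology A) 0"
  shows "\<exists>c\<in>carrier K. a = c \<odot>\<^bsub>cohomology A\<^esub> \<one>\<^bsub>cohomology A\<^esub>"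
proof -
  have "a \<in> (\<lambda>c. c \<odot>\<^bsub>cohomology A\<^esub> \<one>\<^bsub>cohomology A\<^esub>) ` carrier K"
    using connected assms by (simp add: cohomologically_connected_def bij_betw_def)
  then show ?thesis by auto
qed

lemma coh_gr_low: "1 \<le> k \<Longrightarrow> k < int r \<Longrightarrow> gr (cohomology A) k = {\<zero>\<^bsub>cohomology A\<^esub>}"
  using connected r_ge_2 unfolding cohomologically_connected_def by auto

text \<open>Against a class of degree \<open>n\<close> only the degree 0 part of the other argument
  counts, and by connectedness it is a multiple of the unit. Nondegeneracy thus says that the
  integral is injective in degree \<open>n\<close>.\<close>

lemma fund_eq_zero:
  assumes a: "a \<in> gr (cohomology A) (int n)" and f: "fund a = \<zero>\<^bsub>K\<^esub>"
  shows "a = \<zero>\<^bsub>cohomology A\<^esub>"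
proof (rule pairing_nondegenerate_left)
  interpret H: dgca K "cohomology A" by (rule dgca_cohomology)
  show ac: "a \<in> carrier (cohomology A)" using a by (rule H.gr_closed)
  show "\<forall>b\<in>carrier (cohomology A). cohomology_pairing A n fund a b = \<zero>\<^bsub>K\<^esub>"
  proof
    fix b assume b: "b \<in> carrier (cohomology A)"
    obtain c where c: "c \<in> carrier K"
      and bc: "component (cohomology A) 0 b = c \<odot>\<^bsub>cohomology A\<^esub> \<one>\<^bsub>cohomology A\<^esub>"
      using coh_gr_0[OF H.component_gr[OF b, of 0]] by blast
    have "component (cohomology A) (int n) (a \<otimes>\<^bsub>cohomology A\<^esub> b) = c \<odot>\<^bsub>cohomology A\<^esub> a"
      using H.component_mult_left[OF a b, of 0] c ac by (simp add: bc H.smult_mult_right)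
    then show "cohomology_pairing A n fund a b = \<zero>\<^bsub>K\<^esub>"
      using c by (simp add: cohomology_pairing_def fund_smult[OF c a] f)
  qed
qed

lemma pi_top_zero:
  assumes "u \<in> gr A (int n)" "fund (coh_class A u) = \<zero>\<^bsub>K\<^esub>"
  shows "\<pi> u = \<zero>"
proof -
  have u: "u \<in> cocycles A" using assms(1) by (rule top_cocycle)
  then have "coh_class A u = \<zero>\<^bsub>cohomology A\<^esub>"
    using assms by (intro fund_eq_zero) (auto simp: coh_gr)
  then show ?thesis using u cocycle_closed by (simp add: coh_class_eq_zero_iff pi_coboundary)
qed

text \<open>In top degree the harmonic part is detected by the integral, so the isotropy of the
  image of \<open>h\<close> becomes an identity between elements.\<close>

lemma pi_h_h_top:
  assumes "x \<in> carrier A" "y \<in> carrier A" "h x \<otimes> h y \<in> gr A (int n)"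
  shows "\<pi> (h x \<otimes> h y) = \<zero>"
  using assms by (intro pi_top_zero) (auto simp flip: cochain_pairing_top intro: h_isotropic)

lemma pi_harmonic_h_top:
  assumes "x \<in> harmonic A h" "y \<in> carrier A" "x \<otimes> h y \<in> gr A (int n)"
  shows "\<pi> (x \<otimes> h y) = \<zero>"
  using assms by (intro pi_top_zero)
    (auto simp flip: cochain_pairing_top simp: harmonicD intro: harmonic_orthogonal)

text \<open>The last interval is dual to the degrees \<open>1\<close> to \<open>r - 1\<close>, where
  connectedness makes the cohomology vanish: a class of degree \<open>k\<close> in it pairs only
  with classes of degree \<open>n - k\<close>, which lies between \<open>1\<close> and
  \<open>r - 1\<close>.\<close>

lemma pi_gr_vanish:
  assumes x: "x \<in> gr A k" and k: "k < 0 \<or> int n < k \<or> (1 \<le> k \<and> k < int r) \<or> (int n - int r < k \<and> k < int n)"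
  shows "\<pi> x = \<zero>"
proof -
  interpret H: dgca K "cohomology A" by (rule dgca_cohomology)
  let ?a = "coh_class A (\<pi> x)"
  have xc: "x \<in> carrier A" using x by (rule gr_closed)
  have a: "?a \<in> gr (cohomology A) k" using x pi_cocycle[OF xc] pi_gr by (auto simp: coh_gr)
  have "?a = \<zero>\<^bsub>cohomology A\<^esub>"
  proof (cases "int n - int r < k \<and> k < int n")
    case False
    then consider "k < 0 \<or> int n < k" | "1 \<le> k" "k < int r" using k by auto
    then show ?thesis
    proof cases
      case 1
      then have "\<pi> x = \<zero>" using pi_gr[OF x] gr_bounded[of k] by auto
      then show ?thesis by (simp add: coh_class_zero)
    qed (use a coh_gr_low in auto)
  next
    case True
    show ?thesis
    proof (rule pairing_nondegenerate_left)
      show ac: "?a \<in> carrier (cohomology A)" using a by (rule H.gr_closed)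
      show "\<forall>b\<in>carrier (cohomology A). cohomology_pairing A n fund ?a b = \<zero>\<^bsub>K\<^esub>"
      proof
        fix b assume b: "b \<in> carrier (cohomology A)"
        have "component (cohomology A) (int n - k) b = \<zero>\<^bsub>cohomology A\<^esub>"
          using H.component_gr[OF b, of "int n - k"] coh_gr_low[of "int n - k"] True by auto
        then have "component (cohomology A) (int n) (?a \<otimes>\<^bsub>cohomology A\<^esub> b) = \<zero>\<^bsub>cohomology A\<^esub>"
          using H.component_mult_left[OF a b, of "int n - k"] ac by simp
        then show "cohomology_pairing A n fund ?a b = \<zero>\<^bsub>K\<^esub>"
          by (simp add: cohomology_pairing_def fund_zero)
      qed
    qed
  qed
  then have "\<pi> x \<in> coboundaries A" using xc by (simp add: coh_class_eq_zero_iff)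
  then have "\<pi> (\<pi> x) = \<zero>" by (rule pi_coboundary)
  then show ?thesis using xc by simp
qed

lemma pi_gr_0:
  assumes x: "x \<in> gr A 0"
  obtains c where "c \<in> carrier K" "\<pi> x = c \<odot> \<one>"
proof -
  have xc: "x \<in> carrier A" using x by (rule gr_closed)
  have "coh_class A (\<pi> x) \<in> gr (cohomology A) 0" using x pi_cocycle[OF xc] pi_gr by (auto simp: coh_gr)
  then obtain c where c: "c \<in> carrier K" "coh_class A (\<pi> x) = c \<odot>\<^bsub>cohomology A\<^esub> \<one>\<^bsub>cohomology A\<^esub>"
    using coh_gr_0 by blast
  then have "coh_class A (\<pi> x) = coh_class A (c \<odot> \<one>)" by (simp add: coh_one coh_smult cocycle_one)
  then have "\<pi> (\<pi> x) = \<pi> (c \<odot> \<one>)"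
    using pi_eq_iff[OF pi_cocycle[OF xc] cocycle_smult[OF c(1) cocycle_one]] by simp
  then have "\<pi> x = c \<odot> \<one>" using xc c by (simp add: pi_smult pi_one)
  then show thesis using that c by blast
qed

lemma degree_bounds: "int n \<le> 4 * int r - 1" "2 \<le> int r"
  using n_le r_ge_2 by auto

text \<open>The product has degree at least \<open>4r - 2\<close>, hence at least
  \<open>n - 1\<close>. Degree \<open>n - 1\<close> is excluded by duality, degree \<open>n\<close>
  by isotropy, and beyond \<open>n\<close> the algebra is zero.\<close>

lemma pi_h_h:
  assumes "x \<in> gr A i" "y \<in> gr A j" "2 * int r \<le> i" "2 * int r \<le> j"
  shows "\<pi> (h x \<otimes> h y) = \<zero>"
proof -
  have g: "h x \<otimes> h y \<in> gr A ((i - 1) + (j - 1))" using assms by (intro mult_gr h_degree)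
  show ?thesis
  proof (cases "(i - 1) + (j - 1) = int n")
    case True
    then show ?thesis using g assms gr_closed by (intro pi_h_h_top) auto
  next
    case False
    then show ?thesis using degree_bounds assms by (intro pi_gr_vanish[OF g]) auto
  qed
qed

text \<open>A harmonic \<open>w\<close> of degree 0 is a scalar, and \<open>h\<close> has no
  harmonic values. For \<open>i\<close> at least \<open>r\<close> the product has degree at least
  \<open>3r - 1\<close>, hence at least \<open>n - r\<close>, with equality only in the excluded
  case; in the other degrees duality, orthogonality in degree \<open>n\<close>, or the bound
  \<open>n\<close> applies.\<close>

lemma pi_harmonic_h:
  assumes w: "w \<in> harmonic A h" "w \<in> gr A i" and y: "y \<in> gr A j" and j: "2 * int r \<le> j"
    and exc: "\<not> (n = 4 * r - 1 \<and> i = int r \<and> j = 2 * int r)"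
  shows "\<pi> (w \<otimes> h y) = \<zero>" "\<pi> (h y \<otimes> w) = \<zero>"
proof -
  have g: "w \<otimes> h y \<in> gr A (i + (j - 1))" using w y by (intro mult_gr h_degree)
  have c: "w \<in> carrier A" "y \<in> carrier A" using w y gr_closed by auto
  show 1: "\<pi> (w \<otimes> h y) = \<zero>"
  proof -
    consider "i = 0" | "i < 0 \<or> (1 \<le> i \<and> i < int r)" | "int r \<le> i" by linarith
    then show ?thesis
    proof cases
      case 1
      then obtain e where e: "e \<in> carrier K" "\<pi> w = e \<odot> \<one>" using pi_gr_0 w by blast
      then have "w \<otimes> h y = e \<odot> h y" using w c by (simp add: harmonicD smult_mult_left)
      then show ?thesis using e c by (simp add: pi_smult pi_h)
    next
      case 2
      then have "w = \<zero>" using pi_gr_vanish[OF w(2)] w(1) harmonicD by auto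
      then show ?thesis using c by simp
    next
      case 3
      show ?thesis
      proof (cases "i + (j - 1) = int n")
        case True
        then show ?thesis using g w c by (intro pi_harmonic_h_top) auto
      next
        case False
        then show ?thesis using degree_bounds 3 j exc
          by (intro pi_gr_vanish[OF g]) linarith
      qed
    qed
  qed
  then show "\<pi> (h y \<otimes> w) = \<zero>"
    using mult_commute_cases[OF h_degree[OF y] w(2)] c by (auto simp: pi_minus)
qed

text \<open>What the projection removes from \<open>u\<close> does not count: times the closed
  element \<open>w\<close>, the exact part gives an exact product, and the part in the image of
  \<open>h\<close> is orthogonal to \<open>w\<close> in degree \<open>n\<close>.\<close>

lemma pi_mult_pi_top:
  assumes w: "w \<in> harmonic A h" "w \<in> gr A i" and u: "u \<in> gr A j" and ij: "i + j = int n"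
  shows "\<pi> (w \<otimes> \<pi> u) = \<pi> (w \<otimes> u)" "\<pi> (\<pi> u \<otimes> w) = \<pi> (u \<otimes> w)"
proof -
  have c: "w \<in> carrier A" "u \<in> carrier A" using w u gr_closed by auto
  have hd: "h (diff A u) \<in> gr A j" using h_degree[OF diff_degree[OF u]] by simp
  have e1: "\<pi> (w \<otimes> diff A (h u)) = \<zero>"
  proof -
    have "\<zero> = \<pi> (diff A (w \<otimes> h u))" using c by (simp add: pi_d)
    also have "\<dots> = [neg1_pow i] \<cdot> \<pi> (w \<otimes> diff A (h u))"
      using leibniz[OF w(2), of "h u"] w c by (simp add: harmonicD M.add_neg1_pow pi_minus)
    finally show ?thesis using c by (auto simp: M.add_neg1_pow M.diff_simps M.diff_simps2 split: if_splits)
  qed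
  have e2: "\<pi> (w \<otimes> h (diff A u)) = \<zero>"
    using mult_gr[OF w(2) hd] ij w c by (intro pi_harmonic_h_top) auto
  have "\<pi> (w \<otimes> u) = \<pi> (w \<otimes> (\<pi> u \<oplus> (diff A (h u) \<oplus> h (diff A u))))"
    using pi_decomp[OF c(2)] by simp
  also have "\<dots> = \<pi> (w \<otimes> \<pi> u)" using c by (simp add: B.r_distr pi_add e1 e2)
  finally show 1: "\<pi> (w \<otimes> \<pi> u) = \<pi> (w \<otimes> u)" ..
  then show "\<pi> (\<pi> u \<otimes> w) = \<pi> (u \<otimes> w)"
    using mult_commute_cases[OF u w(2)] mult_commute_cases[OF pi_gr[OF u] w(2)] c
    by (auto simp: pi_minus)
qed

text \<open>The products have degree \<open>n\<close>. In the Hodge decomposition of the argument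
  outside \<open>h\<close> only the exact part contributes, and integration by parts moves the
  differential across; since \<open>h x\<close> has odd degree \<open>2r - 1\<close>, no sign
  appears. This will make \<open>\<kappa>\<close> graded symmetric in degrees
  \<open>(2r, 2r)\<close>.\<close>

lemma pi_h_selfadjoint:
  assumes n: "n = 4 * r - 1" and x: "x \<in> gr A (2 * int r)" and y: "y \<in> gr A (2 * int r)"
  shows "\<pi> (h x \<otimes> y) = \<pi> (x \<otimes> h y)"
proof -
  have nn: "int n = 4 * int r - 1" using n r_ge_2 by auto
  have c: "x \<in> carrier A" "y \<in> carrier A" using x y gr_closed by auto
  have hx: "h x \<in> gr A (2 * int r - 1)" and hy: "h y \<in> gr A (2 * int r - 1)"
    using x y by (auto intro: h_degree)
  have dx: "diff A x \<in> gr A (2 * int r + 1)" and dy: "diff A y \<in> gr A (2 * int r + 1)"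
    using x y by (auto intro: diff_degree)
  have r1: "2 * int r \<noteq> int r" using r_ge_2 by simp
  have z: "\<pi> (h x \<otimes> \<pi> y) = \<zero>" "\<pi> (\<pi> x \<otimes> h y) = \<zero>"
    using pi_harmonic_h[OF pi_harmonic[OF c(2)] pi_gr[OF y] x]
      pi_harmonic_h[OF pi_harmonic[OF c(1)] pi_gr[OF x] y] r1 by auto
  have z2: "\<pi> (h x \<otimes> h (diff A y)) = \<zero>" "\<pi> (h (diff A x) \<otimes> h y) = \<zero>"
    using pi_h_h[OF x dy] pi_h_h[OF dx y] by auto
  have "\<pi> (h x \<otimes> y) = \<pi> (h x \<otimes> (\<pi> y \<oplus> (diff A (h y) \<oplus> h (diff A y))))"
    using pi_decomp[OF c(2)] by simp
  also have "\<dots> = \<pi> (h x \<otimes> diff A (h y))" using c z z2 by (simp add: B.r_distr pi_add)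
  also have "\<dots> = \<pi> (diff A (h x) \<otimes> h y)"
  proof -
    have "\<zero> = \<pi> (diff A (h x \<otimes> h y))" using c by (simp add: pi_d)
    also have "diff A (h x \<otimes> h y) = diff A (h x) \<otimes> h y \<ominus> h x \<otimes> diff A (h y)"
      using leibniz[OF hx, of "h y"] c by (simp add: M.add_neg1_pow a_minus_def)
    finally show ?thesis using c by (simp add: pi_sub M.diff_simps)
  qed
  also have "\<dots> = \<pi> ((\<pi> x \<oplus> (diff A (h x) \<oplus> h (diff A x))) \<otimes> h y)"
    using c z z2 by (simp add: B.l_distr pi_add)
  also have "\<dots> = \<pi> (x \<otimes> h y)" using pi_decomp[OF c(1)] by simp
  finally show ?thesis .
qed

text \<open>Harmonic below degree \<open>2r - 1\<close>, the kernel of \<open>h\<close> in degree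
  \<open>2r - 1\<close>, and everything from \<open>2r\<close> on. Products of elements of degree at
  least \<open>r\<close> start in degree \<open>2r\<close>, where no condition is imposed; degree
  \<open>2r - 1\<close> must be larger than the harmonic part so that \<open>S\<close> remains
  closed under \<open>h\<close>.\<close>

definition S :: "int \<Rightarrow> 'a set" where
  "S k = {x \<in> gr A k. (k < 2 * int r \<longrightarrow> h x = \<zero>) \<and> (k < 2 * int r - 1 \<longrightarrow> diff A x = \<zero>)}"

lemma S_gr: "x \<in> S k \<Longrightarrow> x \<in> gr A k" by (simp add: S_def)

lemma S_closed: "x \<in> S k \<Longrightarrow> x \<in> carrier A" using S_gr gr_closed by blast

lemma S_harmonic: "x \<in> S k \<Longrightarrow> k < 2 * int r - 1 \<Longrightarrow> x \<in> harmonic A h"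
  using S_closed pi_eq by (auto simp: S_def harmonic_iff)

lemma harmonic_S: "x \<in> harmonic A h \<Longrightarrow> x \<in> gr A k \<Longrightarrow> x \<in> S k"
  using harmonicD by (auto simp: S_def)

lemma S_zero: "\<zero> \<in> S k" by (simp add: S_def gr_zero)

lemma S_add: "x \<in> S k \<Longrightarrow> y \<in> S k \<Longrightarrow> x \<oplus> y \<in> S k"
  using gr_closed by (auto simp: S_def gr_add h_add d_add)

lemma S_smult: "c \<in> carrier K \<Longrightarrow> x \<in> S k \<Longrightarrow> c \<odot> x \<in> S k"
  using gr_closed by (auto simp: S_def gr_smult h_smult d_smult)

lemma S_0:
  assumes "x \<in> S 0" obtains c where "c \<in> carrier K" "x = c \<odot> \<one>"
  using pi_gr_0[OF S_gr[OF assms]] S_harmonic[OF assms] r_ge_2 harmonicD by (metis of_nat_0_less_iff degree_bounds(2) diff_gt_0_iff_gt less_le_trans mult_2 add_increasing2 of_nat_0_le_iff one_less_numeral_iff semiring_norm(76))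

lemma S_low: "x \<in> S k \<Longrightarrow> k < 0 \<or> (1 \<le> k \<and> k < int r) \<Longrightarrow> x = \<zero>"
  using S_harmonic[of x k] pi_gr_vanish[OF S_gr, of x k] r_ge_2 harmonicD by force

lemma S_one: "\<one> \<in> S 0"
  by (rule harmonic_S) (simp_all add: harmonic_iff pi_one one_gr)

lemma S_d: "x \<in> S k \<Longrightarrow> diff A x \<in> S (k + 1)"
  using S_closed diff_degree diff_diff by (auto simp: S_def)

lemma S_h: "x \<in> S k \<Longrightarrow> h x \<in> S (k - 1)"
  using S_closed h_degree h_h by (auto simp: S_def)

text \<open>A factor of degree 0 is a scalar, and one in any other degree below \<open>r\<close> is
  zero. Two factors of degree at least \<open>r\<close> have a product in degree at least
  \<open>2r\<close>, where membership in \<open>S\<close> only means being homogeneous.\<close>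

lemma S_mult:
  assumes x: "x \<in> S j" and y: "y \<in> S k"
  shows "x \<otimes> y \<in> S (j + k)"
proof -
  have c: "x \<in> carrier A" "y \<in> carrier A" using assms S_closed by auto
  consider "j = 0" | "k = 0" | "j < 0 \<or> (1 \<le> j \<and> j < int r)" | "k < 0 \<or> (1 \<le> k \<and> k < int r)"
    | "int r \<le> j" "int r \<le> k" by linarith
  then show ?thesis
  proof cases
    case 1
    then obtain e where "e \<in> carrier K" "x = e \<odot> \<one>" using S_0 x by blast
    then show ?thesis using c y 1 by (simp add: smult_mult_left S_smult)
  next
    case 2
    then obtain e where "e \<in> carrier K" "y = e \<odot> \<one>" using S_0 y by blast
    then show ?thesis using c x 2 by (simp add: smult_mult_right S_smult)
  next
    case 3
    then show ?thesis using S_low[OF x] c S_zero by simp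
  next
    case 4
    then show ?thesis using S_low[OF y] c S_zero by simp
  next
    case 5
    then show ?thesis using mult_gr[OF S_gr[OF x] S_gr[OF y]] by (simp add: S_def)
  qed
qed

lemma S_decomp: "x \<in> S k \<Longrightarrow> k < 2 * int r \<Longrightarrow> x = \<pi> x \<oplus> h (diff A x)"
  using pi_decomp[OF S_closed, of x k] S_closed[of x k] by (simp add: S_def)

text \<open>The pairs of degrees in which \<open>\<kappa>\<close> can be nonzero on
  \<open>S\<close>. Its values then have degree \<open>3r - 1 = n - r\<close> or
  \<open>4r - 1 = n\<close>.\<close>

abbreviation exceptional :: "int \<Rightarrow> int \<Rightarrow> bool" where
  "exceptional j k \<equiv> n = 4 * r - 1 \<and> (j, k) \<in> {(int r, 2 * int r), (2 * int r, int r), (2 * int r, 2 * int r)}"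

text \<open>Below degree \<open>2r\<close> the homotopy vanishes on \<open>S\<close>. If only
  \<open>x\<close> has degree at least \<open>2r\<close>, then \<open>y\<close> is a harmonic
  element plus an element of the image of \<open>h\<close>, and \<open>pi_harmonic_h\<close> and
  \<open>pi_h_h\<close> apply. If both have, the degree is at least \<open>4r - 1\<close>, which
  exceeds \<open>n\<close> except in the excluded case.\<close>

lemma kappa_first_zero:
  assumes x: "x \<in> S j" and y: "y \<in> S k"
    and "\<not> (n = 4 * r - 1 \<and> j = 2 * int r \<and> (k = int r \<or> k = 2 * int r))"
  shows "\<pi> (h x \<otimes> y) = \<zero>"
proof -
  have c: "x \<in> carrier A" "y \<in> carrier A" using assms S_closed by auto
  consider "j < 2 * int r" | "2 * int r \<le> j" "k < 2 * int r" | "2 * int r \<le> j" "2 * int r \<le> k" by linarith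
  then show ?thesis
  proof cases
    case 1
    then show ?thesis using x c by (simp add: S_def)
  next
    case 2
    have "\<pi> (h x \<otimes> \<pi> y) = \<zero>"
      using assms 2 by (intro pi_harmonic_h(2)[OF pi_harmonic[OF c(2)] pi_gr[OF S_gr[OF y]] S_gr[OF x]]) auto
    moreover have "\<pi> (h x \<otimes> h (diff A y)) = \<zero>"
    proof (cases "k < 2 * int r - 1")
      case True
      then show ?thesis using y c by (simp add: S_def)
    next
      case False
      then show ?thesis using 2 by (intro pi_h_h[OF S_gr[OF x] S_gr[OF S_d[OF y]]]) auto
    qed
    ultimately have "\<pi> (h x \<otimes> (\<pi> y \<oplus> h (diff A y))) = \<zero>"
      using c by (simp add: B.r_distr pi_add)
    then show ?thesis using S_decomp[OF y 2(2)] by simp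
  next
    case 3
    have "h x \<otimes> y \<in> gr A (j - 1 + k)" using x y by (intro mult_gr h_degree S_gr)
    then show ?thesis using 3 degree_bounds assms(3) r_ge_2 by (intro pi_gr_vanish) (auto split: if_splits)
  qed
qed

lemma kappa_second_zero:
  assumes x: "x \<in> S j" and y: "y \<in> S k" and "\<not> (n = 4 * r - 1 \<and> j = int r \<and> k = 2 * int r)"
  shows "\<pi> (\<pi> x \<otimes> h y) = \<zero>"
proof -
  have c: "x \<in> carrier A" "y \<in> carrier A" using assms S_closed by auto
  show ?thesis
  proof (cases "k < 2 * int r")
    case True
    then show ?thesis using y c by (simp add: S_def)
  next
    case False
    then show ?thesis
      using assms by (intro pi_harmonic_h(1)[OF pi_harmonic[OF c(1)] pi_gr[OF S_gr[OF x]] S_gr[OF y]]) auto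
  qed
qed

lemma kappa_S_zero:
  assumes x: "x \<in> S j" and y: "y \<in> S k" and "\<not> exceptional j k"
  shows "\<kappa> x y = \<zero>"
  using kappa_first_zero[OF x y] kappa_second_zero[OF x y] assms(3)
    kappa_homogeneous[OF S_gr[OF x] S_closed[OF y]] by (auto simp: M.add_neg1_pow)

lemma kappa_S_first:
  assumes x: "x \<in> S (2 * int r)" and y: "y \<in> S k"
  shows "\<kappa> x y = \<pi> (h x \<otimes> y)"
  using kappa_second_zero[OF x y] r_ge_2 S_closed[OF x] S_closed[OF y]
    kappa_homogeneous[OF S_gr[OF x] S_closed[OF y]] by (auto simp: M.add_neg1_pow)

lemma kappa_S_second:
  assumes x: "x \<in> S (int r)" and y: "y \<in> S k"
  shows "\<kappa> x y = [neg1_pow (int r)] \<cdot> \<pi> (x \<otimes> h y)"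
proof -
  have "x \<in> harmonic A h" using x r_ge_2 by (intro S_harmonic[OF x]) auto
  moreover have "h x = \<zero>" using x r_ge_2 by (simp add: S_def)
  ultimately show ?thesis using S_closed[OF x] S_closed[OF y]
    kappa_homogeneous[OF S_gr[OF x] S_closed[OF y]] by (simp add: M.add_neg1_pow harmonicD)
qed

text \<open>In degrees \<open>r\<close> and \<open>2r\<close> exchanging the arguments exchanges the
  two summands of \<open>\<kappa>\<close>. In degrees \<open>(2r, 2r)\<close> symmetry is the
  self-adjointness of \<open>h\<close>.\<close>

lemma kappa_comm:
  assumes x: "x \<in> S j" and y: "y \<in> S k"
  shows "\<kappa> x y = [neg1_pow (j * k)] \<cdot> \<kappa> y x"
proof -
  have c: "x \<in> carrier A" "y \<in> carrier A" using assms S_closed by auto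
  have *: "\<kappa> x y = \<kappa> y x" if x: "x \<in> S (int r)" and y: "y \<in> S (2 * int r)" for x y
  proof -
    have c: "x \<in> carrier A" "y \<in> carrier A" using that S_closed by auto
    show ?thesis unfolding kappa_S_second[OF x y] kappa_S_first[OF y x]
      using mult_commute_cases[OF S_gr[OF x] h_degree[OF S_gr[OF y]]] c
      by (auto simp: M.add_neg1_pow pi_minus)
  qed
  consider "\<not> exceptional j k" | "j = int r" "k = 2 * int r" | "j = 2 * int r" "k = int r"
    | "n = 4 * r - 1" "j = 2 * int r" "k = 2 * int r" by auto
  then show ?thesis
  proof cases
    case 1
    then show ?thesis using kappa_S_zero[OF x y] kappa_S_zero[OF y x] by (auto simp: M.add_neg1_pow)
  next
    case 2
    then show ?thesis using *[of x y] x y c by (simp add: M.add_neg1_pow)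
  next
    case 3
    then show ?thesis using *[of y x] x y c by (simp add: M.add_neg1_pow)
  next
    case 4
    have x': "x \<in> gr A (2 * int r)" and y': "y \<in> gr A (2 * int r)" using x y S_gr 4 by auto
    have "\<kappa> x y = \<pi> (h x \<otimes> y)" "\<kappa> y x = \<pi> (h y \<otimes> x)" using kappa_S_first x y 4 by auto
    then show ?thesis using pi_h_selfadjoint[OF 4(1) y' x'] mult_commute_cases[OF y' h_degree[OF x']] c 4
      by (simp add: M.add_neg1_pow)
  qed
qed

lemma S_cases:
  assumes "x \<in> S j"
  obtains (scalar) c where "j = 0" "c \<in> carrier K" "x = c \<odot> \<one>" | (zero) "x = \<zero>"
    | (positive) "int r \<le> j"
proof -
  consider "j = 0" | "j < 0 \<or> (1 \<le> j \<and> j < int r)" | "int r \<le> j" by linarith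
  then show thesis
    using S_low[OF assms] S_0 assms that by cases (metis, metis, metis)
qed

text \<open>The relation is the Hochschild cocycle condition for \<open>\<kappa>\<close> along
  \<open>\<pi>\<close>. For factors of degree at least \<open>r\<close>, a term can survive only in
  degree \<open>n - r\<close>, which requires the excluded degrees \<open>(r, r, r)\<close>, or in
  degree \<open>n\<close> with factors of degrees \<open>r\<close>, \<open>r\<close>,
  \<open>2r\<close> in some order. In the latter case two terms survive, and they agree by
  \<open>pi_mult_pi_top\<close>, associativity and the self-adjointness of \<open>h\<close>.\<close>

lemma kappa_assoc:
  assumes x: "x \<in> S j" and y: "y \<in> S k" and w: "w \<in> S l"
    and exc: "\<not> (n = 4 * r - 1 \<and> j = int r \<and> k = int r \<and> l = int r)"
  shows "\<kappa> (x \<otimes> y) w \<oplus> \<pi> (\<kappa> x y \<otimes> \<pi> w) = \<kappa> x (y \<otimes> w) \<oplus> [neg1_pow j] \<cdot> \<pi> (\<pi> x \<otimes> \<kappa> y w)"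
proof -
  have c: "x \<in> carrier A" "y \<in> carrier A" "w \<in> carrier A" using assms S_closed by auto
  have xy: "x \<otimes> y \<in> S (j + k)" and yw: "y \<otimes> w \<in> S (k + l)" using S_mult x y w by auto
  show ?thesis using x
  proof (cases rule: S_cases)
    case (scalar e)
    then show ?thesis using c kappa_harmonic[of y w]
      by (simp add: smult_mult_left kappa_smult_left kappa_one_left pi_smult pi_one M.add_neg1_pow)
  next
    case zero
    then show ?thesis using c by (simp add: M.add_neg1_pow)
  next
    case xpos: positive
    show ?thesis using y
    proof (cases rule: S_cases)
      case (scalar e)
      then show ?thesis using c
        by (simp add: smult_mult_left smult_mult_right kappa_smult_left kappa_smult_right
          kappa_one_left kappa_one_right pi_smult M.add_neg1_pow)
    next
      case zero
      then show ?thesis using c by (simp add: M.add_neg1_pow)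
    next
      case ypos: positive
      show ?thesis using w
      proof (cases rule: S_cases)
        case (scalar e)
        then show ?thesis using c kappa_harmonic[of x y]
          by (simp add: smult_mult_right kappa_smult_right kappa_one_right pi_smult pi_one M.add_neg1_pow)
      next
        case zero
        then show ?thesis using c by (simp add: M.add_neg1_pow)
      next
        case wpos: positive
        \<comment> \<open>The facts \<open>z1\<close> to \<open>z4\<close> isolate, for each of the
          four terms, the only degrees in which it can be nonzero.\<close>
        have z1: "\<kappa> (x \<otimes> y) w = \<zero>" if "\<not> (n = 4 * r - 1 \<and> j = int r \<and> k = int r \<and> l = 2 * int r)"
          using xpos ypos wpos exc that by (intro kappa_S_zero[OF xy w]) auto
        have z2: "\<pi> (\<kappa> x y \<otimes> \<pi> w) = \<zero>" if "\<not> (exceptional j k \<and> l = int r \<and> j + k = 3 * int r)"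
        proof (cases "exceptional j k")
          case False
          then show ?thesis using c by (simp add: kappa_S_zero[OF x y])
        next
          case True
          have "\<kappa> x y \<otimes> \<pi> w \<in> gr A ((j + k - 1) + l)"
            using x y w S_gr by (intro mult_gr kappa_gr pi_gr) auto
          then show ?thesis using True that wpos degree_bounds by (intro pi_gr_vanish) auto
        qed
        have z3: "\<kappa> x (y \<otimes> w) = \<zero>" if "\<not> (n = 4 * r - 1 \<and> j = 2 * int r \<and> k = int r \<and> l = int r)"
          using xpos ypos wpos exc that by (intro kappa_S_zero[OF x yw]) auto
        have z4: "\<pi> (\<pi> x \<otimes> \<kappa> y w) = \<zero>" if "\<not> (exceptional k l \<and> j = int r \<and> k + l = 3 * int r)"
        proof (cases "exceptional k l")
          case False
          then show ?thesis using c by (simp add: kappa_S_zero[OF y w])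
        next
          case True
          have "\<pi> x \<otimes> \<kappa> y w \<in> gr A (j + (k + l - 1))"
            using x y w S_gr by (intro mult_gr kappa_gr pi_gr) auto
          then show ?thesis using True that xpos degree_bounds by (intro pi_gr_vanish) auto
        qed
        have n4: "int n = 4 * int r - 1" if "n = 4 * r - 1" using that r_ge_2 by auto
        have hd: "u \<in> harmonic A h" if "u \<in> S (int r)" for u
          using S_harmonic[OF that] r_ge_2 by simp
        \<comment> \<open>In the first three cases the surviving terms are, in this order of cases,
          the first and fourth, the second and fourth, and the second and third.\<close>
        consider "n = 4 * r - 1" "j = int r" "k = int r" "l = 2 * int r"
          | "n = 4 * r - 1" "j = int r" "k = 2 * int r" "l = int r"
          | "n = 4 * r - 1" "j = 2 * int r" "k = int r" "l = int r"
          | "\<not> (n = 4 * r - 1 \<and> ((j = int r \<and> k = int r \<and> l = 2 * int r) \<or>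
              (j = int r \<and> k = 2 * int r \<and> l = int r) \<or> (j = 2 * int r \<and> k = int r \<and> l = int r)))"
          by auto
        then show ?thesis
        proof cases
          case 1
          have xh: "x \<in> harmonic A h" "y \<in> harmonic A h" using hd x y 1 by auto
          have xy': "x \<otimes> y \<in> gr A (2 * int r)" using S_gr[OF xy] 1 by simp
          have "\<kappa> (x \<otimes> y) w = \<pi> (x \<otimes> y \<otimes> h w)"
            using kappa_S_first[of "x \<otimes> y" w l] xy w 1 pi_h_selfadjoint[OF 1(1) xy'] S_gr[OF w] by simp
          moreover have "\<pi> (\<pi> x \<otimes> \<kappa> y w) = [neg1_pow (int r)] \<cdot> \<pi> (x \<otimes> y \<otimes> h w)"
          proof -
            have g: "y \<otimes> h w \<in> gr A (3 * int r - 1)"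
              using mult_gr[OF S_gr[OF y] h_degree[OF S_gr[OF w]]] 1 by (simp add: algebra_simps)
            have "\<pi> (x \<otimes> \<pi> (y \<otimes> h w)) = \<pi> (x \<otimes> (y \<otimes> h w))"
              using 1 n4 by (intro pi_mult_pi_top[OF xh(1) S_gr[OF x] g]) auto
            then show ?thesis using kappa_S_second[of y w l] y w 1 xh c
              by (simp add: harmonicD M.add_neg1_pow B.r_minus pi_minus B.m_assoc)
          qed
          moreover have "\<pi> (\<kappa> x y \<otimes> \<pi> w) = \<zero>" "\<kappa> x (y \<otimes> w) = \<zero>"
            using z2 z3 1 r_ge_2 by auto
          ultimately show ?thesis using c 1 by (simp add: M.add_neg1_pow)
        next
          case 2
          have xh: "x \<in> harmonic A h" "w \<in> harmonic A h" using hd x w 2 by auto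
          have g1: "x \<otimes> h y \<in> gr A (3 * int r - 1)"
            using mult_gr[OF S_gr[OF x] h_degree[OF S_gr[OF y]]] 2 by (simp add: algebra_simps)
          have g2: "h y \<otimes> w \<in> gr A (3 * int r - 1)"
            using mult_gr[OF h_degree[OF S_gr[OF y]] S_gr[OF w]] 2 by (simp add: algebra_simps)
          have "\<pi> (\<pi> (x \<otimes> h y) \<otimes> w) = \<pi> (x \<otimes> h y \<otimes> w)"
            using 2 n4 by (intro pi_mult_pi_top(2)[OF xh(2) S_gr[OF w] g1]) auto
          moreover have "\<pi> (x \<otimes> \<pi> (h y \<otimes> w)) = \<pi> (x \<otimes> (h y \<otimes> w))"
            using 2 n4 by (intro pi_mult_pi_top(1)[OF xh(1) S_gr[OF x] g2]) auto
          moreover have "\<kappa> x y = [neg1_pow (int r)] \<cdot> \<pi> (x \<otimes> h y)" "\<kappa> y w = \<pi> (h y \<otimes> w)"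
            using kappa_S_second[of x y k] kappa_S_first[of y w l] x y w 2 by auto
          moreover have "\<kappa> (x \<otimes> y) w = \<zero>" "\<kappa> x (y \<otimes> w) = \<zero>"
            using z1 z3 2 r_ge_2 by auto
          ultimately show ?thesis using c 2 xh
            by (auto simp: harmonicD M.add_neg1_pow B.l_minus pi_minus B.m_assoc)
        next
          case 3
          have xh: "w \<in> harmonic A h" using hd w 3 by auto
          have g1: "h x \<otimes> y \<in> gr A (3 * int r - 1)"
            using mult_gr[OF h_degree[OF S_gr[OF x]] S_gr[OF y]] 3 by (simp add: algebra_simps)
          have "\<pi> (\<pi> (h x \<otimes> y) \<otimes> w) = \<pi> (h x \<otimes> y \<otimes> w)"
            using 3 n4 by (intro pi_mult_pi_top(2)[OF xh S_gr[OF w] g1]) auto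
          moreover have "\<kappa> x y = \<pi> (h x \<otimes> y)" "\<kappa> x (y \<otimes> w) = \<pi> (h x \<otimes> (y \<otimes> w))"
            using kappa_S_first[of x y k] kappa_S_first[of x "y \<otimes> w" "k + l"] x y yw 3 by auto
          moreover have "\<kappa> (x \<otimes> y) w = \<zero>" "\<pi> (\<pi> x \<otimes> \<kappa> y w) = \<zero>"
            using z1 z4 3 r_ge_2 by auto
          ultimately show ?thesis using c xh by (simp add: harmonicD M.add_neg1_pow B.m_assoc)
        next
          case 4
          have "\<kappa> (x \<otimes> y) w = \<zero>" "\<pi> (\<kappa> x y \<otimes> \<pi> w) = \<zero>" "\<kappa> x (y \<otimes> w) = \<zero>" "\<pi> (\<pi> x \<otimes> \<kappa> y w) = \<zero>"
            using 4 r_ge_2 by (intro z1 z2 z3 z4; auto)+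
          then show ?thesis by (simp add: M.add_neg1_pow)
        qed
      qed
    qed
  qed
qed

text \<open>Here the cocycle condition fails: the difference of the two terms that survive is the
  harmonic representative of the ternary operation.\<close>

lemma kappa_assoc_exceptional:
  assumes x: "x \<in> S (int r)" and y: "y \<in> S (int r)" and w: "w \<in> S (int r)"
  shows "\<kappa> (x \<otimes> y) w = \<pi> (h (x \<otimes> y) \<otimes> w)" "\<pi> (\<kappa> x y \<otimes> \<pi> w) = \<zero>"
    "\<kappa> x (y \<otimes> w) = [neg1_pow (int r)] \<cdot> \<pi> (x \<otimes> h (y \<otimes> w))" "\<pi> (\<pi> x \<otimes> \<kappa> y w) = \<zero>"
proof -
  have xy: "x \<otimes> y \<in> S (2 * int r)" "y \<otimes> w \<in> S (2 * int r)"
    using S_mult[OF x y] S_mult[OF y w] by (simp_all only: mult_2)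
  show "\<kappa> (x \<otimes> y) w = \<pi> (h (x \<otimes> y) \<otimes> w)" using kappa_S_first[OF xy(1) w] .
  show "\<kappa> x (y \<otimes> w) = [neg1_pow (int r)] \<cdot> \<pi> (x \<otimes> h (y \<otimes> w))" using kappa_S_second[OF x xy(2)] .
  have ne: "\<not> exceptional (int r) (int r)" using r_ge_2 by simp
  have "\<kappa> x y = \<zero>" "\<kappa> y w = \<zero>"
    by (rule kappa_S_zero[OF x y ne], rule kappa_S_zero[OF y w ne])
  then show "\<pi> (\<kappa> x y \<otimes> \<pi> w) = \<zero>" "\<pi> (\<pi> x \<otimes> \<kappa> y w) = \<zero>"
    using S_closed[OF x] S_closed[OF w] by simp_all
qed

end

section \<open>Twisted homotopy pullbacks\<close>

lemma decomposes_induct: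
  assumes "abelian_group B" "\<And>k x. x \<in> gr B k \<Longrightarrow> x \<in> carrier B" "\<zero>\<^bsub>B\<^esub> \<in> gr B 0"
    and dec: "decomposes B x c"
    and hom: "\<And>k y. y \<in> gr B k \<Longrightarrow> P y"
    and add: "\<And>x y. x \<in> carrier B \<Longrightarrow> y \<in> carrier B \<Longrightarrow> P x \<Longrightarrow> P y \<Longrightarrow> P (x \<oplus>\<^bsub>B\<^esub> y)"
  shows "P x"
proof -
  interpret B: abelian_group B by fact
  have c: "c k \<in> gr B k" for k using dec by (simp add: decomposes_def)
  have "P (\<Oplus>\<^bsub>B\<^esub> k\<in>S. c k)" if "finite S" for S
    using that
  proof (induction S rule: finite_induct)
    case empty
    then show ?case using hom assms(3) by simp
  next
    case (insert k S)
    have "c \<in> S \<rightarrow> carrier B" using assms(2) c by blast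
    then have "(\<Oplus>\<^bsub>B\<^esub> k\<in>S. c k) \<in> carrier B" by (rule B.finsum_closed)
    moreover have "(\<Oplus>\<^bsub>B\<^esub> k\<in>insert k S. c k) = c k \<oplus>\<^bsub>B\<^esub> (\<Oplus>\<^bsub>B\<^esub> k\<in>S. c k)"
      using insert assms(2) c by (intro B.finsum_insert) auto
    ultimately show ?case using add[OF assms(2)[OF c[of k]] _ hom[OF c[of k]] insert.IH] by simp
  qed
  then show ?thesis using dec by (simp add: decomposes_def)
qed

text \<open>The product of triples is under control only on homogeneous elements. Associativity,
  commutativity and the Leibniz rule are therefore asked for there and extended by additivity;
  closure of the carrier under the product is obtained in the same way.\<close>

lemma dgcaI:
  fixes B :: "('k, 'a) dgca" (structure)
  assumes "field K" and m: "module K B"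
    and sub: "\<And>k. submodule K (gr B k) B"
    and dec: "\<And>x. x \<in> carrier B \<Longrightarrow> \<exists>!c. decomposes B x c"
    and add_l: "\<And>x x' y. x \<in> carrier B \<Longrightarrow> x' \<in> carrier B \<Longrightarrow> y \<in> carrier B \<Longrightarrow> (x \<oplus> x') \<otimes> y = x \<otimes> y \<oplus> x' \<otimes> y"
    and add_r: "\<And>x x' y. x \<in> carrier B \<Longrightarrow> x' \<in> carrier B \<Longrightarrow> y \<in> carrier B \<Longrightarrow> y \<otimes> (x \<oplus> x') = y \<otimes> x \<oplus> y \<otimes> x'"
    and smult_l: "\<And>c x y. c \<in> carrier K \<Longrightarrow> x \<in> carrier B \<Longrightarrow> y \<in> carrier B \<Longrightarrow> (c \<odot> x) \<otimes> y = c \<odot> (x \<otimes> y)"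
    and smult_r: "\<And>c x y. c \<in> carrier K \<Longrightarrow> x \<in> carrier B \<Longrightarrow> y \<in> carrier B \<Longrightarrow> x \<otimes> (c \<odot> y) = c \<odot> (x \<otimes> y)"
    and one: "\<one> \<in> gr B 0" "\<And>x. x \<in> carrier B \<Longrightarrow> \<one> \<otimes> x = x" "\<And>x. x \<in> carrier B \<Longrightarrow> x \<otimes> \<one> = x"
    and mult_gr: "\<And>x y k l. x \<in> gr B k \<Longrightarrow> y \<in> gr B l \<Longrightarrow> x \<otimes> y \<in> gr B (k + l)"
    and assoc: "\<And>x y z j k l. x \<in> gr B j \<Longrightarrow> y \<in> gr B k \<Longrightarrow> z \<in> gr B l \<Longrightarrow> (x \<otimes> y) \<otimes> z = x \<otimes> (y \<otimes> z)"
    and comm: "\<And>x y k l. x \<in> gr B k \<Longrightarrow> y \<in> gr B l \<Longrightarrow> x \<otimes> y = [neg1_pow (k * l)] \<cdot> (y \<otimes> x)"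
    and d_lin: "diff B \<in> module_hom K B B"
    and d_gr: "\<And>x k. x \<in> gr B k \<Longrightarrow> diff B x \<in> gr B (k + 1)"
    and dd: "\<And>x. x \<in> carrier B \<Longrightarrow> diff B (diff B x) = \<zero>"
    and leibniz: "\<And>x y k l. x \<in> gr B k \<Longrightarrow> y \<in> gr B l \<Longrightarrow>
      diff B (x \<otimes> y) = diff B x \<otimes> y \<oplus> [neg1_pow k] \<cdot> (x \<otimes> diff B y)"
  shows "dgca K B"
proof -
  interpret K: field K by fact
  interpret B: module K B by fact
  note sb = submodule.subset[OF sub]
  have gc: "x \<in> gr B k \<Longrightarrow> x \<in> carrier B" for x k using sb by blast
  note z = submodule.zero_closed[OF sub]
  have ind: "P x" if x: "x \<in> carrier B" and hom: "\<And>k y. y \<in> gr B k \<Longrightarrow> P y"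
    and add: "\<And>x y. x \<in> carrier B \<Longrightarrow> y \<in> carrier B \<Longrightarrow> P x \<Longrightarrow> P y \<Longrightarrow> P (x \<oplus> y)" for P x
  proof -
    obtain c where c: "decomposes B x c" using dec[OF x] by blast
    show ?thesis
      by (rule decomposes_induct[where P = P]) (fact B.M.abelian_group_axioms gc z c hom add)+
  qed
  have mult: "x \<otimes> y \<in> carrier B" if x: "x \<in> carrier B" and y: "y \<in> carrier B" for x y
    using x
  proof (rule ind)
    fix k u assume u: "u \<in> gr B k"
    show "u \<otimes> y \<in> carrier B" using y
      by (rule ind) (use mult_gr[OF u] gc add_r gc[OF u] in auto)
  qed (use add_l y in auto)
  have "(x \<otimes> y) \<otimes> w = x \<otimes> (y \<otimes> w)" if x: "x \<in> carrier B" and y: "y \<in> carrier B" and w: "w \<in> carrier B" for x y w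
    using x
  proof (rule ind)
    fix k u assume u: "u \<in> gr B k"
    show "(u \<otimes> y) \<otimes> w = u \<otimes> (y \<otimes> w)" using y
    proof (rule ind)
      fix l v assume v: "v \<in> gr B l"
      show "(u \<otimes> v) \<otimes> w = u \<otimes> (v \<otimes> w)" using w
        by (rule ind) (use assoc[OF u v] add_r gc[OF u] gc[OF v] mult in auto)
    qed (use add_l add_r w gc[OF u] mult in auto)
  qed (use add_l y w mult in auto)
  then have monoid: "monoid B" using mult one gc by (intro monoidI) auto
  have ring: "ring B"
    using B.M.abelian_group_axioms monoid add_l add_r by (intro ringI)
  have vs: "vectorspace K B" ..
  have leib: "diff B (x \<otimes> y) = diff B x \<otimes> y \<oplus> [neg1_pow k] \<cdot> (x \<otimes> diff B y)"
    if x: "x \<in> gr B k" and y: "y \<in> carrier B" for x y k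
    using y
  proof (rule ind)
    fix u v assume *: "u \<in> carrier B" "v \<in> carrier B"
      "diff B (x \<otimes> u) = diff B x \<otimes> u \<oplus> [neg1_pow k] \<cdot> (x \<otimes> diff B u)"
      "diff B (x \<otimes> v) = diff B x \<otimes> v \<oplus> [neg1_pow k] \<cdot> (x \<otimes> diff B v)"
    note dm = module_hom_facts[OF m m d_lin]
    have c: "x \<otimes> u \<in> carrier B" "x \<otimes> v \<in> carrier B" "diff B x \<in> carrier B" "diff B u \<in> carrier B"
      "diff B v \<in> carrier B" "x \<in> carrier B" "diff B x \<otimes> u \<in> carrier B" "diff B x \<otimes> v \<in> carrier B"
      "x \<otimes> diff B u \<in> carrier B" "x \<otimes> diff B v \<in> carrier B"
      using mult gc[OF x] *(1,2) dm(1) by auto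
    show "diff B (x \<otimes> (u \<oplus> v)) = diff B x \<otimes> (u \<oplus> v) \<oplus> [neg1_pow k] \<cdot> (x \<otimes> diff B (u \<oplus> v))"
      using * c by (simp add: add_r dm(2) B.M.add_neg1_pow B.M.minus_add B.M.a_ac)
  qed (use leibniz[OF x] in auto)
  show ?thesis
  proof (intro dgca.intro graded_comm_algebra.intro dgca_axioms.intro graded_comm_algebra_axioms.intro)
    show "subspace K (gr B k) B" for k unfolding subspace_def using vs sub by blast
  qed (fact vs ring smult_l smult_r dec one mult_gr comm d_lin d_gr dd leib)+
qed

text \<open>Merges the cocycle conditions for the two versions of \<open>\<kappa>\<close> and for
  \<open>\<beta>\<close> into the one for their combination \<open>M\<close>.\<close>

lemma (in abelian_group) assoc_combine:
  assumes "ka \<in> carrier G" "kb \<in> carrier G" "kc \<in> carrier G" "kd \<in> carrier G"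
    "pa \<in> carrier G" "pb \<in> carrier G" "pc \<in> carrier G" "pd \<in> carrier G"
    "ba \<in> carrier G" "bb \<in> carrier G" "bc \<in> carrier G" "bd \<in> carrier G"
    and "ka \<oplus> kb = kc \<oplus> kd" "pa \<oplus> pb = pc \<oplus> pd" "ba \<oplus> bb = bc \<oplus> bd"
  shows "((ka \<ominus> pa) \<oplus> ba) \<oplus> ((kb \<ominus> pb) \<oplus> bb) = ((kc \<ominus> pc) \<oplus> bc) \<oplus> ((kd \<ominus> pd) \<oplus> bd)"
proof -
  have "((ka \<ominus> pa) \<oplus> ba) \<oplus> ((kb \<ominus> pb) \<oplus> bb) = ((ka \<oplus> kb) \<ominus> (pa \<oplus> pb)) \<oplus> (ba \<oplus> bb)"
    "((kc \<ominus> pc) \<oplus> bc) \<oplus> ((kd \<ominus> pd) \<oplus> bd) = ((kc \<oplus> kd) \<ominus> (pc \<oplus> pd)) \<oplus> (bc \<oplus> bd)"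
    using assms(1-12) by (simp_all add: diff_simps a_ac)
  then show ?thesis using assms(13-15) by simp
qed

text \<open>Here \<open>p\<close> is an isomorphism of cohomology read on harmonic elements and
  precomposed with the harmonic projection, and \<open>\<beta>\<close> is a harmonic-valued
  correction. Outside degrees \<open>(r, r, r)\<close> with \<open>n = 4r - 1\<close>,
  \<open>\<beta>\<close> satisfies the same cocycle condition as \<open>\<kappa>\<close>; in these
  degrees \<open>\<beta>_cocycle\<close> lets it absorb the difference of the two ternary
  operations. Triples are abstract, with constructor \<open>mk\<close> and selectors, because the
  carrier has to live in the prescribed type of zig-zags.\<close>

locale hodge_pair = X: connected_hodge K A n fund h r + Y: connected_hodge K A' n fund' h' r
  for K :: "('k, 'l) ring_scheme" and A :: "('k, 'a) dgca" and A' :: "('k, 'b) dgca" (structure) and n :: nat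
    and fund :: "'a set \<Rightarrow> 'k" and fund' :: "'b set \<Rightarrow> 'k" and h :: "'a \<Rightarrow> 'a" and h' :: "'b \<Rightarrow> 'b"
    and r :: nat +
  fixes p :: "'a \<Rightarrow> 'b" and \<beta> :: "'b \<Rightarrow> 'b \<Rightarrow> 'b"
    and mk :: "'a \<Rightarrow> 'b \<Rightarrow> 'b \<Rightarrow> 'c" and f1 :: "'c \<Rightarrow> 'a" and f2 f3 :: "'c \<Rightarrow> 'b"
  assumes mk [simp]: "f1 (mk a b c) = a" "f2 (mk a b c) = b" "f3 (mk a b c) = c"
    and p_linear: "p \<in> module_hom K A A'"
    and p_gr: "a \<in> gr A k \<Longrightarrow> p a \<in> gr A' k"
    and p_harmonic: "a \<in> carrier A \<Longrightarrow> Y.\<pi> (p a) = p a"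
    and p_pi: "a \<in> carrier A \<Longrightarrow> p (X.\<pi> a) = p a"
    and p_mult: "a \<in> harmonic A h \<Longrightarrow> a' \<in> harmonic A h \<Longrightarrow> p (a \<otimes>\<^bsub>A\<^esub> a') = Y.\<pi> (p a \<otimes> p a')"
    and p_one: "p \<one>\<^bsub>A\<^esub> = \<one>"
    and p_inj: "a \<in> harmonic A h \<Longrightarrow> p a = \<zero> \<Longrightarrow> a = \<zero>\<^bsub>A\<^esub>"
    and p_surj: "y \<in> harmonic A' h' \<Longrightarrow> \<exists>x\<in>harmonic A h. p x = y"
    and \<beta>_closed: "y \<in> carrier A' \<Longrightarrow> y' \<in> carrier A' \<Longrightarrow> \<beta> y y' \<in> carrier A'"
    and \<beta>_harmonic: "y \<in> carrier A' \<Longrightarrow> y' \<in> carrier A' \<Longrightarrow> Y.\<pi> (\<beta> y y') = \<beta> y y'"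
    and \<beta>_add_left: "x \<in> carrier A' \<Longrightarrow> x' \<in> carrier A' \<Longrightarrow> y \<in> carrier A' \<Longrightarrow> \<beta> (x \<oplus> x') y = \<beta> x y \<oplus> \<beta> x' y"
    and \<beta>_add_right: "x \<in> carrier A' \<Longrightarrow> x' \<in> carrier A' \<Longrightarrow> y \<in> carrier A' \<Longrightarrow> \<beta> y (x \<oplus> x') = \<beta> y x \<oplus> \<beta> y x'"
    and \<beta>_smult_left: "e \<in> carrier K \<Longrightarrow> x \<in> carrier A' \<Longrightarrow> y \<in> carrier A' \<Longrightarrow> \<beta> (e \<odot> x) y = e \<odot> \<beta> x y"
    and \<beta>_smult_right: "e \<in> carrier K \<Longrightarrow> x \<in> carrier A' \<Longrightarrow> y \<in> carrier A' \<Longrightarrow> \<beta> x (e \<odot> y) = e \<odot> \<beta> x y"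
    and \<beta>_gr: "y \<in> gr A' k \<Longrightarrow> y' \<in> gr A' l \<Longrightarrow> \<beta> y y' \<in> gr A' (k + l - 1)"
    and \<beta>_zero: "y \<in> gr A' k \<Longrightarrow> y' \<in> gr A' l \<Longrightarrow>
      \<not> (n = 4 * r - 1 \<and> k \<in> {int r, 2 * int r} \<and> l \<in> {int r, 2 * int r}) \<Longrightarrow> \<beta> y y' = \<zero>"
    and \<beta>_d: "y \<in> carrier A' \<Longrightarrow> y' \<in> carrier A' \<Longrightarrow> \<beta> (diff A' y) y' = \<zero> \<and> \<beta> y (diff A' y') = \<zero>"
    and \<beta>_comm: "y \<in> gr A' k \<Longrightarrow> y' \<in> gr A' l \<Longrightarrow> \<beta> y y' = [neg1_pow (k * l)] \<cdot> \<beta> y' y"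
    and \<beta>_assoc: "x \<in> Y.S j \<Longrightarrow> y \<in> Y.S k \<Longrightarrow> w \<in> Y.S l \<Longrightarrow>
      \<not> (n = 4 * r - 1 \<and> j = int r \<and> k = int r \<and> l = int r) \<Longrightarrow>
      \<beta> (x \<otimes> y) w \<oplus> Y.\<pi> (\<beta> x y \<otimes> Y.\<pi> w) = \<beta> x (y \<otimes> w) \<oplus> [neg1_pow j] \<cdot> Y.\<pi> (Y.\<pi> x \<otimes> \<beta> y w)"
    and \<beta>_cocycle: "n = 4 * r - 1 \<Longrightarrow> a \<in> X.S (int r) \<Longrightarrow> a' \<in> X.S (int r) \<Longrightarrow> a'' \<in> X.S (int r) \<Longrightarrow>
      ((Y.\<pi> (h' (p a \<otimes> p a') \<otimes> p a'') \<ominus> p (h (a \<otimes>\<^bsub>A\<^esub> a') \<otimes>\<^bsub>A\<^esub> a'')) \<oplus> \<beta> (p a \<otimes> p a') (p a'')) \<oplus>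
        Y.\<pi> (\<beta> (p a) (p a') \<otimes> p a'') =
      (([neg1_pow (int r)] \<cdot> Y.\<pi> (p a \<otimes> h' (p a' \<otimes> p a'')) \<ominus>
        [neg1_pow (int r)] \<cdot> p (a \<otimes>\<^bsub>A\<^esub> h (a' \<otimes>\<^bsub>A\<^esub> a''))) \<oplus> \<beta> (p a) (p a' \<otimes> p a'')) \<oplus>
        [neg1_pow (int r)] \<cdot> Y.\<pi> (p a \<otimes> \<beta> (p a') (p a''))"
begin

lemmas p_hom = module_hom_facts[OF X.is_module Y.is_module p_linear]
lemmas p_closed [simp] = p_hom(1)
lemmas p_add = p_hom(2)
lemmas p_smult = p_hom(3)
lemmas p_zero [simp] = p_hom(4)
lemmas p_minus = p_hom(5)
declare \<beta>_closed [simp]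

lemma p_in_harmonic: "x \<in> carrier A \<Longrightarrow> p x \<in> harmonic A' h'"
  by (simp add: Y.harmonic_iff p_harmonic)

lemma p_cocycle: "x \<in> carrier A \<Longrightarrow> p x \<in> cocycles A'"
  using p_in_harmonic Y.harmonic_cocycle by blast

lemma p_d: "x \<in> carrier A \<Longrightarrow> p (diff A x) = \<zero>"
  using p_pi[of "diff A x"] by (simp add: X.pi_d)

lemma p_h: "x \<in> carrier A \<Longrightarrow> p (h x) = \<zero>"
  using p_pi[of "h x"] by (simp add: X.pi_h)

lemma p_pi_mult:
  "x \<in> carrier A \<Longrightarrow> y \<in> carrier A \<Longrightarrow> p (X.\<pi> (X.\<pi> x \<otimes>\<^bsub>A\<^esub> X.\<pi> y)) = Y.\<pi> (p x \<otimes> p y)"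
  using p_mult[of "X.\<pi> x" "X.\<pi> y"] by (simp add: p_pi X.pi_harmonic)

lemma component_p: "x \<in> carrier A \<Longrightarrow> component A' k (p x) = p (component A k x)"
  using component_graded_hom[of K A A' p 0 x k] p_gr p_add
    X.graded_comm_algebra_axioms Y.graded_comm_algebra_axioms by simp

text \<open>The degrees in which the two sides of the pullback are only identified up to homotopy.\<close>

definition D :: "int set" where
  "D = (if n = 4 * r - 1 then {2 * int r - 1, 3 * int r - 1, 4 * int r - 1} else {})"

lemma D_iff: "k \<in> D \<longleftrightarrow> n = 4 * r - 1 \<and> (k = 2 * int r - 1 \<or> k = 3 * int r - 1 \<or> k = 4 * int r - 1)"
  by (simp add: D_def)

lemma D_bounds: "k \<in> D \<Longrightarrow> n = 4 * r - 1 \<and> int n = 4 * int r - 1 \<and> 2 * int r - 1 \<le> k"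
  using X.r_ge_2 by (auto simp: D_iff)

text \<open>The elements of \<open>D\<close> are the degrees \<open>k + l - 1\<close> with
  \<open>k\<close> and \<open>l\<close> in \<open>{r, 2r}\<close>. The pairs exceptional for
  \<open>\<kappa>\<close> account for \<open>3r - 1\<close> and \<open>4r - 1\<close>, while
  \<open>2r - 1\<close> comes from \<open>\<beta>\<close> on two arguments of degree
  \<open>r\<close>.\<close>

lemma exceptional_D: "X.exceptional j k \<Longrightarrow> j + k - 1 \<in> D"
  unfolding D_iff by auto

text \<open>Two degrees in \<open>D\<close> add up to \<open>4r - 2 = n - 1\<close>, where duality
  applies, or to more than \<open>n\<close>. This is why products of two correction terms never
  contribute.\<close>

lemma pi_D_D:
  assumes "v \<in> gr A' i" "w \<in> gr A' l" "i \<in> D" "l \<in> D"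
  shows "Y.\<pi> (v \<otimes> w) = \<zero>"
  using D_bounds[OF assms(3)] assms(3,4) X.r_ge_2 unfolding D_iff
  by (intro Y.pi_gr_vanish[OF Y.mult_gr[OF assms(1,2)]]) auto

text \<open>From \<open>3r - 1 = n - r\<close> on, a degree outside \<open>D\<close> is either
  strictly between \<open>n - r\<close> and \<open>n\<close> or beyond \<open>n\<close>.\<close>

lemma pi_not_D:
  assumes "v \<in> gr A' i" "k \<in> D" "3 * int r - 1 \<le> i" "i \<notin> D"
  shows "Y.\<pi> v = \<zero>"
  using D_bounds[OF assms(2)] assms(3,4) X.r_ge_2 unfolding D_iff
  by (intro Y.pi_gr_vanish[OF assms(1)]) auto

definition T :: "int \<Rightarrow> 'a \<Rightarrow> 'b \<Rightarrow> 'b \<Rightarrow> bool" where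
  "T k x y z \<longleftrightarrow> x \<in> X.S k \<and> y \<in> Y.S k \<and> z \<in> harmonic A' h' \<and> z \<in> gr A' (k - 1) \<and>
     (k \<notin> D \<longrightarrow> p x = Y.\<pi> y) \<and> (k - 1 \<notin> D \<longrightarrow> z = \<zero>)"

lemma TD:
  assumes "T k x y z"
  shows "x \<in> X.S k" "y \<in> Y.S k" "z \<in> harmonic A' h'" "z \<in> gr A' (k - 1)"
    "k \<notin> D \<Longrightarrow> p x = Y.\<pi> y" "k - 1 \<notin> D \<Longrightarrow> z = \<zero>"
    "x \<in> carrier A" "y \<in> carrier A'" "z \<in> carrier A'" "Y.\<pi> z = z" "diff A' z = \<zero>" "z \<in> cocycles A'"
    "x \<in> gr A k" "y \<in> gr A' k" "p x \<in> gr A' k" "p x \<in> carrier A'" "p x \<in> cocycles A'" "Y.\<pi> y \<in> cocycles A'"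
  using assms X.S_closed Y.S_closed Y.harmonicD X.S_gr Y.S_gr p_gr p_cocycle Y.pi_cocycle Y.harmonic_cocycle
  unfolding T_def by auto

text \<open>The homotopies for the two products, compared along \<open>p\<close> and corrected by
  \<open>\<beta>\<close>.\<close>

definition M :: "'a \<Rightarrow> 'b \<Rightarrow> 'a \<Rightarrow> 'b \<Rightarrow> 'b" where
  "M x y x' y' = (Y.\<kappa> y y' \<ominus> p (X.\<kappa> x x')) \<oplus> \<beta> y y'"

text \<open>The third entry of the product. The last two terms let the algebra act on homotopies
  from both sides. Acting through \<open>p x\<close> or through \<open>\<pi> y\<close> gives the
  same harmonic part: they differ only in degrees of \<open>D\<close>, where \<open>z\<close> also
  lives, so \<open>pi_D_D\<close> applies.\<close>

definition Z :: "'a \<Rightarrow> 'b \<Rightarrow> 'b \<Rightarrow> 'a \<Rightarrow> 'b \<Rightarrow> 'b \<Rightarrow> 'b" where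
  "Z x y z x' y' z' = M x y x' y' \<oplus> (Y.\<pi> (sign_twist A' 1 (p x) \<otimes> z') \<oplus> Y.\<pi> (z \<otimes> p x'))"

lemma M_closed [simp]:
  "x \<in> carrier A \<Longrightarrow> y \<in> carrier A' \<Longrightarrow> x' \<in> carrier A \<Longrightarrow> y' \<in> carrier A' \<Longrightarrow> M x y x' y' \<in> carrier A'"
  by (simp add: M_def)

lemma Z_closed [simp]:
  "x \<in> carrier A \<Longrightarrow> y \<in> carrier A' \<Longrightarrow> z \<in> carrier A' \<Longrightarrow> x' \<in> carrier A \<Longrightarrow> y' \<in> carrier A' \<Longrightarrow>
    z' \<in> carrier A' \<Longrightarrow> Z x y z x' y' z' \<in> carrier A'"
  by (simp add: Z_def)

lemma Z_homogeneous:
  assumes "T j x y z" "z' \<in> carrier A'" "x' \<in> carrier A"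
  shows "Z x y z x' y' z' =
    M x y x' y' \<oplus> ([neg1_pow j] \<cdot> Y.\<pi> (p x \<otimes> z') \<oplus> Y.\<pi> (z \<otimes> p x'))"
  unfolding Z_def using TD[OF assms(1)] assms(2,3)
  by (simp add: Y.sign_twist_homogeneous[of _ j] Y.M.add_neg1_pow Y.B.l_minus Y.pi_minus)

lemma M_harmonic:
  "x \<in> carrier A \<Longrightarrow> y \<in> carrier A' \<Longrightarrow> x' \<in> carrier A \<Longrightarrow> y' \<in> carrier A' \<Longrightarrow> Y.\<pi> (M x y x' y') = M x y x' y'"
  by (simp add: M_def Y.pi_add Y.pi_sub Y.kappa_harmonic p_harmonic \<beta>_harmonic)

lemma M_gr:
  assumes "x \<in> gr A j" "y \<in> gr A' j" "x' \<in> gr A k" "y' \<in> gr A' k"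
  shows "M x y x' y' \<in> gr A' (j + k - 1)"
  using assms by (auto simp: M_def intro!: Y.gr_add Y.gr_diff Y.kappa_gr p_gr X.kappa_gr \<beta>_gr)

lemma M_zero:
  assumes "T j x y z" "T k x' y' z'" "j + k - 1 \<notin> D"
  shows "M x y x' y' = \<zero>"
proof -
  note t = TD[OF assms(1)] and t' = TD[OF assms(2)]
  have ne: "\<not> X.exceptional j k" using assms(3) exceptional_D by blast
  have nb: "\<not> (n = 4 * r - 1 \<and> j \<in> {int r, 2 * int r} \<and> k \<in> {int r, 2 * int r})"
    using assms(3) by (auto simp: D_iff)
  show ?thesis unfolding M_def X.kappa_S_zero[OF t(1) t'(1) ne] Y.kappa_S_zero[OF t(2) t'(2) ne]
      \<beta>_zero[OF t(14) t'(14) nb] by (simp add: Y.sub_self)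
qed

lemma S_degree:
  "x \<in> X.S k \<Longrightarrow> x = \<zero>\<^bsub>A\<^esub> \<or> k = 0 \<or> int r \<le> k" "y \<in> Y.S k \<Longrightarrow> y = \<zero> \<or> k = 0 \<or> int r \<le> k"
  using X.S_low[of x k] Y.S_low[of y k] by linarith+

lemma Z_zero:
  assumes "T j x y z" "T k x' y' z'" "j + k - 1 \<notin> D"
  shows "Z x y z x' y' z' = \<zero>"
proof -
  note t = TD[OF assms(1)] and t' = TD[OF assms(2)]
  have 1: "Y.\<pi> (p x \<otimes> z') = \<zero>"
  proof (cases "k - 1 \<in> D \<and> x \<noteq> \<zero>\<^bsub>A\<^esub>")
    case True
    then have "int r \<le> j" using S_degree(1)[OF t(1)] assms(3) by auto
    then show ?thesis using True D_bounds[of "k - 1"] assms(3)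
      by (intro pi_not_D[OF Y.mult_gr[OF t(15) t'(4)], of "k - 1"]) (auto simp: algebra_simps)
  qed (use t' t in auto)
  have 2: "Y.\<pi> (z \<otimes> p x') = \<zero>"
  proof (cases "j - 1 \<in> D \<and> x' \<noteq> \<zero>\<^bsub>A\<^esub>")
    case True
    then have "int r \<le> k" using S_degree(1)[OF t'(1)] assms(3) by auto
    then show ?thesis using True D_bounds[of "j - 1"] assms(3)
      by (intro pi_not_D[OF Y.mult_gr[OF t(4) t'(15)], of "j - 1"]) (auto simp: algebra_simps)
  qed (use t' t in auto)
  show ?thesis unfolding Z_homogeneous[OF assms(1) t'(9) t'(7)] M_zero[OF assms] 1 2
    by (simp add: Y.M.add_neg1_pow)
qed

text \<open>By \<open>pi_mult_homotopy\<close> the defect is a sum of values of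
  \<open>\<kappa>\<close> with one differentiated argument. Such a value has degree
  \<open>j + k\<close> and vanishes unless an exceptional pair of degrees occurs, which forces
  \<open>j + k\<close> into \<open>D\<close>.\<close>

lemma p_mult_S:
  assumes "x \<in> X.S j" "x' \<in> X.S k"
  shows "\<exists>v\<in>gr A' (j + k). p (x \<otimes>\<^bsub>A\<^esub> x') = Y.\<pi> (p x \<otimes> p x') \<oplus> v \<and> (j + k \<notin> D \<longrightarrow> v = \<zero>)"
proof -
  have c: "x \<in> carrier A" "x' \<in> carrier A" using assms X.S_closed by auto
  let ?v = "X.\<kappa> (diff A x) x' \<oplus>\<^bsub>A\<^esub> [neg1_pow j] \<cdot>\<^bsub>A\<^esub> X.\<kappa> x (diff A x')"
  have v: "?v \<in> gr A (j + k)"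
    using X.kappa_gr[OF X.S_gr[OF X.S_d[OF assms(1)]] X.S_gr[OF assms(2)]]
      X.kappa_gr[OF X.S_gr[OF assms(1)] X.S_gr[OF X.S_d[OF assms(2)]]]
    by (intro X.gr_add X.gr_sign) (simp_all add: algebra_simps)
  have "?v = \<zero>\<^bsub>A\<^esub>" if "j + k \<notin> D"
  proof -
    have "\<not> X.exceptional (j + 1) k" "\<not> X.exceptional j (k + 1)"
      using exceptional_D[of "j + 1" k] exceptional_D[of j "k + 1"] that by (auto simp: algebra_simps)
    then show ?thesis using X.kappa_S_zero[OF X.S_d[OF assms(1)] assms(2)]
      X.kappa_S_zero[OF assms(1) X.S_d[OF assms(2)]] by (simp add: X.M.add_neg1_pow)
  qed
  moreover have "p (x \<otimes>\<^bsub>A\<^esub> x') = Y.\<pi> (p x \<otimes> p x') \<oplus> p ?v"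
  proof -
    have "p (x \<otimes>\<^bsub>A\<^esub> x') = p (X.\<pi> (x \<otimes>\<^bsub>A\<^esub> x'))" using c by (simp add: p_pi)
    also have "\<dots> = p (X.\<pi> (X.\<pi> x \<otimes>\<^bsub>A\<^esub> X.\<pi> x')) \<oplus> p ?v"
      unfolding X.pi_mult_homotopy[OF X.S_gr[OF assms(1)] c(2)]
      using c v X.gr_closed by (intro p_add) auto
    finally show ?thesis using c by (simp add: p_pi_mult)
  qed
  ultimately show ?thesis using p_gr[OF v] by (intro bexI[of _ "p ?v"]) auto
qed

lemma pi_mult_S:
  assumes "y \<in> Y.S j" "y' \<in> Y.S k" "j + k \<notin> D"
  shows "Y.\<pi> (y \<otimes> y') = Y.\<pi> (Y.\<pi> y \<otimes> Y.\<pi> y')"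
proof -
  have "\<not> Y.exceptional (j + 1) k" "\<not> Y.exceptional j (k + 1)"
    using exceptional_D[of "j + 1" k] exceptional_D[of j "k + 1"] assms(3) by (auto simp: algebra_simps)
  then show ?thesis using Y.kappa_S_zero[OF Y.S_d[OF assms(1)] assms(2)]
      Y.kappa_S_zero[OF assms(1) Y.S_d[OF assms(2)]] Y.S_closed[OF assms(1)] Y.S_closed[OF assms(2)]
      Y.pi_mult_homotopy[OF Y.S_gr[OF assms(1)] Y.S_closed[OF assms(2)]]
    by (simp add: Y.M.add_neg1_pow)
qed

text \<open>The point is that the images of the products agree in degrees outside \<open>D\<close>.
  If neither factor has degree in \<open>D\<close>, both images are products of equal elements. If
  one does and the other factor has degree at least \<open>r\<close>, the product lies in a degree
  from \<open>3r - 1\<close> on and outside \<open>D\<close>, where there are no harmonic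
  elements.\<close>

lemma T_mult:
  assumes "T j x y z" "T k x' y' z'"
  shows "T (j + k) (x \<otimes>\<^bsub>A\<^esub> x') (y \<otimes> y') (Z x y z x' y' z')"
proof -
  note t = TD[OF assms(1)] and t' = TD[OF assms(2)]
  have "p (x \<otimes>\<^bsub>A\<^esub> x') = Y.\<pi> (y \<otimes> y')" if jk: "j + k \<notin> D"
  proof -
    have "p (x \<otimes>\<^bsub>A\<^esub> x') = Y.\<pi> (p x \<otimes> p x')"
      using p_mult_S[OF t(1) t'(1)] jk t t' by auto
    also have "\<dots> = Y.\<pi> (Y.\<pi> y \<otimes> Y.\<pi> y')"
    proof -
      consider "j \<notin> D" "k \<notin> D" | "k = 0 \<or> int r \<le> k" "j \<in> D" | "x' = \<zero>\<^bsub>A\<^esub>" "y' = \<zero>"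
        | "j = 0 \<or> int r \<le> j" "k \<in> D" | "x = \<zero>\<^bsub>A\<^esub>" "y = \<zero>"
        using S_degree(1)[OF t(1)] S_degree(1)[OF t'(1)] S_degree(2)[OF t(2)] S_degree(2)[OF t'(2)] by blast
      then show ?thesis
      proof cases
        case 1
        then show ?thesis using t t' by simp
      next
        case 2
        then have "int r \<le> k" using jk by auto
        then show ?thesis using D_bounds[OF 2(2)] jk t t'
          by (subst (1 2) pi_not_D[OF Y.mult_gr 2(2)]) (auto intro: Y.pi_gr)
      next
        case 3
        then show ?thesis using t by simp
      next
        case 4
        then have "int r \<le> j" using jk by auto
        then show ?thesis using D_bounds[OF 4(2)] jk t t'
          by (subst (1 2) pi_not_D[OF Y.mult_gr 4(2)]) (auto intro: Y.pi_gr)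
      next
        case 5
        then show ?thesis using t' by simp
      qed
    qed
    finally show ?thesis using pi_mult_S[OF t(2) t'(2) jk] by simp
  qed
  moreover have "Z x y z x' y' z' \<in> gr A' (j + k - 1)"
    unfolding Z_homogeneous[OF assms(1) t'(9) t'(7)]
    using M_gr[OF t(13,14) t'(13,14)] Y.mult_gr[OF t(15) t'(4)] Y.mult_gr[OF t(4) t'(15)]
    by (intro Y.gr_add Y.gr_sign Y.pi_gr) (simp_all add: algebra_simps)
  moreover have "Z x y z x' y' z' \<in> harmonic A' h'"
    using t t' by (simp add: Y.harmonic_iff Z_def Y.pi_add M_harmonic)
  ultimately show ?thesis unfolding T_def
    using X.S_mult[OF t(1) t'(1)] Y.S_mult[OF t(2) t'(2)] Z_zero[OF assms] by simp
qed

lemma T_d: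
  assumes "T k x y z"
  shows "T (k + 1) (diff A x) (diff A' y) (Y.\<pi> y \<ominus> p x)"
proof -
  note t = TD[OF assms]
  have "Y.\<pi> y \<ominus> p x = \<zero>" if "k \<notin> D" using t that by (simp add: Y.sub_self)
  moreover have "Y.\<pi> y \<ominus> p x \<in> gr A' k" using t by (intro Y.gr_diff Y.pi_gr) auto
  moreover have "Y.\<pi> y \<ominus> p x \<in> harmonic A' h'"
    using t by (simp add: Y.harmonic_iff Y.pi_sub p_harmonic)
  ultimately show ?thesis unfolding T_def using t X.S_d Y.S_d by (simp add: p_d Y.pi_d)
qed

text \<open>\<open>\<pi> y\<close> and \<open>p x\<close> can differ only in degrees of
  \<open>D\<close>, and there their products with \<open>v\<close> have no harmonic part.\<close>

lemma pi_mult_swap: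
  assumes "T k x y z" "v \<in> gr A' i" "i \<notin> D \<Longrightarrow> v = \<zero>"
  shows "Y.\<pi> (v \<otimes> Y.\<pi> y) = Y.\<pi> (v \<otimes> p x)" "Y.\<pi> (Y.\<pi> y \<otimes> v) = Y.\<pi> (p x \<otimes> v)"
proof -
  note t = TD[OF assms(1)]
  have "Y.\<pi> (v \<otimes> Y.\<pi> y) = Y.\<pi> (v \<otimes> p x) \<and> Y.\<pi> (Y.\<pi> y \<otimes> v) = Y.\<pi> (p x \<otimes> v)"
  proof (cases "k \<in> D \<and> i \<in> D")
    case True
    then show ?thesis using pi_D_D[OF assms(2) Y.pi_gr[OF t(14)]] pi_D_D[OF assms(2) t(15)]
      pi_D_D[OF Y.pi_gr[OF t(14)] assms(2)] pi_D_D[OF t(15) assms(2)] by simp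
  next
    case False
    then show ?thesis using t assms(3) by auto
  qed
  then show "Y.\<pi> (v \<otimes> Y.\<pi> y) = Y.\<pi> (v \<otimes> p x)" "Y.\<pi> (Y.\<pi> y \<otimes> v) = Y.\<pi> (p x \<otimes> v)" by auto
qed

text \<open>The failure of \<open>p\<close> to be multiplicative lives in degrees of
  \<open>D\<close>, as does \<open>v\<close>, so it is invisible in the harmonic part of the
  product.\<close>

lemma p_mult_assoc:
  assumes t: "T j x y z" and t': "T k x' y' z'" and v: "v \<in> gr A' i" "v \<in> cocycles A'" "i \<notin> D \<Longrightarrow> v = \<zero>"
  shows "Y.\<pi> (p (x \<otimes>\<^bsub>A\<^esub> x') \<otimes> v) = Y.\<pi> (p x \<otimes> Y.\<pi> (p x' \<otimes> v))"
    "Y.\<pi> (v \<otimes> p (x \<otimes>\<^bsub>A\<^esub> x')) = Y.\<pi> (Y.\<pi> (v \<otimes> p x) \<otimes> p x')"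
proof -
  note t = TD[OF t] and t' = TD[OF t']
  obtain u where u: "u \<in> gr A' (j + k)" "p (x \<otimes>\<^bsub>A\<^esub> x') = Y.\<pi> (p x \<otimes> p x') \<oplus> u"
     "j + k \<notin> D \<Longrightarrow> u = \<zero>" using p_mult_S[OF t(1) t'(1)] by blast
  have vc: "v \<in> carrier A'" using v Y.cocycle_closed by blast
  have uc: "u \<in> carrier A'" using u Y.gr_closed by blast
  have z: "Y.\<pi> (u \<otimes> v) = \<zero> \<and> Y.\<pi> (v \<otimes> u) = \<zero>"
  proof (cases "i \<in> D \<and> j + k \<in> D")
    case True
    then show ?thesis using pi_D_D[OF u(1) v(1)] pi_D_D[OF v(1) u(1)] by simp
  next
    case False
    then show ?thesis using u(3) v(3) uc vc by auto
  qed
  have "Y.\<pi> (p (x \<otimes>\<^bsub>A\<^esub> x') \<otimes> v) = Y.\<pi> (Y.\<pi> (p x \<otimes> p x') \<otimes> v)"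
    unfolding u(2) using z t t' uc vc by (simp add: Y.B.l_distr Y.pi_add)
  also have "\<dots> = Y.\<pi> (p x \<otimes> (p x' \<otimes> v))"
    using t t' v vc by (simp add: Y.pi_mult_left Y.cocycle_mult Y.B.m_assoc)
  also have "\<dots> = Y.\<pi> (p x \<otimes> Y.\<pi> (p x' \<otimes> v))"
    using t t' v by (simp add: Y.pi_mult_right Y.cocycle_mult)
  finally show "Y.\<pi> (p (x \<otimes>\<^bsub>A\<^esub> x') \<otimes> v) = Y.\<pi> (p x \<otimes> Y.\<pi> (p x' \<otimes> v))" .
  have "Y.\<pi> (v \<otimes> p (x \<otimes>\<^bsub>A\<^esub> x')) = Y.\<pi> (v \<otimes> Y.\<pi> (p x \<otimes> p x'))"
    unfolding u(2) using z t t' uc vc by (simp add: Y.B.r_distr Y.pi_add)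
  also have "\<dots> = Y.\<pi> ((v \<otimes> p x) \<otimes> p x')"
    using t t' v vc by (simp add: Y.pi_mult_right Y.cocycle_mult Y.B.m_assoc)
  also have "\<dots> = Y.\<pi> (Y.\<pi> (v \<otimes> p x) \<otimes> p x')"
    using t t' v by (simp add: Y.pi_mult_left Y.cocycle_mult)
  finally show "Y.\<pi> (v \<otimes> p (x \<otimes>\<^bsub>A\<^esub> x')) = Y.\<pi> (Y.\<pi> (v \<otimes> p x) \<otimes> p x')" .
qed

lemma p_pi_mult_kappa:
  assumes "x \<in> carrier A" "y \<in> carrier A" "w \<in> carrier A"
  shows "p (X.\<pi> (X.\<kappa> x y \<otimes>\<^bsub>A\<^esub> X.\<pi> w)) = Y.\<pi> (p (X.\<kappa> x y) \<otimes> p w)"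
    "p (X.\<pi> (X.\<pi> w \<otimes>\<^bsub>A\<^esub> X.\<kappa> x y)) = Y.\<pi> (p w \<otimes> p (X.\<kappa> x y))"
  using p_pi_mult[of "X.\<kappa> x y" w] p_pi_mult[of w "X.\<kappa> x y"] assms by (simp_all add: X.kappa_harmonic)

text \<open>Outside degrees \<open>(r, r, r)\<close> each of the three summands of \<open>M\<close>
  satisfies the cocycle condition by itself. In degrees \<open>(r, r, r)\<close> with
  \<open>n = 4r - 1\<close> only the sum does, which is what \<open>\<beta>_cocycle\<close>
  asserts.\<close>

lemma M_assoc:
  assumes t1: "T j x y z" and t2: "T k x' y' z'" and t3: "T l x'' y'' z''"
  shows "M (x \<otimes>\<^bsub>A\<^esub> x') (y \<otimes> y') x'' y'' \<oplus> Y.\<pi> (M x y x' y' \<otimes> p x'') =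
    M x y (x' \<otimes>\<^bsub>A\<^esub> x'') (y' \<otimes> y'') \<oplus> [neg1_pow j] \<cdot> Y.\<pi> (p x \<otimes> M x' y' x'' y'')"
proof -
  note t = TD[OF t1] and t' = TD[OF t2] and t'' = TD[OF t3]
  note cl = t(7-9,16) t'(7-9,16) t''(7-9,16)
  note sg = Y.M.add_neg1_pow X.M.add_neg1_pow
  have e1: "Y.\<pi> (M x y x' y' \<otimes> p x'') = (Y.\<pi> (Y.\<kappa> y y' \<otimes> p x'') \<ominus> Y.\<pi> (p (X.\<kappa> x x') \<otimes> p x'')) \<oplus>
      Y.\<pi> (\<beta> y y' \<otimes> p x'')"
    unfolding M_def using cl by (simp add: Y.B.l_distr a_minus_def Y.B.l_minus Y.pi_add Y.pi_minus)
  have e2: "[neg1_pow j] \<cdot> Y.\<pi> (p x \<otimes> M x' y' x'' y'') =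
     ([neg1_pow j] \<cdot> Y.\<pi> (p x \<otimes> Y.\<kappa> y' y'') \<ominus> [neg1_pow j] \<cdot> Y.\<pi> (p x \<otimes> p (X.\<kappa> x' x''))) \<oplus>
      [neg1_pow j] \<cdot> Y.\<pi> (p x \<otimes> \<beta> y' y'')"
    unfolding M_def using cl
    by (simp add: Y.B.r_distr a_minus_def Y.B.r_minus Y.pi_add Y.pi_minus sg Y.M.minus_add)
  show ?thesis
  proof (cases "n = 4 * r - 1 \<and> j = int r \<and> k = int r \<and> l = int r")
    case True
    have r: "int r < 2 * int r - 1" "int r \<notin> D" using X.r_ge_2 by (auto simp: D_iff)
    \<comment> \<open>Degree \<open>r\<close> is below \<open>2r - 1\<close> and not in
      \<open>D\<close>, so the triples are strict with harmonic second entries, and these equal the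
      images of the first entries.\<close>
    have yp: "y = p x" "y' = p x'" "y'' = p x''"
      using t(2,5) t'(2,5) t''(2,5) True r Y.S_harmonic Y.harmonicD by auto
    have S: "x \<in> X.S (int r)" "x' \<in> X.S (int r)" "x'' \<in> X.S (int r)"
      "y \<in> Y.S (int r)" "y' \<in> Y.S (int r)" "y'' \<in> Y.S (int r)" using t t' t'' True by auto
    note kx = X.kappa_assoc_exceptional[OF S(1-3)] and ky = Y.kappa_assoc_exceptional[OF S(4-6)]
    have ne: "\<not> X.exceptional (int r) (int r)" using X.r_ge_2 by simp
    have z: "X.\<kappa> x x' = \<zero>\<^bsub>A\<^esub>" "X.\<kappa> x' x'' = \<zero>\<^bsub>A\<^esub>" "Y.\<kappa> y y' = \<zero>" "Y.\<kappa> y' y'' = \<zero>"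
      using X.kappa_S_zero[OF S(1,2) ne] X.kappa_S_zero[OF S(2,3) ne]
        Y.kappa_S_zero[OF S(4,5) ne] Y.kappa_S_zero[OF S(5,6) ne] by auto
    have pk: "p (X.\<kappa> (x \<otimes>\<^bsub>A\<^esub> x') x'') = p (h (x \<otimes>\<^bsub>A\<^esub> x') \<otimes>\<^bsub>A\<^esub> x'')"
      "p (X.\<kappa> x (x' \<otimes>\<^bsub>A\<^esub> x'')) = [neg1_pow (int r)] \<cdot> p (x \<otimes>\<^bsub>A\<^esub> h (x' \<otimes>\<^bsub>A\<^esub> x''))"
      unfolding kx(1,3) using cl by (simp_all add: p_pi sg p_minus)
    show ?thesis unfolding e1 e2 unfolding M_def pk ky(1,3) z
      using \<beta>_cocycle[of x x' x''] S True cl unfolding yp by (simp add: sg Y.sub_self)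
  next
    case False
    \<comment> \<open>The images under \<open>p\<close> are exchanged for the projections of the
      second entries, because \<open>kappa_assoc\<close> is a statement within one algebra.\<close>
    have k1: "Y.\<kappa> (y \<otimes> y') y'' \<oplus> Y.\<pi> (Y.\<kappa> y y' \<otimes> p x'') =
        Y.\<kappa> y (y' \<otimes> y'') \<oplus> [neg1_pow j] \<cdot> Y.\<pi> (p x \<otimes> Y.\<kappa> y' y'')"
    proof -
      have "j + k - 1 \<notin> D \<Longrightarrow> Y.\<kappa> y y' = \<zero>" "k + l - 1 \<notin> D \<Longrightarrow> Y.\<kappa> y' y'' = \<zero>"
        using exceptional_D Y.kappa_S_zero[OF t(2) t'(2)] Y.kappa_S_zero[OF t'(2) t''(2)] by blast+
      then have "Y.\<pi> (Y.\<kappa> y y' \<otimes> p x'') = Y.\<pi> (Y.\<kappa> y y' \<otimes> Y.\<pi> y'')"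
         "Y.\<pi> (p x \<otimes> Y.\<kappa> y' y'') = Y.\<pi> (Y.\<pi> y \<otimes> Y.\<kappa> y' y'')"
        using pi_mult_swap(1)[OF t3 Y.kappa_gr[OF t(14) t'(14)]]
          pi_mult_swap(2)[OF t1 Y.kappa_gr[OF t'(14) t''(14)]] by simp_all
      then show ?thesis using Y.kappa_assoc[OF t(2) t'(2) t''(2) False] by simp
    qed
    have k2: "p (X.\<kappa> (x \<otimes>\<^bsub>A\<^esub> x') x'') \<oplus> Y.\<pi> (p (X.\<kappa> x x') \<otimes> p x'') =
        p (X.\<kappa> x (x' \<otimes>\<^bsub>A\<^esub> x'')) \<oplus> [neg1_pow j] \<cdot> Y.\<pi> (p x \<otimes> p (X.\<kappa> x' x''))"
    proof -
      have "p (X.\<kappa> (x \<otimes>\<^bsub>A\<^esub> x') x'' \<oplus>\<^bsub>A\<^esub> X.\<pi> (X.\<kappa> x x' \<otimes>\<^bsub>A\<^esub> X.\<pi> x'')) =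
        p (X.\<kappa> x (x' \<otimes>\<^bsub>A\<^esub> x'') \<oplus>\<^bsub>A\<^esub> [neg1_pow j] \<cdot>\<^bsub>A\<^esub> X.\<pi> (X.\<pi> x \<otimes>\<^bsub>A\<^esub> X.\<kappa> x' x''))"
        using X.kappa_assoc[OF t(1) t'(1) t''(1) False] by simp
      then show ?thesis using cl by (simp add: p_add p_minus p_pi_mult_kappa sg)
    qed
    have k3: "\<beta> (y \<otimes> y') y'' \<oplus> Y.\<pi> (\<beta> y y' \<otimes> p x'') =
        \<beta> y (y' \<otimes> y'') \<oplus> [neg1_pow j] \<cdot> Y.\<pi> (p x \<otimes> \<beta> y' y'')"
    proof -
      have "\<beta> y y' = \<zero>" if "j + k - 1 \<notin> D"
        by (rule \<beta>_zero[OF t(14) t'(14)]) (use that[unfolded D_iff] in auto)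
      moreover have "\<beta> y' y'' = \<zero>" if "k + l - 1 \<notin> D"
        by (rule \<beta>_zero[OF t'(14) t''(14)]) (use that[unfolded D_iff] in auto)
      ultimately have "Y.\<pi> (\<beta> y y' \<otimes> p x'') = Y.\<pi> (\<beta> y y' \<otimes> Y.\<pi> y'')"
         "Y.\<pi> (p x \<otimes> \<beta> y' y'') = Y.\<pi> (Y.\<pi> y \<otimes> \<beta> y' y'')"
        using pi_mult_swap(1)[OF t3 \<beta>_gr[OF t(14) t'(14)]]
          pi_mult_swap(2)[OF t1 \<beta>_gr[OF t'(14) t''(14)]] by simp_all
      then show ?thesis using \<beta>_assoc[OF t(2) t'(2) t''(2) False] by simp
    qed
    show ?thesis unfolding e1 e2 unfolding M_def
      by (rule Y.M.assoc_combine[OF _ _ _ _ _ _ _ _ _ _ _ _ k1 k2 k3]) (use cl in \<open>auto simp: sg\<close>)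
  qed
qed

text \<open>Besides the terms matched by \<open>M_assoc\<close>, each side contains three terms,
  linear in one of \<open>z\<close>, \<open>z'\<close>, \<open>z''\<close>, which agree by
  associativity and \<open>p_mult_assoc\<close>.\<close>

lemma Z_assoc:
  assumes t1: "T j x y z" and t2: "T k x' y' z'" and t3: "T l x'' y'' z''"
  shows "Z (x \<otimes>\<^bsub>A\<^esub> x') (y \<otimes> y') (Z x y z x' y' z') x'' y'' z'' =
    Z x y z (x' \<otimes>\<^bsub>A\<^esub> x'') (y' \<otimes> y'') (Z x' y' z' x'' y'' z'')"
proof -
  note t = TD[OF t1] and t' = TD[OF t2] and t'' = TD[OF t3]
  note cl = t(7-9,16) t'(7-9,16) t''(7-9,16)
  note coc = t(12,17) t'(12,17) t''(12,17)
  note sg = Y.M.add_neg1_pow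
  let ?a = "Y.\<pi> (p x \<otimes> Y.\<pi> (p x' \<otimes> z''))"
  let ?b = "Y.\<pi> (p x \<otimes> Y.\<pi> (z' \<otimes> p x''))"
  let ?c = "Y.\<pi> (Y.\<pi> (z \<otimes> p x') \<otimes> p x'')"
  have b: "Y.\<pi> (Y.\<pi> (p x \<otimes> z') \<otimes> p x'') = ?b"
    using coc cl by (simp add: Y.pi_mult_left Y.pi_mult_right Y.cocycle_mult Y.B.m_assoc)
  have pa: "Y.\<pi> (p (x \<otimes>\<^bsub>A\<^esub> x') \<otimes> z'') = ?a"
    by (rule p_mult_assoc(1)[OF t1 t2 t''(4,12)]) (use t''(6) in auto)
  have pc: "Y.\<pi> (z \<otimes> p (x' \<otimes>\<^bsub>A\<^esub> x'')) = ?c"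
    by (rule p_mult_assoc(2)[OF t2 t3 t(4,12)]) (use t(6) in auto)
  have L: "Z (x \<otimes>\<^bsub>A\<^esub> x') (y \<otimes> y') (Z x y z x' y' z') x'' y'' z'' =
    M (x \<otimes>\<^bsub>A\<^esub> x') (y \<otimes> y') x'' y'' \<oplus> ([neg1_pow (j + k)] \<cdot> ?a \<oplus>
      (Y.\<pi> (M x y x' y' \<otimes> p x'') \<oplus> ([neg1_pow j] \<cdot> ?b \<oplus> ?c)))"
    unfolding Z_homogeneous[OF T_mult[OF t1 t2] cl(11,9)]
    unfolding Z_homogeneous[OF t1 cl(7,5)] pa
    using cl b by (simp add: Y.B.l_distr Y.B.l_minus Y.pi_add Y.pi_minus sg)
  have R: "Z x y z (x' \<otimes>\<^bsub>A\<^esub> x'') (y' \<otimes> y'') (Z x' y' z' x'' y'' z'') =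
    M x y (x' \<otimes>\<^bsub>A\<^esub> x'') (y' \<otimes> y'') \<oplus> ([neg1_pow j] \<cdot> (Y.\<pi> (p x \<otimes> M x' y' x'' y'') \<oplus>
      ([neg1_pow k] \<cdot> ?a \<oplus> ?b)) \<oplus> ?c)"
    using cl unfolding Z_homogeneous[OF t1 Z_closed[OF cl(5-7,9-11)] X.B.m_closed[OF cl(5,9)]]
    unfolding Z_homogeneous[OF t2 cl(11,9)] pc
    by (simp add: Y.B.r_distr Y.B.r_minus Y.pi_add Y.pi_minus sg)
  have "Z (x \<otimes>\<^bsub>A\<^esub> x') (y \<otimes> y') (Z x y z x' y' z') x'' y'' z'' =
    (M (x \<otimes>\<^bsub>A\<^esub> x') (y \<otimes> y') x'' y'' \<oplus> Y.\<pi> (M x y x' y' \<otimes> p x'')) \<oplus>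
      ([neg1_pow (j + k)] \<cdot> ?a \<oplus> ([neg1_pow j] \<cdot> ?b \<oplus> ?c))"
    unfolding L using cl by (simp add: sg Y.M.a_ac)
  also have "\<dots> = Z x y z (x' \<otimes>\<^bsub>A\<^esub> x'') (y' \<otimes> y'') (Z x' y' z' x'' y'' z'')"
    unfolding M_assoc[OF assms] R using cl
    by (cases "even j"; cases "even k") (simp_all add: sg Y.M.a_ac Y.M.minus_add)
  finally show ?thesis .
qed

lemma Z_comm:
  assumes t1: "T j x y z" and t2: "T k x' y' z'"
  shows "Z x y z x' y' z' = [neg1_pow (j * k)] \<cdot> Z x' y' z' x y z"
proof -
  note t = TD[OF t1] and t' = TD[OF t2]
  note cl = t(7-9,16) t'(7-9,16)
  note sg = Y.M.add_neg1_pow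
  have 1: "Y.\<kappa> y y' = [neg1_pow (j * k)] \<cdot> Y.\<kappa> y' y" using Y.kappa_comm t t' by blast
  have 2: "p (X.\<kappa> x x') = [neg1_pow (j * k)] \<cdot> p (X.\<kappa> x' x)"
    using X.kappa_comm[OF t(1) t'(1)] cl by (simp add: sg X.M.add_neg1_pow p_minus)
  have 3: "\<beta> y y' = [neg1_pow (j * k)] \<cdot> \<beta> y' y" using \<beta>_comm t t' by blast
  have m: "M x y x' y' = [neg1_pow (j * k)] \<cdot> M x' y' x y"
    unfolding M_def 1 2 3 using cl by (auto simp: sg a_minus_def Y.M.minus_add)
  have 4: "[neg1_pow j] \<cdot> Y.\<pi> (p x \<otimes> z') = [neg1_pow (j * k)] \<cdot> Y.\<pi> (z' \<otimes> p x)"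
    using Y.mult_commute_cases[OF t(15) t'(4)] cl by (auto simp: sg Y.pi_minus)
  have 5: "Y.\<pi> (z \<otimes> p x') = [neg1_pow (j * k)] \<cdot> ([neg1_pow k] \<cdot> Y.\<pi> (p x' \<otimes> z))"
    using Y.mult_commute_cases[OF t(4) t'(15)] cl by (auto simp: sg Y.pi_minus)
  show ?thesis
    unfolding Z_homogeneous[OF t1 t'(9,7)] Z_homogeneous[OF t2 t(9,7)] m 4 5
    using cl by (auto simp: sg Y.M.minus_add Y.M.a_ac)
qed

text \<open>By \<open>pi_mult_homotopy\<close> in both algebras the terms with
  \<open>\<kappa>\<close> match, and \<open>\<beta>\<close> drops out as it vanishes on exact
  arguments. What remains is that the product of the defects \<open>\<pi> y - p x\<close> and
  \<open>\<pi> y' - p x'\<close> has no harmonic part; each defect is zero outside \<open>D\<close>,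
  so this is \<open>pi_D_D\<close>.\<close>

lemma Z_leibniz:
  assumes t1: "T j x y z" and t2: "T k x' y' z'"
  shows "Y.\<pi> (y \<otimes> y') \<ominus> p (x \<otimes>\<^bsub>A\<^esub> x') =
    Z (diff A x) (diff A' y) (Y.\<pi> y \<ominus> p x) x' y' z' \<oplus>
    [neg1_pow j] \<cdot> Z x y z (diff A x') (diff A' y') (Y.\<pi> y' \<ominus> p x')"
proof -
  note t = TD[OF t1] and t' = TD[OF t2]
  note cl = t(7-9,16) t'(7-9,16)
  note sg = Y.M.add_neg1_pow
  let ?ky = "Y.\<kappa> (diff A' y) y' \<oplus> [neg1_pow j] \<cdot> Y.\<kappa> y (diff A' y')"
  let ?kx = "p (X.\<kappa> (diff A x) x') \<oplus> [neg1_pow j] \<cdot> p (X.\<kappa> x (diff A x'))"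
  let ?yx = "Y.\<pi> (Y.\<pi> y \<otimes> p x')" and ?xy = "Y.\<pi> (p x \<otimes> Y.\<pi> y')" and ?xx = "Y.\<pi> (p x \<otimes> p x')"
    and ?yy = "Y.\<pi> (Y.\<pi> y \<otimes> Y.\<pi> y')"
  have L: "Y.\<pi> (y \<otimes> y') = ?yy \<oplus> ?ky" "p (x \<otimes>\<^bsub>A\<^esub> x') = ?xx \<oplus> ?kx"
  proof -
    show "Y.\<pi> (y \<otimes> y') = ?yy \<oplus> ?ky" using Y.pi_mult_homotopy[OF t(14) t'(8)] .
    have "p (x \<otimes>\<^bsub>A\<^esub> x') = p (X.\<pi> (x \<otimes>\<^bsub>A\<^esub> x'))" using cl by (simp add: p_pi)
    also have "\<dots> = ?xx \<oplus> ?kx"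
      unfolding X.pi_mult_homotopy[OF t(13) t'(7)]
      using cl by (simp add: p_add p_pi_mult X.M.add_neg1_pow sg p_minus)
    finally show "p (x \<otimes>\<^bsub>A\<^esub> x') = ?xx \<oplus> ?kx" .
  qed
  have 1: "Z (diff A x) (diff A' y) (Y.\<pi> y \<ominus> p x) x' y' z' =
     (Y.\<kappa> (diff A' y) y' \<ominus> p (X.\<kappa> (diff A x) x')) \<oplus> (?yx \<ominus> ?xx)"
    unfolding Z_homogeneous[OF T_d[OF t1] t'(9,7)] M_def using cl \<beta>_d[of y y']
    by (simp add: p_d Y.B.l_distr a_minus_def Y.B.l_minus Y.pi_add Y.pi_minus sg)
  have 2: "Z x y z (diff A x') (diff A' y') (Y.\<pi> y' \<ominus> p x') =
     (Y.\<kappa> y (diff A' y') \<ominus> p (X.\<kappa> x (diff A x'))) \<oplus> [neg1_pow j] \<cdot> (?xy \<ominus> ?xx)"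
    using Z_homogeneous[OF t1, of "Y.\<pi> y' \<ominus> p x'" "diff A x'"] cl \<beta>_d[of y y']
    by (simp add: M_def p_d Y.B.r_distr a_minus_def Y.B.r_minus Y.pi_add Y.pi_minus sg)
  have dd: "?yy \<oplus> ?xx = ?yx \<oplus> ?xy"
  proof (cases "j \<in> D \<and> k \<in> D")
    case True
    then show ?thesis using pi_D_D[OF Y.pi_gr[OF t(14)] Y.pi_gr[OF t'(14)]]
      pi_D_D[OF Y.pi_gr[OF t(14)] t'(15)] pi_D_D[OF t(15) Y.pi_gr[OF t'(14)]] pi_D_D[OF t(15) t'(15)] by simp
  next
    case False
    then show ?thesis using t t' by (auto simp: Y.M.a_ac)
  qed
  then have dd': "?yy = (?yx \<oplus> ?xy) \<ominus> ?xx" using cl by (simp add: Y.M.diff_simps)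
  show ?thesis unfolding 1 2 L dd' using cl
    by (cases "even j") (simp_all add: sg Y.M.diff_simps Y.M.diff_simps2 Y.M.a_ac)
qed

section \<open>The DGCA of triples\<close>

definition C :: "('k, 'c) dgca" where
  "C = \<lparr>carrier = {mk x y z | x y z. x \<in> carrier A \<and> y \<in> carrier A' \<and> z \<in> carrier A' \<and>
          (\<forall>k. T k (component A k x) (component A' k y) (component A' (k - 1) z))},
     mult = (\<lambda>u v. mk (f1 u \<otimes>\<^bsub>A\<^esub> f1 v) (f2 u \<otimes> f2 v) (Z (f1 u) (f2 u) (f3 u) (f1 v) (f2 v) (f3 v))),
     one = mk \<one>\<^bsub>A\<^esub> \<one> \<zero>, zero = mk \<zero>\<^bsub>A\<^esub> \<zero> \<zero>,
     add = (\<lambda>u v. mk (f1 u \<oplus>\<^bsub>A\<^esub> f1 v) (f2 u \<oplus> f2 v) (f3 u \<oplus> f3 v)),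
     smult = (\<lambda>c u. mk (c \<odot>\<^bsub>A\<^esub> f1 u) (c \<odot> f2 u) (c \<odot> f3 u)),
     gr = (\<lambda>k. {mk x y z | x y z. T k x y z}),
     diff = (\<lambda>u. mk (diff A (f1 u)) (diff A' (f2 u)) (Y.\<pi> (f2 u) \<ominus> p (f1 u)))\<rparr>"

lemma C_simps [simp]:
  "mk x y z \<otimes>\<^bsub>C\<^esub> mk x' y' z' = mk (x \<otimes>\<^bsub>A\<^esub> x') (y \<otimes> y') (Z x y z x' y' z')"
  "mk x y z \<oplus>\<^bsub>C\<^esub> mk x' y' z' = mk (x \<oplus>\<^bsub>A\<^esub> x') (y \<oplus> y') (z \<oplus> z')"
  "c \<odot>\<^bsub>C\<^esub> mk x y z = mk (c \<odot>\<^bsub>A\<^esub> x) (c \<odot> y) (c \<odot> z)"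
  "\<one>\<^bsub>C\<^esub> = mk \<one>\<^bsub>A\<^esub> \<one> \<zero>" "\<zero>\<^bsub>C\<^esub> = mk \<zero>\<^bsub>A\<^esub> \<zero> \<zero>"
  "diff C (mk x y z) = mk (diff A x) (diff A' y) (Y.\<pi> y \<ominus> p x)"
  by (simp_all add: C_def)

lemma mk_eq_iff [simp]: "mk x y z = mk x' y' z' \<longleftrightarrow> x = x' \<and> y = y' \<and> z = z'"
  by (metis mk)

lemma C_gr: "u \<in> gr C k \<longleftrightarrow> (\<exists>x y z. u = mk x y z \<and> T k x y z)"
  by (auto simp: C_def)

lemma C_carrier: "mk x y z \<in> carrier C \<longleftrightarrow> x \<in> carrier A \<and> y \<in> carrier A' \<and> z \<in> carrier A' \<and>
  (\<forall>k. T k (component A k x) (component A' k y) (component A' (k - 1) z))"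
  by (auto simp: C_def)

lemma C_cases [consumes 1]:
  assumes "u \<in> carrier C"
  obtains x y z where "u = mk x y z" "x \<in> carrier A" "y \<in> carrier A'" "z \<in> carrier A'"
    "\<And>k. T k (component A k x) (component A' k y) (component A' (k - 1) z)"
  using assms by (auto simp: C_def)

lemma T_zero: "T k \<zero>\<^bsub>A\<^esub> \<zero> \<zero>"
  by (simp add: T_def X.S_zero Y.S_zero Y.harmonic_iff Y.gr_zero)

lemma T_add:
  assumes "T k x y z" "T k x' y' z'"
  shows "T k (x \<oplus>\<^bsub>A\<^esub> x') (y \<oplus> y') (z \<oplus> z')"
proof -
  note t = TD[OF assms(1)] and t' = TD[OF assms(2)]
  have "p (x \<oplus>\<^bsub>A\<^esub> x') = Y.\<pi> (y \<oplus> y')" if "k \<notin> D"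
    using t(5,7,8) t'(5,7,8) that by (simp add: p_add Y.pi_add)
  moreover have "z \<oplus> z' = \<zero>" if "k - 1 \<notin> D" using t(6) t'(6) that by simp
  moreover have "z \<oplus> z' \<in> harmonic A' h'" using t(9,10) t'(9,10) by (simp add: Y.harmonic_iff Y.pi_add)
  ultimately show ?thesis unfolding T_def
    using X.S_add[OF t(1) t'(1)] Y.S_add[OF t(2) t'(2)] Y.gr_add[OF t(4) t'(4)] by blast
qed

lemma T_smult:
  assumes c: "c \<in> carrier K" and "T k x y z"
  shows "T k (c \<odot>\<^bsub>A\<^esub> x) (c \<odot> y) (c \<odot> z)"
proof -
  note t = TD[OF assms(2)]
  have "p (c \<odot>\<^bsub>A\<^esub> x) = Y.\<pi> (c \<odot> y)" if "k \<notin> D"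
    using t(5,7,8) that c by (simp add: p_smult Y.pi_smult)
  moreover have "c \<odot> z = \<zero>" if "k - 1 \<notin> D" using t(6) that c by simp
  moreover have "c \<odot> z \<in> harmonic A' h'" using t(9,10) c by (simp add: Y.harmonic_iff Y.pi_smult)
  ultimately show ?thesis unfolding T_def
    using X.S_smult[OF c t(1)] Y.S_smult[OF c t(2)] Y.gr_smult[OF c t(4)] by blast
qed

lemma T_one: "T 0 \<one>\<^bsub>A\<^esub> \<one> \<zero>"
  by (simp add: T_def X.S_one Y.S_one Y.harmonic_iff Y.gr_zero p_one Y.pi_one)

lemma T_components:
  assumes "T l x y z"
  shows "T k (component A k x) (component A' k y) (component A' (k - 1) z)"
  unfolding X.component_homogeneous[OF TD(13)[OF assms]] Y.component_homogeneous[OF TD(14)[OF assms]]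
    Y.component_homogeneous[OF TD(4)[OF assms]]
  using assms T_zero by (cases "k = l") simp_all

lemma T_closed: "T k x y z \<Longrightarrow> mk x y z \<in> carrier C"
  unfolding C_carrier using TD(7-9) T_components by blast

lemma C_closed_gr: "u \<in> gr C k \<Longrightarrow> u \<in> carrier C"
  unfolding C_gr using T_closed by blast

lemma C_zero: "\<zero>\<^bsub>C\<^esub> \<in> carrier C"
  by (simp add: C_carrier T_zero)

lemma C_add: "u \<in> carrier C \<Longrightarrow> v \<in> carrier C \<Longrightarrow> u \<oplus>\<^bsub>C\<^esub> v \<in> carrier C"
  by (elim C_cases) (simp add: C_carrier X.component_add Y.component_add T_add)

lemma C_smult: "c \<in> carrier K \<Longrightarrow> u \<in> carrier C \<Longrightarrow> c \<odot>\<^bsub>C\<^esub> u \<in> carrier C"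
  by (elim C_cases) (simp add: C_carrier X.component_smult Y.component_smult T_smult)

lemma C_abelian_group: "abelian_group C"
proof (rule abelian_groupI)
  fix u v w assume "u \<in> carrier C" "v \<in> carrier C" "w \<in> carrier C"
  then show "u \<oplus>\<^bsub>C\<^esub> v \<oplus>\<^bsub>C\<^esub> w = u \<oplus>\<^bsub>C\<^esub> (v \<oplus>\<^bsub>C\<^esub> w)"
    by (elim C_cases) (simp add: X.M.a_assoc Y.M.a_assoc)
next
  fix u v assume "u \<in> carrier C" "v \<in> carrier C"
  then show "u \<oplus>\<^bsub>C\<^esub> v = v \<oplus>\<^bsub>C\<^esub> u" by (elim C_cases) (simp add: X.M.a_comm Y.M.a_comm)
next
  fix u assume "u \<in> carrier C"
  then show "\<zero>\<^bsub>C\<^esub> \<oplus>\<^bsub>C\<^esub> u = u" by (elim C_cases) simp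
  have "(\<ominus>\<^bsub>K\<^esub> \<one>\<^bsub>K\<^esub>) \<odot>\<^bsub>C\<^esub> u \<oplus>\<^bsub>C\<^esub> u = \<zero>\<^bsub>C\<^esub>" using \<open>u \<in> carrier C\<close>
    by (elim C_cases) (simp add: X.smult_minus_one Y.smult_minus_one X.M.l_neg Y.M.l_neg)
  then show "\<exists>v\<in>carrier C. v \<oplus>\<^bsub>C\<^esub> u = \<zero>\<^bsub>C\<^esub>" using C_smult[of "\<ominus>\<^bsub>K\<^esub> \<one>\<^bsub>K\<^esub>" u] \<open>u \<in> carrier C\<close> by auto
qed (fact C_add C_zero)+

lemma C_module: "module K C"
proof (rule moduleI)
  show "cring K" ..
  fix a b u v assume *: "a \<in> carrier K" "b \<in> carrier K" "u \<in> carrier C" "v \<in> carrier C"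
  then show "(a \<oplus>\<^bsub>K\<^esub> b) \<odot>\<^bsub>C\<^esub> u = a \<odot>\<^bsub>C\<^esub> u \<oplus>\<^bsub>C\<^esub> b \<odot>\<^bsub>C\<^esub> u" "a \<odot>\<^bsub>C\<^esub> (u \<oplus>\<^bsub>C\<^esub> v) = a \<odot>\<^bsub>C\<^esub> u \<oplus>\<^bsub>C\<^esub> a \<odot>\<^bsub>C\<^esub> v"
     "(a \<otimes>\<^bsub>K\<^esub> b) \<odot>\<^bsub>C\<^esub> u = a \<odot>\<^bsub>C\<^esub> (b \<odot>\<^bsub>C\<^esub> u)"
    by (elim C_cases; simp add: X.smult_l_distr Y.smult_l_distr X.smult_r_distr Y.smult_r_distr
       X.smult_assoc1 Y.smult_assoc1)+
next
  fix u assume "u \<in> carrier C"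
  then show "\<one>\<^bsub>K\<^esub> \<odot>\<^bsub>C\<^esub> u = u" by (elim C_cases) simp
qed (fact C_abelian_group C_smult)+

lemma C_minus: "mk x y z \<in> carrier C \<Longrightarrow> \<ominus>\<^bsub>C\<^esub> mk x y z = mk (\<ominus>\<^bsub>A\<^esub> x) (\<ominus> y) (\<ominus> z)"
proof -
  assume u: "mk x y z \<in> carrier C"
  interpret C: module K C by (rule C_module)
  have "(\<ominus>\<^bsub>K\<^esub> \<one>\<^bsub>K\<^esub>) \<odot>\<^bsub>C\<^esub> mk x y z = \<ominus>\<^bsub>C\<^esub> mk x y z"
    using C.smult_l_minus[OF X.R.one_closed u] C.smult_one[OF u] by (simp only:)
  then show ?thesis using u by (simp add: C_carrier X.smult_minus_one Y.smult_minus_one)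
qed

lemma C_sign: "mk x y z \<in> carrier C \<Longrightarrow>
  [neg1_pow k] \<cdot>\<^bsub>C\<^esub> mk x y z = mk ([neg1_pow k] \<cdot>\<^bsub>A\<^esub> x) ([neg1_pow k] \<cdot> y) ([neg1_pow k] \<cdot> z)"
  using abelian_group.add_neg1_pow[OF C_abelian_group, of "mk x y z" k] C_minus[of x y z]
  by (simp add: C_carrier X.M.add_neg1_pow Y.M.add_neg1_pow)

lemma C_decomposition:
  assumes "u \<in> carrier C"
  shows "\<exists>!c. decomposes C u c"
proof (rule unique_decompositionI(2)[where P = "\<lambda>k u. mk (component A k (f1 u)) (component A' k (f2 u)) (component A' (k - 1) (f3 u))"])
  show "abelian_group C" by (rule C_abelian_group)
  show "x \<in> carrier C" if "x \<in> gr C k" for k x using that by (rule C_closed_gr)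
  show "mk (component A k (f1 x)) (component A' k (f2 x)) (component A' (k - 1) (f3 x)) \<in> gr C k"
    if "x \<in> carrier C" for k x
    using that by (elim C_cases) (auto simp: C_gr)
  show "mk (component A k (f1 (x \<oplus>\<^bsub>C\<^esub> y))) (component A' k (f2 (x \<oplus>\<^bsub>C\<^esub> y))) (component A' (k - 1) (f3 (x \<oplus>\<^bsub>C\<^esub> y))) =
     mk (component A k (f1 x)) (component A' k (f2 x)) (component A' (k - 1) (f3 x)) \<oplus>\<^bsub>C\<^esub>
     mk (component A k (f1 y)) (component A' k (f2 y)) (component A' (k - 1) (f3 y))"
    if "x \<in> carrier C" "y \<in> carrier C" for k x y
    using that by (elim C_cases) (simp add: X.component_add Y.component_add)
  show "mk (component A k (f1 x)) (component A' k (f2 x)) (component A' (k - 1) (f3 x)) = x"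
    if x: "x \<in> gr C k" for k x
  proof -
    obtain a b c where *: "x = mk a b c" "T k a b c" using x by (auto simp: C_gr)
    note TD[OF *(2)]
    then show ?thesis using X.component_homogeneous[of a k k] Y.component_homogeneous[of b k k]
      Y.component_homogeneous[of c "k - 1" "k - 1"] * by simp
  qed
  show "mk (component A k (f1 x)) (component A' k (f2 x)) (component A' (k - 1) (f3 x)) = \<zero>\<^bsub>C\<^esub>"
    if x: "x \<in> gr C l" and "l \<noteq> k" for k l x
  proof -
    obtain a b c where *: "x = mk a b c" "T l a b c" using x by (auto simp: C_gr)
    note TD[OF *(2)]
    then show ?thesis using X.component_homogeneous[of a l k] Y.component_homogeneous[of b l k]
      Y.component_homogeneous[of c "l - 1" "k - 1"] * \<open>l \<noteq> k\<close> by simp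
  qed
  show "finite {k. mk (component A k (f1 x)) (component A' k (f2 x)) (component A' (k - 1) (f3 x)) \<noteq> \<zero>\<^bsub>C\<^esub>}"
    if x: "x \<in> carrier C" for x
  proof -
    obtain a b c where *: "x = mk a b c" "a \<in> carrier A" "b \<in> carrier A'" "c \<in> carrier A'"
      using x by (rule C_cases)
    \<comment> \<open>The third entry sits one degree lower than the other two, hence the shifted
      copy of its support.\<close>
    have "{k. mk (component A k (f1 x)) (component A' k (f2 x)) (component A' (k - 1) (f3 x)) \<noteq> \<zero>\<^bsub>C\<^esub>} \<subseteq>
      {k. component A k a \<noteq> \<zero>\<^bsub>A\<^esub>} \<union> {k. component A' k b \<noteq> \<zero>} \<union> (\<lambda>k. k + 1) ` {k. component A' k c \<noteq> \<zero>}"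
      using * by (auto simp: image_iff) (metis diff_add_cancel)
    then show ?thesis
      using X.finite_components[OF *(2)] Y.finite_components[OF *(3)] Y.finite_components[OF *(4)]
      by (auto intro: finite_subset)
  qed
  show "x = \<zero>\<^bsub>C\<^esub>" if x: "x \<in> carrier C"
    and z: "\<And>k. mk (component A k (f1 x)) (component A' k (f2 x)) (component A' (k - 1) (f3 x)) = \<zero>\<^bsub>C\<^esub>" for x
  proof -
    obtain a b c where *: "x = mk a b c" "a \<in> carrier A" "b \<in> carrier A'" "c \<in> carrier A'"
      using x by (rule C_cases)
    have "component A k a = \<zero>\<^bsub>A\<^esub>" "component A' k b = \<zero>" "component A' k c = \<zero>" for k
      using z[of k] z[of "k + 1"] * by auto
    then show ?thesis using * X.component_eq_zeroI Y.component_eq_zeroI by simp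
  qed
qed (fact assms)

lemma Z_add_left:
  assumes "x \<in> carrier A" "y \<in> carrier A'" "z \<in> carrier A'" "x' \<in> carrier A" "y' \<in> carrier A'" "z' \<in> carrier A'"
    "x'' \<in> carrier A" "y'' \<in> carrier A'" "z'' \<in> carrier A'"
  shows "Z (x \<oplus>\<^bsub>A\<^esub> x') (y \<oplus> y') (z \<oplus> z') x'' y'' z'' = Z x y z x'' y'' z'' \<oplus> Z x' y' z' x'' y'' z''"
    "Z x'' y'' z'' (x \<oplus>\<^bsub>A\<^esub> x') (y \<oplus> y') (z \<oplus> z') = Z x'' y'' z'' x y z \<oplus> Z x'' y'' z'' x' y' z'"
  using assms unfolding Z_def M_def
  by (simp_all add: Y.kappa_add_left X.kappa_add_left Y.kappa_add_right X.kappa_add_right p_add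
    \<beta>_add_left \<beta>_add_right Y.sign_twist_add Y.B.l_distr Y.B.r_distr Y.pi_add Y.M.diff_simps Y.M.a_ac)

lemma Z_smult:
  assumes "c \<in> carrier K" "x \<in> carrier A" "y \<in> carrier A'" "z \<in> carrier A'" "x' \<in> carrier A" "y' \<in> carrier A'" "z' \<in> carrier A'"
  shows "Z (c \<odot>\<^bsub>A\<^esub> x) (c \<odot> y) (c \<odot> z) x' y' z' = c \<odot> Z x y z x' y' z'"
    "Z x y z (c \<odot>\<^bsub>A\<^esub> x') (c \<odot> y') (c \<odot> z') = c \<odot> Z x y z x' y' z'"
  using assms unfolding Z_def M_def
  by (simp_all add: Y.kappa_smult_left X.kappa_smult_left Y.kappa_smult_right X.kappa_smult_right p_smult
    \<beta>_smult_left \<beta>_smult_right Y.sign_twist_smult Y.smult_mult_left Y.smult_mult_right Y.pi_smult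
    Y.smult_r_distr a_minus_def Y.smult_r_minus)

lemma \<beta>_one:
  assumes "y \<in> carrier A'"
  shows "\<beta> \<one> y = \<zero>" "\<beta> y \<one> = \<zero>"
proof -
  have z: "\<beta> \<one> u = \<zero>" "\<beta> u \<one> = \<zero>" if "u \<in> gr A' k" for u k
    using \<beta>_zero[OF Y.one_gr that] \<beta>_zero[OF that Y.one_gr] X.r_ge_2 by auto
  show "\<beta> \<one> y = \<zero>" "\<beta> y \<one> = \<zero>"
    using assms by (induction rule: Y.homogeneous_induct) (simp_all add: z \<beta>_add_right \<beta>_add_left)
qed

lemma Z_one:
  assumes "mk x y z \<in> carrier C"
  shows "Z \<one>\<^bsub>A\<^esub> \<one> \<zero> x y z = z" "Z x y z \<one>\<^bsub>A\<^esub> \<one> \<zero> = z"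
proof -
  have c: "x \<in> carrier A" "y \<in> carrier A'" "z \<in> carrier A'" using assms by (auto simp: C_carrier)
  \<comment> \<open>The third entry is harmonic because its components are. Its component of degree
    \<open>k\<close> belongs to the triple of degree \<open>k + 1\<close>.\<close>
  have "component A' k (Y.\<pi> z) = component A' k z" for k
  proof -
    have "T (k + 1) (component A (k + 1) x) (component A' (k + 1) y) (component A' (k + 1 - 1) z)"
      using assms unfolding C_carrier by blast
    from TD(10)[OF this] show ?thesis using c by (simp add: Y.component_pi)
  qed
  then have "Y.\<pi> z = z" using Y.components_eqI[OF Y.pi_closed[OF c(3)] c(3)] by blast
  then show "Z \<one>\<^bsub>A\<^esub> \<one> \<zero> x y z = z" "Z x y z \<one>\<^bsub>A\<^esub> \<one> \<zero> = z"
    using c by (simp_all add: Z_def M_def Y.kappa_one_left X.kappa_one_left Y.kappa_one_right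
      X.kappa_one_right \<beta>_one p_one Y.sign_twist_one Y.sub_self)
qed

lemma dgca_C: "dgca K C"
proof (rule dgcaI)
  show "field K" by (rule X.field_axioms)
  show "module K C" by (rule C_module)
  show "submodule K (gr C k) C" for k
    unfolding submodule_def using C_module C_closed_gr T_zero T_add T_smult by (fastforce simp: C_gr)
  show "\<one>\<^bsub>C\<^esub> \<in> gr C 0" using T_one by (auto simp: C_gr)
  show "\<one>\<^bsub>C\<^esub> \<otimes>\<^bsub>C\<^esub> u = u" "u \<otimes>\<^bsub>C\<^esub> \<one>\<^bsub>C\<^esub> = u" if "u \<in> carrier C" for u
  proof -
    obtain x y z where u: "u = mk x y z" "x \<in> carrier A" "y \<in> carrier A'" using \<open>u \<in> carrier C\<close> by (rule C_cases)
    then show "\<one>\<^bsub>C\<^esub> \<otimes>\<^bsub>C\<^esub> u = u" "u \<otimes>\<^bsub>C\<^esub> \<one>\<^bsub>C\<^esub> = u" using Z_one[of x y z] \<open>u \<in> carrier C\<close> by simp_all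
  qed
  show "\<exists>!c. decomposes C u c" if "u \<in> carrier C" for u using that by (rule C_decomposition)
  fix u v w assume c: "u \<in> carrier C" "v \<in> carrier C" "w \<in> carrier C"
  show "(u \<oplus>\<^bsub>C\<^esub> v) \<otimes>\<^bsub>C\<^esub> w = u \<otimes>\<^bsub>C\<^esub> w \<oplus>\<^bsub>C\<^esub> v \<otimes>\<^bsub>C\<^esub> w" "w \<otimes>\<^bsub>C\<^esub> (u \<oplus>\<^bsub>C\<^esub> v) = w \<otimes>\<^bsub>C\<^esub> u \<oplus>\<^bsub>C\<^esub> w \<otimes>\<^bsub>C\<^esub> v"
    using c by (elim C_cases; simp add: Z_add_left X.B.l_distr X.B.r_distr Y.B.l_distr Y.B.r_distr)+
next
  fix c u v assume c: "c \<in> carrier K" "u \<in> carrier C" "v \<in> carrier C"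
  show "(c \<odot>\<^bsub>C\<^esub> u) \<otimes>\<^bsub>C\<^esub> v = c \<odot>\<^bsub>C\<^esub> (u \<otimes>\<^bsub>C\<^esub> v)" "u \<otimes>\<^bsub>C\<^esub> (c \<odot>\<^bsub>C\<^esub> v) = c \<odot>\<^bsub>C\<^esub> (u \<otimes>\<^bsub>C\<^esub> v)"
    using c by (elim C_cases; simp add: Z_smult X.smult_mult_left X.smult_mult_right Y.smult_mult_left
      Y.smult_mult_right)+
next
  fix u v w j k l assume u: "u \<in> gr C j" and v: "v \<in> gr C k" and w: "w \<in> gr C l"
  obtain x y z where x: "u = mk x y z" "T j x y z" using u by (auto simp: C_gr)
  obtain x' y' z' where x': "v = mk x' y' z'" "T k x' y' z'" using v by (auto simp: C_gr)
  obtain x'' y'' z'' where x'': "w = mk x'' y'' z''" "T l x'' y'' z''" using w by (auto simp: C_gr)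
  note cl = TD(7-9,13,14)[OF x(2)] TD(7-9,13,14)[OF x'(2)] TD(7-9,13,14)[OF x''(2)]
  show "u \<otimes>\<^bsub>C\<^esub> v \<in> gr C (j + k)" using T_mult[OF x(2) x'(2)] x x' by (auto simp: C_gr)
  show "u \<otimes>\<^bsub>C\<^esub> v \<otimes>\<^bsub>C\<^esub> w = u \<otimes>\<^bsub>C\<^esub> (v \<otimes>\<^bsub>C\<^esub> w)"
    using cl Z_assoc[OF x(2) x'(2) x''(2)] by (simp add: x x' x'' X.B.m_assoc Y.B.m_assoc)
  show "u \<otimes>\<^bsub>C\<^esub> v = [neg1_pow (j * k)] \<cdot>\<^bsub>C\<^esub> (v \<otimes>\<^bsub>C\<^esub> u)"
    using C_sign[OF T_closed[OF T_mult[OF x'(2) x(2)]], of "j * k"] Z_comm[OF x(2) x'(2)]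
      X.graded_comm[OF cl(4) cl(9)] Y.graded_comm[OF cl(5) cl(10)]
    by (simp add: x x')
  show "diff C (u \<otimes>\<^bsub>C\<^esub> v) = diff C u \<otimes>\<^bsub>C\<^esub> v \<oplus>\<^bsub>C\<^esub> [neg1_pow j] \<cdot>\<^bsub>C\<^esub> (u \<otimes>\<^bsub>C\<^esub> diff C v)"
    using C_sign[OF T_closed[OF T_mult[OF x(2) T_d[OF x'(2)]]], of j] Z_leibniz[OF x(2) x'(2)]
      X.leibniz[OF cl(4) cl(6)] Y.leibniz[OF cl(5) cl(7)]
    by (simp add: x x')
next
  show "diff C u \<in> gr C (k + 1)" if "u \<in> gr C k" for u k
    using that T_d by (auto simp: C_gr)
  show "diff C (diff C u) = \<zero>\<^bsub>C\<^esub>" if "u \<in> carrier C" for u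
    using that by (elim C_cases) (simp add: X.diff_diff Y.diff_diff Y.pi_d p_d Y.sub_self)
  have "diff C u \<in> carrier C" if u: "u \<in> carrier C" for u
  proof -
    obtain x y z where *: "u = mk x y z" "x \<in> carrier A" "y \<in> carrier A'" "z \<in> carrier A'"
      "\<And>k. T k (component A k x) (component A' k y) (component A' (k - 1) z)" using u by (rule C_cases) blast
    have "T k (component A k (diff A x)) (component A' k (diff A' y)) (component A' (k - 1) (Y.\<pi> y \<ominus> p x))" for k
      using T_d[OF *(5)[of "k - 1"]] *
      by (simp add: X.component_d Y.component_d Y.component_diff Y.component_pi component_p)
    then show ?thesis using * by (simp add: C_carrier)
  qed
  moreover have "diff C (u \<oplus>\<^bsub>C\<^esub> v) = diff C u \<oplus>\<^bsub>C\<^esub> diff C v" if "u \<in> carrier C" "v \<in> carrier C" for u v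
    using that by (elim C_cases)
      (simp add: X.d_add Y.d_add Y.pi_add p_add Y.M.diff_simps Y.M.a_ac)
  moreover have "diff C (c \<odot>\<^bsub>C\<^esub> u) = c \<odot>\<^bsub>C\<^esub> diff C u" if "c \<in> carrier K" "u \<in> carrier C" for c u
    using that by (elim C_cases)
      (simp add: X.d_smult Y.d_smult Y.pi_smult p_smult a_minus_def Y.smult_r_distr Y.smult_r_minus)
  ultimately show "diff C \<in> module_hom K C C" by (simp add: module_hom_def)
qed

section \<open>The two projections are quasi-isomorphisms\<close>

lemma projections: "f1 \<in> dgca_hom K C A" "f2 \<in> dgca_hom K C A'"
  unfolding dgca_hom_def graded_algebra_hom_def ring_hom_def module_hom_def
  by (auto elim!: C_cases simp: C_gr TD)

lemma cocycle_lift: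
  assumes x: "x \<in> harmonic A h"
  shows "mk x (p x) \<zero> \<in> cocycles C"
proof -
  interpret C: dgca K C by (rule dgca_C)
  have c: "x \<in> carrier A" "X.\<pi> x = x" "diff A x = \<zero>\<^bsub>A\<^esub>" using X.harmonicD[OF x] by auto
  have "T k (component A k x) (component A' k (p x)) \<zero>" for k
  proof -
    have "X.\<pi> (component A k x) = component A k x" using X.component_pi[of x k] c by simp
    then have 1: "component A k x \<in> X.S k"
      using c by (intro X.harmonic_S) (simp_all add: X.harmonic_iff)
    have 2: "p (component A k x) \<in> Y.S k"
      using c by (intro Y.harmonic_S p_in_harmonic p_gr) simp_all
    show ?thesis unfolding T_def using 1 2 c
      by (simp add: component_p Y.harmonic_iff Y.gr_zero p_harmonic)
  qed
  then have "mk x (p x) \<zero> \<in> carrier C" using c by (simp add: C_carrier)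
  moreover have "diff C (mk x (p x) \<zero>) = \<zero>\<^bsub>C\<^esub>"
    using c Y.harmonicD[OF p_in_harmonic[of x]] by (simp add: p_harmonic Y.sub_self)
  ultimately show ?thesis by (simp add: C.cocycles_iff)
qed

text \<open>The primitive is \<open>mk (h x) (h' y \<oplus> z) \<zero>\<close>. Injectivity of
  \<open>p\<close> on harmonic elements shows that \<open>x\<close> and \<open>y\<close> have no
  harmonic part, so they are the differentials of \<open>h x\<close> and \<open>h' y\<close>. Adding
  the closed harmonic \<open>z\<close> to the second entry does not change this and reproduces
  \<open>z\<close> as the third entry of the differential.\<close>

lemma cocycle_coboundary:
  assumes u: "u \<in> cocycles C" and p0: "p (f1 u) = \<zero>"
  shows "u \<in> coboundaries C"
proof -
  interpret C: dgca K C by (rule dgca_C)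
  have "u \<in> carrier C" using u by (rule C.cocycle_closed)
  then obtain x y z where *: "u = mk x y z" "x \<in> carrier A" "y \<in> carrier A'" "z \<in> carrier A'"
    "\<And>k. T k (component A k x) (component A' k y) (component A' (k - 1) z)" by (rule C_cases) blast
  have d: "diff A x = \<zero>\<^bsub>A\<^esub>" "diff A' y = \<zero>" "Y.\<pi> y \<ominus> p x = \<zero>"
    using u * by (auto simp: C.cocycles_iff)
  have px: "p x = \<zero>" using p0 * by simp
  then have "p (X.\<pi> x) = \<zero>" using * by (simp add: p_pi)
  then have xh: "X.\<pi> x = \<zero>\<^bsub>A\<^esub>" using p_inj X.pi_harmonic * by blast
  have yh: "Y.\<pi> y = \<zero>" using d(3) px * by (simp add: a_minus_def)
  have xe: "x = diff A (h x)" using X.pi_decomp[OF *(2)] xh d * by simp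
  have ye: "y = diff A' (h' y)" using Y.pi_decomp[OF *(3)] yh d * by simp
  have zk: "component A' k (Y.\<pi> z) = component A' k z" "diff A' (component A' k z) = \<zero>" for k
    using TD(10,11)[OF *(5)[of "k + 1"]] * by (simp_all add: Y.component_pi)
  have zh: "Y.\<pi> z = z" using Y.components_eqI[OF Y.pi_closed[OF *(4)] *(4)] zk(1) by blast
  have dz: "diff A' z = \<zero>" using Y.d_pi[OF *(4)] zh by simp
  have "T k (component A k (h x)) (component A' k (h' y \<oplus> z)) \<zero>" for k
  proof -
    note t = TD[OF *(5)[of "k + 1"]]
    have e: "component A k (h x) = h (component A (k + 1) x)" "component A' k (h' y) = h' (component A' (k + 1) y)"
      using X.component_h[OF *(2), of "k + 1"] Y.component_h[OF *(3), of "k + 1"] by auto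
    have 1: "h (component A (k + 1) x) \<in> X.S k" "h' (component A' (k + 1) y) \<in> Y.S k"
      using X.S_h[OF t(1)] Y.S_h[OF t(2)] by auto
    \<comment> \<open>Harmonic elements belong to \<open>S\<close> in every degree, so adding
      \<open>z\<close> to the second entry is permitted.\<close>
    have 2: "component A' k z \<in> Y.S k" using t by (intro Y.harmonic_S) auto
    have "Y.\<pi> (h' (component A' (k + 1) y) \<oplus> component A' k z) = component A' k z"
      using * t by (simp add: Y.pi_add Y.pi_h)
    then show ?thesis unfolding T_def e Y.component_add[OF Y.h_closed[OF *(3)] *(4)]
      using 1 Y.S_add[OF 1(2) 2] * t by (simp add: Y.harmonic_iff Y.gr_zero p_h Y.pi_h)
  qed
  then have "mk (h x) (h' y \<oplus> z) \<zero> \<in> carrier C" using * by (simp add: C_carrier)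
  moreover have "diff C (mk (h x) (h' y \<oplus> z) \<zero>) = u"
    using * xe ye zh dz by (simp add: Y.d_add Y.pi_add Y.pi_h p_h a_minus_def)
  ultimately show ?thesis using C.coboundaries_iff by blast
qed

lemma quasi_isos: "quasi_iso K C A f1" "quasi_iso K C A' f2"
proof -
  interpret C: dgca K C by (rule dgca_C)
  have c: "p (f1 u) = Y.\<pi> (f2 u) \<and> f1 u \<in> carrier A \<and> f2 u \<in> carrier A'" if "u \<in> cocycles C" for u
  proof -
    have "u \<in> carrier C" "diff C u = \<zero>\<^bsub>C\<^esub>" using that by (auto simp: C.cocycles_iff)
    then show ?thesis by (elim C_cases) (simp add: Y.M.diff_simps)
  qed
  show "quasi_iso K C A f1"
    unfolding quasi_iso_iff[OF dgca_C X.dgca_axioms projections(1)]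
  proof (intro conjI ballI impI)
    fix x assume x: "x \<in> cocycles A"
    then show "\<exists>u\<in>cocycles C. x \<ominus>\<^bsub>A\<^esub> f1 u \<in> coboundaries A"
      using cocycle_lift[of "X.\<pi> x"] X.cocycle_sub_pi X.pi_harmonic X.cocycle_closed
      by (intro bexI[of _ "mk (X.\<pi> x) (p (X.\<pi> x)) \<zero>"]) auto
  next
    fix u assume u: "u \<in> cocycles C" and b: "f1 u \<in> coboundaries A"
    have "p (f1 u) = p (X.\<pi> (f1 u))" using c[OF u] by (simp add: p_pi)
    then have "p (f1 u) = \<zero>" using X.pi_coboundary[OF b] by simp
    then show "u \<in> coboundaries C" using cocycle_coboundary[OF u] by simp
  qed
  show "quasi_iso K C A' f2"
    unfolding quasi_iso_iff[OF dgca_C Y.dgca_axioms projections(2)]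
  proof (intro conjI ballI impI)
    fix y assume y: "y \<in> cocycles A'"
    then obtain x where x: "x \<in> harmonic A h" "p x = Y.\<pi> y"
      using p_surj Y.pi_harmonic Y.cocycle_closed by blast
    then show "\<exists>u\<in>cocycles C. y \<ominus> f2 u \<in> coboundaries A'"
      using cocycle_lift[OF x(1)] Y.cocycle_sub_pi[OF y]
      by (intro bexI[of _ "mk x (p x) \<zero>"]) auto
  next
    fix u assume u: "u \<in> cocycles C" and b: "f2 u \<in> coboundaries A'"
    have "p (f1 u) = \<zero>" using c[OF u] Y.pi_coboundary[OF b] by simp
    then show "u \<in> coboundaries C" using cocycle_coboundary[OF u] by simp
  qed
qed

end

section \<open>Invariance of the ternary operation\<close>

definition linear_in_both :: "('k, 'l) ring_scheme \<Rightarrow> ('k, 'h, 'm) graded_module_scheme \<Rightarrow> ('k, 'd) dgca \<Rightarrow>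
    ('h \<Rightarrow> 'h \<Rightarrow> 'd) \<Rightarrow> bool" where
  "linear_in_both K H D \<eta> \<longleftrightarrow>
    (\<forall>x\<in>carrier H. \<forall>y\<in>carrier H. \<eta> x y \<in> carrier D) \<and>
    (\<forall>x\<in>carrier H. \<forall>x'\<in>carrier H. \<forall>y\<in>carrier H.
       \<eta> (x \<oplus>\<^bsub>H\<^esub> x') y = \<eta> x y \<oplus>\<^bsub>D\<^esub> \<eta> x' y \<and> \<eta> y (x \<oplus>\<^bsub>H\<^esub> x') = \<eta> y x \<oplus>\<^bsub>D\<^esub> \<eta> y x') \<and>
    (\<forall>c\<in>carrier K. \<forall>x\<in>carrier H. \<forall>y\<in>carrier H.
       \<eta> (c \<odot>\<^bsub>H\<^esub> x) y = c \<odot>\<^bsub>D\<^esub> \<eta> x y \<and> \<eta> x (c \<odot>\<^bsub>H\<^esub> y) = c \<odot>\<^bsub>D\<^esub> \<eta> x y)"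

text \<open>Says that \<open>a \<mapsto> [s a]\<close> is an isomorphism of graded vector spaces
  onto cohomology that preserves the unit, without forming the quotient. It makes sense on every
  DGCA.\<close>

definition cohomology_section :: "('k, 'l) ring_scheme \<Rightarrow> ('k, 'h, 'm) graded_module_scheme \<Rightarrow>
    ('k, 'd) dgca \<Rightarrow> ('h \<Rightarrow> 'd) \<Rightarrow> bool" where
  "cohomology_section K H D s \<longleftrightarrow>
     s \<in> module_hom K H D \<and> (\<forall>k. \<forall>a\<in>gr H k. s a \<in> gr D k) \<and> (\<forall>a\<in>carrier H. s a \<in> cocycles D) \<and>
     (\<forall>y\<in>cocycles D. \<exists>a\<in>carrier H. y \<ominus>\<^bsub>D\<^esub> s a \<in> coboundaries D) \<and>
     (\<forall>a\<in>carrier H. s a \<in> coboundaries D \<longrightarrow> a = \<zero>\<^bsub>H\<^esub>) \<and> s \<one>\<^bsub>H\<^esub> \<ominus>\<^bsub>D\<^esub> \<one>\<^bsub>D\<^esub> \<in> coboundaries D"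

text \<open>Symmetry is asked for only modulo coboundaries, which is the form that can be recovered
  after lifting along a quasi-isomorphism.\<close>

definition product_homotopy :: "('k, 'l) ring_scheme \<Rightarrow> ('k, 'h, 'm) graded_module_scheme \<Rightarrow>
    ('k, 'd) dgca \<Rightarrow> ('h \<Rightarrow> 'd) \<Rightarrow> ('h \<Rightarrow> 'h \<Rightarrow> 'd) \<Rightarrow> bool" where
  "product_homotopy K H D s \<eta> \<longleftrightarrow> linear_in_both K H D \<eta> \<and>
     (\<forall>k l. \<forall>a\<in>gr H k. \<forall>b\<in>gr H l. \<eta> a b \<in> gr D (k + l - 1) \<and>
        \<eta> a b \<ominus>\<^bsub>D\<^esub> [neg1_pow (k * l)] \<cdot>\<^bsub>D\<^esub> \<eta> b a \<in> coboundaries D) \<and>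
     (\<forall>a\<in>carrier H. \<forall>b\<in>carrier H. diff D (\<eta> a b) = s a \<otimes>\<^bsub>D\<^esub> s b \<ominus>\<^bsub>D\<^esub> s (a \<otimes>\<^bsub>H\<^esub> b))"

text \<open>The ternary operation of the transferred structure is the class of this cocycle.\<close>

definition massey :: "('k, 'h, 'm) graded_module_scheme \<Rightarrow> ('k, 'd) dgca \<Rightarrow> ('h \<Rightarrow> 'd) \<Rightarrow> ('h \<Rightarrow> 'h \<Rightarrow> 'd) \<Rightarrow>
    int \<Rightarrow> 'h \<Rightarrow> 'h \<Rightarrow> 'h \<Rightarrow> 'd" where
  "massey H D s \<eta> k a b c = ((\<eta> a b \<otimes>\<^bsub>D\<^esub> s c \<ominus>\<^bsub>D\<^esub> [neg1_pow k] \<cdot>\<^bsub>D\<^esub> (s a \<otimes>\<^bsub>D\<^esub> \<eta> b c)) \<oplus>\<^bsub>D\<^esub> \<eta> (a \<otimes>\<^bsub>H\<^esub> b) c) \<ominus>\<^bsub>D\<^esub>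
     \<eta> a (b \<otimes>\<^bsub>H\<^esub> c)"

definition transfers :: "('k, 'l) ring_scheme \<Rightarrow> ('k, 'h, 'm) graded_module_scheme \<Rightarrow>
    ('k, 'd) dgca \<Rightarrow> ('h \<Rightarrow> 'h \<Rightarrow> 'h \<Rightarrow> 'h) \<Rightarrow> ('h \<Rightarrow> 'd) \<Rightarrow> ('h \<Rightarrow> 'h \<Rightarrow> 'd) \<Rightarrow> bool" where
  "transfers K H D m s \<eta> \<longleftrightarrow> cohomology_section K H D s \<and> product_homotopy K H D s \<eta> \<and>
     (\<forall>j k l. \<forall>a\<in>gr H j. \<forall>b\<in>gr H k. \<forall>c\<in>gr H l. massey H D s \<eta> j a b c \<ominus>\<^bsub>D\<^esub> s (m a b c) \<in> coboundaries D)"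

lemma linear_in_bothD:
  assumes "linear_in_both K H D \<eta>"
  shows "\<And>x y. x \<in> carrier H \<Longrightarrow> y \<in> carrier H \<Longrightarrow> \<eta> x y \<in> carrier D"
    "\<And>x x' y. x \<in> carrier H \<Longrightarrow> x' \<in> carrier H \<Longrightarrow> y \<in> carrier H \<Longrightarrow> \<eta> (x \<oplus>\<^bsub>H\<^esub> x') y = \<eta> x y \<oplus>\<^bsub>D\<^esub> \<eta> x' y"
    "\<And>x x' y. x \<in> carrier H \<Longrightarrow> x' \<in> carrier H \<Longrightarrow> y \<in> carrier H \<Longrightarrow> \<eta> y (x \<oplus>\<^bsub>H\<^esub> x') = \<eta> y x \<oplus>\<^bsub>D\<^esub> \<eta> y x'"
    "\<And>c x y. c \<in> carrier K \<Longrightarrow> x \<in> carrier H \<Longrightarrow> y \<in> carrier H \<Longrightarrow> \<eta> (c \<odot>\<^bsub>H\<^esub> x) y = c \<odot>\<^bsub>D\<^esub> \<eta> x y"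
    "\<And>c x y. c \<in> carrier K \<Longrightarrow> x \<in> carrier H \<Longrightarrow> y \<in> carrier H \<Longrightarrow> \<eta> x (c \<odot>\<^bsub>H\<^esub> y) = c \<odot>\<^bsub>D\<^esub> \<eta> x y"
  using assms unfolding linear_in_both_def by blast+

text \<open>The computation behind \<open>transfers_gauge\<close> with all values replaced by ring
  elements. Letters \<open>t\<close>, \<open>s\<close>, \<open>e\<close> stand for values of the
  gauge map, the section and the homotopy, primes for the changed ones, and \<open>ua\<close>,
  \<open>uc\<close> for the differentials of the gauge map. The signs become \<open>\<sigma>\<close>
  and \<open>\<tau>\<close>, each the identity or negation.\<close>

lemma (in ring) gauge_identity:
  fixes \<sigma> \<tau> :: "'a \<Rightarrow> 'a"
  assumes \<sigma>: "(\<forall>x\<in>carrier R. \<sigma> x = x) \<or> (\<forall>x\<in>carrier R. \<sigma> x = \<ominus> x)"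
    and \<tau>: "(\<forall>x\<in>carrier R. \<tau> x = x) \<or> (\<forall>x\<in>carrier R. \<tau> x = \<ominus> x)"
    and c [simp]: "ta \<in> carrier R" "tb \<in> carrier R" "tc \<in> carrier R" "tab \<in> carrier R" "tbc \<in> carrier R"
    "tabc \<in> carrier R" "sa \<in> carrier R" "sb \<in> carrier R" "sc \<in> carrier R" "sab \<in> carrier R"
    "sb' \<in> carrier R" "sc' \<in> carrier R" "sbc' \<in> carrier R" "ua \<in> carrier R" "uc \<in> carrier R"
    "eab \<in> carrier R" "ebc \<in> carrier R" "e1 \<in> carrier R" "e2 \<in> carrier R"
    and sc': "sc' = sc \<oplus> uc"
    and ebc': "ebc' = ebc \<oplus> ((tb \<otimes> sc' \<oplus> \<tau> (sb \<otimes> tc)) \<ominus> tbc)"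
  shows "(((eab \<oplus> ((ta \<otimes> sb' \<oplus> \<sigma> (sa \<otimes> tb)) \<ominus> tab)) \<otimes> sc' \<ominus> \<sigma> ((sa \<oplus> ua) \<otimes> ebc')) \<oplus>
      (e1 \<oplus> ((tab \<otimes> sc' \<oplus> \<sigma> (\<tau> (sab \<otimes> tc))) \<ominus> tabc))) \<ominus> (e2 \<oplus> ((ta \<otimes> sbc' \<oplus> \<sigma> (sa \<otimes> tbc)) \<ominus> tabc)) =
    ((((eab \<otimes> sc \<ominus> \<sigma> (sa \<otimes> ebc)) \<oplus> e1) \<ominus> e2) \<oplus> (ta \<otimes> (sb' \<otimes> sc' \<ominus> sbc') \<ominus> \<sigma> (ua \<otimes> ebc'))) \<oplus>
      (eab \<otimes> uc \<ominus> \<sigma> (\<tau> ((sa \<otimes> sb \<ominus> sab) \<otimes> tc)))"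
proof -
  have e: "eab \<otimes> sc' = eab \<otimes> sc \<oplus> eab \<otimes> uc" by (simp add: sc' r_distr)
  have u: "ua \<otimes> ebc' \<in> carrier R" using ebc' \<tau> by auto
  have main: "((((X \<oplus> Y) \<oplus> A) \<ominus> B) \<ominus> \<sigma> ((sa \<otimes> ebc \<oplus> ((sa \<otimes> tb \<otimes> sc' \<oplus> \<tau> (sa \<otimes> sb \<otimes> tc)) \<ominus> sa \<otimes> tbc)) \<oplus> V) \<oplus>
      (e1 \<oplus> ((B \<oplus> \<sigma> (\<tau> (sab \<otimes> tc))) \<ominus> tabc))) \<ominus> (e2 \<oplus> ((F \<oplus> \<sigma> (sa \<otimes> tbc)) \<ominus> tabc)) =
     ((((X \<ominus> \<sigma> (sa \<otimes> ebc)) \<oplus> e1) \<ominus> e2) \<oplus> ((G \<ominus> F) \<ominus> \<sigma> V)) \<oplus> (Y \<ominus> (\<sigma> (\<tau> (sa \<otimes> sb \<otimes> tc)) \<ominus> \<sigma> (\<tau> (sab \<otimes> tc))))"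
    if "A = G \<oplus> \<sigma> (sa \<otimes> tb \<otimes> sc')" "X \<in> carrier R" "Y \<in> carrier R" "B \<in> carrier R" "F \<in> carrier R" "G \<in> carrier R"
      "V \<in> carrier R" for X Y A B F G V
    using \<sigma>
  proof
    assume s: "\<forall>x\<in>carrier R. \<sigma> x = x"
    show ?thesis using \<tau> that(2-) unfolding that(1)
      by (elim disjE) (simp_all add: s sc' diff_simps a_ac)
  next
    assume s: "\<forall>x\<in>carrier R. \<sigma> x = \<ominus> x"
    show ?thesis using \<tau> that(2-) unfolding that(1)
      by (elim disjE) (simp_all add: s sc' diff_simps diff_simps2 a_ac)
  qed
  have sig: "\<sigma> x \<in> carrier R" "\<tau> x \<in> carrier R" if "x \<in> carrier R" for x using \<sigma> \<tau> that by auto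
  have sm: "\<sigma> x \<otimes> y = \<sigma> (x \<otimes> y)" "y \<otimes> \<tau> x = \<tau> (y \<otimes> x)" if "x \<in> carrier R" "y \<in> carrier R" for x y
    using \<sigma> \<tau> that by (auto simp: l_minus r_minus)
  have sd: "\<sigma> (\<tau> (x \<ominus> y)) = \<sigma> (\<tau> x) \<ominus> \<sigma> (\<tau> y)" if "x \<in> carrier R" "y \<in> carrier R" for x y
    using \<sigma> \<tau> that by (elim disjE) (auto simp: diff_simps diff_simps2)
  have l1: "(eab \<oplus> ((ta \<otimes> sb' \<oplus> \<sigma> (sa \<otimes> tb)) \<ominus> tab)) \<otimes> sc' =
     ((eab \<otimes> sc \<oplus> eab \<otimes> uc) \<oplus> (ta \<otimes> (sb' \<otimes> sc') \<oplus> \<sigma> (sa \<otimes> tb \<otimes> sc'))) \<ominus> tab \<otimes> sc'"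
    using c sig by (simp add: a_minus_def l_distr e l_minus sm m_assoc a_assoc)
  have l2: "(sa \<oplus> ua) \<otimes> ebc' = (sa \<otimes> ebc \<oplus> ((sa \<otimes> tb \<otimes> sc' \<oplus> \<tau> (sa \<otimes> sb \<otimes> tc)) \<ominus> sa \<otimes> tbc)) \<oplus> ua \<otimes> ebc'"
  proof -
    have "ebc' \<in> carrier R" using ebc' sig by (simp add: sc')
    then have "(sa \<oplus> ua) \<otimes> ebc' = sa \<otimes> ebc' \<oplus> ua \<otimes> ebc'" by (simp add: l_distr)
    also have "sa \<otimes> ebc' = sa \<otimes> ebc \<oplus> ((sa \<otimes> tb \<otimes> sc' \<oplus> \<tau> (sa \<otimes> sb \<otimes> tc)) \<ominus> sa \<otimes> tbc)"
      unfolding ebc' using sig by (simp add: a_minus_def r_distr r_minus sm m_assoc sc')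
    finally show ?thesis .
  qed
  have l3: "ta \<otimes> (sb' \<otimes> sc' \<ominus> sbc') = ta \<otimes> (sb' \<otimes> sc') \<ominus> ta \<otimes> sbc'"
    by (simp add: a_minus_def r_distr r_minus sc')
  have l4: "\<sigma> (\<tau> ((sa \<otimes> sb \<ominus> sab) \<otimes> tc)) = \<sigma> (\<tau> (sa \<otimes> sb \<otimes> tc)) \<ominus> \<sigma> (\<tau> (sab \<otimes> tc))"
    using sd[of "sa \<otimes> sb \<otimes> tc" "sab \<otimes> tc"] by (simp add: a_minus_def l_distr l_minus)
  show ?thesis unfolding l1 l2 l3 l4 using u by (intro main) (auto simp: sc')
qed

locale dgca_over = D: dgca K D + H: graded_comm_algebra K H
  for K :: "('k, 'l) ring_scheme" and D :: "('k, 'd) dgca" (structure) and H :: "('k, 'h, 'm) graded_module_scheme"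
begin

lemma H_module: "module K H" ..

lemma cohomology_sectionD:
  assumes "cohomology_section K H D s"
  shows "s \<in> module_hom K H D" "\<And>a. a \<in> carrier H \<Longrightarrow> s a \<in> carrier D"
    "\<And>a b. a \<in> carrier H \<Longrightarrow> b \<in> carrier H \<Longrightarrow> s (a \<oplus>\<^bsub>H\<^esub> b) = s a \<oplus> s b"
    "\<And>c a. c \<in> carrier K \<Longrightarrow> a \<in> carrier H \<Longrightarrow> s (c \<odot>\<^bsub>H\<^esub> a) = c \<odot> s a"
    "\<And>a. a \<in> carrier H \<Longrightarrow> s (\<ominus>\<^bsub>H\<^esub> a) = \<ominus> s a"
    "\<And>a b. a \<in> carrier H \<Longrightarrow> b \<in> carrier H \<Longrightarrow> s (a \<ominus>\<^bsub>H\<^esub> b) = s a \<ominus> s b"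
    "\<And>a k. a \<in> gr H k \<Longrightarrow> s a \<in> gr D k" "\<And>a. a \<in> carrier H \<Longrightarrow> s a \<in> cocycles D"
    "\<And>a. a \<in> carrier H \<Longrightarrow> diff D (s a) = \<zero>"
    "\<And>y. y \<in> cocycles D \<Longrightarrow> \<exists>a\<in>carrier H. y \<ominus> s a \<in> coboundaries D"
    "\<And>a. a \<in> carrier H \<Longrightarrow> s a \<in> coboundaries D \<Longrightarrow> a = \<zero>\<^bsub>H\<^esub>"
    "s \<one>\<^bsub>H\<^esub> \<ominus> \<one> \<in> coboundaries D"
proof -
  show m: "s \<in> module_hom K H D" using assms by (simp add: cohomology_section_def)
  note m = module_hom_facts[OF H_module D.is_module m]
  show "\<And>a. a \<in> carrier H \<Longrightarrow> s a \<in> carrier D"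
    "\<And>a b. a \<in> carrier H \<Longrightarrow> b \<in> carrier H \<Longrightarrow> s (a \<oplus>\<^bsub>H\<^esub> b) = s a \<oplus> s b"
    "\<And>c a. c \<in> carrier K \<Longrightarrow> a \<in> carrier H \<Longrightarrow> s (c \<odot>\<^bsub>H\<^esub> a) = c \<odot> s a"
    "\<And>a. a \<in> carrier H \<Longrightarrow> s (\<ominus>\<^bsub>H\<^esub> a) = \<ominus> s a"
    "\<And>a b. a \<in> carrier H \<Longrightarrow> b \<in> carrier H \<Longrightarrow> s (a \<ominus>\<^bsub>H\<^esub> b) = s a \<ominus> s b" by (fact m)+
  show "\<And>a k. a \<in> gr H k \<Longrightarrow> s a \<in> gr D k" "\<And>a. a \<in> carrier H \<Longrightarrow> s a \<in> cocycles D"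
    "\<And>a. a \<in> carrier H \<Longrightarrow> diff D (s a) = \<zero>"
    "\<And>y. y \<in> cocycles D \<Longrightarrow> \<exists>a\<in>carrier H. y \<ominus> s a \<in> coboundaries D"
    "\<And>a. a \<in> carrier H \<Longrightarrow> s a \<in> coboundaries D \<Longrightarrow> a = \<zero>\<^bsub>H\<^esub>"
    "s \<one>\<^bsub>H\<^esub> \<ominus> \<one> \<in> coboundaries D"
    using assms by (auto simp: cohomology_section_def D.cocycles_iff)
qed

lemma product_homotopyD:
  assumes "product_homotopy K H D s \<eta>"
  shows "linear_in_both K H D \<eta>"
    "\<And>a b k l. a \<in> gr H k \<Longrightarrow> b \<in> gr H l \<Longrightarrow> \<eta> a b \<in> gr D (k + l - 1)"
    "\<And>a b k l. a \<in> gr H k \<Longrightarrow> b \<in> gr H l \<Longrightarrow> \<eta> a b \<ominus> [neg1_pow (k * l)] \<cdot> \<eta> b a \<in> coboundaries D"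
    "\<And>a b. a \<in> carrier H \<Longrightarrow> b \<in> carrier H \<Longrightarrow> diff D (\<eta> a b) = s a \<otimes> s b \<ominus> s (a \<otimes>\<^bsub>H\<^esub> b)"
  using assms unfolding product_homotopy_def by blast+

lemma section_eqI:
  assumes "cohomology_section K H D s" "a \<in> carrier H" "b \<in> carrier H" "s a \<ominus> s b \<in> coboundaries D"
  shows "a = b"
proof -
  note s = cohomology_sectionD[OF assms(1)]
  have "a \<ominus>\<^bsub>H\<^esub> b = \<zero>\<^bsub>H\<^esub>" using s(11)[of "a \<ominus>\<^bsub>H\<^esub> b"] s(6) assms by simp
  then show ?thesis using assms by (simp add: H.M.diff_simps)
qed

text \<open>The differential of each of the four summands is a difference of products of section
  values, and the differences telescope.\<close>

lemma massey_cocycle: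
  assumes "cohomology_section K H D s" "product_homotopy K H D s \<eta>" and a: "a \<in> gr H k"
    and b: "b \<in> carrier H" and c: "c \<in> carrier H"
  shows "massey H D s \<eta> k a b c \<in> cocycles D"
proof -
  note s = cohomology_sectionD[OF assms(1)] and h = product_homotopyD[OF assms(2)]
  note hc = linear_in_bothD(1)[OF h(1)]
  have ac: "a \<in> carrier H" using a H.gr_closed by simp
  note cl = ac b c s(2)[OF ac] s(2)[OF b] s(2)[OF c] hc[OF ac b] hc[OF b c]
  have d1: "diff D (\<eta> a b \<otimes> s c) = s a \<otimes> s b \<otimes> s c \<ominus> s (a \<otimes>\<^bsub>H\<^esub> b) \<otimes> s c"
    using cl s(2) h(4)[OF ac b] s(9)[OF c]
    by (simp add: D.leibniz_general a_minus_def D.B.l_distr D.B.l_minus)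
  have d2: "diff D (s a \<otimes> \<eta> b c) = [neg1_pow k] \<cdot> (s a \<otimes> s b \<otimes> s c \<ominus> s a \<otimes> s (b \<otimes>\<^bsub>H\<^esub> c))"
    using cl s(2) h(4)[OF b c] s(9)[OF ac] D.leibniz[OF s(7)[OF a], of "\<eta> b c"]
    by (simp add: D.M.add_neg1_pow a_minus_def D.B.r_distr D.B.r_minus D.B.m_assoc)
  have d3: "diff D (\<eta> (a \<otimes>\<^bsub>H\<^esub> b) c) = s (a \<otimes>\<^bsub>H\<^esub> b) \<otimes> s c \<ominus> s (a \<otimes>\<^bsub>H\<^esub> b \<otimes>\<^bsub>H\<^esub> c)"
    "diff D (\<eta> a (b \<otimes>\<^bsub>H\<^esub> c)) = s a \<otimes> s (b \<otimes>\<^bsub>H\<^esub> c) \<ominus> s (a \<otimes>\<^bsub>H\<^esub> b \<otimes>\<^bsub>H\<^esub> c)"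
    using h(4)[of "a \<otimes>\<^bsub>H\<^esub> b" c] h(4)[of a "b \<otimes>\<^bsub>H\<^esub> c"] cl by (simp_all add: H.B.m_assoc)
  have "diff D (massey H D s \<eta> k a b c) = \<zero>"
    unfolding massey_def using cl s(2) hc
    by (simp add: D.d_add D.d_diff D.d_minus d1 d2 d3 D.M.add_neg1_pow D.M.diff_simps D.M.a_ac)
  moreover have "massey H D s \<eta> k a b c \<in> carrier D"
    unfolding massey_def using cl s(2) hc by (simp add: D.M.add_neg1_pow)
  ultimately show ?thesis by (simp add: D.cocycles_iff)
qed

lemma transfers_gauge:
  assumes tr: "transfers K H D m s \<eta>" and t: "t \<in> module_hom K H D"
    and tg: "\<And>a k. a \<in> gr H k \<Longrightarrow> t a \<in> gr D (k - 1)"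
    and m: "closed3 H m"
  shows "\<exists>\<eta>'. transfers K H D m (\<lambda>a. s a \<oplus> diff D (t a)) \<eta>'"
proof -
  have sec: "cohomology_section K H D s" and hty: "product_homotopy K H D s \<eta>"
    and mas: "\<And>a b c j k l. a \<in> gr H j \<Longrightarrow> b \<in> gr H k \<Longrightarrow> c \<in> gr H l \<Longrightarrow> massey H D s \<eta> j a b c \<ominus> s (m a b c) \<in> coboundaries D"
    using tr unfolding transfers_def by blast+
  note s = cohomology_sectionD[OF sec] and h = product_homotopyD[OF hty]
  note \<eta> = linear_in_bothD[OF h(1)]
  note t = module_hom_facts[OF H_module D.is_module t]
  let ?s = "\<lambda>a. s a \<oplus> diff D (t a)"
  \<comment> \<open>One product contains the new section and the other the old one, so that the
    differential of the two is exactly the difference between the new and the old product of section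
    values.\<close>
  let ?\<eta> = "\<lambda>a b. \<eta> a b \<oplus> ((t a \<otimes> ?s b \<oplus> sign_twist D 1 (s a) \<otimes> t b) \<ominus> t (a \<otimes>\<^bsub>H\<^esub> b))"
  have s'c: "?s a \<in> carrier D" if "a \<in> carrier H" for a using that s(2) t(1) by simp
  have sec': "cohomology_section K H D ?s"
    unfolding cohomology_section_def
  proof (intro conjI allI ballI impI)
    show "?s \<in> module_hom K H D" unfolding module_hom_def
      using s(2-4) t(1-3) by (auto simp: D.d_add D.d_smult D.M.a_ac D.smult_r_distr)
    show "?s a \<in> gr D k" if "a \<in> gr H k" for a k
      using s(7)[OF that] D.diff_degree[OF tg[OF that]] by (simp add: D.gr_add)
    show "?s a \<in> cocycles D" if "a \<in> carrier H" for a
      using s(8)[OF that] t(1)[OF that] D.coboundaries_cocycles[OF D.coboundary_d] D.cocycle_add by blast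
    show "\<exists>a\<in>carrier H. y \<ominus> ?s a \<in> coboundaries D" if y: "y \<in> cocycles D" for y
    proof -
      obtain a where a: "a \<in> carrier H" "y \<ominus> s a \<in> coboundaries D" using s(10)[OF y] by blast
      have "y \<ominus> ?s a = (y \<ominus> s a) \<ominus> diff D (t a)"
        using a s(2) t(1) D.cocycle_closed[OF y] by (simp add: D.M.diff_simps)
      then have "y \<ominus> ?s a \<in> coboundaries D"
        using D.coboundary_diff[OF a(2) D.coboundary_d[OF t(1)[OF a(1)]]] by simp
      then show ?thesis using a by blast
    qed
    show "a = \<zero>\<^bsub>H\<^esub>" if a: "a \<in> carrier H" "?s a \<in> coboundaries D" for a
    proof -
      have "s a = ?s a \<ominus> diff D (t a)"
        using a s(2) t(1) by (simp add: D.M.diff_simps)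
      then have "s a \<in> coboundaries D"
        using D.coboundary_diff[OF a(2) D.coboundary_d[OF t(1)[OF a(1)]]] by simp
      then show ?thesis using s(11) a by blast
    qed
    have "?s \<one>\<^bsub>H\<^esub> \<ominus> \<one> = (s \<one>\<^bsub>H\<^esub> \<ominus> \<one>) \<oplus> diff D (t \<one>\<^bsub>H\<^esub>)"
      using s(2) t(1) by (simp add: D.M.diff_simps)
    then show "?s \<one>\<^bsub>H\<^esub> \<ominus> \<one> \<in> coboundaries D"
      using D.coboundary_add[OF s(12) D.coboundary_d[OF t(1)]] by simp
  qed
  have \<eta>_hom: "?\<eta> a b = \<eta> a b \<oplus> ((t a \<otimes> ?s b \<oplus> [neg1_pow k] \<cdot> (s a \<otimes> t b)) \<ominus> t (a \<otimes>\<^bsub>H\<^esub> b))"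
    if "a \<in> gr H k" "b \<in> carrier H" for a b k
    using that H.gr_closed[OF that(1)] s(2) t(1)
    by (simp add: D.sign_twist_homogeneous[OF s(7)] D.M.add_neg1_pow D.B.l_minus)
  have d\<eta>: "diff D (?\<eta> a b) = ?s a \<otimes> ?s b \<ominus> ?s (a \<otimes>\<^bsub>H\<^esub> b)" if ab: "a \<in> carrier H" "b \<in> carrier H" for a b
  proof -
    have 1: "diff D (t a \<otimes> ?s b) = diff D (t a) \<otimes> s b \<oplus> diff D (t a) \<otimes> diff D (t b)"
      using ab s(2) t(1) s(9)[OF ab(2)]
      by (simp add: D.leibniz_general D.d_add D.diff_diff D.B.r_distr)
    have "sign_twist D 1 \<zero> = \<zero>" using D.sign_twist_smult[of "\<zero>\<^bsub>K\<^esub>" "\<zero>" 1] by simp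
    then have 2: "diff D (sign_twist D 1 (s a) \<otimes> t b) = s a \<otimes> diff D (t b)"
      using ab s(2) t(1) s(9)[OF ab(1)]
      by (simp add: D.leibniz_general D.d_sign_twist D.sign_twist_involution)
    have "diff D (?\<eta> a b) = (s a \<otimes> s b \<ominus> s (a \<otimes>\<^bsub>H\<^esub> b)) \<oplus>
       (((diff D (t a) \<otimes> s b \<oplus> diff D (t a) \<otimes> diff D (t b)) \<oplus> s a \<otimes> diff D (t b)) \<ominus> diff D (t (a \<otimes>\<^bsub>H\<^esub> b)))"
      using ab s(2) t(1) \<eta>(1) by (simp add: D.d_add D.d_diff h(4) 1 2)
    also have "\<dots> = ?s a \<otimes> ?s b \<ominus> ?s (a \<otimes>\<^bsub>H\<^esub> b)"
      using ab s(2) t(1) by (simp add: D.B.l_distr D.B.r_distr D.M.diff_simps D.M.a_ac)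
    finally show ?thesis .
  qed
  have hty': "product_homotopy K H D ?s ?\<eta>"
    unfolding product_homotopy_def
  proof (intro conjI allI ballI)
    show "linear_in_both K H D ?\<eta>" unfolding linear_in_both_def
      using \<eta> s(2-4) t(1-3)
      by (auto simp: D.d_add D.d_smult D.B.l_distr D.B.r_distr D.sign_twist_add D.sign_twist_smult
        H.B.l_distr H.B.r_distr D.smult_mult_left D.smult_mult_right H.smult_mult_left H.smult_mult_right
        D.smult_r_distr D.smult_r_minus D.M.minus_add a_minus_def D.M.a_ac)
    show "?\<eta> a b \<in> gr D (k + l - 1)" if ab: "a \<in> gr H k" "b \<in> gr H l" for a b k l
    proof -
      have "t a \<otimes> ?s b \<in> gr D ((k - 1) + l)"
        using D.mult_gr[OF tg[OF ab(1)] D.gr_add[OF s(7)[OF ab(2)]]] D.diff_degree[OF tg[OF ab(2)]] by simp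
      moreover have "s a \<otimes> t b \<in> gr D (k + (l - 1))" by (rule D.mult_gr[OF s(7)[OF ab(1)] tg[OF ab(2)]])
      moreover have "t (a \<otimes>\<^bsub>H\<^esub> b) \<in> gr D (k + l - 1)" by (rule tg[OF H.mult_gr[OF ab]])
      ultimately show ?thesis unfolding \<eta>_hom[OF ab(1) H.gr_closed[OF ab(2)]]
        using h(2)[OF ab] by (intro D.gr_add D.gr_diff D.gr_sign) (simp_all add: algebra_simps)
    qed
    show "?\<eta> a b \<ominus> [neg1_pow (k * l)] \<cdot> ?\<eta> b a \<in> coboundaries D" if ab: "a \<in> gr H k" "b \<in> gr H l" for a b k l
    proof -
      have c: "a \<in> carrier H" "b \<in> carrier H" using ab H.gr_closed by auto
      note cl = c s(2)[OF c(1)] s(2)[OF c(2)] t(1)[OF c(1)] t(1)[OF c(2)] \<eta>(1)[OF c] \<eta>(1)[OF c(2,1)]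
      let ?sg = "\<lambda>x. [neg1_pow (k * l)] \<cdot> x"
      have 1: "t a \<otimes> s b = ?sg (([neg1_pow l] \<cdot> (s b \<otimes> t a)))"
        using D.mult_commute_cases[OF tg[OF ab(1)] s(7)[OF ab(2)]] cl by (auto simp: D.M.add_neg1_pow)
      have 2: "s a \<otimes> t b = ?sg ([neg1_pow k] \<cdot> (t b \<otimes> s a))"
        using D.mult_commute_cases[OF s(7)[OF ab(1)] tg[OF ab(2)]] cl by (auto simp: D.M.add_neg1_pow)
      have 3: "t (a \<otimes>\<^bsub>H\<^esub> b) = ?sg (t (b \<otimes>\<^bsub>H\<^esub> a))"
        using H.mult_commute_cases[OF ab] cl t(1,5) by (auto simp: D.M.add_neg1_pow)
      have 4: "t b \<otimes> diff D (t a) = [neg1_pow (k * l + k)] \<cdot> (diff D (t a) \<otimes> t b)"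
        using D.mult_commute_cases[OF tg[OF ab(2)] D.diff_degree[OF tg[OF ab(1)]]] cl
        by (auto simp: D.M.add_neg1_pow)
      \<comment> \<open>The unsymmetric choice in the homotopy costs a term that is exact: up to
        sign the differential of \<open>t a \<otimes> t b\<close>.\<close>
      have 5: "t a \<otimes> diff D (t b) \<ominus> ?sg (t b \<otimes> diff D (t a)) = [neg1_pow (k - 1)] \<cdot> diff D (t a \<otimes> t b)"
        unfolding 4 using D.leibniz[OF tg[OF ab(1)] cl(6)] cl
        by (auto simp: D.M.add_neg1_pow D.M.diff_simps D.M.diff_simps2 D.M.a_ac)
      have "?\<eta> a b \<ominus> ?sg (?\<eta> b a) = (\<eta> a b \<ominus> ?sg (\<eta> b a)) \<oplus>
         (t a \<otimes> diff D (t b) \<ominus> ?sg (t b \<otimes> diff D (t a)))"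
        unfolding \<eta>_hom[OF ab(1) c(2)] \<eta>_hom[OF ab(2) c(1)]
        unfolding D.B.r_distr[OF cl(4) D.d_closed[OF cl(6)] cl(5)]
          D.B.r_distr[OF cl(3) D.d_closed[OF cl(5)] cl(6)] 1 2 3
        using cl t(1) by (cases "even k"; cases "even l")
          (simp_all add: D.M.add_neg1_pow D.M.diff_simps D.M.diff_simps2 D.M.a_ac)
      moreover have "[neg1_pow (k - 1)] \<cdot> diff D (t a \<otimes> t b) \<in> coboundaries D"
        using D.coboundary_d[of "t a \<otimes> t b"] D.coboundary_minus[of "diff D (t a \<otimes> t b)"] cl
        by (simp add: D.M.add_neg1_pow)
      ultimately show ?thesis using D.coboundary_add[OF h(3)[OF ab]] 5 by metis
    qed
    show "diff D (?\<eta> a b) = ?s a \<otimes> ?s b \<ominus> ?s (a \<otimes>\<^bsub>H\<^esub> b)" if "a \<in> carrier H" "b \<in> carrier H" for a b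
      using d\<eta> that .
  qed
  have rearrange: "((u \<oplus> x) \<oplus> y) \<ominus> (v \<oplus> w) = (((u \<ominus> v) \<oplus> x) \<oplus> y) \<ominus> w"
    if "u \<in> carrier D" "x \<in> carrier D" "y \<in> carrier D" "v \<in> carrier D" "w \<in> carrier D" for u x y v w
    using that by (simp add: D.M.diff_simps D.M.a_ac)
  have mas': "massey H D ?s ?\<eta> k a b c \<ominus> ?s (m a b c) \<in> coboundaries D"
    if abc: "a \<in> gr H k" "b \<in> gr H l" "c \<in> gr H j" for a b c k l j
  proof -
    have cc: "a \<in> carrier H" "b \<in> carrier H" "c \<in> carrier H" using abc H.gr_closed by auto
    have pc: "a \<otimes>\<^bsub>H\<^esub> b \<in> carrier H" "b \<otimes>\<^bsub>H\<^esub> c \<in> carrier H" "a \<otimes>\<^bsub>H\<^esub> b \<otimes>\<^bsub>H\<^esub> c \<in> carrier H" using cc by auto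
    let ?\<sigma> = "\<lambda>x. [neg1_pow k] \<cdot> x" and ?\<tau> = "\<lambda>x. [neg1_pow l] \<cdot> x"
    have \<sigma>: "(\<forall>x\<in>carrier D. ?\<sigma> x = x) \<or> (\<forall>x\<in>carrier D. ?\<sigma> x = \<ominus> x)"
      "(\<forall>x\<in>carrier D. ?\<tau> x = x) \<or> (\<forall>x\<in>carrier D. ?\<tau> x = \<ominus> x)"
      by (simp_all add: D.M.add_neg1_pow)
    have \<sigma>\<tau>: "[neg1_pow (k + l)] \<cdot> x = ?\<sigma> (?\<tau> x)" if "x \<in> carrier D" for x
      using that by (simp add: D.M.add_neg1_pow)
    note sc = s(2) t(1) \<eta>(1) cc pc
    let ?X = "t a \<otimes> (?s b \<otimes> ?s c \<ominus> ?s (b \<otimes>\<^bsub>H\<^esub> c)) \<ominus> ?\<sigma> (diff D (t a) \<otimes> ?\<eta> b c)"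
    let ?Y = "\<eta> a b \<otimes> diff D (t c) \<ominus> ?\<sigma> (?\<tau> ((s a \<otimes> s b \<ominus> s (a \<otimes>\<^bsub>H\<^esub> b)) \<otimes> t c))"
    have eq: "massey H D ?s ?\<eta> k a b c = (massey H D s \<eta> k a b c \<oplus> ?X) \<oplus> ?Y"
      unfolding massey_def
      unfolding \<eta>_hom[OF abc(1) cc(2)] \<eta>_hom[OF abc(1) pc(2)] \<eta>_hom[OF H.mult_gr[OF abc(1,2)] cc(3)]
      unfolding \<sigma>\<tau>[OF D.B.m_closed[OF s(2)[OF pc(1)] t(1)[OF cc(3)]]]
        H.B.m_assoc[OF cc]
      by (rule D.B.gauge_identity[OF \<sigma>]) (use sc \<eta>_hom[OF abc(2) cc(3)] in auto)
    have ec: "?\<eta> b c \<in> carrier D" using sc by simp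
    \<comment> \<open>By the Leibniz rule \<open>?X\<close> is, up to sign, the differential of
      \<open>t a\<close> times the new homotopy at \<open>b\<close> and \<open>c\<close>. In the
      same way \<open>?Y\<close> below is that of \<open>\<eta> a b\<close> times
      \<open>t c\<close>.\<close>
    have "t a \<otimes> diff D v \<ominus> ?\<sigma> (diff D (t a) \<otimes> v) = [neg1_pow (k - 1)] \<cdot> diff D (t a \<otimes> v)"
      if "v \<in> carrier D" for v
      using D.leibniz[OF tg[OF abc(1)] that] t(1)[OF cc(1)] that
      by (cases "even k") (simp_all add: D.M.add_neg1_pow D.M.diff_simps D.M.a_ac D.M.r_neg D.M.minus_add)
    from this[OF ec] have "?X = [neg1_pow (k - 1)] \<cdot> diff D (t a \<otimes> ?\<eta> b c)"
      unfolding d\<eta>[OF cc(2,3), symmetric] .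
    then have X: "?X \<in> coboundaries D" using ec sc D.coboundary_d D.coboundary_minus by (simp add: D.M.add_neg1_pow)
    have "\<eta> a b \<otimes> diff D v \<ominus> ?\<sigma> (?\<tau> (diff D (\<eta> a b) \<otimes> v)) =
        [neg1_pow (k + l - 1)] \<cdot> diff D (\<eta> a b \<otimes> v)" if "v \<in> carrier D" for v
      using D.leibniz[OF h(2)[OF abc(1,2)] that] \<eta>(1)[OF cc(1,2)] that
      by (cases "even k"; cases "even l")
        (simp_all add: D.M.add_neg1_pow D.M.diff_simps D.M.a_ac D.M.r_neg D.M.minus_add)
    from this[OF t(1)[OF cc(3)]] have "?Y = [neg1_pow (k + l - 1)] \<cdot> diff D (\<eta> a b \<otimes> t c)"
      unfolding h(4)[OF cc(1,2), symmetric] .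
    then have Y: "?Y \<in> coboundaries D" using sc D.coboundary_d D.coboundary_minus by (simp add: D.M.add_neg1_pow)
    have mc: "m a b c \<in> carrier H" using closed3D[OF m] cc by simp
    have cl: "massey H D s \<eta> k a b c \<in> carrier D" "?X \<in> carrier D" "?Y \<in> carrier D"
      using D.cocycle_closed[OF massey_cocycle[OF sec hty abc(1) cc(2,3)]] X Y D.coboundary_closed by auto
    have "massey H D ?s ?\<eta> k a b c \<ominus> ?s (m a b c) =
       (((massey H D s \<eta> k a b c \<ominus> s (m a b c)) \<oplus> ?X) \<oplus> ?Y) \<ominus> diff D (t (m a b c))"
      unfolding eq using rearrange[OF cl s(2)[OF mc] D.d_closed[OF t(1)[OF mc]]] .
    then show ?thesis using mas[OF abc] X Y D.coboundary_d[OF t(1)[OF mc]]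
      by (simp add: D.coboundary_add D.coboundary_diff)
  qed
  show ?thesis using sec' hty' mas' unfolding transfers_def by blast
qed

end

section \<open>Linear extension from a homogeneous spanning family\<close>

lemma finsum_mem:
  assumes "abelian_monoid G" "finite I" "\<zero>\<^bsub>G\<^esub> \<in> N" "\<And>x y. x \<in> N \<Longrightarrow> y \<in> N \<Longrightarrow> x \<oplus>\<^bsub>G\<^esub> y \<in> N" "N \<subseteq> carrier G"
    and f: "\<And>i. i \<in> I \<Longrightarrow> f i \<in> N"
  shows "(\<Oplus>\<^bsub>G\<^esub> i\<in>I. f i) \<in> N"
proof -
  interpret abelian_monoid G by fact
  show ?thesis using assms(2) f
  proof (induction I rule: finite_induct)
    case empty
    then show ?case using assms(3) by simp
  next
    case (insert i I)
    then have "f \<in> I \<rightarrow> carrier G" "f i \<in> carrier G" using assms(5) by auto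
    then show ?case using insert assms(4) by simp
  qed
qed

lemma finsum_Times:
  assumes "abelian_monoid G" "finite I" "finite J" "\<And>i j. i \<in> I \<Longrightarrow> j \<in> J \<Longrightarrow> f i j \<in> carrier G"
  shows "(\<Oplus>\<^bsub>G\<^esub> q\<in>I \<times> J. f (fst q) (snd q)) = (\<Oplus>\<^bsub>G\<^esub> j\<in>J. \<Oplus>\<^bsub>G\<^esub> i\<in>I. f i j)"
proof -
  interpret abelian_monoid G by fact
  show ?thesis using assms(3,4)
  proof (induction J rule: finite_induct)
    case empty
    then show ?case by simp
  next
    case (insert j J)
    have e: "I \<times> insert j J = (\<lambda>i. (i, j)) ` I \<union> I \<times> J" by auto
    have c: "(\<Oplus>\<^bsub>G\<^esub> i\<in>I. f i k) \<in> carrier G" if "k \<in> insert j J" for k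
      using that insert by (intro finsum_closed) auto
    have "(\<Oplus>\<^bsub>G\<^esub> q\<in>I \<times> insert j J. f (fst q) (snd q)) =
      (\<Oplus>\<^bsub>G\<^esub> q\<in>(\<lambda>i. (i, j)) ` I. f (fst q) (snd q)) \<oplus>\<^bsub>G\<^esub> (\<Oplus>\<^bsub>G\<^esub> q\<in>I \<times> J. f (fst q) (snd q))"
      unfolding e using insert assms(2) by (intro finsum_Un_disjoint) auto
    also have "(\<Oplus>\<^bsub>G\<^esub> q\<in>(\<lambda>i. (i, j)) ` I. f (fst q) (snd q)) = (\<Oplus>\<^bsub>G\<^esub> i\<in>I. f i j)"
      using insert by (subst finsum_reindex) (auto simp: inj_on_def)
    finally show ?case using insert c by simp
  qed
qed

text \<open>The family spans but may be redundant, so \<open>extend D x\<close> need not take the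
  value \<open>x i\<close> at \<open>e i\<close>. What the later arguments use is that it is linear
  and graded, and that every linear map is the extension of its own values on the family.\<close>

locale homogeneous_coordinates = graded_comm_algebra K H
  for K :: "('k, 'l) ring_scheme" and H :: "('k, 'h, 'm) graded_module_scheme" +
  fixes I :: "'i set" and e :: "'i \<Rightarrow> 'h" and dg :: "'i \<Rightarrow> int" and cf :: "'i \<Rightarrow> 'h \<Rightarrow> 'k"
  assumes fin: "finite I"
    and e_gr: "i \<in> I \<Longrightarrow> e i \<in> gr H (dg i)"
    and cf_closed: "i \<in> I \<Longrightarrow> a \<in> carrier H \<Longrightarrow> cf i a \<in> carrier K"
    and cf_add: "i \<in> I \<Longrightarrow> a \<in> carrier H \<Longrightarrow> b \<in> carrier H \<Longrightarrow> cf i (a \<oplus>\<^bsub>H\<^esub> b) = cf i a \<oplus>\<^bsub>K\<^esub> cf i b"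
    and cf_smult: "i \<in> I \<Longrightarrow> c \<in> carrier K \<Longrightarrow> a \<in> carrier H \<Longrightarrow> cf i (c \<odot>\<^bsub>H\<^esub> a) = c \<otimes>\<^bsub>K\<^esub> cf i a"
    and cf_zero: "i \<in> I \<Longrightarrow> a \<in> gr H k \<Longrightarrow> dg i \<noteq> k \<Longrightarrow> cf i a = \<zero>\<^bsub>K\<^esub>"
    and expand: "a \<in> carrier H \<Longrightarrow> (\<Oplus>\<^bsub>H\<^esub> i\<in>I. cf i a \<odot>\<^bsub>H\<^esub> e i) = a"
begin

lemma H_module: "module K H" ..

lemma e_closed: "i \<in> I \<Longrightarrow> e i \<in> carrier H"
  using e_gr gr_closed by blast

definition extend :: "('k, 'd) dgca \<Rightarrow> ('i \<Rightarrow> 'd) \<Rightarrow> 'h \<Rightarrow> 'd" where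
  "extend D x a = (\<Oplus>\<^bsub>D\<^esub> i\<in>I. cf i a \<odot>\<^bsub>D\<^esub> x i)"

lemma extend_hom:
  assumes "module K D" and x: "\<And>i. i \<in> I \<Longrightarrow> x i \<in> carrier D"
  shows "extend D x \<in> module_hom K H D"
proof -
  interpret D: module K D by fact
  have t: "(\<lambda>i. cf i a \<odot>\<^bsub>D\<^esub> x i) \<in> I \<rightarrow> carrier D" if "a \<in> carrier H" for a
    using that x cf_closed by auto
  have "extend D x (a \<oplus>\<^bsub>H\<^esub> b) = extend D x a \<oplus>\<^bsub>D\<^esub> extend D x b" if "a \<in> carrier H" "b \<in> carrier H" for a b
  proof -
    have "extend D x (a \<oplus>\<^bsub>H\<^esub> b) = (\<Oplus>\<^bsub>D\<^esub> i\<in>I. cf i a \<odot>\<^bsub>D\<^esub> x i \<oplus>\<^bsub>D\<^esub> cf i b \<odot>\<^bsub>D\<^esub> x i)"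
      unfolding extend_def
      by (rule D.M.finsum_cong'[OF refl]) (use that x cf_closed cf_add D.smult_l_distr in auto)
    also have "\<dots> = extend D x a \<oplus>\<^bsub>D\<^esub> extend D x b"
      unfolding extend_def using t that by (intro D.M.finsum_addf) auto
    finally show ?thesis .
  qed
  moreover have "extend D x (c \<odot>\<^bsub>H\<^esub> a) = c \<odot>\<^bsub>D\<^esub> extend D x a" if "c \<in> carrier K" "a \<in> carrier H" for a c
  proof -
    have "extend D x (c \<odot>\<^bsub>H\<^esub> a) = (\<Oplus>\<^bsub>D\<^esub> i\<in>I. c \<odot>\<^bsub>D\<^esub> (cf i a \<odot>\<^bsub>D\<^esub> x i))"
      unfolding extend_def
      by (rule D.M.finsum_cong'[OF refl]) (use that x cf_closed cf_smult D.smult_assoc1 in auto)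
    also have "\<dots> = c \<odot>\<^bsub>D\<^esub> extend D x a"
      unfolding extend_def using that fin x cf_closed D.smult_r_distr D.M.abelian_group_axioms
      by (intro additive_finsum[symmetric]) auto
    finally show ?thesis .
  qed
  moreover have "extend D x a \<in> carrier D" if "a \<in> carrier H" for a
    unfolding extend_def using t that by (intro D.M.finsum_closed) auto
  ultimately show ?thesis by (simp add: module_hom_def)
qed

lemma extend_closed:
  assumes "module K D" "\<And>i. i \<in> I \<Longrightarrow> x i \<in> carrier D" "a \<in> carrier H"
  shows "extend D x a \<in> carrier D"
  using extend_hom[OF assms(1), of x] assms(2,3) by (auto simp: module_hom_def)

lemma extend_gr:
  assumes "dgca K D" and x: "\<And>i. i \<in> I \<Longrightarrow> x i \<in> gr D (dg i + q)" and a: "a \<in> gr H k"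
  shows "extend D x a \<in> gr D (k + q)"
proof -
  interpret D: dgca K D by fact
  show ?thesis unfolding extend_def
  proof (rule finsum_mem[OF D.M.abelian_monoid_axioms fin])
    show "cf i a \<odot>\<^bsub>D\<^esub> x i \<in> gr D (k + q)" if "i \<in> I" for i
    proof (cases "dg i = k")
      case True
      then show ?thesis using x[OF that] cf_closed[OF that] gr_closed[OF a] D.gr_smult by auto
    next
      case False
      then show ?thesis using cf_zero[OF that a] D.gr_closed[OF x[OF that]] D.gr_zero by simp
    qed
  qed (auto intro: D.gr_zero D.gr_add D.gr_closed)
qed

lemma hom_extend:
  assumes "module K C" "module K D" "g \<in> module_hom K C D" and x: "\<And>i. i \<in> I \<Longrightarrow> x i \<in> carrier C"
    and a: "a \<in> carrier H"
  shows "g (extend C x a) = extend D (\<lambda>i. g (x i)) a"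
proof -
  interpret C: module K C by fact
  interpret D: module K D by fact
  note g = module_hom_facts[OF assms(1-3)]
  have "g (extend C x a) = (\<Oplus>\<^bsub>D\<^esub> i\<in>I. g (cf i a \<odot>\<^bsub>C\<^esub> x i))"
    unfolding extend_def using g fin x cf_closed a C.M.abelian_group_axioms D.M.abelian_group_axioms
    by (intro additive_finsum) auto
  also have "\<dots> = extend D (\<lambda>i. g (x i)) a"
    unfolding extend_def by (rule D.M.finsum_cong'[OF refl]) (use g x cf_closed a in auto)
  finally show ?thesis .
qed

lemma hom_eq_extend:
  assumes "module K D" "g \<in> module_hom K H D" "a \<in> carrier H"
  shows "g a = extend D (\<lambda>i. g (e i)) a"
proof -
  interpret D: module K D by fact
  note g = module_hom_facts[OF H_module assms(1,2)]
  have "g a = g (\<Oplus>\<^bsub>H\<^esub> i\<in>I. cf i a \<odot>\<^bsub>H\<^esub> e i)" using expand[OF assms(3)] by simp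
  also have "\<dots> = (\<Oplus>\<^bsub>D\<^esub> i\<in>I. g (cf i a \<odot>\<^bsub>H\<^esub> e i))"
    using g fin e_closed cf_closed assms(3) M.abelian_group_axioms D.M.abelian_group_axioms
    by (intro additive_finsum) auto
  also have "\<dots> = extend D (\<lambda>i. g (e i)) a"
    unfolding extend_def by (rule D.M.finsum_cong'[OF refl]) (use g e_closed cf_closed assms(3) in auto)
  finally show ?thesis .
qed

lemma extend_sub:
  assumes "module K D" and x: "\<And>i. i \<in> I \<Longrightarrow> x i \<in> carrier D" "\<And>i. i \<in> I \<Longrightarrow> x' i \<in> carrier D"
    and a: "a \<in> carrier H"
  shows "extend D (\<lambda>i. x i \<ominus>\<^bsub>D\<^esub> x' i) a = extend D x a \<ominus>\<^bsub>D\<^esub> extend D x' a"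
proof -
  interpret D: module K D by fact
  have cl: "extend D x a \<in> carrier D" "extend D x' a \<in> carrier D" "extend D (\<lambda>i. x i \<ominus>\<^bsub>D\<^esub> x' i) a \<in> carrier D"
    using x a cf_closed by (auto simp: extend_def intro!: D.M.finsum_closed)
  have "extend D x a = (\<Oplus>\<^bsub>D\<^esub> i\<in>I. cf i a \<odot>\<^bsub>D\<^esub> (x i \<ominus>\<^bsub>D\<^esub> x' i) \<oplus>\<^bsub>D\<^esub> cf i a \<odot>\<^bsub>D\<^esub> x' i)"
    unfolding extend_def
  proof (rule D.M.finsum_cong'[OF refl])
    fix i assume i: "i \<in> I"
    have "x i = (x i \<ominus>\<^bsub>D\<^esub> x' i) \<oplus>\<^bsub>D\<^esub> x' i" using x i by (simp add: D.M.diff_simps)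
    then have "cf i a \<odot>\<^bsub>D\<^esub> x i = cf i a \<odot>\<^bsub>D\<^esub> ((x i \<ominus>\<^bsub>D\<^esub> x' i) \<oplus>\<^bsub>D\<^esub> x' i)" by simp
    then show "cf i a \<odot>\<^bsub>D\<^esub> x i = cf i a \<odot>\<^bsub>D\<^esub> (x i \<ominus>\<^bsub>D\<^esub> x' i) \<oplus>\<^bsub>D\<^esub> cf i a \<odot>\<^bsub>D\<^esub> x' i"
      using x i a cf_closed D.smult_r_distr[of "cf i a" "x i \<ominus>\<^bsub>D\<^esub> x' i" "x' i"] by simp
  qed (use x a cf_closed in auto)
  also have "\<dots> = extend D (\<lambda>i. x i \<ominus>\<^bsub>D\<^esub> x' i) a \<oplus>\<^bsub>D\<^esub> extend D x' a"
    unfolding extend_def using x a cf_closed by (intro D.M.finsum_addf) auto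
  finally show ?thesis using cl by (simp add: D.M.diff_simps)
qed

lemma extend_mem:
  assumes "module K D" and N: "submodule K N D" and "\<And>i. i \<in> I \<Longrightarrow> x i \<in> N" and a: "a \<in> carrier H"
  shows "extend D x a \<in> N"
proof -
  interpret D: module K D by fact
  show ?thesis unfolding extend_def
    using submodule.zero_closed[OF N] submodule.m_closed[OF N] submodule.subset[OF N]
      submodule.smult_closed[OF N] assms(3) cf_closed a
    by (intro finsum_mem[OF D.M.abelian_monoid_axioms fin]) auto
qed

lemma extend_cong:
  assumes "module K D" "\<And>i. i \<in> I \<Longrightarrow> x i = y i" "\<And>i. i \<in> I \<Longrightarrow> y i \<in> carrier D" "a \<in> carrier H"
  shows "extend D x a = extend D y a"
proof -
  interpret D: module K D by fact
  show ?thesis unfolding extend_def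
    by (rule D.M.finsum_cong'[OF refl]) (use assms cf_closed in auto)
qed

definition extend2 :: "('k, 'd) dgca \<Rightarrow> ('i \<Rightarrow> 'i \<Rightarrow> 'd) \<Rightarrow> 'h \<Rightarrow> 'h \<Rightarrow> 'd" where
  "extend2 D y a b = extend D (\<lambda>i. extend D (y i) b) a"

lemma linear_in_both_partial:
  assumes "linear_in_both K H D F" "x \<in> carrier H"
  shows "F x \<in> module_hom K H D" "(\<lambda>y. F y x) \<in> module_hom K H D"
  using linear_in_bothD[OF assms(1)] assms(2) by (auto simp: module_hom_def)

lemma extend2_linear:
  assumes m: "module K D" and y: "\<And>i j. i \<in> I \<Longrightarrow> j \<in> I \<Longrightarrow> y i j \<in> carrier D"
  shows "linear_in_both K H D (extend2 D y)"
proof -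
  interpret D: module K D by fact
  have inner: "extend D (y i) b \<in> carrier D" if "i \<in> I" "b \<in> carrier H" for i b
    by (rule extend_closed[OF m _ that(2)]) (use y that in auto)
  have 1: "(\<lambda>a. extend2 D y a b) \<in> module_hom K H D" if "b \<in> carrier H" for b
    unfolding extend2_def using extend_hom[OF m, of "\<lambda>i. extend D (y i) b"] inner that by simp
  have ih: "extend D (y i) \<in> module_hom K H D" if "i \<in> I" for i using extend_hom[OF m] y that by blast
  note ih = module_hom_facts[OF H_module m ih]
  have sum: "extend2 D y a (b \<oplus>\<^bsub>H\<^esub> b') = extend2 D y a b \<oplus>\<^bsub>D\<^esub> extend2 D y a b'"
    if "a \<in> carrier H" "b \<in> carrier H" "b' \<in> carrier H" for a b b'
  proof -
    have "extend2 D y a (b \<oplus>\<^bsub>H\<^esub> b') = (\<Oplus>\<^bsub>D\<^esub> i\<in>I. cf i a \<odot>\<^bsub>D\<^esub> extend D (y i) b \<oplus>\<^bsub>D\<^esub> cf i a \<odot>\<^bsub>D\<^esub> extend D (y i) b')"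
      unfolding extend2_def extend_def[of D "\<lambda>i. extend D (y i) (b \<oplus>\<^bsub>H\<^esub> b')"]
      by (rule D.M.finsum_cong'[OF refl]) (use that inner cf_closed ih(2) D.smult_r_distr in auto)
    also have "\<dots> = extend2 D y a b \<oplus>\<^bsub>D\<^esub> extend2 D y a b'"
      unfolding extend2_def extend_def[of D "\<lambda>i. extend D (y i) b"] extend_def[of D "\<lambda>i. extend D (y i) b'"]
      using that inner cf_closed by (intro D.M.finsum_addf) auto
    finally show ?thesis .
  qed
  have smult: "extend2 D y a (c \<odot>\<^bsub>H\<^esub> b) = c \<odot>\<^bsub>D\<^esub> extend2 D y a b"
    if "a \<in> carrier H" "b \<in> carrier H" "c \<in> carrier K" for a b c
  proof -
    have "extend2 D y a (c \<odot>\<^bsub>H\<^esub> b) = (\<Oplus>\<^bsub>D\<^esub> i\<in>I. c \<odot>\<^bsub>D\<^esub> (cf i a \<odot>\<^bsub>D\<^esub> extend D (y i) b))"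
      unfolding extend2_def extend_def[of D "\<lambda>i. extend D (y i) (c \<odot>\<^bsub>H\<^esub> b)"]
    proof (rule D.M.finsum_cong'[OF refl])
      fix i assume i: "i \<in> I"
      show "cf i a \<odot>\<^bsub>D\<^esub> extend D (y i) (c \<odot>\<^bsub>H\<^esub> b) = c \<odot>\<^bsub>D\<^esub> (cf i a \<odot>\<^bsub>D\<^esub> extend D (y i) b)"
        using that i inner cf_closed ih(3)[OF i]
          D.smult_assoc1[of "cf i a" c "extend D (y i) b"] D.smult_assoc1[of c "cf i a" "extend D (y i) b"]
        by (simp add: R.m_comm)
    qed (use that inner cf_closed in auto)
    also have "\<dots> = c \<odot>\<^bsub>D\<^esub> extend2 D y a b"
      unfolding extend2_def extend_def[of D "\<lambda>i. extend D (y i) b"]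
      using that fin inner cf_closed D.smult_r_distr D.M.abelian_group_axioms
      by (intro additive_finsum[symmetric]) auto
    finally show ?thesis .
  qed
  note l = module_hom_facts[OF H_module m 1]
  show ?thesis unfolding linear_in_both_def
    by (intro conjI ballI) (simp_all add: l(1-3) sum smult)
qed

lemma extend2_gr:
  assumes "dgca K D" and y: "\<And>i j. i \<in> I \<Longrightarrow> j \<in> I \<Longrightarrow> y i j \<in> gr D (dg i + dg j - 1)"
    and ab: "a \<in> gr H k" "b \<in> gr H l"
  shows "extend2 D y a b \<in> gr D (k + l - 1)"
proof -
  have "extend D (y i) b \<in> gr D (dg i + (l - 1))" if "i \<in> I" for i
    using extend_gr[OF assms(1), of "y i" "dg i - 1" b l] y[OF that] ab(2) by (simp add: algebra_simps)
  then show ?thesis using extend_gr[OF assms(1), of "\<lambda>i. extend D (y i) b" "l - 1" a k] ab(1)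
    by (simp add: extend2_def algebra_simps)
qed

lemma hom_extend2:
  assumes "module K C" "module K D" "g \<in> module_hom K C D" and y: "\<And>i j. i \<in> I \<Longrightarrow> j \<in> I \<Longrightarrow> y i j \<in> carrier C"
    and a: "a \<in> carrier H" "b \<in> carrier H"
  shows "g (extend2 C y a b) = extend2 D (\<lambda>i j. g (y i j)) a b"
proof -
  have "extend C (y i) b \<in> carrier C" if "i \<in> I" for i
    by (rule extend_closed[OF assms(1) _ a(2)]) (use y that in auto)
  moreover have "g (extend C (y i) b) = extend D (\<lambda>j. g (y i j)) b" if "i \<in> I" for i
    using hom_extend[OF assms(1-3)] y that a by blast
  moreover have "extend D (\<lambda>j. g (y i j)) b \<in> carrier D" if "i \<in> I" for i
    by (rule extend_closed[OF assms(2) _ a(2)]) (use y that module_hom_facts(1)[OF assms(1-3)] in auto)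
  ultimately show ?thesis unfolding extend2_def
    using hom_extend[OF assms(1-3), of "\<lambda>i. extend C (y i) b" a] a
      extend_cong[OF assms(2), of "\<lambda>i. g (extend C (y i) b)" "\<lambda>i. extend D (\<lambda>j. g (y i j)) b" a]
    by simp
qed

lemma linear_in_both_eq_extend2:
  assumes m: "module K D" and F: "linear_in_both K H D F" and a: "a \<in> carrier H" "b \<in> carrier H"
  shows "F a b = extend2 D (\<lambda>i j. F (e i) (e j)) a b"
proof -
  have "F (e i) b = extend D (\<lambda>j. F (e i) (e j)) b" if "i \<in> I" for i
    using hom_eq_extend[OF m linear_in_both_partial(1)[OF F e_closed[OF that]] a(2)] .
  moreover have "F (e i) b \<in> carrier D" if "i \<in> I" for i
    using linear_in_bothD(1)[OF F e_closed[OF that] a(2)] .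
  ultimately show ?thesis unfolding extend2_def
    using hom_eq_extend[OF m linear_in_both_partial(2)[OF F a(2)] a(1)]
      extend_cong[OF m, of "\<lambda>i. F (e i) b" "\<lambda>i. extend D (\<lambda>j. F (e i) (e j)) b" a] a by auto
qed

text \<open>Carries identities modulo a submodule from the spanning family to all arguments, since a
  bilinear map is the extension of its values. It is applied with the coboundaries and with the zero
  submodule.\<close>

lemma extend2_sub_mem:
  assumes m: "module K D" and y: "\<And>i j. i \<in> I \<Longrightarrow> j \<in> I \<Longrightarrow> y i j \<in> carrier D"
    and F: "linear_in_both K H D F" and N: "submodule K N D"
    and yN: "\<And>i j. i \<in> I \<Longrightarrow> j \<in> I \<Longrightarrow> y i j \<ominus>\<^bsub>D\<^esub> F (e i) (e j) \<in> N" and a: "a \<in> carrier H" "b \<in> carrier H"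
  shows "extend2 D y a b \<ominus>\<^bsub>D\<^esub> F a b \<in> N"
proof -
  interpret D: module K D by fact
  have Fc: "F (e i) (e j) \<in> carrier D" if "i \<in> I" "j \<in> I" for i j
    using linear_in_bothD(1)[OF F e_closed e_closed] that by blast
  have c: "extend D x b \<in> carrier D" if "\<And>j. j \<in> I \<Longrightarrow> x j \<in> carrier D" for x
    by (rule extend_closed[OF m that a(2)])
  have "extend2 D y a b \<ominus>\<^bsub>D\<^esub> F a b =
      extend D (\<lambda>i. extend D (y i) b \<ominus>\<^bsub>D\<^esub> extend D (\<lambda>j. F (e i) (e j)) b) a"
    unfolding linear_in_both_eq_extend2[OF m F a] extend2_def
    using c y Fc a by (intro extend_sub[OF m, symmetric]) auto
  also have "\<dots> \<in> N"
  proof (rule extend_mem[OF m N _ a(1)])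
    fix i assume i: "i \<in> I"
    have "extend D (y i) b \<ominus>\<^bsub>D\<^esub> extend D (\<lambda>j. F (e i) (e j)) b = extend D (\<lambda>j. y i j \<ominus>\<^bsub>D\<^esub> F (e i) (e j)) b"
      using extend_sub[OF m, of "y i" "\<lambda>j. F (e i) (e j)" b] y Fc i a by simp
    also have "\<dots> \<in> N" by (rule extend_mem[OF m N _ a(2)]) (use yN[OF i] in auto)
    finally show "extend D (y i) b \<ominus>\<^bsub>D\<^esub> extend D (\<lambda>j. F (e i) (e j)) b \<in> N" .
  qed
  finally show ?thesis .
qed

end

lemma (in dgca) coboundaries_submodule: "submodule K (coboundaries A) A"
  unfolding submodule_def using coboundary_closed coboundary_zero coboundary_add coboundary_smult is_module
  by auto

lemma (in dgca) zero_submodule: "submodule K {\<zero>\<^bsub>A\<^esub>} A"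
  unfolding submodule_def using is_module by auto

lemma (in dgca_over) product_linear:
  assumes "s \<in> module_hom K H D"
  shows "linear_in_both K H D (\<lambda>a b. s a \<otimes>\<^bsub>D\<^esub> s b \<ominus>\<^bsub>D\<^esub> s (a \<otimes>\<^bsub>H\<^esub> b))"
proof -
  note s = module_hom_facts[OF H_module D.is_module assms]
  show ?thesis unfolding linear_in_both_def
    by (intro conjI ballI) (simp_all add: s(1-3) D.B.l_distr D.B.r_distr H.B.l_distr H.B.r_distr
      D.smult_mult_left D.smult_mult_right H.smult_mult_left H.smult_mult_right D.M.diff_simps D.M.a_ac
      a_minus_def[of D "_ \<odot>\<^bsub>D\<^esub> _"] D.smult_r_distr D.smult_r_minus a_minus_def D.M.minus_add)
qed

section \<open>Moving transfer data along quasi-isomorphisms\<close>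

lemma quasi_isoD:
  assumes "quasi_iso K C D f"
  shows "dgca K C" "dgca K D" "f \<in> dgca_hom K C D"
    "\<And>y. y \<in> cocycles D \<Longrightarrow> \<exists>x\<in>cocycles C. y \<ominus>\<^bsub>D\<^esub> f x \<in> coboundaries D"
    "\<And>x. x \<in> cocycles C \<Longrightarrow> f x \<in> coboundaries D \<Longrightarrow> x \<in> coboundaries C"
proof -
  show d: "dgca K C" "dgca K D" "f \<in> dgca_hom K C D" using assms by (auto simp: quasi_iso_def)
  show "\<And>y. y \<in> cocycles D \<Longrightarrow> \<exists>x\<in>cocycles C. y \<ominus>\<^bsub>D\<^esub> f x \<in> coboundaries D"
    "\<And>x. x \<in> cocycles C \<Longrightarrow> f x \<in> coboundaries D \<Longrightarrow> x \<in> coboundaries C"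
    using assms unfolding quasi_iso_iff[OF d] by blast+
qed

text \<open>Taking the component of degree \<open>k\<close> of an arbitrary lift makes both the lift
  and the correcting primitive homogeneous, so that they can serve as values of graded maps.\<close>

lemma quasi_iso_homogeneous_lift:
  assumes q: "quasi_iso K C D f" and y: "y \<in> cocycles D" "y \<in> gr D k"
  shows "\<exists>x\<in>cocycles C \<inter> gr C k. \<exists>w\<in>gr D (k - 1). f x = y \<oplus>\<^bsub>D\<^esub> diff D w"
proof -
  note q = quasi_isoD[OF q]
  interpret C: dgca K C by (rule q)
  interpret D: dgca K D by (rule q)
  note f = dgca_homD[OF q(1-3)]
  obtain x where x: "x \<in> cocycles C" "y \<ominus>\<^bsub>D\<^esub> f x \<in> coboundaries D" using q(4)[OF y(1)] by blast
  have xc: "x \<in> carrier C" and yc: "y \<in> carrier D" using x y C.cocycle_closed D.cocycle_closed by auto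
  have cf: "component D k (f x) = f (component C k x)"
    using component_graded_hom[of K C D f 0 x k] f(2,3,11) C.graded_comm_algebra_axioms
      D.graded_comm_algebra_axioms xc by simp
  have "component D k (y \<ominus>\<^bsub>D\<^esub> f x) = y \<ominus>\<^bsub>D\<^esub> f (component C k x)"
    using D.component_homogeneous[OF y(2), of k] f(2) xc yc by (simp add: D.component_diff cf)
  then have b: "y \<ominus>\<^bsub>D\<^esub> f (component C k x) \<in> coboundaries D"
    using D.component_coboundary[OF x(2), of k] by simp
  have fx: "f (component C k x) \<in> gr D k" using f(11) xc by simp
  obtain w where w: "w \<in> gr D (k - 1)" "y \<ominus>\<^bsub>D\<^esub> f (component C k x) = diff D w"
    using D.homogeneous_coboundary[OF b D.gr_diff[OF y(2) fx]] by blast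
  have wc: "w \<in> carrier D" using w D.gr_closed by blast
  have "f (component C k x) = y \<oplus>\<^bsub>D\<^esub> diff D (\<ominus>\<^bsub>D\<^esub> w)"
    using w(2) wc yc D.gr_closed[OF fx] by (simp add: D.d_minus D.M.diff_simps D.M.diff_simps2 D.M.a_ac)
  then show ?thesis using x xc w D.gr_minus C.component_cocycle by (intro bexI[of _ "component C k x"] bexI[of _ "\<ominus>\<^bsub>D\<^esub> w"]) auto
qed

lemma transfers_push:
  assumes q: "quasi_iso K C D f" and H: "graded_comm_algebra K H" and tr: "transfers K H C m s \<eta>"
    and m: "closed3 H m"
  shows "transfers K H D m (\<lambda>a. f (s a)) (\<lambda>a b. f (\<eta> a b))"
proof -
  note q = quasi_isoD[OF q]
  interpret H: graded_comm_algebra K H by fact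
  interpret C: dgca_over K C H by (simp add: dgca_over_def q H)
  interpret D: dgca_over K D H by (simp add: dgca_over_def q H)
  note f = dgca_homD[OF q(1-3)]
  have sec: "cohomology_section K H C s" and hty: "product_homotopy K H C s \<eta>"
    and mas: "\<And>a b c j k l. a \<in> gr H j \<Longrightarrow> b \<in> gr H k \<Longrightarrow> c \<in> gr H l \<Longrightarrow> massey H C s \<eta> j a b c \<ominus>\<^bsub>C\<^esub> s (m a b c) \<in> coboundaries C"
    using tr unfolding transfers_def by blast+
  note s = C.cohomology_sectionD[OF sec] and h = C.product_homotopyD[OF hty]
  note \<eta> = linear_in_bothD[OF h(1)]
  have "cohomology_section K H D (\<lambda>a. f (s a))"
    unfolding cohomology_section_def
  proof (intro conjI allI ballI impI)
    show "(\<lambda>a. f (s a)) \<in> module_hom K H D" using s(2-4) f by (simp add: module_hom_def)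
    show "\<exists>a\<in>carrier H. y \<ominus>\<^bsub>D\<^esub> f (s a) \<in> coboundaries D" if y: "y \<in> cocycles D" for y
    proof -
      obtain x where x: "x \<in> cocycles C" "y \<ominus>\<^bsub>D\<^esub> f x \<in> coboundaries D" using q(4)[OF y] by blast
      obtain a where a: "a \<in> carrier H" "x \<ominus>\<^bsub>C\<^esub> s a \<in> coboundaries C" using s(10)[OF x(1)] by blast
      have xc: "x \<in> carrier C" "y \<in> carrier D" using x y C.D.cocycle_closed D.D.cocycle_closed by auto
      have "f (x \<ominus>\<^bsub>C\<^esub> s a) \<in> coboundaries D" using f(13) a by blast
      then have "(y \<ominus>\<^bsub>D\<^esub> f x) \<oplus>\<^bsub>D\<^esub> (f x \<ominus>\<^bsub>D\<^esub> f (s a)) \<in> coboundaries D"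
        using D.D.coboundary_add[OF x(2)] f(8) xc s(2) a by simp
      moreover have "(y \<ominus>\<^bsub>D\<^esub> f x) \<oplus>\<^bsub>D\<^esub> (f x \<ominus>\<^bsub>D\<^esub> f (s a)) = y \<ominus>\<^bsub>D\<^esub> f (s a)"
        using xc f(2) s(2) a by (simp add: D.D.M.diff_simps D.D.M.a_ac)
      ultimately show ?thesis using a by auto
    qed
    show "f (s \<one>\<^bsub>H\<^esub>) \<ominus>\<^bsub>D\<^esub> \<one>\<^bsub>D\<^esub> \<in> coboundaries D"
      using f(13)[OF s(12)] f(8,10) s(2) by simp
  qed (use s f q(5) in auto)
  moreover have "product_homotopy K H D (\<lambda>a. f (s a)) (\<lambda>a b. f (\<eta> a b))"
    unfolding product_homotopy_def
  proof (intro conjI allI ballI)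
    show "linear_in_both K H D (\<lambda>a b. f (\<eta> a b))" using \<eta> f by (simp add: linear_in_both_def)
    show "f (\<eta> a b) \<ominus>\<^bsub>D\<^esub> [neg1_pow (k * l)] \<cdot>\<^bsub>D\<^esub> f (\<eta> b a) \<in> coboundaries D"
      if ab: "a \<in> gr H k" "b \<in> gr H l" for a b k l
    proof -
      have "a \<in> carrier H" "b \<in> carrier H" using ab H.gr_closed by auto
      then have "f (\<eta> a b \<ominus>\<^bsub>C\<^esub> [neg1_pow (k * l)] \<cdot>\<^bsub>C\<^esub> \<eta> b a) = f (\<eta> a b) \<ominus>\<^bsub>D\<^esub> [neg1_pow (k * l)] \<cdot>\<^bsub>D\<^esub> f (\<eta> b a)"
        using \<eta>(1) f(2,7,8) by (simp add: C.D.M.add_neg1_pow D.D.M.add_neg1_pow)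
      then show ?thesis using f(13)[OF h(3)[OF ab]] by simp
    qed
    show "diff D (f (\<eta> a b)) = f (s a) \<otimes>\<^bsub>D\<^esub> f (s b) \<ominus>\<^bsub>D\<^esub> f (s (a \<otimes>\<^bsub>H\<^esub> b))" if "a \<in> carrier H" "b \<in> carrier H" for a b
      using f(6)[OF \<eta>(1)[OF that]] h(4)[OF that] f(4,8) s(2) that by simp
  qed (use h(2) f(11) in auto)
  moreover have "massey H D (\<lambda>a. f (s a)) (\<lambda>a b. f (\<eta> a b)) j a b c \<ominus>\<^bsub>D\<^esub> f (s (m a b c)) \<in> coboundaries D"
    if abc: "a \<in> gr H j" "b \<in> gr H k" "c \<in> gr H l" for a b c j k l
  proof -
    have c: "a \<in> carrier H" "b \<in> carrier H" "c \<in> carrier H" using abc H.gr_closed by auto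
    have mc: "massey H C s \<eta> j a b c \<in> carrier C"
      using C.D.cocycle_closed[OF C.massey_cocycle[OF sec hty abc(1) c(2,3)]] .
    have "f (massey H C s \<eta> j a b c) = massey H D (\<lambda>a. f (s a)) (\<lambda>a b. f (\<eta> a b)) j a b c"
      unfolding massey_def using c s(2) \<eta>(1) f by (simp add: C.D.M.add_neg1_pow D.D.M.add_neg1_pow)
    then show ?thesis using f(13)[OF mas[OF abc]] f(8)[OF mc s(2)[OF closed3D[OF m c]]] by simp
  qed
  ultimately show ?thesis unfolding transfers_def by blast
qed

text \<open>Lifts of the section values map back to them only up to exact terms. Gauging the data on
  \<open>D\<close> removes this discrepancy, so that \<open>f\<close> carries the lifted section to
  the new one strictly. The homotopy is then lifted modulo coboundaries, which suffices because a
  cocycle of \<open>C\<close> is exact as soon as its image is.\<close>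

lemma (in homogeneous_coordinates) transfers_lift:
  fixes D :: "('k, 'd) dgca" (structure)
  assumes qi: "quasi_iso K C D f" and tr: "transfers K H D m so \<eta>o" and m: "closed3 H m"
  shows "\<exists>s \<eta>. transfers K H C m s \<eta>"
proof -
  note q = quasi_isoD[OF qi]
  have H: "graded_comm_algebra K H" by (rule graded_comm_algebra_axioms)
  interpret C: dgca_over K C H by (simp add: dgca_over_def q H)
  interpret D: dgca_over K D H by (simp add: dgca_over_def q H)
  note f = dgca_homD[OF q(1-3)]
  have sec0: "cohomology_section K H D so" using tr by (simp add: transfers_def)
  note s0 = D.cohomology_sectionD[OF sec0]
  have "\<exists>x w. x \<in> cocycles C \<and> x \<in> gr C (dg i) \<and> w \<in> gr D (dg i - 1) \<and> f x = so (e i) \<oplus> diff D w" if "i \<in> I" for i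
    using quasi_iso_homogeneous_lift[OF qi s0(8)[OF e_closed[OF that]] s0(7)[OF e_gr[OF that]]] by blast
  then obtain x w where xw: "\<And>i. i \<in> I \<Longrightarrow> x i \<in> cocycles C" "\<And>i. i \<in> I \<Longrightarrow> x i \<in> gr C (dg i)"
    "\<And>i. i \<in> I \<Longrightarrow> w i \<in> gr D (dg i - 1)" "\<And>i. i \<in> I \<Longrightarrow> f (x i) = so (e i) \<oplus> diff D (w i)" by metis
  have xc: "x i \<in> carrier C" and wc: "w i \<in> carrier D" if "i \<in> I" for i
    using xw that C.D.gr_closed D.D.gr_closed by blast+
  define s where "s = extend C x"
  define t where "t = extend D w"
  have sh: "s \<in> module_hom K H C" unfolding s_def by (rule extend_hom[OF C.D.is_module xc])
  have th: "t \<in> module_hom K H D" unfolding t_def by (rule extend_hom[OF D.D.is_module wc])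
  note sh' = module_hom_facts[OF H_module C.D.is_module sh]
  note th' = module_hom_facts[OF H_module D.D.is_module th]
  have sg: "s a \<in> gr C k" if "a \<in> gr H k" for a k
    using extend_gr[OF q(1), of x 0 a k] xw(2) that by (simp add: s_def)
  have tg: "t a \<in> gr D (k - 1)" if "a \<in> gr H k" for a k
    using extend_gr[OF q(2), of w "-1" a k] xw(3) that by (simp add: t_def)
  \<comment> \<open>The gauge map extends the primitives \<open>w i\<close>, so the new section on
    \<open>D\<close> is the image of \<open>s\<close>.\<close>
  obtain \<eta>' where tr': "transfers K H D m (\<lambda>a. so a \<oplus> diff D (t a)) \<eta>'"
    using D.transfers_gauge[OF tr th tg m] by blast
  define s' where "s' = (\<lambda>a. so a \<oplus> diff D (t a))"
  have sec': "cohomology_section K H D s'" and hty': "product_homotopy K H D s' \<eta>'"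
    and mas': "\<And>a b c j k l. a \<in> gr H j \<Longrightarrow> b \<in> gr H k \<Longrightarrow> c \<in> gr H l \<Longrightarrow> massey H D s' \<eta>' j a b c \<ominus> s' (m a b c) \<in> coboundaries D"
    using tr' unfolding transfers_def s'_def by blast+
  note s' = D.cohomology_sectionD[OF sec'] and h' = D.product_homotopyD[OF hty']
  note \<eta>' = linear_in_bothD[OF h'(1)]
  have fs: "f (s a) = s' a" if a: "a \<in> carrier H" for a
  proof -
    have 1: "f (s a) = extend D (\<lambda>i. f (x i)) a"
      unfolding s_def by (rule hom_extend[OF C.D.is_module D.D.is_module f(1) xc a])
    have 2: "s' a = extend D (\<lambda>i. s' (e i)) a" by (rule hom_eq_extend[OF D.D.is_module s'(1) a])
    have dt: "(\<lambda>a. diff D (t a)) \<in> module_hom K H D"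
      using th' by (simp add: module_hom_def D.D.d_add D.D.d_smult)
    have "extend D (\<lambda>i. f (x i)) a \<ominus> so a = extend D (\<lambda>i. f (x i) \<ominus> so (e i)) a"
      unfolding hom_eq_extend[OF D.D.is_module s0(1) a]
      using extend_sub[OF D.D.is_module, of "\<lambda>i. f (x i)" "\<lambda>i. so (e i)" a] f(2) xc s0(2) e_closed a by simp
    also have "\<dots> = extend D (\<lambda>i. diff D (w i)) a"
      by (rule extend_cong[OF D.D.is_module])
        (use xw(4) s0(2) e_closed wc a in \<open>auto simp: D.D.M.diff_simps D.D.M.a_ac\<close>)
    also have "\<dots> = diff D (t a)"
      unfolding t_def using hom_extend[OF D.D.is_module D.D.is_module D.D.diff_linear wc a] by simp
    finally have 3: "extend D (\<lambda>i. f (x i)) a \<ominus> so a = diff D (t a)" .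
    have ec: "extend D (\<lambda>i. f (x i)) a \<in> carrier D"
      by (rule extend_closed[OF D.D.is_module _ a]) (use f(2) xc in auto)
    have "extend D (\<lambda>i. f (x i)) a = so a \<oplus> diff D (t a)"
      using 3 ec s0(2)[OF a] th'(1)[OF a] by (simp add: D.D.M.diff_simps D.D.M.a_ac)
    then show ?thesis unfolding 1 s'_def .
  qed
  have scoc: "s a \<in> cocycles C" if "a \<in> carrier H" for a
  proof -
    have "submodule K (cocycles C) C"
      unfolding submodule_def using C.D.cocycle_closed C.D.cocycle_add C.D.cocycle_smult C.D.cocycle_zero C.D.is_module by auto
    then show ?thesis unfolding s_def using extend_mem[OF C.D.is_module] xw(1) that by blast
  qed
  have sec: "cohomology_section K H C s"
    unfolding cohomology_section_def
  proof (intro conjI allI ballI impI)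
    show "\<exists>a\<in>carrier H. y \<ominus>\<^bsub>C\<^esub> s a \<in> coboundaries C" if y: "y \<in> cocycles C" for y
    proof -
      obtain a where a: "a \<in> carrier H" "f y \<ominus> s' a \<in> coboundaries D" using s'(10) f(12)[OF y] by blast
      then have "f (y \<ominus>\<^bsub>C\<^esub> s a) \<in> coboundaries D" using f(8) C.D.cocycle_closed y sh'(1) fs by simp
      then show ?thesis using q(5) C.D.cocycle_diff y scoc a by blast
    qed
    show "a = \<zero>\<^bsub>H\<^esub>" if a: "a \<in> carrier H" "s a \<in> coboundaries C" for a
      using s'(11)[OF a(1)] f(13)[OF a(2)] fs[OF a(1)] by simp
    have "f (s \<one>\<^bsub>H\<^esub> \<ominus>\<^bsub>C\<^esub> \<one>\<^bsub>C\<^esub>) \<in> coboundaries D" using s'(12) f(8,10) fs sh'(1) by simp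
    then show "s \<one>\<^bsub>H\<^esub> \<ominus>\<^bsub>C\<^esub> \<one>\<^bsub>C\<^esub> \<in> coboundaries C"
      using q(5) C.D.cocycle_diff scoc C.D.cocycle_one by blast
  qed (use sh sg scoc in auto)
  note s = C.cohomology_sectionD[OF sec]
  \<comment> \<open>The primitive \<open>y0\<close> of the defect is free up to a cocycle. Lifting
    the cocycle \<open>?v\<close>, which compares the image of \<open>y0\<close> with
    \<open>\<eta>'\<close>, and subtracting the lift makes the image agree with
    \<open>\<eta>'\<close> modulo coboundaries.\<close>
  have "\<exists>y. y \<in> gr C (dg i + dg j - 1) \<and> diff C y = s (e i) \<otimes>\<^bsub>C\<^esub> s (e j) \<ominus>\<^bsub>C\<^esub> s (e i \<otimes>\<^bsub>H\<^esub> e j) \<and>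
      f y \<ominus> \<eta>' (e i) (e j) \<in> coboundaries D" if ij: "i \<in> I" "j \<in> I" for i j
  proof -
    have ec: "e i \<in> carrier H" "e j \<in> carrier H" using e_closed ij by auto
    let ?u = "s (e i) \<otimes>\<^bsub>C\<^esub> s (e j) \<ominus>\<^bsub>C\<^esub> s (e i \<otimes>\<^bsub>H\<^esub> e j)"
    have u: "?u \<in> cocycles C" using s(8) ec C.D.cocycle_mult C.D.cocycle_diff by simp
    have ug: "?u \<in> gr C (dg i + dg j)"
      by (rule C.D.gr_diff[OF C.D.mult_gr[OF s(7)[OF e_gr[OF ij(1)]] s(7)[OF e_gr[OF ij(2)]]]
        s(7)[OF mult_gr[OF e_gr[OF ij(1)] e_gr[OF ij(2)]]]])
    have fu: "f ?u = diff D (\<eta>' (e i) (e j))"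
      using h'(4)[OF ec] f(4,8) s(2) ec fs by simp
    then have "?u \<in> coboundaries C" using q(5)[OF u] D.D.coboundary_d[OF \<eta>'(1)[OF ec]] by simp
    then obtain y0 where y0: "y0 \<in> gr C (dg i + dg j - 1)" "?u = diff C y0"
      using C.D.homogeneous_coboundary[OF _ ug] by blast
    have y0c: "y0 \<in> carrier C" using y0 C.D.gr_closed by blast
    let ?v = "f y0 \<ominus> \<eta>' (e i) (e j)"
    have v: "?v \<in> cocycles D" using f(2,6) y0c \<eta>'(1)[OF ec] y0(2) fu
      by (simp add: D.D.cocycles_iff D.D.d_diff D.D.sub_self)
    have vg: "?v \<in> gr D (dg i + dg j - 1)"
      using D.D.gr_diff f(11) y0 h'(2)[OF e_gr[OF ij(1)] e_gr[OF ij(2)]] by blast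
    obtain z b where z: "z \<in> cocycles C" "z \<in> gr C (dg i + dg j - 1)" "b \<in> carrier D" "f z = ?v \<oplus> diff D b"
      using quasi_iso_homogeneous_lift[OF qi v vg] D.D.gr_closed by blast
    have zc: "z \<in> carrier C" using z C.D.cocycle_closed by blast
    have "f (y0 \<ominus>\<^bsub>C\<^esub> z) \<ominus> \<eta>' (e i) (e j) = diff D (\<ominus> b)"
      unfolding f(8)[OF y0c zc] z(4)
      using f(2) y0c z(3) \<eta>'(1)[OF ec] by (simp add: D.D.d_minus D.D.M.diff_simps D.D.M.diff_simps2 D.D.M.a_ac)
    then have "f (y0 \<ominus>\<^bsub>C\<^esub> z) \<ominus> \<eta>' (e i) (e j) \<in> coboundaries D"
      using D.D.coboundary_d[of "\<ominus> b"] z(3) by simp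
    moreover have "diff C (y0 \<ominus>\<^bsub>C\<^esub> z) = ?u"
    proof -
      have "diff C z = \<zero>\<^bsub>C\<^esub>" using z(1) by (simp add: C.D.cocycles_iff)
      then have "diff C (y0 \<ominus>\<^bsub>C\<^esub> z) = diff C y0" using y0c zc by (simp add: C.D.d_diff) (simp add: a_minus_def)
      then show ?thesis using y0(2) by simp
    qed
    moreover have "y0 \<ominus>\<^bsub>C\<^esub> z \<in> gr C (dg i + dg j - 1)" using C.D.gr_diff y0 z by blast
    ultimately show ?thesis by blast
  qed
  then obtain y where y: "\<And>i j. i \<in> I \<Longrightarrow> j \<in> I \<Longrightarrow> y i j \<in> gr C (dg i + dg j - 1)"
    "\<And>i j. i \<in> I \<Longrightarrow> j \<in> I \<Longrightarrow> diff C (y i j) = s (e i) \<otimes>\<^bsub>C\<^esub> s (e j) \<ominus>\<^bsub>C\<^esub> s (e i \<otimes>\<^bsub>H\<^esub> e j)"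
    "\<And>i j. i \<in> I \<Longrightarrow> j \<in> I \<Longrightarrow> f (y i j) \<ominus> \<eta>' (e i) (e j) \<in> coboundaries D" by metis
  have yc: "y i j \<in> carrier C" if "i \<in> I" "j \<in> I" for i j using y(1)[OF that] C.D.gr_closed by blast
  define \<eta> where "\<eta> = extend2 C y"
  have \<eta>l: "linear_in_both K H C \<eta>" unfolding \<eta>_def by (rule extend2_linear[OF C.D.is_module yc])
  note \<eta> = linear_in_bothD[OF \<eta>l]
  have f\<eta>: "f (\<eta> a b) \<ominus> \<eta>' a b \<in> coboundaries D" if "a \<in> carrier H" "b \<in> carrier H" for a b
  proof -
    have *: "f (extend2 C y a b) = extend2 D (\<lambda>i j. f (y i j)) a b"
      by (rule hom_extend2[OF C.D.is_module D.D.is_module f(1) _ that]) (use yc in auto)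
    show ?thesis unfolding \<eta>_def *
    by (rule extend2_sub_mem[OF D.D.is_module _ h'(1) D.D.coboundaries_submodule _ that])
      (use f(2) yc y(3) in auto)
  qed
  have d\<eta>: "diff C (\<eta> a b) = s a \<otimes>\<^bsub>C\<^esub> s b \<ominus>\<^bsub>C\<^esub> s (a \<otimes>\<^bsub>H\<^esub> b)" if ab: "a \<in> carrier H" "b \<in> carrier H" for a b
  proof -
    have *: "diff C (extend2 C y a b) = extend2 C (\<lambda>i j. diff C (y i j)) a b"
      by (rule hom_extend2[OF C.D.is_module C.D.is_module C.D.diff_linear _ ab]) (use yc in auto)
    have "diff C (\<eta> a b) \<ominus>\<^bsub>C\<^esub> (s a \<otimes>\<^bsub>C\<^esub> s b \<ominus>\<^bsub>C\<^esub> s (a \<otimes>\<^bsub>H\<^esub> b)) \<in> {\<zero>\<^bsub>C\<^esub>}"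
      unfolding \<eta>_def *
      by (rule extend2_sub_mem[OF C.D.is_module _ C.product_linear[OF s(1)] C.D.zero_submodule _ ab])
        (use yc y(2) s(2) e_closed in \<open>auto simp: C.D.sub_self\<close>)
    then show ?thesis using \<eta>(1) s(2) ab by (simp add: C.D.M.diff_simps)
  qed
  have hty: "product_homotopy K H C s \<eta>"
    unfolding product_homotopy_def
  proof (intro conjI allI ballI)
    show "\<eta> a b \<in> gr C (k + l - 1)" if "a \<in> gr H k" "b \<in> gr H l" for a b k l
      unfolding \<eta>_def by (rule extend2_gr[OF q(1) y(1) that])
    show "\<eta> a b \<ominus>\<^bsub>C\<^esub> [neg1_pow (k * l)] \<cdot>\<^bsub>C\<^esub> \<eta> b a \<in> coboundaries C" if ab: "a \<in> gr H k" "b \<in> gr H l" for a b k l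
    \<comment> \<open>Exactness can be tested in \<open>D\<close>, where symmetry modulo
      coboundaries is known for \<open>\<eta>'\<close>.\<close>
    proof (rule q(5))
      have c: "a \<in> carrier H" "b \<in> carrier H" using ab gr_closed by auto
      let ?S = "\<lambda>x. [neg1_pow (k * l)] \<cdot> x"
      have 1: "s a \<otimes>\<^bsub>C\<^esub> s b = (if even (k * l) then s b \<otimes>\<^bsub>C\<^esub> s a else \<ominus>\<^bsub>C\<^esub> (s b \<otimes>\<^bsub>C\<^esub> s a))"
        using C.D.mult_commute_cases[OF s(7)[OF ab(1)] s(7)[OF ab(2)]] .
      have 2: "s (a \<otimes>\<^bsub>H\<^esub> b) = (if even (k * l) then s (b \<otimes>\<^bsub>H\<^esub> a) else \<ominus>\<^bsub>C\<^esub> s (b \<otimes>\<^bsub>H\<^esub> a))"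
        using mult_commute_cases[OF ab] s(5) c by auto
      have "diff C (\<eta> a b) = [neg1_pow (k * l)] \<cdot>\<^bsub>C\<^esub> diff C (\<eta> b a)"
        unfolding d\<eta>[OF c] d\<eta>[OF c(2,1)] 1 2 using c s(2) by (simp add: C.D.M.add_neg1_pow a_minus_def C.D.M.minus_add)
      then have "diff C (\<eta> a b \<ominus>\<^bsub>C\<^esub> [neg1_pow (k * l)] \<cdot>\<^bsub>C\<^esub> \<eta> b a) = \<zero>\<^bsub>C\<^esub>"
        using c \<eta>(1) by (simp add: C.D.d_diff C.D.d_minus C.D.M.add_neg1_pow C.D.sub_self)
      then show "\<eta> a b \<ominus>\<^bsub>C\<^esub> [neg1_pow (k * l)] \<cdot>\<^bsub>C\<^esub> \<eta> b a \<in> cocycles C"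
        using c \<eta>(1) by (simp add: C.D.cocycles_iff C.D.M.add_neg1_pow)
      have "f (\<eta> a b \<ominus>\<^bsub>C\<^esub> [neg1_pow (k * l)] \<cdot>\<^bsub>C\<^esub> \<eta> b a) = f (\<eta> a b) \<ominus> ?S (f (\<eta> b a))"
        using c \<eta>(1) f(2,7,8) by (simp add: C.D.M.add_neg1_pow D.D.M.add_neg1_pow)
      also have "\<dots> = ((f (\<eta> a b) \<ominus> \<eta>' a b) \<ominus> ?S (f (\<eta> b a) \<ominus> \<eta>' b a)) \<oplus> (\<eta>' a b \<ominus> ?S (\<eta>' b a))"
        using c \<eta>(1) \<eta>'(1) f(2) by (cases "even (k * l)") (simp_all add: D.D.M.add_neg1_pow D.D.M.diff_simps D.D.M.diff_simps2 D.D.M.a_ac)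
      also have "\<dots> \<in> coboundaries D"
      proof -
        have "?S (f (\<eta> b a) \<ominus> \<eta>' b a) \<in> coboundaries D"
          using f\<eta>[OF c(2,1)] D.D.coboundary_minus D.D.coboundary_closed by (simp add: D.D.M.add_neg1_pow)
        from D.D.coboundary_add[OF D.D.coboundary_diff[OF f\<eta>[OF c] this] h'(3)[OF ab]] show ?thesis .
      qed
      finally show "f (\<eta> a b \<ominus>\<^bsub>C\<^esub> [neg1_pow (k * l)] \<cdot>\<^bsub>C\<^esub> \<eta> b a) \<in> coboundaries D" .
    qed
  qed (use \<eta>l d\<eta> in auto)
  have "massey H C s \<eta> j a b c \<ominus>\<^bsub>C\<^esub> s (m a b c) \<in> coboundaries C"
    if abc: "a \<in> gr H j" "b \<in> gr H k" "c \<in> gr H l" for a b c j k l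
  proof (rule q(5))
    have cc: "a \<in> carrier H" "b \<in> carrier H" "c \<in> carrier H" using abc gr_closed by auto
    have mc: "m a b c \<in> carrier H" using closed3D[OF m cc] .
    have Mc: "massey H C s \<eta> j a b c \<in> cocycles C" using C.massey_cocycle[OF sec hty abc(1) cc(2,3)] .
    show "massey H C s \<eta> j a b c \<ominus>\<^bsub>C\<^esub> s (m a b c) \<in> cocycles C"
      using C.D.cocycle_diff[OF Mc s(8)[OF mc]] .
    let ?S = "\<lambda>x. [neg1_pow j] \<cdot> x"
    let ?\<epsilon> = "\<lambda>a b. f (\<eta> a b) \<ominus> \<eta>' a b"
    note cl = cc s'(2) \<eta>(1) \<eta>'(1) f(2)
    \<comment> \<open>Expands the Massey expression around \<open>\<eta>'\<close>. The first group
      is linear in the differences, which are coboundaries; the second is the expression for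
      \<open>\<eta>'\<close>.\<close>
    have split: "((((e1 \<otimes> p \<ominus> ?S (r \<otimes> e2)) \<oplus> e3) \<ominus> e4) \<ominus> v) =
      ((((e1 \<ominus> g1) \<otimes> p \<ominus> ?S (r \<otimes> (e2 \<ominus> g2))) \<oplus> (e3 \<ominus> g3)) \<ominus> (e4 \<ominus> g4)) \<oplus>
      ((((g1 \<otimes> p \<ominus> ?S (r \<otimes> g2)) \<oplus> g3) \<ominus> g4) \<ominus> v)"
      if "e1 \<in> carrier D" "e2 \<in> carrier D" "e3 \<in> carrier D" "e4 \<in> carrier D" "g1 \<in> carrier D" "g2 \<in> carrier D"
        "g3 \<in> carrier D" "g4 \<in> carrier D" "p \<in> carrier D" "r \<in> carrier D" "v \<in> carrier D"
      for e1 e2 e3 e4 g1 g2 g3 g4 p r v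
    proof -
      have e: "(e1 \<ominus> g1) \<otimes> p = e1 \<otimes> p \<ominus> g1 \<otimes> p" "r \<otimes> (e2 \<ominus> g2) = r \<otimes> e2 \<ominus> r \<otimes> g2"
        using that by (simp_all add: a_minus_def D.D.B.l_distr D.D.B.r_distr D.D.B.l_minus D.D.B.r_minus)
      show ?thesis unfolding e using that
        by (cases "even j") (simp_all add: D.D.M.add_neg1_pow D.D.M.diff_simps D.D.M.diff_simps2 D.D.M.a_ac)
    qed
    have "f (massey H C s \<eta> j a b c \<ominus>\<^bsub>C\<^esub> s (m a b c)) =
       ((((f (\<eta> a b) \<otimes> s' c \<ominus> ?S (s' a \<otimes> f (\<eta> b c))) \<oplus> f (\<eta> (a \<otimes>\<^bsub>H\<^esub> b) c)) \<ominus> f (\<eta> a (b \<otimes>\<^bsub>H\<^esub> c))) \<ominus> s' (m a b c))"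
      unfolding massey_def using cc mc \<eta>(1) s(2) s'(2) f(2-10) fs
      by (simp add: C.D.M.add_neg1_pow D.D.M.add_neg1_pow)
    also have "\<dots> = (((?\<epsilon> a b \<otimes> s' c \<ominus> ?S (s' a \<otimes> ?\<epsilon> b c)) \<oplus> ?\<epsilon> (a \<otimes>\<^bsub>H\<^esub> b) c) \<ominus> ?\<epsilon> a (b \<otimes>\<^bsub>H\<^esub> c)) \<oplus>
      (massey H D s' \<eta>' j a b c \<ominus> s' (m a b c))"
      unfolding massey_def by (rule split) (use cl mc in auto)
    also have "\<dots> \<in> coboundaries D"
    proof -
      have 1: "?\<epsilon> a b \<otimes> s' c \<in> coboundaries D"
        using D.D.coboundary_mult_right[OF f\<eta> s'(8)] cc by blast
      have "s' a \<otimes> ?\<epsilon> b c \<in> coboundaries D"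
        using D.D.coboundary_mult_left[OF s'(8) f\<eta>] cc by blast
      then have 2: "?S (s' a \<otimes> ?\<epsilon> b c) \<in> coboundaries D"
        using D.D.coboundary_minus D.D.coboundary_closed by (simp add: D.D.M.add_neg1_pow)
      have 3: "?\<epsilon> (a \<otimes>\<^bsub>H\<^esub> b) c \<in> coboundaries D" "?\<epsilon> a (b \<otimes>\<^bsub>H\<^esub> c) \<in> coboundaries D" using f\<eta> cc by auto
      show ?thesis
        using D.D.coboundary_add[OF D.D.coboundary_diff[OF D.D.coboundary_add[OF
          D.D.coboundary_diff[OF 1 2] 3(1)] 3(2)] mas'[OF abc]] .
    qed
    finally show "f (massey H C s \<eta> j a b c \<ominus>\<^bsub>C\<^esub> s (m a b c)) \<in> coboundaries D" .
  qed
  then show ?thesis using sec hty unfolding transfers_def by blast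
qed

section \<open>Invariance along zig-zags\<close>

context homogeneous_coordinates
begin

text \<open>The algebra \<open>H\<close> and the operation \<open>m\<close> stay fixed while the
  DGCA varies, so the property can be carried through the intermediate algebras of a
  zig-zag.\<close>

definition invariant :: "('k, 'd) dgca \<Rightarrow> ('h \<Rightarrow> 'h \<Rightarrow> 'h \<Rightarrow> 'h) \<Rightarrow> bool" where
  "invariant D m \<longleftrightarrow> (\<exists>s \<eta>. transfers K H D m s \<eta>)"

lemma invariant_quasi_iso:
  assumes "closed3 H m" "has_quasi_iso K C D"
  shows "invariant C m \<longleftrightarrow> invariant D m"
  using assms transfers_push[OF _ graded_comm_algebra_axioms] transfers_lift
  unfolding invariant_def has_quasi_iso_def by blast

lemma invariant_same_homotopy_class:
  fixes U :: "'u itself"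
  assumes m: "closed3 H m" and same: "same_homotopy_class U K A B" and inv: "invariant A m"
  shows "invariant B m"
proof -
  obtain C D :: "('k, ('a, 'b, 'u) zigzag_space) dgca" where
    1: "has_quasi_iso K A C \<or> has_quasi_iso K C A" and 2: "equivclp (has_quasi_iso K) C D" and
    3: "has_quasi_iso K D B \<or> has_quasi_iso K B D"
    using same unfolding same_homotopy_class_def by blast
  have "invariant C m" using 1 inv invariant_quasi_iso[OF m, of A C] invariant_quasi_iso[OF m, of C A] by auto
  with 2 have "invariant D m"
  proof (induction rule: equivclp_induct)
    case base
    then show ?case .
  next
    case (step y z)
    then show ?case using invariant_quasi_iso[OF m, of y z] invariant_quasi_iso[OF m, of z y] by auto
  qed
  then show ?thesis using 3 invariant_quasi_iso[OF m, of D B] invariant_quasi_iso[OF m, of B D] by auto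
qed

end

section \<open>The transferred operation of a Hodge homotopy\<close>

text \<open>Coordinates with respect to a finite basis; their uniqueness makes them linear.\<close>

lemma (in vectorspace) coefficient_functionals:
  assumes "fin_dim"
  obtains B cf where "finite B" "B \<subseteq> carrier V"
    "\<And>b v. b \<in> B \<Longrightarrow> v \<in> carrier V \<Longrightarrow> cf b v \<in> carrier K"
    "\<And>b v w. b \<in> B \<Longrightarrow> v \<in> carrier V \<Longrightarrow> w \<in> carrier V \<Longrightarrow> cf b (v \<oplus>\<^bsub>V\<^esub> w) = cf b v \<oplus>\<^bsub>K\<^esub> cf b w"
    "\<And>b c v. b \<in> B \<Longrightarrow> c \<in> carrier K \<Longrightarrow> v \<in> carrier V \<Longrightarrow> cf b (c \<odot>\<^bsub>V\<^esub> v) = c \<otimes>\<^bsub>K\<^esub> cf b v"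
    "\<And>v. v \<in> carrier V \<Longrightarrow> (\<Oplus>\<^bsub>V\<^esub> b\<in>B. cf b v \<odot>\<^bsub>V\<^esub> b) = v"
proof -
  obtain B where B: "finite B" "basis B" using finite_basis_exists[OF assms] by blast
  have BV: "B \<subseteq> carrier V" using B(2) by (simp add: basis_def)
  have ex: "\<exists>!a. a \<in> B \<rightarrow>\<^sub>E carrier K \<and> lincomb a B = v" if "v \<in> carrier V" for v
    using basis_criterion[OF B(1) BV] B(2) that by blast
  define c where "c v = (THE a. a \<in> B \<rightarrow>\<^sub>E carrier K \<and> lincomb a B = v)" for v
  have c: "c v \<in> B \<rightarrow>\<^sub>E carrier K" "lincomb (c v) B = v" if "v \<in> carrier V" for v
    using theI'[OF ex[OF that]] unfolding c_def by blast+
  have cP: "c v \<in> B \<rightarrow> carrier K" if "v \<in> carrier V" for v using c(1)[OF that] by blast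
  have uniq: "c v b = a b" if "v \<in> carrier V" "a \<in> B \<rightarrow> carrier K" "lincomb a B = v" "b \<in> B" for v a b
  proof -
    have *: "lincomb (restrict a B) B = lincomb a B" by (rule lincomb_cong) (use BV that in auto)
    have **: "restrict a B \<in> B \<rightarrow>\<^sub>E carrier K" using that by auto
    have "c v = restrict a B"
      unfolding c_def by (rule the1_equality[OF ex[OF that(1)]]) (use * ** that(3) in simp)
    then show ?thesis using that by simp
  qed
  show thesis
  proof (rule that[of B "\<lambda>b v. c v b"])
    fix b v assume bv: "b \<in> B" "v \<in> carrier V"
    show "c v b \<in> carrier K" using cP[OF bv(2)] bv(1) by blast
    show "c (v \<oplus>\<^bsub>V\<^esub> w) b = c v b \<oplus>\<^bsub>K\<^esub> c w b" if w: "w \<in> carrier V" for w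
    proof (rule uniq)
      show "lincomb (\<lambda>b. c v b \<oplus>\<^bsub>K\<^esub> c w b) B = v \<oplus>\<^bsub>V\<^esub> w"
        using lincomb_sum[OF B(1) BV cP[OF bv(2)] cP[OF w]] c(2) bv w by simp
    qed (use bv w cP[OF bv(2)] cP[OF w] in auto)
    show "c (x \<odot>\<^bsub>V\<^esub> v) b = x \<otimes>\<^bsub>K\<^esub> c v b" if x: "x \<in> carrier K" for x
    proof (rule uniq)
      show "lincomb (\<lambda>b. x \<otimes>\<^bsub>K\<^esub> c v b) B = x \<odot>\<^bsub>V\<^esub> v"
        using lincomb_smult[OF BV cP[OF bv(2)] x] c(2) bv by simp
    qed (use bv x cP[OF bv(2)] in auto)
  next
    show "(\<Oplus>\<^bsub>V\<^esub> b\<in>B. c v b \<odot>\<^bsub>V\<^esub> b) = v" if "v \<in> carrier V" for v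
      using c(2)[OF that] by (simp add: lincomb_def)
  qed (use B BV in auto)
qed

text \<open>The basis obtained from finite dimension need not be homogeneous. The family therefore
  consists of all components of basis vectors, and the coefficient at \<open>(b, k)\<close> is that
  of \<open>b\<close> in the degree \<open>k\<close> part of the argument. Projecting the expansion
  of this part to degree \<open>k\<close> gives the required expansion.\<close>

lemma (in poincare_dgca) cohomology_coordinates:
  obtains I :: "('a set \<times> int) set" and e dg cf where "homogeneous_coordinates K (cohomology A) I e dg cf"
proof -
  interpret H: dgca K "cohomology A" by (rule dgca_cohomology)
  obtain B cB where B: "finite B" "B \<subseteq> carrier (cohomology A)"
    "\<And>b v. b \<in> B \<Longrightarrow> v \<in> carrier (cohomology A) \<Longrightarrow> cB b v \<in> carrier K"
    "\<And>b v w. b \<in> B \<Longrightarrow> v \<in> carrier (cohomology A) \<Longrightarrow> w \<in> carrier (cohomology A) \<Longrightarrow>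
      cB b (v \<oplus>\<^bsub>cohomology A\<^esub> w) = cB b v \<oplus>\<^bsub>K\<^esub> cB b w"
    "\<And>b c v. b \<in> B \<Longrightarrow> c \<in> carrier K \<Longrightarrow> v \<in> carrier (cohomology A) \<Longrightarrow> cB b (c \<odot>\<^bsub>cohomology A\<^esub> v) = c \<otimes>\<^bsub>K\<^esub> cB b v"
    "\<And>v. v \<in> carrier (cohomology A) \<Longrightarrow> (\<Oplus>\<^bsub>cohomology A\<^esub>b\<in>B. cB b v \<odot>\<^bsub>cohomology A\<^esub> b) = v"
    by (rule H.coefficient_functionals[OF cohomology_fin_dim]) blast
  let ?C = "component (cohomology A)"
  have high: "?C k a = \<zero>\<^bsub>cohomology A\<^esub>" if "a \<in> carrier (cohomology A)" "k \<notin> {0..int n}" for k a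
    using H.component_gr[OF that(1), of k] gr_bounded[of k] that(2) coh_class_zero
    by (auto simp: coh_gr)
  have cB0: "cB b \<zero>\<^bsub>cohomology A\<^esub> = \<zero>\<^bsub>K\<^esub>" if "b \<in> B" for b
    using B(5)[OF that, of "\<zero>\<^bsub>K\<^esub>" "\<zero>\<^bsub>cohomology A\<^esub>"] B(3)[OF that, of "\<zero>\<^bsub>cohomology A\<^esub>"] by simp
  have "homogeneous_coordinates K (cohomology A) (B \<times> {0..int n}) (\<lambda>q. ?C (snd q) (fst q)) snd
    (\<lambda>q a. cB (fst q) (?C (snd q) a))"
  proof (intro homogeneous_coordinates.intro homogeneous_coordinates_axioms.intro)
    show "graded_comm_algebra K (cohomology A)" by (rule H.graded_comm_algebra_axioms)
    show "finite (B \<times> {0..int n})" using B(1) by simp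
    fix q assume q: "q \<in> B \<times> {0..int n}"
    then have qB: "fst q \<in> B" "fst q \<in> carrier (cohomology A)" using B(2) by auto
    show "?C (snd q) (fst q) \<in> gr (cohomology A) (snd q)" using qB by simp
    fix a assume a: "a \<in> carrier (cohomology A)"
    show "cB (fst q) (?C (snd q) a) \<in> carrier K" using B(3) qB a by simp
    show "cB (fst q) (?C (snd q) (a \<oplus>\<^bsub>cohomology A\<^esub> b)) = cB (fst q) (?C (snd q) a) \<oplus>\<^bsub>K\<^esub> cB (fst q) (?C (snd q) b)"
      if "b \<in> carrier (cohomology A)" for b
      using B(4) qB a that by (simp add: H.component_add)
  next
    fix q c a assume "q \<in> B \<times> {0..int n}" "c \<in> carrier K" "a \<in> carrier (cohomology A)"
    then show "cB (fst q) (?C (snd q) (c \<odot>\<^bsub>cohomology A\<^esub> a)) = c \<otimes>\<^bsub>K\<^esub> cB (fst q) (?C (snd q) a)"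
      using B(5) by (auto simp: H.component_smult)
  next
    fix q a k assume "q \<in> B \<times> {0..int n}" "a \<in> gr (cohomology A) k" "snd q \<noteq> k"
    then show "cB (fst q) (?C (snd q) a) = \<zero>\<^bsub>K\<^esub>" using cB0 by (auto simp: H.component_homogeneous)
  next
    fix a assume a: "a \<in> carrier (cohomology A)"
    have c: "cB b (?C k a) \<odot>\<^bsub>cohomology A\<^esub> b \<in> carrier (cohomology A)" if "b \<in> B" for b k
      using that a B(2,3) by auto
    have inner: "(\<Oplus>\<^bsub>cohomology A\<^esub>b\<in>B. cB b (?C k a) \<odot>\<^bsub>cohomology A\<^esub> ?C k b) = ?C k a" for k
    proof -
      have "(\<Oplus>\<^bsub>cohomology A\<^esub>b\<in>B. cB b (?C k a) \<odot>\<^bsub>cohomology A\<^esub> ?C k b) =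
          (\<Oplus>\<^bsub>cohomology A\<^esub>b\<in>B. ?C k (cB b (?C k a) \<odot>\<^bsub>cohomology A\<^esub> b))"
        by (rule H.M.finsum_cong'[OF refl]) (use a B(2,3) c in \<open>auto simp: H.component_smult subsetD\<close>)
      also have "\<dots> = ?C k (\<Oplus>\<^bsub>cohomology A\<^esub>b\<in>B. cB b (?C k a) \<odot>\<^bsub>cohomology A\<^esub> b)"
        by (rule additive_finsum[symmetric, OF H.M.abelian_group_axioms H.M.abelian_group_axioms])
          (use B(1) c in \<open>auto simp: H.component_add\<close>)
      also have "\<dots> = ?C k a" using B(6)[of "?C k a"] a H.component_homogeneous[OF H.component_gr[OF a, of k]] by simp
      finally show ?thesis .
    qed
    have "(\<Oplus>\<^bsub>cohomology A\<^esub>q\<in>B \<times> {0..int n}. cB (fst q) (?C (snd q) a) \<odot>\<^bsub>cohomology A\<^esub> ?C (snd q) (fst q)) =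
       (\<Oplus>\<^bsub>cohomology A\<^esub>k\<in>{0..int n}. \<Oplus>\<^bsub>cohomology A\<^esub>b\<in>B. cB b (?C k a) \<odot>\<^bsub>cohomology A\<^esub> ?C k b)"
      by (rule finsum_Times[OF H.M.abelian_monoid_axioms B(1)]) (use a B(2,3) in auto)
    also have "\<dots> = a" unfolding inner by (rule H.sum_components[OF a]) (use high[OF a] in auto)
    finally show "(\<Oplus>\<^bsub>cohomology A\<^esub>q\<in>B \<times> {0..int n}. cB (fst q) (?C (snd q) a) \<odot>\<^bsub>cohomology A\<^esub> ?C (snd q) (fst q)) = a" .
  qed
  then show thesis using that by blast
qed

definition triadditive :: "('k, 'a, 'm) graded_module_scheme \<Rightarrow> ('k, 'b, 'n) graded_module_scheme \<Rightarrow>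
    ('a \<Rightarrow> 'a \<Rightarrow> 'a \<Rightarrow> 'b) \<Rightarrow> bool" where
  "triadditive B C f \<longleftrightarrow> (\<forall>x\<in>carrier B. \<forall>y\<in>carrier B. \<forall>z\<in>carrier B. f x y z \<in> carrier C \<and>
     (\<forall>w\<in>carrier B. f (x \<oplus>\<^bsub>B\<^esub> w) y z = f x y z \<oplus>\<^bsub>C\<^esub> f w y z \<and> f x (y \<oplus>\<^bsub>B\<^esub> w) z = f x y z \<oplus>\<^bsub>C\<^esub> f x w z \<and>
       f x y (z \<oplus>\<^bsub>B\<^esub> w) = f x y z \<oplus>\<^bsub>C\<^esub> f x y w))"

text \<open>Induction over homogeneous components, one argument at a time. It is needed because the
  Massey cocycle carries the degree of its first argument explicitly.\<close>

lemma (in graded_comm_algebra) triadditive_eqI: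
  assumes F: "triadditive B C F" and G: "triadditive B C G"
    and eq: "\<And>j k l a b c. a \<in> gr B j \<Longrightarrow> b \<in> gr B k \<Longrightarrow> c \<in> gr B l \<Longrightarrow> F a b c = G a b c"
    and a: "a \<in> carrier B" and b: "b \<in> carrier B" and c: "c \<in> carrier B"
  shows "F a b c = G a b c"
proof -
  have 1: "F a b c = G a b c" if ab: "a \<in> gr B j" "b \<in> gr B k" for a b j k
    using c
  proof (induction rule: homogeneous_induct)
    case (homogeneous l y)
    show ?case by (rule eq[OF ab homogeneous])
  next
    case (add x y)
    then show ?case using F G gr_closed[OF ab(1)] gr_closed[OF ab(2)] unfolding triadditive_def by metis
  qed
  have 2: "F a b c = G a b c" if a: "a \<in> gr B j" for a j
    using b
  proof (induction rule: homogeneous_induct)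
    case (homogeneous l y)
    then show ?case using 1[OF a] by blast
  next
    case (add x y)
    then show ?case using F G gr_closed[OF a] c unfolding triadditive_def by metis
  qed
  show ?thesis using a
  proof (induction rule: homogeneous_induct)
    case (homogeneous l y)
    then show ?case using 2 by blast
  next
    case (add x y)
    then show ?case using F G b c unfolding triadditive_def by metis
  qed
qed

section \<open>Transfer data coming from a Hodge homotopy\<close>

context hodge_homotopy
begin

lemma harmonic_rep_linear: "harmonic_rep A h \<in> module_hom K (cohomology A) A"
proof -
  have "harmonic_rep A h X \<in> carrier A" if "X \<in> carrier (cohomology A)" for X
    using harmonic_rep_props(1)[OF that] harmonicD by blast
  moreover have "harmonic_rep A h (X \<oplus>\<^bsub>cohomology A\<^esub> Y) = harmonic_rep A h X \<oplus>\<^bsub>A\<^esub> harmonic_rep A h Y"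
    if X: "X \<in> carrier (cohomology A)" and Y: "Y \<in> carrier (cohomology A)" for X Y
  proof -
    obtain x where x: "x \<in> cocycles A" "X = coh_class A x" using X by (rule coh_cases)
    obtain y where y: "y \<in> cocycles A" "Y = coh_class A y" using Y by (rule coh_cases)
    show ?thesis using x y cocycle_closed by (simp add: coh_add harmonic_rep_class cocycle_add pi_add)
  qed
  moreover have "harmonic_rep A h (c \<odot>\<^bsub>cohomology A\<^esub> X) = c \<odot>\<^bsub>A\<^esub> harmonic_rep A h X"
    if c: "c \<in> carrier K" and X: "X \<in> carrier (cohomology A)" for X c
  proof -
    obtain x where "x \<in> cocycles A" "X = coh_class A x" using X by (rule coh_cases)
    then show ?thesis using c cocycle_closed by (simp add: coh_smult harmonic_rep_class cocycle_smult pi_smult)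
  qed
  ultimately show ?thesis by (simp add: module_hom_def)
qed

lemma harmonic_rep_gr:
  assumes "X \<in> gr (cohomology A) k" shows "harmonic_rep A h X \<in> gr A k"
proof -
  obtain x where "x \<in> cocycles A" "x \<in> gr A k" "X = coh_class A x" using assms by (auto simp: coh_gr)
  then show ?thesis by (simp add: harmonic_rep_class pi_gr)
qed

lemma harmonic_rep_mult:
  assumes "X \<in> carrier (cohomology A)" "Y \<in> carrier (cohomology A)"
  shows "harmonic_rep A h (X \<otimes>\<^bsub>cohomology A\<^esub> Y) = \<pi> (harmonic_rep A h X \<otimes>\<^bsub>A\<^esub> harmonic_rep A h Y)"
proof -
  obtain x where x: "x \<in> cocycles A" "X = coh_class A x" using assms(1) by (rule coh_cases)
  obtain y where y: "y \<in> cocycles A" "Y = coh_class A y" using assms(2) by (rule coh_cases)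
  show ?thesis using x y cocycle_closed
    by (simp add: coh_mult harmonic_rep_class cocycle_mult pi_mult_left pi_mult_right pi_cocycle)
qed

lemma harmonic_rep_section: "cohomology_section K (cohomology A) A (harmonic_rep A h)"
  unfolding cohomology_section_def
proof (intro conjI allI ballI impI)
  show "harmonic_rep A h \<in> module_hom K (cohomology A) A" by (rule harmonic_rep_linear)
  show "harmonic_rep A h X \<in> gr A k" if "X \<in> gr (cohomology A) k" for X k using that by (rule harmonic_rep_gr)
  show "harmonic_rep A h X \<in> cocycles A" if "X \<in> carrier (cohomology A)" for X
    using harmonic_rep_props(1)[OF that] by (rule harmonic_cocycle)
  show "\<exists>X\<in>carrier (cohomology A). y \<ominus>\<^bsub>A\<^esub> harmonic_rep A h X \<in> coboundaries A" if "y \<in> cocycles A" for y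
    using that by (intro bexI[of _ "coh_class A y"]) (simp_all add: harmonic_rep_class cocycle_sub_pi)
  show "X = \<zero>\<^bsub>cohomology A\<^esub>" if "X \<in> carrier (cohomology A)" "harmonic_rep A h X \<in> coboundaries A" for X
    using that harmonic_rep_props[OF that(1)] coh_class_eq_zero_iff harmonicD by metis
  show "harmonic_rep A h \<one>\<^bsub>cohomology A\<^esub> \<ominus>\<^bsub>A\<^esub> \<one>\<^bsub>A\<^esub> \<in> coboundaries A"
    by (simp add: coh_one harmonic_rep_class cocycle_one pi_one sub_self coboundary_zero)
qed

lemma mu3_triadditive: "triadditive (cohomology A) (cohomology A) (mu3 A h)"
proof -
  interpret H: dgca K "cohomology A" by (rule dgca_cohomology)
  note r = module_hom_facts[OF H.is_module is_module harmonic_rep_linear]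
  have cl: "coh_class A (\<pi> (u \<oplus>\<^bsub>A\<^esub> v)) = coh_class A (\<pi> u) \<oplus>\<^bsub>cohomology A\<^esub> coh_class A (\<pi> v)"
    if "u \<in> carrier A" "v \<in> carrier A" for u v using that by (simp add: coh_add pi_cocycle pi_add)
  have m: "((u \<oplus>\<^bsub>A\<^esub> u') \<ominus>\<^bsub>A\<^esub> (v \<oplus>\<^bsub>A\<^esub> v')) = (u \<ominus>\<^bsub>A\<^esub> v) \<oplus>\<^bsub>A\<^esub> (u' \<ominus>\<^bsub>A\<^esub> v')"
    if "u \<in> carrier A" "v \<in> carrier A" "u' \<in> carrier A" "v' \<in> carrier A" for u u' v v'
    using that by (simp add: a_minus_def M.minus_add M.a_ac)
  show ?thesis unfolding triadditive_def
    by (auto simp: mu3_def Let_def r(1,2) H.sign_twist_add B.l_distr B.r_distr h_add m cl[symmetric] pi_cocycle)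
qed

lemma mu3_closed3: "closed3 (cohomology A) (mu3 A h)"
  using mu3_triadditive by (auto simp: triadditive_def closed3_def)

lemma mu3_class_cochain: "mu3_class K A h = harr_class K (cohomology A) 3 (-1) (cochain3 (cohomology A) (mu3 A h))"
  by (simp add: mu3_class_def cochain3_def)

lemma mu3_harmonic:
  assumes "x \<in> harmonic A h" "x \<in> gr A k" "y \<in> harmonic A h" "z \<in> harmonic A h"
  shows "mu3 A h (coh_class A x) (coh_class A y) (coh_class A z) =
    coh_class A (\<pi> (h (x \<otimes>\<^bsub>A\<^esub> y) \<otimes>\<^bsub>A\<^esub> z \<ominus>\<^bsub>A\<^esub> [neg1_pow k] \<cdot>\<^bsub>A\<^esub> (x \<otimes>\<^bsub>A\<^esub> h (y \<otimes>\<^bsub>A\<^esub> z))))"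
proof -
  note c = harmonicD[OF assms(1)] harmonicD[OF assms(3)] harmonicD[OF assms(4)]
  note cc = harmonic_cocycle[OF assms(1)] harmonic_cocycle[OF assms(3)] harmonic_cocycle[OF assms(4)]
  have tw: "sign_twist A 1 x = [neg1_pow k] \<cdot>\<^bsub>A\<^esub> x" using sign_twist_homogeneous[OF assms(2), of 1] by simp
  have "harmonic_rep A h (sign_twist (cohomology A) 1 (coh_class A x)) = [neg1_pow k] \<cdot>\<^bsub>A\<^esub> x"
    using c cc by (simp add: sign_twist_cohomology[OF cc(1) assms(2)] tw harmonic_rep_class M.add_neg1_pow cocycle_minus pi_minus)
  then show ?thesis using c cc
    by (simp add: mu3_def Let_def harmonic_rep_class M.add_neg1_pow B.l_minus)
qed

text \<open>A product of cocycles is its harmonic part plus the differential of its image under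
  \<open>h\<close>, and by the hypothesis on products the harmonic part is the section
  value.\<close>

lemma harmonic_product_homotopy:
  assumes H: "graded_comm_algebra K H" and sec: "cohomology_section K H A s"
    and hs: "\<And>a. a \<in> carrier H \<Longrightarrow> \<pi> (s a) = s a"
    and m: "\<And>a b. a \<in> carrier H \<Longrightarrow> b \<in> carrier H \<Longrightarrow> s (a \<otimes>\<^bsub>H\<^esub> b) = \<pi> (s a \<otimes>\<^bsub>A\<^esub> s b)"
  shows "product_homotopy K H A s (\<lambda>a b. h (s a \<otimes>\<^bsub>A\<^esub> s b))"
proof -
  interpret H: graded_comm_algebra K H by fact
  interpret dgca_over K A H ..
  note s = cohomology_sectionD[OF sec]
  show ?thesis unfolding product_homotopy_def
  proof (intro conjI allI ballI)
    show "linear_in_both K H A (\<lambda>a b. h (s a \<otimes>\<^bsub>A\<^esub> s b))" unfolding linear_in_both_def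
      by (auto simp: s(2-4) B.l_distr B.r_distr smult_mult_left smult_mult_right h_add h_smult)
    fix a b k l assume ab: "a \<in> gr H k" "b \<in> gr H l"
    then have c: "a \<in> carrier H" "b \<in> carrier H" using H.gr_closed by auto
    show "h (s a \<otimes>\<^bsub>A\<^esub> s b) \<in> gr A (k + l - 1)" by (intro h_degree mult_gr s(7) ab)
    show "h (s a \<otimes>\<^bsub>A\<^esub> s b) \<ominus>\<^bsub>A\<^esub> [neg1_pow (k * l)] \<cdot>\<^bsub>A\<^esub> h (s b \<otimes>\<^bsub>A\<^esub> s a) \<in> coboundaries A"
      using mult_commute_cases[OF s(7)[OF ab(1)] s(7)[OF ab(2)]] c s(2)
      by (simp add: M.add_neg1_pow h_minus sub_self coboundary_zero)
  next
    fix a b assume c: "a \<in> carrier H" "b \<in> carrier H"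
    have "s a \<otimes>\<^bsub>A\<^esub> s b \<in> cocycles A" using c s(8) cocycle_mult by blast
    then show "diff A (h (s a \<otimes>\<^bsub>A\<^esub> s b)) = s a \<otimes>\<^bsub>A\<^esub> s b \<ominus>\<^bsub>A\<^esub> s (a \<otimes>\<^bsub>H\<^esub> b)"
      using cocycle_pi[of "s a \<otimes>\<^bsub>A\<^esub> s b"] c s(2) by (simp add: m M.diff_simps M.a_ac)
  qed
qed

text \<open>The last two terms of the Massey cocycle lie in the image of \<open>h\<close> and
  disappear under \<open>\<pi>\<close>; the first two are those of \<open>mu3\<close>.\<close>

lemma harmonic_massey_class:
  assumes H: "graded_comm_algebra K H" and sec: "cohomology_section K H A s"
    and hs: "\<And>a. a \<in> carrier H \<Longrightarrow> \<pi> (s a) = s a"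
    and m: "\<And>a b. a \<in> carrier H \<Longrightarrow> b \<in> carrier H \<Longrightarrow> s (a \<otimes>\<^bsub>H\<^esub> b) = \<pi> (s a \<otimes>\<^bsub>A\<^esub> s b)"
    and a: "a \<in> gr H k" and b: "b \<in> carrier H" and c: "c \<in> carrier H"
  shows "coh_class A (massey H A s (\<lambda>a b. h (s a \<otimes>\<^bsub>A\<^esub> s b)) k a b c) =
    mu3 A h (coh_class A (s a)) (coh_class A (s b)) (coh_class A (s c))"
proof -
  interpret H: graded_comm_algebra K H by fact
  interpret dgca_over K A H ..
  note s = cohomology_sectionD[OF sec]
  have ac: "a \<in> carrier H" using a H.gr_closed by blast
  let ?M = "massey H A s (\<lambda>a b. h (s a \<otimes>\<^bsub>A\<^esub> s b)) k a b c"
  have sh: "s a \<in> harmonic A h" if "a \<in> carrier H" for a using that hs s(2) by (simp add: harmonic_iff)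
  have "?M \<in> cocycles A"
    using massey_cocycle[OF sec harmonic_product_homotopy[OF H sec hs m] a b c] by simp
  then have "coh_class A ?M = coh_class A (\<pi> ?M)" using coh_class_pi by simp
  also have "\<pi> ?M = \<pi> (h (s a \<otimes>\<^bsub>A\<^esub> s b) \<otimes>\<^bsub>A\<^esub> s c \<ominus>\<^bsub>A\<^esub> [neg1_pow k] \<cdot>\<^bsub>A\<^esub> (s a \<otimes>\<^bsub>A\<^esub> h (s b \<otimes>\<^bsub>A\<^esub> s c)))"
    unfolding massey_def using ac b c s(2) by (simp add: M.add_neg1_pow pi_add pi_sub pi_minus pi_h a_minus_def)
  also have "coh_class A \<dots> = mu3 A h (coh_class A (s a)) (coh_class A (s b)) (coh_class A (s c))"
    by (rule mu3_harmonic[symmetric]) (use sh s(7)[OF a] ac b c in auto)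
  finally show ?thesis .
qed

lemma transfers_harmonic_rep:
  "transfers K (cohomology A) A (mu3 A h) (harmonic_rep A h) (\<lambda>a b. h (harmonic_rep A h a \<otimes>\<^bsub>A\<^esub> harmonic_rep A h b))"
proof -
  interpret H: dgca K "cohomology A" by (rule dgca_cohomology)
  interpret dgca_over K A "cohomology A" ..
  note s = cohomology_sectionD[OF harmonic_rep_section]
  have hs: "\<pi> (harmonic_rep A h a) = harmonic_rep A h a" if "a \<in> carrier (cohomology A)" for a
    using harmonic_rep_props(1)[OF that] harmonicD by blast
  note * = H.graded_comm_algebra_axioms harmonic_rep_section hs harmonic_rep_mult
  show ?thesis unfolding transfers_def
  proof (intro conjI allI ballI harmonic_rep_section harmonic_product_homotopy[OF *])
    fix a b c j k l assume abc: "a \<in> gr (cohomology A) j" "b \<in> gr (cohomology A) k" "c \<in> gr (cohomology A) l"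
    then have cc: "a \<in> carrier (cohomology A)" "b \<in> carrier (cohomology A)" "c \<in> carrier (cohomology A)"
      using H.gr_closed by auto
    let ?M = "massey (cohomology A) A (harmonic_rep A h) (\<lambda>a b. h (harmonic_rep A h a \<otimes>\<^bsub>A\<^esub> harmonic_rep A h b)) j a b c"
    have m: "mu3 A h a b c \<in> carrier (cohomology A)" using closed3D[OF mu3_closed3 cc] .
    have "coh_class A ?M = coh_class A (harmonic_rep A h (mu3 A h a b c))"
      using harmonic_massey_class[OF * abc(1) cc(2,3)] harmonic_rep_props(2) cc m by simp
    moreover have "?M \<in> carrier A"
      using massey_cocycle[OF harmonic_rep_section harmonic_product_homotopy[OF *] abc(1) cc(2,3)] cocycle_closed by simp
    ultimately show "?M \<ominus>\<^bsub>A\<^esub> harmonic_rep A h (mu3 A h a b c) \<in> coboundaries A"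
      using coh_class_eq_iff s(2)[OF m] by simp
  qed
qed

end

text \<open>Multiplicativity holds since the product homotopy is a primitive of its defect.\<close>

lemma (in dgca_over) section_iso:
  assumes sec: "cohomology_section K H D s" and ph: "product_homotopy K H D s \<eta>"
  shows "(\<lambda>a. coh_class D (s a)) \<in> graded_algebra_iso K H (cohomology D)"
proof -
  note s = cohomology_sectionD[OF sec] and p = product_homotopyD[OF ph]
  have mult: "coh_class D (s (a \<otimes>\<^bsub>H\<^esub> b)) = coh_class D (s a) \<otimes>\<^bsub>cohomology D\<^esub> coh_class D (s b)"
    if ab: "a \<in> carrier H" "b \<in> carrier H" for a b
  proof -
    have "s a \<otimes>\<^bsub>D\<^esub> s b \<ominus>\<^bsub>D\<^esub> s (a \<otimes>\<^bsub>H\<^esub> b) \<in> coboundaries D"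
      using p(4)[OF ab] D.coboundary_d[OF linear_in_bothD(1)[OF p(1) ab]] by simp
    then have "coh_class D (s a \<otimes>\<^bsub>D\<^esub> s b) = coh_class D (s (a \<otimes>\<^bsub>H\<^esub> b))"
      using D.coh_class_eq_iff s(2) ab by simp
    then show ?thesis using D.coh_mult s(8) ab by simp
  qed
  have "inj_on (\<lambda>a. coh_class D (s a)) (carrier H)"
    by (rule inj_onI) (use section_eqI[OF sec] D.coh_class_eq_iff s(2) in blast)
  moreover have "(\<lambda>a. coh_class D (s a)) ` carrier H = carrier (cohomology D)"
  proof
    show "carrier (cohomology D) \<subseteq> (\<lambda>a. coh_class D (s a)) ` carrier H"
    proof
      fix Y assume "Y \<in> carrier (cohomology D)"
      then obtain y where y: "y \<in> cocycles D" "Y = coh_class D y" by (rule D.coh_cases)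
      then show "Y \<in> (\<lambda>a. coh_class D (s a)) ` carrier H"
        using s(10)[OF y(1)] D.coh_class_eq_iff D.cocycle_closed[OF y(1)] s(2) by blast
    qed
  qed (use s(8) in auto)
  ultimately have bij: "bij_betw (\<lambda>a. coh_class D (s a)) (carrier H) (carrier (cohomology D))"
    by (simp add: bij_betw_def)
  have one: "coh_class D (s \<one>\<^bsub>H\<^esub>) = \<one>\<^bsub>cohomology D\<^esub>"
    using s(12) D.coh_class_eq_iff s(2) by (simp add: D.coh_one)
  show ?thesis unfolding graded_algebra_iso_def graded_algebra_hom_def
    using bij mult one s
    by (auto simp: ring_hom_def module_hom_def D.coh_add D.coh_smult D.coh_gr H.gr_closed intro!: imageI)
qed

context graded_comm_algebra
begin

lemma harrison_diff2_triadditive: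
  assumes "harrison2 K B \<beta>"
  shows "triadditive B B (harrison_diff2 B \<beta>)"
proof -
  have "(((p \<oplus>\<^bsub>B\<^esub> p') \<ominus>\<^bsub>B\<^esub> (q \<oplus>\<^bsub>B\<^esub> q')) \<oplus>\<^bsub>B\<^esub> (u \<oplus>\<^bsub>B\<^esub> u')) \<ominus>\<^bsub>B\<^esub> (v \<oplus>\<^bsub>B\<^esub> v') = (((p \<ominus>\<^bsub>B\<^esub> q) \<oplus>\<^bsub>B\<^esub> u) \<ominus>\<^bsub>B\<^esub> v) \<oplus>\<^bsub>B\<^esub> (((p' \<ominus>\<^bsub>B\<^esub> q') \<oplus>\<^bsub>B\<^esub> u') \<ominus>\<^bsub>B\<^esub> v')"
    if "p \<in> carrier B" "p' \<in> carrier B" "q \<in> carrier B" "q' \<in> carrier B"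
      "u \<in> carrier B" "u' \<in> carrier B" "v \<in> carrier B" "v' \<in> carrier B" for p p' q q' u u' v v'
    using that by (simp add: M.diff_simps M.a_ac)
  then show ?thesis
    unfolding triadditive_def harrison_diff2_def using harrison2D(1-3)[OF assms]
    by (simp add: sign_twist_add B.l_distr B.r_distr)
qed

lemma triadditive_add:
  assumes "triadditive B B F" "triadditive B B G"
  shows "triadditive B B (\<lambda>x y z. F x y z \<oplus>\<^bsub>B\<^esub> G x y z)"
  using assms unfolding triadditive_def by (auto simp: M.a_ac)

end

lemma (in dgca) coh_sub:
  assumes "x \<in> cocycles A" "y \<in> cocycles A"
  shows "coh_class A x \<ominus>\<^bsub>cohomology A\<^esub> coh_class A y = coh_class A (x \<ominus>\<^bsub>A\<^esub> y)"
  using assms by (simp add: a_minus_def coh_minus coh_add cocycle_minus)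

text \<open>After gauging the section to be harmonic, the given homotopy and the one built from
  \<open>h\<close> have the same differential. Their difference consists of cocycles, whose classes
  form a Harrison cochain; up to sign its differential is the difference of the two ternary
  operations.\<close>

lemma (in hodge_homotopy) transfers_compare:
  assumes H: "graded_comm_algebra K H" and tr: "transfers K H A m s \<eta>" and m: "triadditive H H m"
  shows "\<exists>\<phi>\<in>graded_algebra_iso K H (cohomology A).
     harr_cohomology_map K H (cohomology A) 3 (-1) \<phi> (harr_class K H 3 (-1) (cochain3 H m)) = mu3_class K A h"
proof -
  interpret H: graded_comm_algebra K H by fact
  interpret C: dgca K "cohomology A" by (rule dgca_cohomology)
  interpret dgca_over K A H ..
  let ?C = "cohomology A"
  have m3: "closed3 H m" using m by (auto simp: triadditive_def closed3_def)
  have "cohomology_section K H A s" using tr by (simp add: transfers_def)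
  note s0 = cohomology_sectionD[OF this]
  \<comment> \<open>With this choice \<open>s a \<oplus> diff A (t a)\<close> is the harmonic
    projection of \<open>s a\<close>.\<close>
  define t where "t a = \<ominus>\<^bsub>A\<^esub> h (s a)" for a
  have t: "t \<in> module_hom K H A" unfolding module_hom_def t_def
    using s0(2-4) by (auto simp: h_add h_smult M.minus_add smult_r_minus)
  have tg: "t a \<in> gr A (k - 1)" if "a \<in> gr H k" for a k
    unfolding t_def by (intro gr_minus h_degree s0(7) that)
  define \<sigma> where "\<sigma> = (\<lambda>a. s a \<oplus>\<^bsub>A\<^esub> diff A (t a))"
  obtain \<eta>' where tr': "transfers K H A m \<sigma> \<eta>'"
    unfolding \<sigma>_def using transfers_gauge[OF tr t tg m3] by blast
  have hs: "\<pi> (\<sigma> a) = \<sigma> a" if a: "a \<in> carrier H" for a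
  proof -
    have "\<sigma> a = s a \<ominus>\<^bsub>A\<^esub> diff A (h (s a))" using a s0(2) by (simp add: \<sigma>_def t_def d_minus a_minus_def)
    also have "\<dots> = \<pi> (s a)" using a s0(2,9) by (simp add: harmonic_proj_def)
    finally show ?thesis using a s0(2) by simp
  qed
  have sec: "cohomology_section K H A \<sigma>" and ph: "product_homotopy K H A \<sigma> \<eta>'"
    and mas: "\<And>a b c j k l. a \<in> gr H j \<Longrightarrow> b \<in> gr H k \<Longrightarrow> c \<in> gr H l \<Longrightarrow> massey H A \<sigma> \<eta>' j a b c \<ominus>\<^bsub>A\<^esub> \<sigma> (m a b c) \<in> coboundaries A"
    using tr' unfolding transfers_def by blast+
  note s = cohomology_sectionD[OF sec] and p = product_homotopyD[OF ph]
  note \<eta> = linear_in_bothD[OF p(1)]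
  have mult: "\<sigma> (a \<otimes>\<^bsub>H\<^esub> b) = \<pi> (\<sigma> a \<otimes>\<^bsub>A\<^esub> \<sigma> b)" if ab: "a \<in> carrier H" "b \<in> carrier H" for a b
  proof -
    have "\<zero>\<^bsub>A\<^esub> = \<pi> (diff A (\<eta>' a b))" using \<eta>(1) ab by (simp add: pi_d)
    also have "\<dots> = \<pi> (\<sigma> a \<otimes>\<^bsub>A\<^esub> \<sigma> b) \<ominus>\<^bsub>A\<^esub> \<sigma> (a \<otimes>\<^bsub>H\<^esub> b)" using ab s(2) by (simp add: p(4) pi_sub hs)
    finally show ?thesis using ab s(2) by (simp add: M.diff_simps)
  qed
  let ?g = "\<lambda>a b. h (\<sigma> a \<otimes>\<^bsub>A\<^esub> \<sigma> b)"
  have ph0: "product_homotopy K H A \<sigma> ?g" using harmonic_product_homotopy[OF H sec hs mult] .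
  note p0 = product_homotopyD[OF ph0]
  note g = linear_in_bothD[OF p0(1)]
  define \<delta> where "\<delta> a b = \<eta>' a b \<ominus>\<^bsub>A\<^esub> h (\<sigma> a \<otimes>\<^bsub>A\<^esub> \<sigma> b)" for a b
  have \<delta>c: "\<delta> a b \<in> carrier A" "\<delta> a b \<in> cocycles A" if "a \<in> carrier H" "b \<in> carrier H" for a b
    using that \<eta>(1)[OF that] g(1)[OF that] s(2) p(4)[OF that] p0(4)[OF that]
    by (simp_all add: cocycles_iff \<delta>_def d_diff sub_self)
  define \<phi> where "\<phi> = (\<lambda>a. coh_class A (\<sigma> a))"
  have \<phi>: "\<phi> \<in> graded_algebra_iso K H ?C" unfolding \<phi>_def by (rule section_iso[OF sec ph])
  define \<psi> where "\<psi> = the_inv_into (carrier H) \<phi>"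
  have \<psi>: "\<psi> \<in> graded_algebra_iso K ?C H"
    unfolding \<psi>_def by (rule graded_algebra_iso_inverse[OF H C.graded_comm_algebra_axioms \<phi>])
  note F = graded_algebra_isoD[OF H C.graded_comm_algebra_axioms \<phi>]
  note G = graded_algebra_isoD[OF C.graded_comm_algebra_axioms H \<psi>]
  have \<phi>\<psi>: "\<phi> (\<psi> x) = x" if "x \<in> carrier ?C" for x
    unfolding \<psi>_def using f_the_inv_into_f_bij_betw[OF F(11)] that by blast
  have \<psi>\<phi>: "\<psi> (\<phi> a) = a" if "a \<in> carrier H" for a
    unfolding \<psi>_def using the_inv_into_f_f[of \<phi> "carrier H" a] F(11) that by (auto simp: bij_betw_def)
  define \<beta> where "\<beta> x y = coh_class A (\<delta> (\<psi> x) (\<psi> y))" for x y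
  have diff4: "(u \<oplus>\<^bsub>A\<^esub> u') \<ominus>\<^bsub>A\<^esub> (v \<oplus>\<^bsub>A\<^esub> v') = (u \<ominus>\<^bsub>A\<^esub> v) \<oplus>\<^bsub>A\<^esub> (u' \<ominus>\<^bsub>A\<^esub> v')"
    if "u \<in> carrier A" "v \<in> carrier A" "u' \<in> carrier A" "v' \<in> carrier A" for u u' v v'
    using that by (simp add: a_minus_def M.minus_add M.a_ac)
  have \<delta>_add: "\<delta> (a \<oplus>\<^bsub>H\<^esub> a') b = \<delta> a b \<oplus>\<^bsub>A\<^esub> \<delta> a' b" "\<delta> b (a \<oplus>\<^bsub>H\<^esub> a') = \<delta> b a \<oplus>\<^bsub>A\<^esub> \<delta> b a'"
    if "a \<in> carrier H" "a' \<in> carrier H" "b \<in> carrier H" for a a' b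
    unfolding \<delta>_def \<eta>(2)[OF that] \<eta>(3)[OF that] g(2)[OF that] g(3)[OF that]
    by (rule diff4; use that \<eta>(1) g(1) in blast)+
  have \<delta>_smult: "\<delta> (c \<odot>\<^bsub>H\<^esub> a) b = c \<odot>\<^bsub>A\<^esub> \<delta> a b" "\<delta> a (c \<odot>\<^bsub>H\<^esub> b) = c \<odot>\<^bsub>A\<^esub> \<delta> a b"
    if "c \<in> carrier K" "a \<in> carrier H" "b \<in> carrier H" for c a b
    unfolding \<delta>_def \<eta>(4)[OF that] \<eta>(5)[OF that] g(4)[OF that] g(5)[OF that]
    using that \<eta>(1)[OF that(2,3)] g(1)[OF that(2,3)] by (simp_all add: a_minus_def smult_r_distr smult_r_minus)
  have h\<beta>: "harrison2 K ?C \<beta>"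
    unfolding harrison2_def
  proof (intro conjI allI ballI)
    fix x y assume xy: "x \<in> carrier ?C" "y \<in> carrier ?C"
    show "\<beta> x y \<in> carrier ?C" unfolding \<beta>_def using \<delta>c(2) G(1) xy by simp
    fix x' assume x': "x' \<in> carrier ?C"
    show "\<beta> (x \<oplus>\<^bsub>?C\<^esub> y) x' = \<beta> x x' \<oplus>\<^bsub>?C\<^esub> \<beta> y x'" "\<beta> x' (x \<oplus>\<^bsub>?C\<^esub> y) = \<beta> x' x \<oplus>\<^bsub>?C\<^esub> \<beta> x' y"
      unfolding \<beta>_def using xy x' G(1,2) \<delta>c by (simp_all add: coh_add \<delta>_add)
  next
    fix c x y assume c: "c \<in> carrier K" and xy: "x \<in> carrier ?C" "y \<in> carrier ?C"
    show "\<beta> (c \<odot>\<^bsub>?C\<^esub> x) y = c \<odot>\<^bsub>?C\<^esub> \<beta> x y" "\<beta> x (c \<odot>\<^bsub>?C\<^esub> y) = c \<odot>\<^bsub>?C\<^esub> \<beta> x y"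
      unfolding \<beta>_def using c xy G(1,4) \<delta>c by (simp_all add: coh_smult \<delta>_smult)
  next
    fix k l x y assume xy: "x \<in> gr ?C k" "y \<in> gr ?C l"
    then have c: "\<psi> x \<in> gr H k" "\<psi> y \<in> gr H l" "\<psi> x \<in> carrier H" "\<psi> y \<in> carrier H"
      using G(9) H.gr_closed by auto
    show "\<beta> x y \<in> gr ?C (k + l - 1)" unfolding \<beta>_def coh_gr
      using \<delta>c(2)[OF c(3,4)] gr_diff[OF p(2)[OF c(1,2)] p0(2)[OF c(1,2)]] by (intro imageI) (simp add: \<delta>_def)
    let ?S = "\<lambda>x. [neg1_pow (k * l)] \<cdot>\<^bsub>A\<^esub> x"
    note d = \<delta>c[OF c(3,4)] \<delta>c[OF c(4,3)]
    have "\<delta> (\<psi> x) (\<psi> y) \<ominus>\<^bsub>A\<^esub> ?S (\<delta> (\<psi> y) (\<psi> x)) =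
        (\<eta>' (\<psi> x) (\<psi> y) \<ominus>\<^bsub>A\<^esub> ?S (\<eta>' (\<psi> y) (\<psi> x))) \<ominus>\<^bsub>A\<^esub> (?g (\<psi> x) (\<psi> y) \<ominus>\<^bsub>A\<^esub> ?S (?g (\<psi> y) (\<psi> x)))"
      unfolding \<delta>_def using \<eta>(1) g(1) c s(2)
      by (cases "even (k * l)") (simp_all add: M.add_neg1_pow M.diff_simps M.diff_simps2 M.a_ac)
    also have "\<dots> \<in> coboundaries A" using coboundary_diff[OF p(3)[OF c(1,2)] p0(3)[OF c(1,2)]] .
    finally have "coh_class A (\<delta> (\<psi> x) (\<psi> y)) = coh_class A (?S (\<delta> (\<psi> y) (\<psi> x)))"
      using d by (subst coh_class_eq_iff) (simp_all add: M.add_neg1_pow)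
    then show "\<beta> x y = [neg1_pow (k * l)] \<cdot>\<^bsub>?C\<^esub> \<beta> y x"
      unfolding \<beta>_def using d by (simp add: M.add_neg1_pow C.M.add_neg1_pow coh_minus)
  qed
  have key: "\<phi> (m a b c) = harrison_diff2 ?C (\<lambda>x y. \<ominus>\<^bsub>?C\<^esub> \<beta> x y) (\<phi> a) (\<phi> b) (\<phi> c) \<oplus>\<^bsub>?C\<^esub> mu3 A h (\<phi> a) (\<phi> b) (\<phi> c)"
    if abc: "a \<in> gr H j" "b \<in> gr H k" "c \<in> gr H l" for a b c j k l
  proof -
    have cc: "a \<in> carrier H" "b \<in> carrier H" "c \<in> carrier H" using abc H.gr_closed by auto
    have pc: "a \<otimes>\<^bsub>H\<^esub> b \<in> carrier H" "b \<otimes>\<^bsub>H\<^esub> c \<in> carrier H" using cc by auto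
    have mc: "m a b c \<in> carrier H" using closed3D[OF m3 cc] .
    let ?S = "\<lambda>x. [neg1_pow j] \<cdot>\<^bsub>A\<^esub> x"
    let ?E = "((\<delta> a b \<otimes>\<^bsub>A\<^esub> \<sigma> c \<ominus>\<^bsub>A\<^esub> ?S (\<sigma> a \<otimes>\<^bsub>A\<^esub> \<delta> b c)) \<oplus>\<^bsub>A\<^esub> \<delta> (a \<otimes>\<^bsub>H\<^esub> b) c) \<ominus>\<^bsub>A\<^esub> \<delta> a (b \<otimes>\<^bsub>H\<^esub> c)"
    have split: "((n1 \<otimes>\<^bsub>A\<^esub> q \<ominus>\<^bsub>A\<^esub> ?S (r \<otimes>\<^bsub>A\<^esub> n2)) \<oplus>\<^bsub>A\<^esub> n3) \<ominus>\<^bsub>A\<^esub> n4 =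
       (((g1 \<otimes>\<^bsub>A\<^esub> q \<ominus>\<^bsub>A\<^esub> ?S (r \<otimes>\<^bsub>A\<^esub> g2)) \<oplus>\<^bsub>A\<^esub> g3) \<ominus>\<^bsub>A\<^esub> g4) \<oplus>\<^bsub>A\<^esub>
       ((((n1 \<ominus>\<^bsub>A\<^esub> g1) \<otimes>\<^bsub>A\<^esub> q \<ominus>\<^bsub>A\<^esub> ?S (r \<otimes>\<^bsub>A\<^esub> (n2 \<ominus>\<^bsub>A\<^esub> g2))) \<oplus>\<^bsub>A\<^esub> (n3 \<ominus>\<^bsub>A\<^esub> g3)) \<ominus>\<^bsub>A\<^esub> (n4 \<ominus>\<^bsub>A\<^esub> g4))"
      if "n1 \<in> carrier A" "n2 \<in> carrier A" "n3 \<in> carrier A" "n4 \<in> carrier A" "g1 \<in> carrier A" "g2 \<in> carrier A"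
        "g3 \<in> carrier A" "g4 \<in> carrier A" "q \<in> carrier A" "r \<in> carrier A" for n1 n2 n3 n4 g1 g2 g3 g4 q r
    proof -
      have e: "(n1 \<ominus>\<^bsub>A\<^esub> g1) \<otimes>\<^bsub>A\<^esub> q = n1 \<otimes>\<^bsub>A\<^esub> q \<ominus>\<^bsub>A\<^esub> g1 \<otimes>\<^bsub>A\<^esub> q" "r \<otimes>\<^bsub>A\<^esub> (n2 \<ominus>\<^bsub>A\<^esub> g2) = r \<otimes>\<^bsub>A\<^esub> n2 \<ominus>\<^bsub>A\<^esub> r \<otimes>\<^bsub>A\<^esub> g2"
        using that by (simp_all add: a_minus_def B.l_distr B.r_distr B.l_minus B.r_minus)
      show ?thesis unfolding e using that
        by (cases "even j") (simp_all add: M.add_neg1_pow M.diff_simps M.diff_simps2 M.a_ac)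
    qed
    have eq: "massey H A \<sigma> \<eta>' j a b c = massey H A \<sigma> ?g j a b c \<oplus>\<^bsub>A\<^esub> ?E"
      unfolding massey_def \<delta>_def by (rule split) (use cc pc \<eta>(1) g(1) s(2) in auto)
    have Mc: "massey H A \<sigma> ?g j a b c \<in> cocycles A" "massey H A \<sigma> \<eta>' j a b c \<in> cocycles A"
      using massey_cocycle[OF sec ph0 abc(1) cc(2,3)] massey_cocycle[OF sec ph abc(1) cc(2,3)] by auto
    note sc = s(8)[OF cc(1)] s(8)[OF cc(2)] s(8)[OF cc(3)]
    note dc = \<delta>c(2)[OF cc(1,2)] \<delta>c(2)[OF cc(2,3)] \<delta>c(2)[OF pc(1) cc(3)] \<delta>c(2)[OF cc(1) pc(2)]
    have Sc: "?S x \<in> cocycles A" if "x \<in> cocycles A" for x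
      using that cocycle_closed[OF that] by (simp add: M.add_neg1_pow cocycle_minus)
    have Ec: "?E \<in> cocycles A"
      by (intro cocycle_diff cocycle_add cocycle_mult Sc sc dc)
    have bc: "\<beta> (\<phi> x) (\<phi> y) = coh_class A (\<delta> x y)" if "x \<in> carrier H" "y \<in> carrier H" for x y
      using that by (simp add: \<beta>_def \<psi>\<phi>)
    have tw: "sign_twist ?C 1 (\<phi> a) = [neg1_pow j] \<cdot>\<^bsub>?C\<^esub> \<phi> a" using C.sign_twist_homogeneous[OF F(9)[OF abc(1)], of 1] by simp
    have cE: "coh_class A ?E = ((\<beta> (\<phi> a) (\<phi> b) \<otimes>\<^bsub>?C\<^esub> \<phi> c \<ominus>\<^bsub>?C\<^esub> sign_twist ?C 1 (\<phi> a) \<otimes>\<^bsub>?C\<^esub> \<beta> (\<phi> b) (\<phi> c)) \<oplus>\<^bsub>?C\<^esub>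
        \<beta> (\<phi> a \<otimes>\<^bsub>?C\<^esub> \<phi> b) (\<phi> c)) \<ominus>\<^bsub>?C\<^esub> \<beta> (\<phi> a) (\<phi> b \<otimes>\<^bsub>?C\<^esub> \<phi> c)"
    proof -
      have 1: "sign_twist ?C 1 (\<phi> a) \<otimes>\<^bsub>?C\<^esub> \<beta> (\<phi> b) (\<phi> c) = coh_class A (?S (\<sigma> a \<otimes>\<^bsub>A\<^esub> \<delta> b c))"
        unfolding tw bc[OF cc(2,3)] unfolding \<phi>_def using sc dc cocycle_closed cocycle_mult
        by (simp add: C.M.add_neg1_pow M.add_neg1_pow coh_mult coh_minus cocycle_minus B.l_minus)
      have 2: "\<beta> (\<phi> a) (\<phi> b) \<otimes>\<^bsub>?C\<^esub> \<phi> c = coh_class A (\<delta> a b \<otimes>\<^bsub>A\<^esub> \<sigma> c)"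
        unfolding bc[OF cc(1,2)] unfolding \<phi>_def using sc dc by (simp add: coh_mult)
      have 3: "\<beta> (\<phi> a \<otimes>\<^bsub>?C\<^esub> \<phi> b) (\<phi> c) = coh_class A (\<delta> (a \<otimes>\<^bsub>H\<^esub> b) c)" "\<beta> (\<phi> a) (\<phi> b \<otimes>\<^bsub>?C\<^esub> \<phi> c) = coh_class A (\<delta> a (b \<otimes>\<^bsub>H\<^esub> c))"
        using F(3)[OF cc(1,2)] F(3)[OF cc(2,3)] bc[OF pc(1) cc(3)] bc[OF cc(1) pc(2)] by simp_all
      show ?thesis unfolding 1 2 3
        using sc dc Sc[OF cocycle_mult[OF sc(1) dc(2)]] cocycle_mult[OF dc(1) sc(3)]
        by (simp add: coh_sub coh_add cocycle_diff cocycle_add)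
    qed
    have "\<phi> (m a b c) = coh_class A (massey H A \<sigma> \<eta>' j a b c)"
      unfolding \<phi>_def using mas[OF abc] coh_class_eq_iff[OF cocycle_closed[OF Mc(2)] s(2)[OF mc]] by simp
    also have "\<dots> = coh_class A (massey H A \<sigma> ?g j a b c) \<oplus>\<^bsub>?C\<^esub> coh_class A ?E"
      unfolding eq using Mc Ec by (simp add: coh_add)
    also have "coh_class A (massey H A \<sigma> ?g j a b c) = mu3 A h (\<phi> a) (\<phi> b) (\<phi> c)"
      unfolding \<phi>_def by (rule harmonic_massey_class[OF H sec hs mult abc(1) cc(2,3)])
    \<comment> \<open>The terms of \<open>?E\<close> are those of the Harrison differential with
      opposite signs, which is why the bounding cochain is the negative of
      \<open>\<beta>\<close>.\<close>
    also have "coh_class A ?E = \<ominus>\<^bsub>?C\<^esub> harrison_diff2 ?C \<beta> (\<phi> a) (\<phi> b) (\<phi> c)"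
      unfolding cE harrison_diff2_def using F(1) cc harrison2D(1)[OF h\<beta>]
      by (simp add: C.M.diff_simps C.M.diff_simps2 C.M.a_ac)
    also have "\<dots> = harrison_diff2 ?C (\<lambda>x y. \<ominus>\<^bsub>?C\<^esub> \<beta> x y) (\<phi> a) (\<phi> b) (\<phi> c)"
      using C.harrison_diff2_minus[OF h\<beta>] F(1) cc by simp
    finally show ?thesis
      using closed3D[OF mu3_closed3] C.harrison_diff2_closed[OF C.harrison2_minus[OF h\<beta>]] F(1) cc by (simp add: C.M.a_comm)
  qed
  have eq: "\<phi> (m (\<psi> x) (\<psi> y) (\<psi> z)) = harrison_diff2 ?C (\<lambda>x y. \<ominus>\<^bsub>?C\<^esub> \<beta> x y) x y z \<oplus>\<^bsub>?C\<^esub> mu3 A h x y z"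
    if "x \<in> carrier ?C" "y \<in> carrier ?C" "z \<in> carrier ?C" for x y z
  proof (rule C.triadditive_eqI[where F = "\<lambda>x y z. \<phi> (m (\<psi> x) (\<psi> y) (\<psi> z))" and C = ?C
        and G = "\<lambda>x y z. harrison_diff2 ?C (\<lambda>x y. \<ominus>\<^bsub>?C\<^esub> \<beta> x y) x y z \<oplus>\<^bsub>?C\<^esub> mu3 A h x y z"])
    show "triadditive ?C ?C (\<lambda>x y z. \<phi> (m (\<psi> x) (\<psi> y) (\<psi> z)))"
      using m F(1,2) G(1,2) unfolding triadditive_def by simp
    show "triadditive ?C ?C (\<lambda>x y z. harrison_diff2 ?C (\<lambda>x y. \<ominus>\<^bsub>?C\<^esub> \<beta> x y) x y z \<oplus>\<^bsub>?C\<^esub> mu3 A h x y z)"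
      by (intro C.triadditive_add C.harrison_diff2_triadditive C.harrison2_minus h\<beta> mu3_triadditive)
    fix j k l x y z assume "x \<in> gr ?C j" "y \<in> gr ?C k" "z \<in> gr ?C l"
    then show "\<phi> (m (\<psi> x) (\<psi> y) (\<psi> z)) = harrison_diff2 ?C (\<lambda>x y. \<ominus>\<^bsub>?C\<^esub> \<beta> x y) x y z \<oplus>\<^bsub>?C\<^esub> mu3 A h x y z"
      using key[OF G(9) G(9) G(9)] \<phi>\<psi> C.gr_closed by metis
  qed (use that in auto)
  have c3: "closed3 ?C (\<lambda>x y z. \<phi> (m (\<psi> x) (\<psi> y) (\<psi> z)))"
    using closed3D[OF m3] F(1) G(1) by (simp add: closed3_def)
  have "harr_class K ?C 3 (-1) (cochain3 ?C (\<lambda>x y z. \<phi> (m (\<psi> x) (\<psi> y) (\<psi> z)))) = mu3_class K A h"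
    unfolding mu3_class_cochain C.harr_class_eq_iff[OF c3 mu3_closed3]
    using C.harrison2_minus[OF h\<beta>] eq by blast
  then have "harr_cohomology_map K H ?C 3 (-1) \<phi> (harr_class K H 3 (-1) (cochain3 H m)) = mu3_class K A h"
    using harr_cohomology_map_class[OF H C.graded_comm_algebra_axioms \<phi> m3] by (simp add: \<psi>_def)
  then show ?thesis using \<phi> by blast
qed

text \<open>The value lies in degree \<open>n\<close>, where a harmonic element times an element of
  the image of \<open>h\<close> has no harmonic part. Both terms are of this kind, the first after
  commuting its factors.\<close>

lemma (in connected_hodge) mu3_top_zero:
  assumes "a \<in> gr (cohomology A) j" "b \<in> gr (cohomology A) k" "c \<in> gr (cohomology A) l" "j + k + l = int n + 1"
  shows "mu3 A h a b c = \<zero>\<^bsub>cohomology A\<^esub>"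
proof -
  interpret C: dgca K "cohomology A" by (rule dgca_cohomology)
  let ?i = "harmonic_rep A h"
  have cc: "a \<in> carrier (cohomology A)" "b \<in> carrier (cohomology A)" "c \<in> carrier (cohomology A)"
    using assms C.gr_closed by auto
  note H = harmonic_rep_props(1)[OF cc(1)] harmonic_rep_props(1)[OF cc(2)] harmonic_rep_props(1)[OF cc(3)]
  note g = harmonic_rep_gr[OF assms(1)] harmonic_rep_gr[OF assms(2)] harmonic_rep_gr[OF assms(3)]
  note e = harmonic_rep_props(2)[OF cc(1)] harmonic_rep_props(2)[OF cc(2)] harmonic_rep_props(2)[OF cc(3)]
  have ic: "?i a \<in> carrier A" "?i b \<in> carrier A" "?i c \<in> carrier A" using g gr_closed by auto
  have gh: "h (?i a \<otimes>\<^bsub>A\<^esub> ?i b) \<in> gr A (j + k - 1)" "h (?i b \<otimes>\<^bsub>A\<^esub> ?i c) \<in> gr A (k + l - 1)"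
    using g by (auto intro: h_degree mult_gr)
  have 1: "\<pi> (?i a \<otimes>\<^bsub>A\<^esub> h (?i b \<otimes>\<^bsub>A\<^esub> ?i c)) = \<zero>\<^bsub>A\<^esub>"
    using mult_gr[OF g(1) gh(2)] assms(4) ic by (intro pi_harmonic_h_top[OF H(1)]) (simp_all add: algebra_simps)
  have "\<pi> (?i c \<otimes>\<^bsub>A\<^esub> h (?i a \<otimes>\<^bsub>A\<^esub> ?i b)) = \<zero>\<^bsub>A\<^esub>"
    using mult_gr[OF g(3) gh(1)] assms(4) ic by (intro pi_harmonic_h_top[OF H(3)]) (simp_all add: algebra_simps)
  then have 2: "\<pi> (h (?i a \<otimes>\<^bsub>A\<^esub> ?i b) \<otimes>\<^bsub>A\<^esub> ?i c) = \<zero>\<^bsub>A\<^esub>"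
    using mult_commute_cases[OF gh(1) g(3)] ic by (simp add: pi_minus split: if_splits)
  show ?thesis using mu3_harmonic[OF H(1) g(1) H(2,3)] ic 1 2
    by (simp add: e M.add_neg1_pow pi_add pi_minus a_minus_def coh_class_zero)
qed

section \<open>Realizing isomorphisms of the invariants\<close>

text \<open>Eliminates the common coboundary \<open>d\<close> from two relations, one between the
  ternary operations and one for \<open>\<beta>\<close>. The result has the shape of
  \<open>\<beta>_cocycle\<close>.\<close>

lemma (in abelian_group) exchange:
  assumes "p1 \<ominus> p2 = d \<oplus> (q1 \<ominus> q2)" "r2 \<oplus> s2 = d \<oplus> (r1 \<oplus> s1)"
    and "p1 \<in> carrier G" "p2 \<in> carrier G" "q1 \<in> carrier G" "q2 \<in> carrier G" "d \<in> carrier G"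
    "r1 \<in> carrier G" "r2 \<in> carrier G" "s1 \<in> carrier G" "s2 \<in> carrier G"
  shows "((p1 \<ominus> q1) \<oplus> r1) \<oplus> s1 = ((p2 \<ominus> q2) \<oplus> r2) \<oplus> s2"
proof -
  have "((p1 \<ominus> q1) \<oplus> r1) \<oplus> s1 = (((p1 \<ominus> p2) \<oplus> p2) \<ominus> q1) \<oplus> (r1 \<oplus> s1)"
    using assms(3-) by (simp add: diff_simps a_ac)
  also have "\<dots> = (p2 \<ominus> q2) \<oplus> (d \<oplus> (r1 \<oplus> s1))"
    unfolding assms(1) using assms(3-) by (simp add: diff_simps a_ac)
  also have "\<dots> = ((p2 \<ominus> q2) \<oplus> r2) \<oplus> s2"
    unfolding assms(2)[symmetric] using assms(3-) by (simp add: diff_simps a_ac)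
  finally show ?thesis .
qed

locale connected_hodge_pair = X: connected_hodge K A n fund h r + Y: connected_hodge K A' n fund' h' r
  for K :: "('k, 'l) ring_scheme" and A :: "('k, 'a) dgca" and A' :: "('k, 'b) dgca" and n :: nat
    and fund :: "'a set \<Rightarrow> 'k" and fund' :: "'b set \<Rightarrow> 'k" and h :: "'a \<Rightarrow> 'a" and h' :: "'b \<Rightarrow> 'b"
    and r :: nat
begin

text \<open>The operation \<open>mu3 A h\<close> is realized on \<open>A\<close> by the harmonic
  section, hence on \<open>A'\<close> by invariance. Comparing this realization with the Hodge
  homotopy of \<open>A'\<close> gives the isomorphism.\<close>

lemma same_homotopy_class_iso:
  assumes "same_homotopy_class U K A A'"
  shows "\<exists>\<phi>\<in>graded_algebra_iso K (cohomology A) (cohomology A').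
     harr_cohomology_map K (cohomology A) (cohomology A') 3 (-1) \<phi> (mu3_class K A h) = mu3_class K A' h'"
proof -
  obtain I :: "('a set \<times> int) set" and e dg cf where "homogeneous_coordinates K (cohomology A) I e dg cf"
    by (rule X.cohomology_coordinates)
  then interpret H: homogeneous_coordinates K "cohomology A" I e dg cf .
  have "H.invariant A (mu3 A h)"
    unfolding H.invariant_def using X.transfers_harmonic_rep by blast
  then have "H.invariant A' (mu3 A h)"
    using H.invariant_same_homotopy_class[OF X.mu3_closed3 assms] by blast
  then obtain s \<eta> where "transfers K (cohomology A) A' (mu3 A h) s \<eta>" unfolding H.invariant_def by blast
  from Y.transfers_compare[OF H.graded_comm_algebra_axioms this X.mu3_triadditive]
  show ?thesis by (simp add: X.mu3_class_cochain)
qed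

end

text \<open>The equation \<open>mu\<close> is the equality of Harrison classes made explicit:
  \<open>b\<close> bounds the difference of the ternary operations.\<close>

locale hodge_iso = connected_hodge_pair K A A' n fund fund' h h' r
  for K :: "('k, 'l) ring_scheme" and A :: "('k, 'a) dgca" and A' :: "('k, 'b) dgca" (structure) and n :: nat
    and fund :: "'a set \<Rightarrow> 'k" and fund' :: "'b set \<Rightarrow> 'k" and h :: "'a \<Rightarrow> 'a" and h' :: "'b \<Rightarrow> 'b"
    and r :: nat +
  fixes \<phi> :: "'a set \<Rightarrow> 'b set" and b :: "'b set \<Rightarrow> 'b set \<Rightarrow> 'b set"
  assumes iso: "\<phi> \<in> graded_algebra_iso K (cohomology A) (cohomology A')"
    and harr_b: "harrison2 K (cohomology A') b"
    and mu: "\<And>x y z. x \<in> carrier (cohomology A) \<Longrightarrow> y \<in> carrier (cohomology A) \<Longrightarrow> z \<in> carrier (cohomology A) \<Longrightarrow>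
      mu3 A' h' (\<phi> x) (\<phi> y) (\<phi> z) =
        harrison_diff2 (cohomology A') b (\<phi> x) (\<phi> y) (\<phi> z) \<oplus>\<^bsub>cohomology A'\<^esub> \<phi> (mu3 A h x y z)"
begin

sublocale C: dgca K "cohomology A" by (rule X.dgca_cohomology)
sublocale C': dgca K "cohomology A'" by (rule Y.dgca_cohomology)

lemmas \<phi> = graded_algebra_isoD[OF C.graded_comm_algebra_axioms C'.graded_comm_algebra_axioms iso]
lemmas b = harrison2D[OF harr_b]
lemmas \<iota> = module_hom_facts[OF C'.is_module Y.is_module Y.harmonic_rep_linear]

text \<open>The isomorphism \<open>\<phi>\<close> read on harmonic elements, and zero on exact
  elements and on the image of \<open>h\<close>.\<close>

definition \<theta> :: "'a \<Rightarrow> 'b" where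
  "\<theta> x = harmonic_rep A' h' (\<phi> (coh_class A (X.\<pi> x)))"

text \<open>Only the classes in degrees \<open>r\<close> and \<open>2r\<close> are twisted, and only if \<open>n = 4r - 1\<close>: the Harrison
  coboundary of \<open>b\<close> has nothing to correct in the other degrees.\<close>

definition cl :: "'b \<Rightarrow> 'b set" where
  "cl y = coh_class A' (Y.\<pi> (component A' (int r) y \<oplus> component A' (2 * int r) y))"

definition \<beta> :: "'b \<Rightarrow> 'b \<Rightarrow> 'b" where
  "\<beta> y y' = (if n = 4 * r - 1 then harmonic_rep A' h' (b (cl y) (cl y')) else \<zero>)"

lemma \<theta>_linear: "\<theta> \<in> module_hom K A A'"
  unfolding module_hom_def \<theta>_def
  by (auto simp: X.pi_add X.pi_smult X.pi_cocycle \<phi>(1,2,4) \<iota>(1-3) simp flip: X.coh_add X.coh_smult)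

lemma coh_pi_closed [simp]: "x \<in> carrier A \<Longrightarrow> coh_class A (X.\<pi> x) \<in> carrier (cohomology A)"
  by (simp add: X.pi_cocycle)

lemma \<theta>_harmonic: "x \<in> carrier A \<Longrightarrow> \<theta> x \<in> harmonic A' h'"
  unfolding \<theta>_def by (intro Y.harmonic_rep_props \<phi>(1) coh_pi_closed)

lemma coh_class_\<theta>: "x \<in> carrier A \<Longrightarrow> coh_class A' (\<theta> x) = \<phi> (coh_class A (X.\<pi> x))"
  unfolding \<theta>_def by (intro Y.harmonic_rep_props \<phi>(1) coh_pi_closed)

lemma coh_pi_gr: "x \<in> gr A k \<Longrightarrow> coh_class A (X.\<pi> x) \<in> gr (cohomology A) k"
  unfolding X.coh_gr using X.pi_gr X.pi_cocycle X.gr_closed by blast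

lemma coh_pi_gr': "y \<in> gr A' k \<Longrightarrow> coh_class A' (Y.\<pi> y) \<in> gr (cohomology A') k"
  unfolding Y.coh_gr using Y.pi_gr Y.pi_cocycle Y.gr_closed by blast

lemma \<theta>_gr: "x \<in> gr A k \<Longrightarrow> \<theta> x \<in> gr A' k"
  unfolding \<theta>_def by (intro Y.harmonic_rep_gr \<phi>(9) coh_pi_gr)

lemma \<theta>_mult:
  assumes "x \<in> harmonic A h" "y \<in> harmonic A h"
  shows "\<theta> (x \<otimes>\<^bsub>A\<^esub> y) = Y.\<pi> (\<theta> x \<otimes> \<theta> y)"
proof -
  have c: "x \<in> cocycles A" "y \<in> cocycles A" "X.\<pi> x = x" "X.\<pi> y = y"
    using assms X.harmonic_cocycle X.harmonicD by auto
  have "coh_class A (X.\<pi> (x \<otimes>\<^bsub>A\<^esub> y)) = coh_class A x \<otimes>\<^bsub>cohomology A\<^esub> coh_class A y"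
    using c by (simp add: X.coh_class_pi X.cocycle_mult X.coh_mult)
  then show ?thesis unfolding \<theta>_def using c X.coh_class_closed by (simp add: \<phi>(1,3) Y.harmonic_rep_mult)
qed

lemma \<theta>_inj:
  assumes "x \<in> harmonic A h" "\<theta> x = \<zero>"
  shows "x = \<zero>\<^bsub>A\<^esub>"
proof -
  note x = X.harmonicD[OF assms(1)] X.harmonic_cocycle[OF assms(1)]
  have "\<phi> (coh_class A x) = \<phi> \<zero>\<^bsub>cohomology A\<^esub>"
    using coh_class_\<theta>[of x] assms(2) x Y.coh_class_zero by (simp add: \<phi>(7))
  then have "coh_class A x = \<zero>\<^bsub>cohomology A\<^esub>"
    using \<phi>(11) x X.coh_class_closed unfolding bij_betw_def inj_on_def by blast
  then have "x \<in> coboundaries A" using x X.coh_class_eq_zero_iff by blast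
  then show ?thesis using X.pi_coboundary x by auto
qed

lemma \<theta>_surj:
  assumes "y \<in> harmonic A' h'"
  shows "\<exists>x\<in>harmonic A h. \<theta> x = y"
proof -
  note y = Y.harmonicD[OF assms] Y.harmonic_cocycle[OF assms]
  obtain a where a: "a \<in> carrier (cohomology A)" "\<phi> a = coh_class A' y"
    using \<phi>(11) Y.coh_class_closed[OF y(2)] unfolding bij_betw_def by (metis imageE)
  have "\<theta> (harmonic_rep A h a) = y" unfolding \<theta>_def
    using X.harmonic_rep_props[OF a(1)] X.harmonicD a y by (simp add: Y.harmonic_rep_class)
  then show ?thesis using X.harmonic_rep_props(1)[OF a(1)] by blast
qed

lemma cl_closed [simp]: "y \<in> carrier A' \<Longrightarrow> cl y \<in> carrier (cohomology A')"
  by (simp add: cl_def Y.pi_cocycle)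

lemma cl_add: "y \<in> carrier A' \<Longrightarrow> w \<in> carrier A' \<Longrightarrow> cl (y \<oplus> w) = cl y \<oplus>\<^bsub>cohomology A'\<^esub> cl w"
  by (simp add: cl_def Y.component_add Y.pi_cocycle Y.cocycle_add Y.coh_add Y.pi_add Y.M.a_ac)

lemma cl_smult: "c \<in> carrier K \<Longrightarrow> y \<in> carrier A' \<Longrightarrow> cl (c \<odot> y) = c \<odot>\<^bsub>cohomology A'\<^esub> cl y"
  by (simp add: cl_def Y.component_smult Y.pi_cocycle Y.cocycle_add Y.coh_smult Y.pi_add Y.pi_smult Y.smult_r_distr)

lemma cl_d: "y \<in> carrier A' \<Longrightarrow> cl (diff A' y) = \<zero>\<^bsub>cohomology A'\<^esub>"
  by (simp add: cl_def Y.component_d Y.pi_add Y.pi_d Y.coh_class_zero)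

lemma r_pos: "int r \<noteq> 2 * int r" "int r \<noteq> 0" using X.r_ge_2 by auto

lemma cl_homogeneous:
  "y \<in> gr A' k \<Longrightarrow> cl y = (if k \<in> {int r, 2 * int r} then coh_class A' (Y.\<pi> y) else \<zero>\<^bsub>cohomology A'\<^esub>)"
  using r_pos Y.gr_closed[of y k] by (auto simp: cl_def Y.component_homogeneous Y.coh_class_zero)

lemma cl_gr: "y \<in> gr A' k \<Longrightarrow> cl y \<in> gr (cohomology A') k"
  using coh_pi_gr' C'.gr_zero by (simp add: cl_homogeneous)

lemma coh_class_\<beta>:
  assumes "n = 4 * r - 1" "y \<in> carrier A'" "w \<in> carrier A'"
  shows "coh_class A' (\<beta> y w) = b (cl y) (cl w)"
  unfolding \<beta>_def using assms b(1) by (simp add: Y.harmonic_rep_props)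

lemma \<beta>_harmonic: "y \<in> carrier A' \<Longrightarrow> w \<in> carrier A' \<Longrightarrow> \<beta> y w \<in> harmonic A' h'"
  unfolding \<beta>_def using b(1) Y.harmonic_rep_props(1) Y.harmonic_iff by simp

lemma \<beta>_closed: "y \<in> carrier A' \<Longrightarrow> w \<in> carrier A' \<Longrightarrow> \<beta> y w \<in> carrier A'"
  using \<beta>_harmonic Y.harmonicD by blast

lemma b_zero: "x \<in> carrier (cohomology A') \<Longrightarrow> b x \<zero>\<^bsub>cohomology A'\<^esub> = \<zero>\<^bsub>cohomology A'\<^esub>"
  "x \<in> carrier (cohomology A') \<Longrightarrow> b \<zero>\<^bsub>cohomology A'\<^esub> x = \<zero>\<^bsub>cohomology A'\<^esub>"
  using b(4)[of "\<zero>\<^bsub>K\<^esub>" "\<zero>\<^bsub>cohomology A'\<^esub>" x] b(5)[of "\<zero>\<^bsub>K\<^esub>" x "\<zero>\<^bsub>cohomology A'\<^esub>"] b(1) by simp_all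

lemma \<beta>_zero:
  assumes "y \<in> gr A' k" "w \<in> gr A' l" "\<not> (n = 4 * r - 1 \<and> k \<in> {int r, 2 * int r} \<and> l \<in> {int r, 2 * int r})"
  shows "\<beta> y w = \<zero>"
  using assms Y.gr_closed[OF assms(1)] Y.gr_closed[OF assms(2)] cl_closed[of y] cl_closed[of w]
  by (auto simp: \<beta>_def cl_homogeneous b_zero \<iota>(4) Y.pi_cocycle)

lemma \<beta>_linear:
  assumes "x \<in> carrier A'" "x' \<in> carrier A'" "y \<in> carrier A'" "c \<in> carrier K"
  shows "\<beta> (x \<oplus> x') y = \<beta> x y \<oplus> \<beta> x' y" "\<beta> y (x \<oplus> x') = \<beta> y x \<oplus> \<beta> y x'"
    "\<beta> (c \<odot> x) y = c \<odot> \<beta> x y" "\<beta> y (c \<odot> x) = c \<odot> \<beta> y x"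
  unfolding \<beta>_def using assms b(1-5) \<iota>(1-4) by (simp_all add: cl_add cl_smult)

lemma \<beta>_gr: "y \<in> gr A' k \<Longrightarrow> w \<in> gr A' l \<Longrightarrow> \<beta> y w \<in> gr A' (k + l - 1)"
  unfolding \<beta>_def using b(6)[OF cl_gr cl_gr] Y.harmonic_rep_gr Y.gr_zero by simp

lemma \<beta>_comm:
  assumes "y \<in> gr A' k" "w \<in> gr A' l" shows "\<beta> y w = [neg1_pow (k * l)] \<cdot> \<beta> w y"
  unfolding \<beta>_def using b(7)[OF cl_gr[OF assms(1)] cl_gr[OF assms(2)]] b(1) \<iota>(1,5) assms Y.gr_closed
  by (simp add: C'.M.add_neg1_pow Y.M.add_neg1_pow)

text \<open>In degrees \<open>(r, r)\<close> the factors are closed and the products agree in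
  cohomology. In the other cases the degree \<open>3r\<close> lies strictly between
  \<open>n - r\<close> and \<open>n\<close>, so both sides vanish.\<close>

lemma cl_mult:
  assumes n: "n = 4 * r - 1" and x: "x \<in> Y.S j" and y: "y \<in> Y.S k"
    and jk: "(j, k) \<in> {(int r, int r), (int r, 2 * int r), (2 * int r, int r)}"
  shows "cl (x \<otimes> y) = cl x \<otimes>\<^bsub>cohomology A'\<^esub> cl y"
proof -
  note c = Y.S_gr[OF x] Y.S_gr[OF y] Y.S_closed[OF x] Y.S_closed[OF y]
  have xy: "x \<otimes> y \<in> gr A' (j + k)" using c by (intro Y.mult_gr)
  show ?thesis
  proof (cases "j = int r \<and> k = int r")
    case True
    then have "x \<in> harmonic A' h'" "y \<in> harmonic A' h'"
      using Y.S_harmonic[OF x] Y.S_harmonic[OF y] X.r_ge_2 by auto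
    then have "x \<in> cocycles A'" "y \<in> cocycles A'" using Y.harmonic_cocycle by auto
    then show ?thesis using True cl_homogeneous[OF c(1)] cl_homogeneous[OF c(2)] cl_homogeneous[OF xy]
      by (simp add: Y.coh_class_pi Y.cocycle_mult Y.coh_mult)
  next
    case False
    then have jk: "j + k = 3 * int r" using jk by auto
    then have "cl (x \<otimes> y) = \<zero>\<^bsub>cohomology A'\<^esub>" using cl_homogeneous[OF xy] X.r_ge_2 by simp
    moreover have "z = \<zero>\<^bsub>cohomology A'\<^esub>" if z: "z \<in> gr (cohomology A') (j + k)" for z
    proof -
      obtain u where u: "u \<in> cocycles A'" "u \<in> gr A' (j + k)" "z = coh_class A' u" using z by (auto simp: Y.coh_gr)
      have "Y.\<pi> u = \<zero>" using jk n X.r_ge_2 by (intro Y.pi_gr_vanish[OF u(2)]) auto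
      then show ?thesis using u Y.coh_class_pi[OF u(1)] Y.coh_class_zero by simp
    qed
    ultimately show ?thesis using C'.mult_gr[OF cl_gr[OF c(1)] cl_gr[OF c(2)]] by simp
  qed
qed

text \<open>Translates the Harrison differential of \<open>b\<close> into the cocycle expression for
  \<open>\<beta>\<close>. In the listed degrees \<open>cl\<close> loses nothing of the outer factors
  and is multiplicative, so products of classes may be formed in \<open>A'\<close>.\<close>

lemma \<beta>_hoch:
  assumes n: "n = 4 * r - 1" and x: "x \<in> Y.S j" and y: "y \<in> Y.S k" and w: "w \<in> Y.S l"
    and jkl: "(j, k, l) \<in> {(int r, int r, int r), (int r, int r, 2 * int r), (int r, 2 * int r, int r), (2 * int r, int r, int r)}"
  shows "coh_class A' (\<beta> x (y \<otimes> w) \<oplus> [neg1_pow j] \<cdot> Y.\<pi> (Y.\<pi> x \<otimes> \<beta> y w)) =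
    harrison_diff2 (cohomology A') b (cl x) (cl y) (cl w) \<oplus>\<^bsub>cohomology A'\<^esub>
      coh_class A' (\<beta> (x \<otimes> y) w \<oplus> Y.\<pi> (\<beta> x y \<otimes> Y.\<pi> w))"
proof -
  note c = Y.S_closed[OF x] Y.S_closed[OF y] Y.S_closed[OF w]
  note g = Y.S_gr[OF x] Y.S_gr[OF y] Y.S_gr[OF w]
  note \<beta>c = \<beta>_harmonic[OF c(1,2), THEN Y.harmonic_cocycle] \<beta>_harmonic[OF c(2,3), THEN Y.harmonic_cocycle]
  have cp: "cl x = coh_class A' (Y.\<pi> x)" "cl w = coh_class A' (Y.\<pi> w)"
    using jkl cl_homogeneous[OF g(1)] cl_homogeneous[OF g(3)] by auto
  have 1: "coh_class A' (Y.\<pi> (\<beta> x y \<otimes> Y.\<pi> w)) = b (cl x) (cl y) \<otimes>\<^bsub>cohomology A'\<^esub> cl w"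
    using c \<beta>c by (simp add: Y.coh_class_pi Y.cocycle_mult Y.pi_cocycle Y.coh_mult[symmetric]
        coh_class_\<beta>[OF n, symmetric] cp(2))
  have 2: "coh_class A' (Y.\<pi> (Y.\<pi> x \<otimes> \<beta> y w)) = cl x \<otimes>\<^bsub>cohomology A'\<^esub> b (cl y) (cl w)"
    using c \<beta>c by (simp add: Y.coh_class_pi Y.cocycle_mult Y.pi_cocycle Y.coh_mult[symmetric]
        coh_class_\<beta>[OF n, symmetric] cp(1))
  have 3: "sign_twist (cohomology A') 1 (cl x) = [neg1_pow j] \<cdot>\<^bsub>cohomology A'\<^esub> cl x"
    using C'.sign_twist_homogeneous[OF cl_gr[OF g(1)], of 1] by simp
  have 4: "cl (x \<otimes> y) = cl x \<otimes>\<^bsub>cohomology A'\<^esub> cl y" "cl (y \<otimes> w) = cl y \<otimes>\<^bsub>cohomology A'\<^esub> cl w"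
    using jkl cl_mult[OF n x y] cl_mult[OF n y w] by auto
  have 5: "coh_class A' ([neg1_pow j] \<cdot> Y.\<pi> (Y.\<pi> x \<otimes> \<beta> y w)) =
      [neg1_pow j] \<cdot>\<^bsub>cohomology A'\<^esub> (cl x \<otimes>\<^bsub>cohomology A'\<^esub> b (cl y) (cl w))"
    using c \<beta>_closed 2 by (simp add: Y.M.add_neg1_pow C'.M.add_neg1_pow Y.coh_minus[symmetric] Y.pi_cocycle b(1))
  have cc: "\<beta> x (y \<otimes> w) \<in> cocycles A'" "\<beta> (x \<otimes> y) w \<in> cocycles A'" "Y.\<pi> (\<beta> x y \<otimes> Y.\<pi> w) \<in> cocycles A'"
    "[neg1_pow j] \<cdot> Y.\<pi> (Y.\<pi> x \<otimes> \<beta> y w) \<in> cocycles A'"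
    using \<beta>_harmonic[THEN Y.harmonic_cocycle] c \<beta>_closed by (auto simp: Y.pi_cocycle Y.M.add_neg1_pow Y.cocycle_minus)
  show ?thesis
    unfolding Y.coh_add[OF cc(1,4), symmetric] Y.coh_add[OF cc(2,3), symmetric] 1 5
      coh_class_\<beta>[OF n c(1) Y.B.m_closed[OF c(2,3)]] coh_class_\<beta>[OF n Y.B.m_closed[OF c(1,2)] c(3)] 4
    unfolding harrison_diff2_def 3 using c b(1)
    by (cases "even j") (simp_all add: C'.M.add_neg1_pow C'.B.l_minus C'.M.diff_simps C'.M.diff_simps2 C'.M.a_ac)
qed

lemma harmonic_eqI:
  assumes "x \<in> harmonic A' h'" "y \<in> harmonic A' h'" "coh_class A' x = coh_class A' y"
  shows "x = y"
  using assms Y.pi_eq_iff[OF Y.harmonic_cocycle Y.harmonic_cocycle] Y.harmonicD by metis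

text \<open>By \<open>mu\<close> this coboundary is the difference of two ternary operations, and
  both vanish in top degree.\<close>

lemma harrison_diff2_top:
  assumes "x \<in> gr (cohomology A') j" "y \<in> gr (cohomology A') k" "w \<in> gr (cohomology A') l" "j + k + l = int n + 1"
  shows "harrison_diff2 (cohomology A') b x y w = \<zero>\<^bsub>cohomology A'\<^esub>"
proof -
  let ?\<psi> = "the_inv_into (carrier (cohomology A)) \<phi>"
  have \<psi>: "?\<psi> \<in> graded_algebra_iso K (cohomology A') (cohomology A)"
    by (rule graded_algebra_iso_inverse[OF C.graded_comm_algebra_axioms C'.graded_comm_algebra_axioms iso])
  note \<psi> = graded_algebra_isoD[OF C'.graded_comm_algebra_axioms C.graded_comm_algebra_axioms \<psi>]
  have inv: "\<phi> (?\<psi> u) = u" if "u \<in> carrier (cohomology A')" for u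
    using f_the_inv_into_f_bij_betw[OF \<phi>(11)] that by blast
  have c: "x \<in> carrier (cohomology A')" "y \<in> carrier (cohomology A')" "w \<in> carrier (cohomology A')"
    using assms C'.gr_closed by auto
  have "mu3 A' h' x y w = \<zero>\<^bsub>cohomology A'\<^esub>" using Y.mu3_top_zero[OF assms] .
  moreover have "mu3 A h (?\<psi> x) (?\<psi> y) (?\<psi> w) = \<zero>\<^bsub>cohomology A\<^esub>"
    using X.mu3_top_zero[OF \<psi>(9)[OF assms(1)] \<psi>(9)[OF assms(2)] \<psi>(9)[OF assms(3)] assms(4)] .
  ultimately show ?thesis
    using mu[OF \<psi>(1)[OF c(1)] \<psi>(1)[OF c(2)] \<psi>(1)[OF c(3)]] C'.harrison_diff2_closed[OF harr_b c]
    by (simp add: inv[OF c(1)] inv[OF c(2)] inv[OF c(3)] \<phi>(7))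
qed

lemma \<beta>_zero_arg:
  assumes "u \<in> carrier A'"
  shows "\<beta> \<zero> u = \<zero>" "\<beta> u \<zero> = \<zero>" "\<beta> \<one> u = \<zero>" "\<beta> u \<one> = \<zero>"
  using assms r_pos cl_homogeneous[OF Y.gr_zero, of "-1"] cl_homogeneous[OF Y.one_gr]
  by (simp_all add: \<beta>_def b_zero \<iota>(4))

text \<open>Both sides are harmonic of degree \<open>j + k + l - 1\<close>. For factors of degree at
  least \<open>r\<close>, not all equal to \<open>r\<close>, this degree carries no harmonic
  elements unless the degrees sum to \<open>4r\<close>. In that case either they are
  \<open>r\<close>, \<open>r\<close>, \<open>2r\<close> in some order and
  \<open>harrison_diff2_top\<close> applies, or every term vanishes by
  \<open>\<beta>_zero\<close>.\<close>

lemma \<beta>_assoc: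
  assumes x: "x \<in> Y.S j" and y: "y \<in> Y.S k" and w: "w \<in> Y.S l"
    and exc: "\<not> (n = 4 * r - 1 \<and> j = int r \<and> k = int r \<and> l = int r)"
  shows "\<beta> (x \<otimes> y) w \<oplus> Y.\<pi> (\<beta> x y \<otimes> Y.\<pi> w) = \<beta> x (y \<otimes> w) \<oplus> [neg1_pow j] \<cdot> Y.\<pi> (Y.\<pi> x \<otimes> \<beta> y w)"
    (is "?L = ?R")
proof (cases "n = 4 * r - 1")
  case False
  then show ?thesis using Y.S_closed x y w by (simp add: \<beta>_def Y.M.add_neg1_pow)
next
  case n: True
  note c = Y.S_closed[OF x] Y.S_closed[OF y] Y.S_closed[OF w]
  note g = Y.S_gr[OF x] Y.S_gr[OF y] Y.S_gr[OF w]
  have \<beta>p: "Y.\<pi> (\<beta> u v) = \<beta> u v" if "u \<in> carrier A'" "v \<in> carrier A'" for u v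
    using \<beta>_harmonic[OF that] Y.harmonicD by blast
  show ?thesis using x proof (cases rule: Y.S_cases)
    case (scalar d)
    then show ?thesis using c \<beta>_closed
      by (simp add: Y.smult_mult_left \<beta>_linear \<beta>_zero_arg Y.pi_smult Y.pi_one \<beta>p neg1_pow_def)
  next
    case zero
    then show ?thesis using c \<beta>_closed by (simp add: \<beta>_zero_arg Y.M.add_neg1_pow)
  next
    case j: positive
    show ?thesis
    using y proof (cases rule: Y.S_cases)
      case (scalar d)
      then show ?thesis using c \<beta>_closed
        by (simp add: Y.smult_mult_left Y.smult_mult_right \<beta>_linear \<beta>_zero_arg Y.M.add_neg1_pow)
    next
      case zero
      then show ?thesis using c \<beta>_closed by (simp add: \<beta>_zero_arg Y.M.add_neg1_pow)
    next
      case k: positive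
      show ?thesis
      using w proof (cases rule: Y.S_cases)
        case (scalar d)
        then show ?thesis using c \<beta>_closed
          by (simp add: Y.smult_mult_right \<beta>_linear \<beta>_zero_arg Y.pi_smult Y.pi_one \<beta>p Y.M.add_neg1_pow)
      next
        case zero
        then show ?thesis using c \<beta>_closed by (simp add: \<beta>_zero_arg Y.M.add_neg1_pow)
      next
        case l: positive
        have Lc: "?L \<in> carrier A'" "?R \<in> carrier A'" using c \<beta>_closed by (simp_all add: Y.M.add_neg1_pow)
        have Lp: "Y.\<pi> ?L = ?L" "Y.\<pi> ?R = ?R"
          using c \<beta>_closed by (simp_all add: Y.pi_add Y.pi_minus \<beta>p Y.M.add_neg1_pow)
        show ?thesis
        proof (cases "j + k + l = 4 * int r")
          case False
          have "?L \<in> gr A' (j + k + l - 1)"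
            using \<beta>_gr[OF Y.mult_gr[OF g(1,2)] g(3)] Y.pi_gr[OF Y.mult_gr[OF \<beta>_gr[OF g(1,2)] Y.pi_gr[OF g(3)]]]
            by (intro Y.gr_add) (simp_all add: algebra_simps)
          moreover have "?R \<in> gr A' (j + k + l - 1)"
            using \<beta>_gr[OF g(1) Y.mult_gr[OF g(2,3)]] Y.pi_gr[OF Y.mult_gr[OF Y.pi_gr[OF g(1)] \<beta>_gr[OF g(2,3)]]]
            by (intro Y.gr_add Y.gr_sign) (simp_all add: algebra_simps)
          moreover have "int n < j + k + l - 1 \<or> (int n - int r < j + k + l - 1 \<and> j + k + l - 1 < int n)"
            using False exc n j k l X.r_ge_2 by auto
          ultimately show ?thesis using Y.pi_gr_vanish Lp by metis
        next
          case sum: True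
          show ?thesis
          proof (cases "(j, k, l) \<in> {(int r, int r, 2 * int r), (int r, 2 * int r, int r), (2 * int r, int r, int r)}")
            case True
            have "harrison_diff2 (cohomology A') b (cl x) (cl y) (cl w) = \<zero>\<^bsub>cohomology A'\<^esub>"
              by (rule harrison_diff2_top[OF cl_gr[OF g(1)] cl_gr[OF g(2)] cl_gr[OF g(3)]])
                (use sum n X.r_ge_2 in auto)
            moreover have "coh_class A' ?L \<in> carrier (cohomology A')"
              using Lp Lc Y.pi_cocycle Y.coh_class_closed by metis
            ultimately have "coh_class A' ?R = coh_class A' ?L"
              using \<beta>_hoch[OF n x y w] True by simp
            then show ?thesis using harmonic_eqI Lp Lc Y.pi_harmonic by metis
          next
            case False
            have "\<beta> (x \<otimes> y) w = \<zero>"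
              by (rule \<beta>_zero[OF Y.mult_gr[OF g(1,2)] g(3)]) (use False sum j k l X.r_ge_2 in auto)
            moreover have "\<beta> x (y \<otimes> w) = \<zero>"
              by (rule \<beta>_zero[OF g(1) Y.mult_gr[OF g(2,3)]]) (use False sum j k l X.r_ge_2 in auto)
            moreover have "\<beta> x y = \<zero>"
              by (rule \<beta>_zero[OF g(1,2)]) (use False sum j k l X.r_ge_2 in auto)
            moreover have "\<beta> y w = \<zero>"
              by (rule \<beta>_zero[OF g(2,3)]) (use False sum j k l X.r_ge_2 in auto)
            ultimately show ?thesis using c by (simp add: Y.M.add_neg1_pow)
          qed
        qed
      qed
    qed
  qed
qed

end

context hodge_iso
begin

text \<open>Both \<open>mu\<close> and \<open>\<beta>_hoch\<close>, applied to the three classes,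
  contain the coboundary \<open>?d\<close>. Eliminating it gives the equation in cohomology, and
  harmonic elements with equal classes are equal.\<close>

lemma \<beta>_cocycle:
  assumes n: "n = 4 * r - 1" and a: "a \<in> X.S (int r)" and a': "a' \<in> X.S (int r)" and a'': "a'' \<in> X.S (int r)"
  shows "((Y.\<pi> (h' (\<theta> a \<otimes> \<theta> a') \<otimes> \<theta> a'') \<ominus> \<theta> (h (a \<otimes>\<^bsub>A\<^esub> a') \<otimes>\<^bsub>A\<^esub> a'')) \<oplus> \<beta> (\<theta> a \<otimes> \<theta> a') (\<theta> a'')) \<oplus>
        Y.\<pi> (\<beta> (\<theta> a) (\<theta> a') \<otimes> \<theta> a'') =
      (([neg1_pow (int r)] \<cdot> Y.\<pi> (\<theta> a \<otimes> h' (\<theta> a' \<otimes> \<theta> a'')) \<ominus>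
        [neg1_pow (int r)] \<cdot> \<theta> (a \<otimes>\<^bsub>A\<^esub> h (a' \<otimes>\<^bsub>A\<^esub> a''))) \<oplus> \<beta> (\<theta> a) (\<theta> a' \<otimes> \<theta> a'')) \<oplus>
        [neg1_pow (int r)] \<cdot> Y.\<pi> (\<theta> a \<otimes> \<beta> (\<theta> a') (\<theta> a''))"
proof -
  let ?C = "cohomology A'" and ?S = "\<lambda>x. [neg1_pow (int r)] \<cdot> x"
  have rr: "int r < 2 * int r - 1" using X.r_ge_2 by simp
  note H = X.S_harmonic[OF a rr] X.S_harmonic[OF a' rr] X.S_harmonic[OF a'' rr]
  note g = X.S_gr[OF a] X.S_gr[OF a'] X.S_gr[OF a'']
  note c = X.S_closed[OF a] X.S_closed[OF a'] X.S_closed[OF a'']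
  note T = module_hom_facts[OF X.is_module Y.is_module \<theta>_linear]
  have tS: "\<theta> x \<in> Y.S (int r)" if "x \<in> gr A (int r)" for x
    using that \<theta>_harmonic[OF X.gr_closed[OF that]] \<theta>_gr Y.harmonic_S by blast
  have tp: "Y.\<pi> (\<theta> x) = \<theta> x" if "x \<in> carrier A" for x using \<theta>_harmonic[OF that] Y.harmonicD by blast
  have cl\<theta>: "cl (\<theta> x) = \<phi> (coh_class A x)" if "x \<in> gr A (int r)" "x \<in> harmonic A h" for x
    using cl_homogeneous[OF \<theta>_gr[OF that(1)]] coh_class_\<theta> X.harmonicD[OF that(2)] by (simp add: tp)
  let ?P1 = "Y.\<pi> (h' (\<theta> a \<otimes> \<theta> a') \<otimes> \<theta> a'')" and ?P2 = "Y.\<pi> (\<theta> a \<otimes> h' (\<theta> a' \<otimes> \<theta> a''))"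
  let ?Q1 = "h (a \<otimes>\<^bsub>A\<^esub> a') \<otimes>\<^bsub>A\<^esub> a''" and ?Q2 = "a \<otimes>\<^bsub>A\<^esub> h (a' \<otimes>\<^bsub>A\<^esub> a'')"
  let ?L = "\<beta> (\<theta> a \<otimes> \<theta> a') (\<theta> a'') \<oplus> Y.\<pi> (\<beta> (\<theta> a) (\<theta> a') \<otimes> \<theta> a'')"
  let ?R = "\<beta> (\<theta> a) (\<theta> a' \<otimes> \<theta> a'') \<oplus> ?S (Y.\<pi> (\<theta> a \<otimes> \<beta> (\<theta> a') (\<theta> a'')))"
  let ?d = "harrison_diff2 ?C b (\<phi> (coh_class A a)) (\<phi> (coh_class A a')) (\<phi> (coh_class A a''))"
  have ac: "coh_class A x \<in> carrier (cohomology A)" if "x \<in> harmonic A h" for x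
    using X.harmonic_cocycle[OF that] by simp
  have c\<theta>: "\<phi> (coh_class A x) = coh_class A' (\<theta> x)" if "x \<in> harmonic A h" for x
    using coh_class_\<theta> X.harmonicD[OF that] by simp
  have 1: "coh_class A' (?P1 \<ominus> ?S ?P2) = mu3 A' h' (\<phi> (coh_class A a)) (\<phi> (coh_class A a')) (\<phi> (coh_class A a''))"
    unfolding c\<theta>[OF H(1)] c\<theta>[OF H(2)] c\<theta>[OF H(3)]
    using Y.mu3_harmonic[OF \<theta>_harmonic[OF c(1)] \<theta>_gr[OF g(1)] \<theta>_harmonic[OF c(2)] \<theta>_harmonic[OF c(3)]] c T(1)
    by (simp add: Y.M.add_neg1_pow Y.pi_sub Y.pi_add Y.pi_minus)
  have Qc: "?Q1 \<ominus>\<^bsub>A\<^esub> [neg1_pow (int r)] \<cdot>\<^bsub>A\<^esub> ?Q2 \<in> carrier A" using c by (simp add: X.M.add_neg1_pow)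
  have "mu3 A h (coh_class A a) (coh_class A a') (coh_class A a'') =
    coh_class A (X.\<pi> (?Q1 \<ominus>\<^bsub>A\<^esub> [neg1_pow (int r)] \<cdot>\<^bsub>A\<^esub> ?Q2))" by (rule X.mu3_harmonic[OF H(1) g(1) H(2,3)])
  then have 2: "\<phi> (mu3 A h (coh_class A a) (coh_class A a') (coh_class A a'')) = coh_class A' (\<theta> ?Q1 \<ominus> ?S (\<theta> ?Q2))"
    using coh_class_\<theta>[OF Qc] c T(1) by (cases "even r") (simp_all add: T(2,5,6) X.M.add_neg1_pow Y.M.add_neg1_pow)
  have 3: "coh_class A' ?R = ?d \<oplus>\<^bsub>?C\<^esub> coh_class A' ?L"
    using \<beta>_hoch[OF n tS[OF g(1)] tS[OF g(2)] tS[OF g(3)]]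
    by (simp add: tp c cl\<theta> g H)
  have tc: "\<theta> x \<in> cocycles A'" if "x \<in> carrier A" for x using \<theta>_harmonic[OF that] Y.harmonic_cocycle by blast
  have Sc: "?S x \<in> harmonic A' h'" if "x \<in> harmonic A' h'" for x
    using Y.harmonicD[OF that] by (simp add: Y.harmonic_iff Y.M.add_neg1_pow Y.pi_minus)
  have Hs: "x \<oplus> y \<in> harmonic A' h'" "x \<ominus> y \<in> harmonic A' h'" if "x \<in> harmonic A' h'" "y \<in> harmonic A' h'" for x y
    using Y.harmonicD[OF that(1)] Y.harmonicD[OF that(2)] by (simp_all add: Y.harmonic_iff Y.pi_add Y.pi_sub)
  have h1: "?P1 \<in> harmonic A' h'" "?S ?P2 \<in> harmonic A' h'" "\<theta> ?Q1 \<in> harmonic A' h'" "?S (\<theta> ?Q2) \<in> harmonic A' h'"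
    "\<beta> (\<theta> a \<otimes> \<theta> a') (\<theta> a'') \<in> harmonic A' h'" "Y.\<pi> (\<beta> (\<theta> a) (\<theta> a') \<otimes> \<theta> a'') \<in> harmonic A' h'"
    "\<beta> (\<theta> a) (\<theta> a' \<otimes> \<theta> a'') \<in> harmonic A' h'" "?S (Y.\<pi> (\<theta> a \<otimes> \<beta> (\<theta> a') (\<theta> a''))) \<in> harmonic A' h'"
    using c T(1) \<beta>_closed by (auto intro!: Sc Y.pi_harmonic \<theta>_harmonic \<beta>_harmonic)
  note h2 = h1[THEN Y.harmonic_cocycle]
  have "coh_class A' ?P1 \<ominus>\<^bsub>?C\<^esub> coh_class A' (?S ?P2) = ?d \<oplus>\<^bsub>?C\<^esub> (coh_class A' (\<theta> ?Q1) \<ominus>\<^bsub>?C\<^esub> coh_class A' (?S (\<theta> ?Q2)))"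
    unfolding Y.coh_sub[OF h2(1,2)] Y.coh_sub[OF h2(3,4)] 1 using mu[OF ac[OF H(1)] ac[OF H(2)] ac[OF H(3)]] by (simp add: 2)
  moreover have "coh_class A' (\<beta> (\<theta> a) (\<theta> a' \<otimes> \<theta> a'')) \<oplus>\<^bsub>?C\<^esub> coh_class A' (?S (Y.\<pi> (\<theta> a \<otimes> \<beta> (\<theta> a') (\<theta> a'')))) =
     ?d \<oplus>\<^bsub>?C\<^esub> (coh_class A' (\<beta> (\<theta> a \<otimes> \<theta> a') (\<theta> a'')) \<oplus>\<^bsub>?C\<^esub> coh_class A' (Y.\<pi> (\<beta> (\<theta> a) (\<theta> a') \<otimes> \<theta> a'')))"
    using 3 by (simp add: Y.coh_add h2)
  ultimately have "((coh_class A' ?P1 \<ominus>\<^bsub>?C\<^esub> coh_class A' (\<theta> ?Q1)) \<oplus>\<^bsub>?C\<^esub> coh_class A' (\<beta> (\<theta> a \<otimes> \<theta> a') (\<theta> a''))) \<oplus>\<^bsub>?C\<^esub>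
      coh_class A' (Y.\<pi> (\<beta> (\<theta> a) (\<theta> a') \<otimes> \<theta> a'')) =
     ((coh_class A' (?S ?P2) \<ominus>\<^bsub>?C\<^esub> coh_class A' (?S (\<theta> ?Q2))) \<oplus>\<^bsub>?C\<^esub> coh_class A' (\<beta> (\<theta> a) (\<theta> a' \<otimes> \<theta> a''))) \<oplus>\<^bsub>?C\<^esub>
      coh_class A' (?S (Y.\<pi> (\<theta> a \<otimes> \<beta> (\<theta> a') (\<theta> a''))))"
    by (rule C'.M.exchange) (use h2 C'.harrison_diff2_closed[OF harr_b] \<phi>(1) ac H in auto)
  then show ?thesis
    by (intro harmonic_eqI Hs h1) (simp add: Y.coh_sub Y.coh_add h2 Y.cocycle_diff Y.cocycle_add)
qed

lemma hodge_pair: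
  assumes "\<And>a b c. f1 (mk a b c) = a" "\<And>a b c. f2 (mk a b c) = b" "\<And>a b c. f3 (mk a b c) = c"
  shows "hodge_pair K A A' n fund fund' h h' r \<theta> \<beta> mk f1 f2 f3"
proof (intro hodge_pair.intro hodge_pair_axioms.intro)
  show "Y.\<pi> (\<theta> a) = \<theta> a" if "a \<in> carrier A" for a using \<theta>_harmonic[OF that] Y.harmonicD by blast
  show "\<theta> (X.\<pi> a) = \<theta> a" if "a \<in> carrier A" for a using that by (simp add: \<theta>_def)
  show "\<theta> \<one>\<^bsub>A\<^esub> = \<one>" using \<phi>(8) by (simp add: \<theta>_def X.pi_one X.coh_one Y.coh_one Y.harmonic_rep_class Y.cocycle_one Y.pi_one)
  show "Y.\<pi> (\<beta> y y') = \<beta> y y'" if "y \<in> carrier A'" "y' \<in> carrier A'" for y y'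
    using \<beta>_harmonic[OF that] Y.harmonicD by blast
  show "\<beta> (diff A' y) y' = \<zero> \<and> \<beta> y (diff A' y') = \<zero>" if "y \<in> carrier A'" "y' \<in> carrier A'" for y y'
    using that by (simp add: \<beta>_def cl_d b_zero \<iota>(4))
  show "\<beta> (x \<oplus> x') y = \<beta> x y \<oplus> \<beta> x' y" "\<beta> y (x \<oplus> x') = \<beta> y x \<oplus> \<beta> y x'"
    if "x \<in> carrier A'" "x' \<in> carrier A'" "y \<in> carrier A'" for x x' y
    using \<beta>_linear(1,2)[OF that, of "\<zero>\<^bsub>K\<^esub>"] by auto
  show "\<beta> (e \<odot> x) y = e \<odot> \<beta> x y" if "e \<in> carrier K" "x \<in> carrier A'" "y \<in> carrier A'" for e x y
    using \<beta>_linear(3) that by blast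
  show "\<beta> x (e \<odot> y) = e \<odot> \<beta> x y" if "e \<in> carrier K" "x \<in> carrier A'" "y \<in> carrier A'" for e x y
    using \<beta>_linear(4) that by blast
qed (assumption | rule assms X.connected_hodge_axioms Y.connected_hodge_axioms \<theta>_linear \<theta>_gr \<theta>_mult \<theta>_inj \<theta>_surj
  \<beta>_closed \<beta>_gr \<beta>_zero \<beta>_comm \<beta>_assoc \<beta>_cocycle)+

lemma same_homotopy_class:
  fixes U :: "'u itself"
  shows "same_homotopy_class U K A A'"
proof -
  \<comment> \<open>The entries of a triple are the values at 0, at 1, and at all larger numbers,
    which places the algebra of triples in the left summand of the type for zig-zags.\<close>
  define mk :: "'a \<Rightarrow> 'b \<Rightarrow> 'b \<Rightarrow> ('a, 'b, 'u) zigzag_space" where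
    "mk x y z = Inl (\<lambda>i. if i = 0 then Inl x else if i = 1 then Inr y else Inr z)" for x y z
  define f1 :: "('a, 'b, 'u) zigzag_space \<Rightarrow> 'a" where "f1 c = projl (projl c 0)" for c
  define f2 :: "('a, 'b, 'u) zigzag_space \<Rightarrow> 'b" where "f2 c = projr (projl c 1)" for c
  define f3 :: "('a, 'b, 'u) zigzag_space \<Rightarrow> 'b" where "f3 c = projr (projl c 2)" for c
  interpret P: hodge_pair K A A' n fund fund' h h' r \<theta> \<beta> mk f1 f2 f3
    by (rule hodge_pair) (simp_all add: mk_def f1_def f2_def f3_def)
  have "has_quasi_iso K P.C A" "has_quasi_iso K P.C A'"
    unfolding has_quasi_iso_def using P.quasi_isos by blast+
  \<comment> \<open>The algebra of triples serves as both ends of the inner zig-zag, which has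
    length zero.\<close>
  then show ?thesis unfolding same_homotopy_class_def
    by (intro exI[of _ P.C] conjI equivclp_refl) auto
qed

end

lemma (in connected_hodge_pair) same_homotopy_class_iff:
  "same_homotopy_class U K A A' \<longleftrightarrow>
    (\<exists>\<phi>\<in>graded_algebra_iso K (cohomology A) (cohomology A').
     harr_cohomology_map K (cohomology A) (cohomology A') 3 (-1) \<phi> (mu3_class K A h) = mu3_class K A' h')"
proof
  assume "\<exists>\<phi>\<in>graded_algebra_iso K (cohomology A) (cohomology A').
     harr_cohomology_map K (cohomology A) (cohomology A') 3 (-1) \<phi> (mu3_class K A h) = mu3_class K A' h'"
  then obtain \<phi> where \<phi>: "\<phi> \<in> graded_algebra_iso K (cohomology A) (cohomology A')"
    and eq: "harr_cohomology_map K (cohomology A) (cohomology A') 3 (-1) \<phi> (mu3_class K A h) = mu3_class K A' h'" by blast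
  interpret C: dgca K "cohomology A" by (rule X.dgca_cohomology)
  interpret C': dgca K "cohomology A'" by (rule Y.dgca_cohomology)
  let ?C = "cohomology A'" and ?\<psi> = "the_inv_into (carrier (cohomology A)) \<phi>"
  note ga = C.graded_comm_algebra_axioms C'.graded_comm_algebra_axioms
  note F = graded_algebra_isoD[OF ga \<phi>]
  note G = graded_algebra_isoD[OF ga(2,1) graded_algebra_iso_inverse[OF ga \<phi>]]
  have inv: "?\<psi> (\<phi> x) = x" if "x \<in> carrier (cohomology A)" for x
    using the_inv_into_f_f[of \<phi> "carrier (cohomology A)" x] F(11) that by (auto simp: bij_betw_def)
  have "closed3 ?C (\<lambda>x y z. \<phi> (mu3 A h (?\<psi> x) (?\<psi> y) (?\<psi> z)))"
    using closed3D[OF X.mu3_closed3] F(1) G(1) by (simp add: closed3_def)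
  from C'.harr_class_eq_iff[OF this Y.mu3_closed3] eq
  obtain \<beta> where \<beta>: "harrison2 K ?C \<beta>" and e: "\<And>x y z. x \<in> carrier ?C \<Longrightarrow> y \<in> carrier ?C \<Longrightarrow> z \<in> carrier ?C \<Longrightarrow>
      \<phi> (mu3 A h (?\<psi> x) (?\<psi> y) (?\<psi> z)) = harrison_diff2 ?C \<beta> x y z \<oplus>\<^bsub>?C\<^esub> mu3 A' h' x y z"
    unfolding X.mu3_class_cochain Y.mu3_class_cochain harr_cohomology_map_class[OF ga \<phi> X.mu3_closed3] by blast
  \<comment> \<open>Equality of classes expresses the transported operation through that of
    \<open>A'\<close>, while \<open>hodge_iso\<close> asks for the converse; hence the negative
    sign.\<close>
  interpret hodge_iso K A A' n fund fund' h h' r \<phi> "\<lambda>x y. \<ominus>\<^bsub>?C\<^esub> \<beta> x y"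
  proof (unfold_locales)
    fix x y z assume c: "x \<in> carrier (cohomology A)" "y \<in> carrier (cohomology A)" "z \<in> carrier (cohomology A)"
    note d = F(1)[OF c(1)] F(1)[OF c(2)] F(1)[OF c(3)]
    show "mu3 A' h' (\<phi> x) (\<phi> y) (\<phi> z) =
        harrison_diff2 ?C (\<lambda>x y. \<ominus>\<^bsub>?C\<^esub> \<beta> x y) (\<phi> x) (\<phi> y) (\<phi> z) \<oplus>\<^bsub>?C\<^esub> \<phi> (mu3 A h x y z)"
      using e[OF d] C'.harrison_diff2_closed[OF \<beta> d] closed3D[OF Y.mu3_closed3 d]
      by (simp add: inv c C'.harrison_diff2_minus[OF \<beta> d] C'.M.r_neg1)
  qed (use \<phi> C'.harrison2_minus[OF \<beta>] in auto)
  show "same_homotopy_class U K A A'" by (rule same_homotopy_class)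
qed (rule same_homotopy_class_iso)

section \<open>Formality\<close>

lemma (in dgca) zero_differential:
  assumes "\<And>x. x \<in> carrier A \<Longrightarrow> diff A x = \<zero>\<^bsub>A\<^esub>"
  shows "cocycles A = carrier A" "\<And>x. x \<in> carrier A \<Longrightarrow> coh_class A x = {x}"
    "coh_class A \<in> graded_algebra_iso K A (cohomology A)"
proof -
  show z: "cocycles A = carrier A" using assms by (auto simp: cocycles_iff)
  have "coboundaries A = {\<zero>\<^bsub>A\<^esub>}" using assms coboundary_zero by (auto simp: coboundaries_iff)
  then show cl: "coh_class A x = {x}" if "x \<in> carrier A" for x using that by (simp add: coh_class_eq_set)
  have "bij_betw (coh_class A) (carrier A) (carrier (cohomology A))"
    using cl by (auto simp: bij_betw_def inj_on_def coh_carrier z)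
  then show "coh_class A \<in> graded_algebra_iso K A (cohomology A)"
    unfolding graded_algebra_iso_def graded_algebra_hom_def
    by (auto simp: ring_hom_def module_hom_def z coh_add coh_mult coh_smult coh_one coh_gr gr_closed coh_carrier)
qed

text \<open>Makes formality an instance of the comparison of two algebras. With zero differential
  every element is harmonic and the zero map is a Hodge homotopy; classes are singletons, so the
  fundamental class is read off with \<open>the_elem\<close>.\<close>

lemma (in hodge_homotopy) hodge_homotopy_cohomology:
  "hodge_homotopy K (cohomology A) n (\<lambda>X. fund (the_elem X)) (\<lambda>_. \<zero>\<^bsub>cohomology A\<^esub>)"
proof -
  let ?H = "cohomology A" and ?fund = "\<lambda>X. fund (the_elem X)" and ?h = "\<lambda>_. \<zero>\<^bsub>cohomology A\<^esub>"
  interpret C: dgca K ?H by (rule dgca_cohomology)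
  interpret CC: dgca K "cohomology ?H" by (rule C.dgca_cohomology)
  note z = C.zero_differential[OF coh_diff]
  have gz: "gr ?H k = {\<zero>\<^bsub>?H\<^esub>}" if "k < 0 \<or> int n < k" for k
    using gr_bounded[OF that] by (auto simp: coh_gr coh_class_zero cocycle_zero)
  have gr: "\<exists>x. x \<in> gr ?H k \<and> x \<in> carrier ?H \<and> a = {x}" if a: "a \<in> gr (cohomology ?H) k" for a k
  proof -
    obtain x where x: "x \<in> gr ?H k" "a = coh_class ?H x" using a unfolding C.coh_gr by blast
    then show ?thesis using z(2)[OF C.gr_closed[OF x(1)]] C.gr_closed[OF x(1)] by blast
  qed
  have car: "\<exists>x. x \<in> carrier ?H \<and> a = {x}" if a: "a \<in> carrier (cohomology ?H)" for a
  proof -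
    obtain x where x: "x \<in> carrier ?H" "a = coh_class ?H x" using a unfolding C.coh_carrier z(1) by blast
    then show ?thesis using z(2)[OF x(1)] by blast
  qed
  have sg: "{x} \<in> carrier (cohomology ?H)" if "x \<in> carrier ?H" for x
    using that z(1) z(2)[OF that, symmetric] C.coh_carrier by auto
  have add: "{x} \<oplus>\<^bsub>cohomology ?H\<^esub> {y} = {x \<oplus>\<^bsub>?H\<^esub> y}" and mult: "{x} \<otimes>\<^bsub>cohomology ?H\<^esub> {y} = {x \<otimes>\<^bsub>?H\<^esub> y}"
    if "x \<in> carrier ?H" "y \<in> carrier ?H" for x y
    using C.coh_add[of x y] C.coh_mult[of x y] that z(1) by (simp_all add: z(2))
  have smult: "c \<odot>\<^bsub>cohomology ?H\<^esub> {x} = {c \<odot>\<^bsub>?H\<^esub> x}" if "c \<in> carrier K" "x \<in> carrier ?H" for c x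
    using C.coh_smult[of c x] that z(1) by (simp add: z(2))
  have zero: "\<zero>\<^bsub>cohomology ?H\<^esub> = {\<zero>\<^bsub>?H\<^esub>}" using C.coh_class_zero z(2)[of "\<zero>\<^bsub>?H\<^esub>"] by simp
  have pair: "cohomology_pairing ?H n ?fund {x} {y} = cohomology_pairing A n fund x y"
    if "x \<in> carrier ?H" "y \<in> carrier ?H" for x y
    using C.component_cohomology[of "x \<otimes>\<^bsub>?H\<^esub> y" "int n"] that z(1)
    by (simp add: cohomology_pairing_def mult z(2))
  \<comment> \<open>The class map is linear and onto, and its domain is finite-dimensional.\<close>
  have "vectorspace.fin_dim K (cohomology ?H)"
  proof -
    have iso: "coh_class ?H \<in> module_hom K ?H (cohomology ?H)" "coh_class ?H ` carrier ?H = carrier (cohomology ?H)"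
      using z(3) by (auto simp: graded_algebra_iso_def graded_algebra_hom_def bij_betw_def)
    have "linear_map K ?H (cohomology ?H) (coh_class ?H)"
      by (intro linear_map.intro mod_hom.intro mod_hom_axioms.intro iso C.vectorspace_axioms CC.vectorspace_axioms
          C.is_module CC.is_module)
    then show ?thesis using linear_map.rank_nullity_main(2) cohomology_fin_dim iso(2) by blast
  qed
  then interpret P: poincare_dgca K ?H n ?fund
  proof (unfold_locales, goal_cases)
    case (1 k)
    then show ?case using gz by blast
  next
    case (3 a)
    then show ?case using gr[OF 3(2)] fund_closed by auto
  next
    case (4 a b)
    then show ?case using gr[OF 4(2)] gr[OF 4(3)] fund_add add by auto
  next
    case (5 c a)
    then show ?case using gr[OF 5(3)] fund_smult smult by auto
  next
    case (6 a)
    obtain x where x: "x \<in> carrier ?H" "a = {x}" using car[OF 6(2)] by blast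
    have "cohomology_pairing A n fund x y = \<zero>\<^bsub>K\<^esub>" if "y \<in> carrier ?H" for y
      using 6(3) sg[OF that] pair[OF x(1) that] x(2) by auto
    then show ?case using pairing_nondegenerate_left[OF x(1)] x(2) zero by auto
  next
    case (7 a)
    obtain x where x: "x \<in> carrier ?H" "a = {x}" using car[OF 7(2)] by blast
    have "cohomology_pairing A n fund y x = \<zero>\<^bsub>K\<^esub>" if "y \<in> carrier ?H" for y
      using 7(3) sg[OF that] pair[OF that x(1)] x(2) by auto
    then show ?case using pairing_nondegenerate_right[OF x(1)] x(2) zero by auto
  qed
  have hc: "harmonic ?H ?h \<subseteq> carrier ?H" by (auto simp: harmonic_def harmonic_proj_def)
  have p0: "cochain_pairing ?H n ?fund x \<zero>\<^bsub>?H\<^esub> = \<zero>\<^bsub>K\<^esub>" if "x \<in> carrier ?H" for x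
    using that by (simp add: cochain_pairing_def z(2) fund_zero)
  show ?thesis
    by unfold_locales (use hc p0 C.gr_zero in \<open>auto simp: module_hom_def coh_diff\<close>)
qed

lemma (in connected_hodge) connected_cohomology: "cohomologically_connected K (cohomology A) (r - 1)"
proof -
  let ?H = "cohomology A"
  interpret C: dgca K ?H by (rule dgca_cohomology)
  note z = C.zero_differential[OF coh_diff]
  have gr: "gr (cohomology ?H) k = coh_class ?H ` gr ?H k" for k
    using C.gr_closed z(1) by (auto simp: C.coh_gr)
  have "bij_betw (coh_class ?H) (gr ?H 0) (gr (cohomology ?H) 0)"
    using z(2) C.gr_closed by (auto simp: bij_betw_def gr inj_on_def)
  moreover have "bij_betw (\<lambda>c. c \<odot>\<^bsub>?H\<^esub> \<one>\<^bsub>?H\<^esub>) (carrier K) (gr ?H 0)"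
    using connected by (simp add: cohomologically_connected_def)
  ultimately have "bij_betw (coh_class ?H \<circ> (\<lambda>c. c \<odot>\<^bsub>?H\<^esub> \<one>\<^bsub>?H\<^esub>)) (carrier K) (gr (cohomology ?H) 0)"
    by (rule bij_betw_trans[rotated])
  then have "bij_betw (\<lambda>c. c \<odot>\<^bsub>cohomology ?H\<^esub> \<one>\<^bsub>cohomology ?H\<^esub>) (carrier K) (gr (cohomology ?H) 0)"
    by (rule bij_betw_cong[THEN iffD1, rotated]) (simp add: C.coh_one C.coh_smult C.cocycle_one)
  then show ?thesis using connected unfolding cohomologically_connected_def
    by (simp add: gr C.coh_class_zero)
qed

text \<open>Both terms of the ternary operation contain the homotopy, which is zero here.\<close>

lemma (in hodge_homotopy) mu3_class_cohomology:
  "mu3_class K (cohomology A) (\<lambda>_. \<zero>\<^bsub>cohomology A\<^esub>) = harr_class K (cohomology (cohomology A)) 3 (-1)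
     (cochain3 (cohomology (cohomology A)) (\<lambda>_ _ _. \<zero>\<^bsub>cohomology (cohomology A)\<^esub>))"
proof -
  let ?H = "cohomology A" and ?C = "cohomology (cohomology A)" and ?h = "\<lambda>_. \<zero>\<^bsub>cohomology A\<^esub>"
  let ?i = "harmonic_rep ?H ?h"
  interpret H: dgca K ?H by (rule dgca_cohomology)
  interpret C: dgca K ?C by (rule H.dgca_cohomology)
  note hodge = hodge_homotopy_cohomology
  have i: "?i u \<in> carrier ?H" if "u \<in> carrier ?C" for u
    using hodge_homotopy.harmonic_rep_props(1)[OF hodge that] hodge_homotopy.harmonicD[OF hodge] by blast
  have core: "coh_class ?H (harmonic_proj ?H ?h (\<zero>\<^bsub>?H\<^esub> \<otimes>\<^bsub>?H\<^esub> u \<ominus>\<^bsub>?H\<^esub> v \<otimes>\<^bsub>?H\<^esub> \<zero>\<^bsub>?H\<^esub>)) = \<zero>\<^bsub>?C\<^esub>"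
    if "u \<in> carrier ?H" "v \<in> carrier ?H" for u v
    using that by (simp add: harmonic_proj_def H.sub_self H.coh_class_zero)
  have "mu3 ?H ?h x y z = \<zero>\<^bsub>?C\<^esub>" if "x \<in> carrier ?C" "y \<in> carrier ?C" "z \<in> carrier ?C" for x y z
    using core[OF i[OF that(3)] i[OF C.sign_twist_closed[OF that(1)]]] unfolding mu3_def Let_def .
  then have "cochain3 ?C (mu3 ?H ?h) = cochain3 ?C (\<lambda>_ _ _. \<zero>\<^bsub>?C\<^esub>)" by (simp add: cochain3_eq_iff)
  then show ?thesis unfolding hodge_homotopy.mu3_class_cochain[OF hodge] by simp
qed

text \<open>Transport sends the zero cochain to the zero cochain and is undone by transport along
  the inverse.\<close>

lemma harr_cohomology_map_eq_zero_iff: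
  assumes B: "graded_comm_algebra K B" and C: "graded_comm_algebra K C" and \<phi>: "\<phi> \<in> graded_algebra_iso K B C"
    and f: "closed3 B f"
  shows "harr_cohomology_map K B C 3 (-1) \<phi> (harr_class K B 3 (-1) (cochain3 B f)) =
      harr_class K C 3 (-1) (cochain3 C (\<lambda>_ _ _. \<zero>\<^bsub>C\<^esub>)) \<longleftrightarrow>
    harr_class K B 3 (-1) (cochain3 B f) = harr_class K B 3 (-1) (cochain3 B (\<lambda>_ _ _. \<zero>\<^bsub>B\<^esub>))"
proof -
  interpret B: graded_comm_algebra K B by fact
  interpret C: graded_comm_algebra K C by fact
  let ?class = "\<lambda>B f. harr_class K B 3 (-1) (cochain3 B f)"
  let ?\<psi> = "the_inv_into (carrier B) \<phi>"
  let ?\<chi> = "the_inv_into (carrier C) ?\<psi>" and ?f = "\<lambda>x y z. \<phi> (f (?\<psi> x) (?\<psi> y) (?\<psi> z))"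
  have \<psi>: "?\<psi> \<in> graded_algebra_iso K C B" by (rule graded_algebra_iso_inverse[OF B C \<phi>])
  note F = graded_algebra_isoD[OF B C \<phi>] and G = graded_algebra_isoD[OF C B \<psi>]
  have inv: "?\<psi> (\<phi> x) = x" "?\<psi> (?\<chi> x) = x" if "x \<in> carrier B" for x
    using the_inv_into_f_f[of \<phi> "carrier B" x] f_the_inv_into_f_bij_betw[OF G(11), of x] F(11) that
    by (auto simp: bij_betw_def)
  have z3: "closed3 B (\<lambda>_ _ _. \<zero>\<^bsub>B\<^esub>)" "closed3 C (\<lambda>_ _ _. \<zero>\<^bsub>C\<^esub>)" by (simp_all add: closed3_def)
  have f3: "closed3 C ?f" using closed3D[OF f] F(1) G(1) by (simp add: closed3_def)
  note push = harr_cohomology_map_class[OF B C \<phi>] and pull = harr_cohomology_map_class[OF C B \<psi>]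
  show ?thesis
  proof
    assume "harr_cohomology_map K B C 3 (-1) \<phi> (?class B f) = ?class C (\<lambda>_ _ _. \<zero>\<^bsub>C\<^esub>)"
    then have "?class C ?f = ?class C (\<lambda>_ _ _. \<zero>\<^bsub>C\<^esub>)" unfolding push[OF f] .
    then have "harr_cohomology_map K C B 3 (-1) ?\<psi> (?class C ?f) = ?class B (\<lambda>_ _ _. \<zero>\<^bsub>B\<^esub>)"
      using pull[OF z3(2)] by (simp add: G(7))
    then have "?class B (\<lambda>x y z. ?\<psi> (?f (?\<chi> x) (?\<chi> y) (?\<chi> z))) = ?class B (\<lambda>_ _ _. \<zero>\<^bsub>B\<^esub>)" unfolding pull[OF f3] .
    moreover have "cochain3 B (\<lambda>x y z. ?\<psi> (?f (?\<chi> x) (?\<chi> y) (?\<chi> z))) = cochain3 B f"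
      using inv closed3D[OF f] by (simp add: cochain3_eq_iff)
    ultimately show "?class B f = ?class B (\<lambda>_ _ _. \<zero>\<^bsub>B\<^esub>)" by simp
  next
    assume "?class B f = ?class B (\<lambda>_ _ _. \<zero>\<^bsub>B\<^esub>)"
    then show "harr_cohomology_map K B C 3 (-1) \<phi> (?class B f) = ?class C (\<lambda>_ _ _. \<zero>\<^bsub>C\<^esub>)"
      using push[OF z3(1)] by (simp add: F(7))
  qed
qed

text \<open>The comparison asks for an isomorphism that takes the class to zero. Whether the image
  is zero does not depend on the isomorphism, and one exists because a DGCA with zero differential
  is isomorphic to its cohomology by the class map.\<close>

lemma (in connected_hodge) formal_iff:
  "formal U K A \<longleftrightarrow> mu3_class K A h = \<zero>\<^bsub>harr_cohomology K (cohomology A) 3 (-1)\<^esub>"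
proof -
  let ?H = "cohomology A"
  interpret C: dgca K ?H by (rule dgca_cohomology)
  have "connected_hodge_pair K A ?H n fund (\<lambda>X. fund (the_elem X)) h (\<lambda>_. \<zero>\<^bsub>?H\<^esub>) r"
    by (intro connected_hodge_pair.intro connected_hodge_axioms connected_hodge.intro connected_hodge_axioms.intro
        hodge_homotopy_cohomology r_ge_2 n_le connected_cohomology)
  from connected_hodge_pair.same_homotopy_class_iff[OF this]
  have "formal U K A \<longleftrightarrow> (\<exists>\<phi>\<in>graded_algebra_iso K ?H (cohomology ?H).
      mu3_class K A h = harr_class K ?H 3 (-1) (cochain3 ?H (\<lambda>_ _ _. \<zero>\<^bsub>?H\<^esub>)))"
    unfolding formal_def mu3_class_cohomology mu3_class_cochain
    using harr_cohomology_map_eq_zero_iff[OF C.graded_comm_algebra_axioms dgca.axioms(1)[OF C.dgca_cohomology] _ mu3_closed3]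
    by blast
  then show ?thesis
    unfolding mu3_class_cochain C.harr_class_eq_zero_iff[OF mu3_closed3] using C.zero_differential(3)[OF coh_diff] by blast
qed

theorem theorem3p9:
  fixes K :: "('k, 'l) ring_scheme"
    and A :: "('k, 'a) dgca" and A' :: "('k, 'b) dgca"
    and fund :: "'a set \<Rightarrow> 'k" and fund' :: "'b set \<Rightarrow> 'k"
    and h :: "'a \<Rightarrow> 'a" and h' :: "'b \<Rightarrow> 'b"
    and r n :: nat and U :: "'u itself"
  assumes "field_of_char_zero K"
    and "2 \<le> r" and "n \<le> 4 * r - 1"
    and "poincare_dgca K A n fund" and "cohomologically_connected K A (r - 1)"
    and "hodge_homotopy K A n fund h"
    and "poincare_dgca K A' n fund'" and "cohomologically_connected K A' (r - 1)"
    and "hodge_homotopy K A' n fund' h'"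
  shows "(same_homotopy_class U K A A' \<longleftrightarrow>
            (\<exists>\<phi> \<in> graded_algebra_iso K (cohomology A) (cohomology A').
               harr_cohomology_map K (cohomology A) (cohomology A') 3 (- 1) \<phi> (mu3_class K A h)
                 = mu3_class K A' h')) \<and>
         (formal U K A \<longleftrightarrow>
            mu3_class K A h = \<zero>\<^bsub>harr_cohomology K (cohomology A) 3 (- 1)\<^esub>)"
proof -
  interpret X: hodge_homotopy K A n fund h by fact
  interpret Y: hodge_homotopy K A' n fund' h' by fact
  interpret P: connected_hodge_pair K A A' n fund fund' h h' r
    by unfold_locales (use assms in auto)
  show ?thesis using P.same_homotopy_class_iff P.X.formal_iff by blast
qed

end
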